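(* Let $L/K$ be a finite Galois extension of number fields, let $G=\mathrm{Gal}(L/K)$ and let $p$ be a prime number. Then $\mathrm{Leo}(L,p)$ holds if and only if $\mathrm{Leo}(L^{\ker\chi},p)$ holds for every complex irreducible character $\chi$ of $G$, where $\ker\chi=\{g\in G:\chi(g)=\chi(1)\}$.
   Context: For a number field $F$ with unit group $\mathcal{O}_F^\times$ and a prime $p$, let $S_p(F)$ be the set of places of $F$ above $p$ and for $w\in S_p(F)$ let $U^1_{F_w}$ be the group of principal units of the completion $F_w$. The diagonal embedding of units induces (after $p$-adic completion) a homomorphism $\lambda_{F,p}:\mathbb{Z}_p\otimes_{\mathbb{Z}}\mathcal{O}_F^\times\to\prod_{w\in S_p(F)}U^1_{F_w}$. One says $\mathrm{Leo}(F,p)$ (Leopoldt's conjecture for $F$ at $p$) holds if $\lambda_{F,p}$ is injective. For a subgroup $H\le G$, $L^H$ denotes the subfield of $L$ fixed by $H$. *)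

theory Defs
  imports "HOL-Algebra.Algebra" "Jordan_Normal_Form.VS_Connect"
begin

section \<open>Number fields and Galois extensions\<close>

text \<open>\<^term>\<open>generate_field F {}\<close> is the prime subfield of \<open>F\<close>, which in characteristic zero
  is a copy of the rationals.\<close>

definition number_field :: "('a, 'b) ring_scheme \<Rightarrow> bool" where
  "number_field F \<longleftrightarrow> Ring.field F \<and>
     (\<forall>n::nat. n > 0 \<longrightarrow> [n] \<cdot>\<^bsub>F\<^esub> \<one>\<^bsub>F\<^esub> \<noteq> \<zero>\<^bsub>F\<^esub>) \<and>
     ring.finite_dimension F (generate_field F {}) (carrier F)"

definition galois_group :: "('a, 'b) ring_scheme \<Rightarrow> 'a set \<Rightarrow> ('a \<Rightarrow> 'a) monoid" where
  "galois_group L K = (BijGroup (carrier L))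
     \<lparr>carrier := {\<sigma> \<in> Bij (carrier L). \<sigma> \<in> Ring.ring_hom L L \<and> (\<forall>x\<in>K. \<sigma> x = x)}\<rparr>"

definition fixed_field :: "('a, 'b) ring_scheme \<Rightarrow> ('a \<Rightarrow> 'a) set \<Rightarrow> 'a set" where
  "fixed_field L H = {x \<in> carrier L. \<forall>\<sigma>\<in>H. \<sigma> x = x}"

definition finite_galois_extension :: "('a, 'b) ring_scheme \<Rightarrow> 'a set \<Rightarrow> bool" where
  "finite_galois_extension L K \<longleftrightarrow> subfield K L \<and>
     ring.finite_dimension L K (carrier L) \<and>
     fixed_field L (carrier (galois_group L K)) = K"

section \<open>Rings of integers\<close>

text \<open>\<^term>\<open>generate_ring F {}\<close> is the image of the integers in \<open>F\<close>. Polynomials are lists of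
  coefficients, leading coefficient first.\<close>

definition integral_element :: "('a, 'b) ring_scheme \<Rightarrow> 'a \<Rightarrow> bool" where
  "integral_element F x \<longleftrightarrow> x \<in> carrier F \<and>
     (\<exists>f. f \<noteq> [] \<and> set f \<subseteq> generate_ring F {} \<and> hd f = \<one>\<^bsub>F\<^esub> \<and>
          ring.eval F f x = \<zero>\<^bsub>F\<^esub>)"

definition ring_of_integers :: "('a, 'b) ring_scheme \<Rightarrow> ('a, 'b) ring_scheme" where
  "ring_of_integers F = F\<lparr>carrier := {x. integral_element F x}\<rparr>"

definition unit_group :: "('a, 'b) ring_scheme \<Rightarrow> 'a monoid" where
  "unit_group F = units_of (ring_of_integers F)"

section \<open>Places above a prime and completions\<close>

text \<open>A place above \<open>p\<close> is an equivalence class of non-archimedean absolute values \<open>v\<close> with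
  \<open>v p < 1\<close>. Equivalent absolute values are powers of each other, so each class contains
  exactly one \<open>v\<close> normalised by \<open>v p = 1 / p\<close>, that is, extending the usual \<open>p\<close>-adic absolute
  value of the rationals; we use it to represent the class.\<close>

definition places_above :: "('a, 'b) ring_scheme \<Rightarrow> nat \<Rightarrow> ('a \<Rightarrow> real) set" where
  "places_above F p = {v \<in> extensional (carrier F).
     (\<forall>x\<in>carrier F. v x \<ge> 0 \<and> (v x = 0 \<longleftrightarrow> x = \<zero>\<^bsub>F\<^esub>)) \<and>
     (\<forall>x\<in>carrier F. \<forall>y\<in>carrier F. v (x \<otimes>\<^bsub>F\<^esub> y) = v x * v y) \<and>
     (\<forall>x\<in>carrier F. \<forall>y\<in>carrier F. v (x \<oplus>\<^bsub>F\<^esub> y) \<le> max (v x) (v y)) \<and>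
     v ([p] \<cdot>\<^bsub>F\<^esub> \<one>\<^bsub>F\<^esub>) = 1 / real p}"

definition cauchy_ring :: "('a, 'b) ring_scheme \<Rightarrow> ('a \<Rightarrow> real) \<Rightarrow> (nat \<Rightarrow> 'a) ring" where
  "cauchy_ring F v =
     \<lparr>carrier = {x. (\<forall>n. x n \<in> carrier F) \<and>
                    (\<forall>e>0. \<exists>N. \<forall>m\<ge>N. \<forall>n\<ge>N. v (x m \<ominus>\<^bsub>F\<^esub> x n) < e)},
      monoid.mult = (\<lambda>x y n. x n \<otimes>\<^bsub>F\<^esub> y n), one = (\<lambda>n. \<one>\<^bsub>F\<^esub>),
      ring.zero = (\<lambda>n. \<zero>\<^bsub>F\<^esub>), ring.add = (\<lambda>x y n. x n \<oplus>\<^bsub>F\<^esub> y n)\<rparr>"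

definition null_sequences :: "('a, 'b) ring_scheme \<Rightarrow> ('a \<Rightarrow> real) \<Rightarrow> (nat \<Rightarrow> 'a) set" where
  "null_sequences F v = {x \<in> carrier (cauchy_ring F v). (\<lambda>n. v (x n)) \<longlonglongrightarrow> 0}"

definition completion :: "('a, 'b) ring_scheme \<Rightarrow> ('a \<Rightarrow> real) \<Rightarrow> (nat \<Rightarrow> 'a) set ring" where
  "completion F v = cauchy_ring F v Quot null_sequences F v"

definition completion_embed ::
    "('a, 'b) ring_scheme \<Rightarrow> ('a \<Rightarrow> real) \<Rightarrow> 'a \<Rightarrow> (nat \<Rightarrow> 'a) set" where
  "completion_embed F v x = null_sequences F v +>\<^bsub>cauchy_ring F v\<^esub> (\<lambda>n. x)"

text \<open>The extension of \<open>v\<close> to the completion; the limit does not depend on the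
  representative \<open>x\<close> of the class \<open>C\<close>.\<close>

definition completion_abs :: "('a \<Rightarrow> real) \<Rightarrow> (nat \<Rightarrow> 'a) set \<Rightarrow> real" where
  "completion_abs v C = the_elem ((\<lambda>x. lim (\<lambda>n. v (x n))) ` C)"

definition principal_units ::
    "('a, 'b) ring_scheme \<Rightarrow> ('a \<Rightarrow> real) \<Rightarrow> (nat \<Rightarrow> 'a) set monoid" where
  "principal_units F v =
     \<lparr>carrier = {x \<in> carrier (completion F v).
                   completion_abs v (x \<ominus>\<^bsub>completion F v\<^esub> \<one>\<^bsub>completion F v\<^esub>) < 1},
      monoid.mult = monoid.mult (completion F v), one = \<one>\<^bsub>completion F v\<^esub>\<rparr>"

section \<open>The Leopoldt homomorphism\<close>

text \<open>The \<open>p\<close>-adic integers as the inverse limit of the rings of integers modulo \<open>p ^ n\<close>, each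
  residue class being represented by its least non-negative element.\<close>

definition padic_integers :: "nat \<Rightarrow> (nat \<Rightarrow> nat) ring" where
  "padic_integers p =
     \<lparr>carrier = {a. \<forall>n. a n < p ^ n \<and> a (Suc n) mod p ^ n = a n},
      monoid.mult = (\<lambda>a b n. (a n * b n) mod p ^ n), one = (\<lambda>n. 1 mod p ^ n),
      ring.zero = (\<lambda>n. 0), ring.add = (\<lambda>a b n. (a n + b n) mod p ^ n)\<rparr>"

text \<open>The tensor product over the integers of two abelian groups, both written
  multiplicatively.\<close>

definition tensor_relations ::
    "('a, 'c) monoid_scheme \<Rightarrow> ('b, 'd) monoid_scheme \<Rightarrow> ('a \<times> 'b \<Rightarrow>\<^sub>0 int) set" where
  "tensor_relations G H =
     {frag_of (x \<otimes>\<^bsub>G\<^esub> x', y) - frag_of (x, y) - frag_of (x', y) | x x' y.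
        x \<in> carrier G \<and> x' \<in> carrier G \<and> y \<in> carrier H} \<union>
     {frag_of (x, y \<otimes>\<^bsub>H\<^esub> y') - frag_of (x, y) - frag_of (x, y') | x y y'.
        x \<in> carrier G \<and> y \<in> carrier H \<and> y' \<in> carrier H}"

definition tensor_product ::
    "('a, 'c) monoid_scheme \<Rightarrow> ('b, 'd) monoid_scheme \<Rightarrow> ('a \<times> 'b \<Rightarrow>\<^sub>0 int) set monoid" where
  "tensor_product G H =
     free_Abelian_group (carrier G \<times> carrier H) Mod
       generate (free_Abelian_group (carrier G \<times> carrier H)) (tensor_relations G H)"

text \<open>The group of units \<open>x\<close> of the completion with absolute value one is the direct product of
  the principal units and the roots of unity of order prime to \<open>p\<close>, and its \<open>p\<close>-adic completion
  is the projection onto the first factor. This is that projection: the principal unit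
  differing from \<open>x\<close> by a root of unity of order prime to \<open>p\<close>.\<close>

definition principal_part ::
    "('a, 'b) ring_scheme \<Rightarrow> nat \<Rightarrow> ('a \<Rightarrow> real) \<Rightarrow> (nat \<Rightarrow> 'a) set \<Rightarrow> (nat \<Rightarrow> 'a) set" where
  "principal_part F p v x =
     (THE y. y \<in> carrier (principal_units F v) \<and>
        (\<exists>m::nat. m > 0 \<and> coprime m p \<and> x [^]\<^bsub>completion F v\<^esub> m = y [^]\<^bsub>completion F v\<^esub> m))"

text \<open>The action of the \<open>p\<close>-adic integers on principal units: \<open>y\<close> to the power \<open>a\<close> is the limit
  of \<open>y ^ a n\<close>, where \<open>a n\<close> is the residue of \<open>a\<close> modulo \<open>p ^ n\<close>.\<close>

definition padic_power ::
    "('a, 'b) ring_scheme \<Rightarrow> ('a \<Rightarrow> real) \<Rightarrow> (nat \<Rightarrow> 'a) set \<Rightarrow> (nat \<Rightarrow> nat) \<Rightarrow> (nat \<Rightarrow> 'a) set" where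
  "padic_power F v y a =
     (THE z. z \<in> carrier (completion F v) \<and>
        (\<lambda>n. completion_abs v (y [^]\<^bsub>completion F v\<^esub> a n \<ominus>\<^bsub>completion F v\<^esub> z)) \<longlonglongrightarrow> 0)"

definition leopoldt_domain ::
    "('a, 'b) ring_scheme \<Rightarrow> nat \<Rightarrow> ((nat \<Rightarrow> nat) \<times> 'a \<Rightarrow>\<^sub>0 int) set monoid" where
  "leopoldt_domain F p = tensor_product (add_monoid (padic_integers p)) (unit_group F)"

definition leopoldt_codomain ::
    "('a, 'b) ring_scheme \<Rightarrow> nat \<Rightarrow> (('a \<Rightarrow> real) \<Rightarrow> (nat \<Rightarrow> 'a) set) monoid" where
  "leopoldt_codomain F p = product_group (places_above F p) (principal_units F)"

text \<open>The image of the pure tensor of \<open>a\<close> and \<open>u\<close>.\<close>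

definition leopoldt_pure ::
    "('a, 'b) ring_scheme \<Rightarrow> nat \<Rightarrow> (nat \<Rightarrow> nat) \<Rightarrow> 'a \<Rightarrow> ('a \<Rightarrow> real) \<Rightarrow> (nat \<Rightarrow> 'a) set" where
  "leopoldt_pure F p a u =
     (\<lambda>v\<in>places_above F p. padic_power F v (principal_part F p v (completion_embed F v u)) a)"

text \<open>Its additive extension to formal sums of pairs is constant on each class \<open>T\<close> of the tensor
  product, and its value there is the value of the induced homomorphism.\<close>

definition leopoldt_map ::
    "('a, 'b) ring_scheme \<Rightarrow> nat \<Rightarrow> ((nat \<Rightarrow> nat) \<times> 'a \<Rightarrow>\<^sub>0 int) set \<Rightarrow>
      (('a \<Rightarrow> real) \<Rightarrow> (nat \<Rightarrow> 'a) set)" where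
  "leopoldt_map F p T =
     the_elem ((\<lambda>c. \<Otimes>\<^bsub>leopoldt_codomain F p\<^esub>t\<in>Poly_Mapping.keys c.
                  leopoldt_pure F p (fst t) (snd t)
                    [^]\<^bsub>leopoldt_codomain F p\<^esub> Poly_Mapping.lookup c t) ` T)"

definition Leo :: "('a, 'b) ring_scheme \<Rightarrow> nat \<Rightarrow> bool" where
  "Leo F p \<longleftrightarrow> inj_on (leopoldt_map F p) (carrier (leopoldt_domain F p))"

section \<open>Complex characters\<close>

text \<open>The unit group of the ring of \<open>n\<close> by \<open>n\<close> matrices is the general linear group.\<close>

definition representation :: "('g, 'b) monoid_scheme \<Rightarrow> nat \<Rightarrow> ('g \<Rightarrow> complex mat) \<Rightarrow> bool" where
  "representation G n \<rho> \<longleftrightarrow> \<rho> \<in> hom G (units_of (ring_mat TYPE(complex) n ()))"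

definition irreducible_representation ::
    "('g, 'b) monoid_scheme \<Rightarrow> nat \<Rightarrow> ('g \<Rightarrow> complex mat) \<Rightarrow> bool" where
  "irreducible_representation G n \<rho> \<longleftrightarrow> representation G n \<rho> \<and> n > 0 \<and>
     (\<forall>W. VectorSpace.subspace class_ring W (module_vec TYPE(complex) n) \<and>
          (\<forall>g\<in>carrier G. \<forall>w\<in>W. \<rho> g *\<^sub>v w \<in> W) \<longrightarrow>
          W = {0\<^sub>v n} \<or> W = carrier_vec n)"

definition irreducible_characters :: "('g, 'b) monoid_scheme \<Rightarrow> ('g \<Rightarrow> complex) set" where
  "irreducible_characters G =
     {\<lambda>g\<in>carrier G. \<Sum>i<n. \<rho> g $$ (i, i) | n \<rho>. irreducible_representation G n \<rho>}"

definition character_kernel :: "('g, 'b) monoid_scheme \<Rightarrow> ('g \<Rightarrow> complex) \<Rightarrow> 'g set" where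
  "character_kernel G \<chi> = {g \<in> carrier G. \<chi> g = \<chi> \<one>\<^bsub>G\<^esub>}"

end

theory Submission
  imports Defs "Jordan_Normal_Form.Char_Poly" "HOL-Number_Theory.Cong"
begin

text \<open>An element of the tensor product is represented by a formal sum \<open>c\<close> of pairs \<open>(a, u)\<close>. Its
  image at a place \<open>v\<close> is trivial iff some power of exponent prime to \<open>p\<close> of the approximating units
  \<open>\<Prod> u ^ (a mod p ^ n)\<close> tends to \<open>1\<close> with respect to \<open>v\<close>. Torsion of the tensor product comes from
  roots of unity, so it meets the kernel trivially as soon as there is a place above \<open>p\<close>; hence
  multiplying by nonzero integers loses nothing.

  For a subgroup \<open>N\<close> of the Galois group, the inclusion of the fixed field of \<open>N\<close> and the norm to it
  preserve the kernels of the Leopoldt homomorphisms, because places extend: a minimal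
  submultiplicative seminorm is multiplicative, and Zorn's lemma provides one. This descends the
  conjecture from \<open>L\<close> to every fixed field. Conversely, if it holds for the fixed field of \<open>N\<close>, then
  the trace element \<open>\<Sum>h\<in>N. h\<close> kills the kernel for \<open>L\<close>, so that \<open>card N - (\<Sum>h\<in>N. h)\<close> acts on it as
  \<open>card N\<close>. The product of these elements of the group ring over the kernels \<open>N\<close> of all irreducible
  characters is zero: otherwise its image in the regular representation would contain an irreducible
  subrepresentation, on which the trace element of its own kernel \<open>N\<close> would be zero although \<open>N\<close>
  acts trivially.\<close>

section \<open>Orthonormal bases and irreducible characters\<close>

text \<open>The projections attached to subgroups have denominators, which the tensor product with
  the \<open>p\<close>-adic integers does not provide. Each is replaced by its integral multiple,
  and the denominators come back as multiplications by \<open>card N\<close>, harmless by the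
  torsion argument. Exponents prime to \<open>p\<close> enter because \<open>principal_part\<close>
  discards the roots of unity of such order. Since principal units have no torsion of order prime to
  \<open>p\<close>, an identity between them may be tested after taking such a power, and then it
  speaks of elements of the field itself and of one absolute value. So the completions are left
  behind once \<open>Leo_iff\<close> is proved, and inclusions, norms and automorphisms act on plain
  formal sums. The vanishing of the product over all kernels is used one coefficient at a time: for
  a fixed generator \<open>t\<close>, the coefficients of \<open>t\<close> in the conjugates of a
  formal sum form a complex function on the group. The functions killed by the traces over all
  kernels form a subrepresentation of the regular representation, and this is zero because it has no
  minimal invariant subspace.\<close>

definition fun_inner :: "'g set \<Rightarrow> ('g \<Rightarrow> complex) \<Rightarrow> ('g \<Rightarrow> complex) \<Rightarrow> complex" where
  "fun_inner S f h = (\<Sum>g\<in>S. cnj (f g) * h g)"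

definition orthonormal :: "'g set \<Rightarrow> nat \<Rightarrow> (nat \<Rightarrow> 'g \<Rightarrow> complex) \<Rightarrow> bool" where
  "orthonormal S d b \<longleftrightarrow> (\<forall>i<d. \<forall>j<d. fun_inner S (b i) (b j) = (if i = j then 1 else 0))"

definition fun_subspace :: "('g \<Rightarrow> complex) set \<Rightarrow> bool" where
  "fun_subspace W \<longleftrightarrow> (\<lambda>g. 0) \<in> W \<and> (\<forall>a. \<forall>f\<in>W. \<forall>h\<in>W. (\<lambda>g. a * f g + h g) \<in> W)"

text \<open>Members of \<open>W\<close> are functions on the whole type, of which
  \<open>fun_inner\<close> sees only the values on \<open>S\<close>; hence the expansion is required
  on \<open>S\<close> only.\<close>

definition orthonormal_basis :: "'g set \<Rightarrow> ('g \<Rightarrow> complex) set \<Rightarrow> nat \<Rightarrow> (nat \<Rightarrow> 'g \<Rightarrow> complex) \<Rightarrow> bool" where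
  "orthonormal_basis S W d b \<longleftrightarrow> orthonormal S d b \<and> (\<forall>i<d. b i \<in> W) \<and>
     (\<forall>f\<in>W. \<forall>g\<in>S. f g = (\<Sum>i<d. fun_inner S (b i) f * b i g))"

lemma fun_inner_cong: "(\<And>g. g \<in> S \<Longrightarrow> f g = f' g) \<Longrightarrow> (\<And>g. g \<in> S \<Longrightarrow> h g = h' g) \<Longrightarrow> fun_inner S f h
    = fun_inner S f' h'"
  unfolding fun_inner_def by (rule sum.cong) auto

lemma fun_inner_cnj: "cnj (fun_inner S f h) = fun_inner S h f"
  unfolding fun_inner_def by (simp add: mult.commute)

lemma fun_inner_lincomb: "fun_inner S f (\<lambda>g. \<Sum>i<d. c i * b i g) = (\<Sum>i<d. c i * fun_inner S f (b i))"
proof -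
  have "fun_inner S f (\<lambda>g. \<Sum>i<d. c i * b i g) = (\<Sum>g\<in>S. \<Sum>i<d. c i * (cnj (f g) * b i g))"
    unfolding fun_inner_def by (simp add: sum_distrib_left algebra_simps)
  also have "\<dots> = (\<Sum>i<d. c i * fun_inner S f (b i))"
    unfolding fun_inner_def by (subst sum.swap) (simp add: sum_distrib_left)
  finally show ?thesis .
qed

lemma fun_inner_diff: "fun_inner S f (\<lambda>g. h g - k g) = fun_inner S f h - fun_inner S f k"
  unfolding fun_inner_def by (simp add: algebra_simps sum_subtractf)

lemma fun_inner_diff_left: "fun_inner S (\<lambda>g. h g - k g) f = fun_inner S h f - fun_inner S k f"
  unfolding fun_inner_def by (simp add: algebra_simps sum_subtractf)

lemma fun_inner_scale: "fun_inner S f (\<lambda>g. a * h g) = a * fun_inner S f h"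
  unfolding fun_inner_def by (simp add: algebra_simps sum_distrib_left)

lemma fun_inner_scale_left: "fun_inner S (\<lambda>g. a * h g) f = cnj a * fun_inner S h f"
  unfolding fun_inner_def by (simp add: algebra_simps sum_distrib_left)

lemma fun_inner_self: "fun_inner S f f = of_real (\<Sum>g\<in>S. (cmod (f g))\<^sup>2)"
  unfolding fun_inner_def by (simp add: complex_norm_square[symmetric] mult.commute del: of_real_power)

text \<open>Subtracting the projection onto the span leaves a vector orthogonal to it, and
  Pythagoras computes its length.\<close>

lemma orthonormal_residual:
  assumes "orthonormal S d b"
  defines "r \<equiv> \<lambda>f g. f g - (\<Sum>i<d. fun_inner S (b i) f * b i g)"
  shows "j < d \<Longrightarrow> fun_inner S (b j) (r f) = 0"
    and "fun_inner S (r f) (r f) = fun_inner S f f - of_real (\<Sum>i<d. (cmod (fun_inner S (b i) f))\<^sup>2)"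
proof -
  have *: "fun_inner S (b j) (r f) = 0" if "j < d" for j
  proof -
    have "fun_inner S (b j) (r f) = fun_inner S (b j) f - (\<Sum>i<d. fun_inner S (b i) f * fun_inner S (b j)
        (b i))"
      unfolding r_def fun_inner_diff fun_inner_lincomb ..
    also have "(\<Sum>i<d. fun_inner S (b i) f * fun_inner S (b j) (b i))
        = (\<Sum>i<d. if i = j then fun_inner S (b i) f else 0)"
      by (rule sum.cong) (use assms that in \<open>auto simp: orthonormal_def\<close>)
    finally show ?thesis using that by simp
  qed
  show "j < d \<Longrightarrow> fun_inner S (b j) (r f) = 0" using * .
  have **: "fun_inner S (r f) (b i) = 0" if "i < d" for i
    using *[OF that] fun_inner_cnj[of S "b i" "r f"] by simp
  have "fun_inner S (r f) (r f) = fun_inner S (r f) f - (\<Sum>i<d. fun_inner S (b i) f * fun_inner S (r f)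
      (b i))"
    by (subst (2) r_def) (simp add: fun_inner_diff fun_inner_lincomb)
  also have "(\<Sum>i<d. fun_inner S (b i) f * fun_inner S (r f) (b i)) = 0"
    using ** by simp
  also have "fun_inner S (r f) f = fun_inner S f f - fun_inner S (\<lambda>g. \<Sum>i<d. fun_inner S (b i) f * b i g)
      f"
    unfolding r_def fun_inner_diff_left ..
  also have "fun_inner S (\<lambda>g. \<Sum>i<d. fun_inner S (b i) f * b i g) f
      = cnj (\<Sum>i<d. fun_inner S (b i) f * fun_inner S f (b i))"
    by (subst fun_inner_cnj[symmetric]) (simp add: fun_inner_lincomb)
  also have "\<dots> = (\<Sum>i<d. of_real ((cmod (fun_inner S (b i) f))\<^sup>2))"
    by (simp add: fun_inner_cnj[symmetric, of S f] complex_norm_square mult.commute del: of_real_power)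
  finally show "fun_inner S (r f) (r f) = fun_inner S f f - of_real
      (\<Sum>i<d. (cmod (fun_inner S (b i) f))\<^sup>2)" by simp
qed

text \<open>The squared length of the residual is non-negative.\<close>

lemma bessel:
  assumes "orthonormal S d b"
  shows "(\<Sum>i<d. (cmod (fun_inner S (b i) f))\<^sup>2) \<le> (\<Sum>g\<in>S. (cmod (f g))\<^sup>2)"
proof -
  let ?r = "\<lambda>g. f g - (\<Sum>i<d. fun_inner S (b i) f * b i g)"
  have "of_real (\<Sum>g\<in>S. (cmod (?r g))\<^sup>2)
      = (of_real ((\<Sum>g\<in>S. (cmod (f g))\<^sup>2) - (\<Sum>i<d. (cmod (fun_inner S (b i) f))\<^sup>2)) :: complex)"
    using orthonormal_residual(2)[OF assms, of f] unfolding fun_inner_self of_real_diff .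
  then have "(\<Sum>g\<in>S. (cmod (?r g))\<^sup>2) = (\<Sum>g\<in>S. (cmod (f g))\<^sup>2) - (\<Sum>i<d. (cmod (fun_inner S (b i) f))\<^sup>2)"
    unfolding of_real_eq_iff .
  moreover have "0 \<le> (\<Sum>g\<in>S. (cmod (?r g))\<^sup>2)" by (rule sum_nonneg) auto
  ultimately show ?thesis by linarith
qed

text \<open>Here the residual vanishes on \<open>S\<close>, which turns Bessel's inequality into an
  equality.\<close>

lemma parseval:
  assumes "orthonormal S d b" "\<And>g. g \<in> S \<Longrightarrow> f g = (\<Sum>i<d. fun_inner S (b i) f * b i g)"
  shows "(\<Sum>i<d. (cmod (fun_inner S (b i) f))\<^sup>2) = (\<Sum>g\<in>S. (cmod (f g))\<^sup>2)"
proof -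
  let ?r = "\<lambda>g. f g - (\<Sum>i<d. fun_inner S (b i) f * b i g)"
  have "?r g = 0" if "g \<in> S" for g using assms(2)[OF that] by simp
  then have "fun_inner S ?r ?r = 0" unfolding fun_inner_def[of S ?r ?r] by (intro sum.neutral) simp
  then have "fun_inner S f f = of_real (\<Sum>i<d. (cmod (fun_inner S (b i) f))\<^sup>2)"
    using orthonormal_residual(2)[OF assms(1), of f] by simp
  then show ?thesis unfolding fun_inner_self of_real_eq_iff by simp
qed

lemma orthonormal_norm:
  assumes "orthonormal S d b" "i < d" shows "(\<Sum>g\<in>S. (cmod (b i g))\<^sup>2) = 1"
proof -
  have "fun_inner S (b i) (b i) = of_real 1" using assms by (simp add: orthonormal_def)
  then show ?thesis unfolding fun_inner_self of_real_eq_iff .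
qed

lemma fun_subspaceD:
  assumes "fun_subspace W" shows "(\<lambda>g. 0) \<in> W" and "f \<in> W \<Longrightarrow> h \<in> W \<Longrightarrow> (\<lambda>g. a * f g + h g) \<in> W"
  using assms by (simp_all add: fun_subspace_def)

lemma fun_subspace_lincomb:
  fixes d :: nat
  assumes "fun_subspace W" "\<And>i. i < d \<Longrightarrow> b i \<in> W"
  shows "(\<lambda>g. \<Sum>i<d. c i * b i g) \<in> W"
  using assms(2)
proof (induction d)
  case 0 then show ?case using assms(1) by (simp add: fun_subspace_def)
next
  case (Suc d)
  then have "(\<lambda>g. c d * b d g + (\<Sum>i<d. c i * b i g)) \<in> W"
    using assms(1) unfolding fun_subspace_def by auto
  then show ?case by (simp add: add.commute)
qed

text \<open>One Gram-Schmidt step: the residual of a vector that is not recovered from its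
  coefficients is nonzero, and after normalisation it serves as the new vector.\<close>

lemma orthonormal_extend:
  assumes "finite S" "fun_subspace W" "orthonormal S d b" "\<forall>i<d. b i \<in> W"
    "f \<in> W" "g \<in> S" "f g \<noteq> (\<Sum>i<d. fun_inner S (b i) f * b i g)"
  shows "\<exists>b'. orthonormal S (Suc d) b' \<and> (\<forall>i<Suc d. b' i \<in> W)"
proof -
  define r where "r = (\<lambda>g. f g - (\<Sum>i<d. fun_inner S (b i) f * b i g))"
  define t where "t = (\<Sum>g\<in>S. (cmod (r g))\<^sup>2)"
  have "(\<lambda>g. (-1) * (\<Sum>i<d. fun_inner S (b i) f * b i g) + f g) \<in> W"
  proof -
    have "(\<lambda>g. \<Sum>i<d. fun_inner S (b i) f * b i g) \<in> W"
      by (rule fun_subspace_lincomb[OF assms(2)]) (use assms(4) in blast)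
    then show ?thesis by (rule fun_subspaceD(2)[OF assms(2) _ assms(5)])
  qed
  then have rW: "r \<in> W" by (simp add: r_def)
  have "r g \<noteq> 0" using assms(7) by (simp add: r_def)
  then have t: "t > 0" unfolding t_def using assms(1,6)
    by (intro sum_pos2[of S g]) auto
  define s where "s = (\<lambda>g. of_real (1 / sqrt t) * r g)"
  have sW: "s \<in> W"
  proof -
    show ?thesis using fun_subspaceD(2)[OF assms(2) rW fun_subspaceD(1)[OF assms(2)], of
        "of_real (1 / sqrt t)"]
      by (simp add: s_def)
  qed
  have rr: "fun_inner S r r = of_real t" unfolding fun_inner_self t_def ..
  have ss: "fun_inner S s s = 1"
  proof -
    have "fun_inner S s s = of_real (1 / sqrt t) * (of_real (1 / sqrt t) * of_real t)"
      unfolding s_def fun_inner_scale fun_inner_scale_left rr by simp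
    also have "\<dots> = of_real ((1 / sqrt t) * ((1 / sqrt t) * t))" by (simp only: of_real_mult)
    also have "(1 / sqrt t) * ((1 / sqrt t) * t) = 1" using t by (simp add: field_simps)
    finally show ?thesis by simp
  qed
  have bs: "fun_inner S (b i) s = 0" if "i < d" for i
    unfolding s_def fun_inner_scale using orthonormal_residual(1)[OF assms(3) that, of f]
        by (simp add: r_def)
  have sb: "fun_inner S s (b i) = 0" if "i < d" for i
    using bs[OF that] fun_inner_cnj[of S "b i" s] by simp
  let ?b = "b(d := s)"
  have "orthonormal S (Suc d) ?b"
    using assms(3) ss bs sb unfolding orthonormal_def by (auto simp: less_Suc_eq)
  moreover have "\<forall>i<Suc d. ?b i \<in> W" using assms(4) sW by (auto simp: less_Suc_eq)
  ultimately show ?thesis by blast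
qed

text \<open>A longest orthonormal family in \<open>W\<close> is a basis, since otherwise
  \<open>orthonormal_extend\<close> lengthens it. A longest one exists because the length is at most
  \<open>card S\<close>.\<close>

lemma orthonormal_basis_exists:
  assumes "finite S" "fun_subspace W" shows "\<exists>d b. orthonormal_basis S W d b"
proof -
  define P where "P = (\<lambda>d. \<exists>b. orthonormal S d b \<and> (\<forall>i<d. b i \<in> W))"
  have P0: "P 0" by (simp add: P_def orthonormal_def)
  have bound: "d \<le> card S" if Pd: "P d" for d
  proof -
    from Pd obtain b where b: "orthonormal S d b" unfolding P_def by blast
    have "(\<Sum>i<d. (cmod (b i g))\<^sup>2) \<le> 1" if "g \<in> S" for g
    proof -
      \<comment> \<open>Bessel for the indicator function of \<open>g\<close> bounds the squares of
        all values at \<open>g\<close> by one; summing over \<open>g\<close> then counts the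
        family.\<close>
      let ?f = "\<lambda>x. if x = g then 1 else 0 :: complex"
      have "fun_inner S (b i) ?f = cnj (b i g)" for i
        unfolding fun_inner_def using assms(1) that by (simp add: if_distrib cong: if_cong)
      moreover have "(\<Sum>x\<in>S. (cmod (?f x))\<^sup>2) = 1"
      proof -
        have "(\<Sum>x\<in>S. (cmod (?f x))\<^sup>2) = (\<Sum>x\<in>S. if x = g then 1 else 0)"
          by (rule sum.cong) auto
        then show ?thesis using assms(1) that by simp
      qed
      ultimately show ?thesis using bessel[OF b, of ?f] by simp
    qed
    then have "(\<Sum>g\<in>S. \<Sum>i<d. (cmod (b i g))\<^sup>2) \<le> (\<Sum>g\<in>S. 1)" by (rule sum_mono)
    moreover have "(\<Sum>g\<in>S. \<Sum>i<d. (cmod (b i g))\<^sup>2) = (\<Sum>i<d. 1)"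
      by (subst sum.swap) (rule sum.cong, auto simp: orthonormal_norm[OF b])
    ultimately show ?thesis by simp
  qed
  define d where "d = (GREATEST d. P d)"
  have "P d" unfolding d_def using P0 bound by (rule GreatestI_nat)
  moreover have "\<not> P (Suc d)"
    using Greatest_le_nat[of P "Suc d" "card S"] bound unfolding d_def by force
  ultimately obtain b where b: "orthonormal S d b" "\<forall>i<d. b i \<in> W" unfolding P_def by blast
  have "f g = (\<Sum>i<d. fun_inner S (b i) f * b i g)" if "f \<in> W" "g \<in> S" for f g
    using orthonormal_extend[OF assms b that] \<open>\<not> P (Suc d)\<close> unfolding P_def by blast
  with b show ?thesis unfolding orthonormal_basis_def by blast
qed

text \<open>The squared coefficients between the two families are summed in two ways: Parseval along
  \<open>b\<close> gives exactly \<open>d'\<close>, Bessel along \<open>b'\<close> gives at most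
  \<open>d\<close>.\<close>

lemma orthonormal_basis_size:
  assumes "orthonormal_basis S W d b" "orthonormal S d' b'" "\<forall>i<d'. b' i \<in> W"
  shows "d' \<le> d"
proof -
  have b: "orthonormal S d b" using assms(1) by (simp add: orthonormal_basis_def)
  have "real d' = (\<Sum>j<d'. \<Sum>i<d. (cmod (fun_inner S (b i) (b' j)))\<^sup>2)"
  proof -
    have "(\<Sum>i<d. (cmod (fun_inner S (b i) (b' j)))\<^sup>2) = 1" if "j < d'" for j
      using parseval[OF b, of "b' j"] assms(1,3) orthonormal_norm[OF assms(2) that] that
      unfolding orthonormal_basis_def by auto
    then show ?thesis by simp
  qed
  also have "\<dots> = (\<Sum>i<d. \<Sum>j<d'. (cmod (fun_inner S (b' j) (b i)))\<^sup>2)"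
    by (subst sum.swap) (intro sum.cong refl, metis complex_mod_cnj fun_inner_cnj)
  also have "\<dots> \<le> (\<Sum>i<d. \<Sum>g\<in>S. (cmod (b i g))\<^sup>2)"
    by (rule sum_mono) (rule bessel[OF assms(2)])
  also have "\<dots> = real d" using orthonormal_norm[OF b] by simp
  finally show ?thesis by simp
qed

lemma orthonormal_basis_coeff:
  assumes "orthonormal S d b" "i < d" "\<And>g. g \<in> S \<Longrightarrow> f g = (\<Sum>k<d. c k * b k g)"
  shows "fun_inner S (b i) f = c i"
proof -
  have "fun_inner S (b i) f = (\<Sum>k<d. c k * fun_inner S (b i) (b k))"
    unfolding fun_inner_lincomb[symmetric] by (rule fun_inner_cong) (use assms(3) in auto)
  also have "\<dots> = (\<Sum>k<d. if k = i then c k else 0)"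
    by (rule sum.cong) (use assms in \<open>auto simp: orthonormal_def\<close>)
  finally show ?thesis using assms(2) by simp
qed

text \<open>The functions satisfying the conditions \<open>ann\<close> form an invariant subspace
  \<open>W\<close> of the regular representation. If it were nonzero, a minimal invariant subspace
  \<open>V\<close> would be irreducible, and the kernel \<open>N\<close> of its character would act
  trivially on \<open>V\<close>. Then the sums over \<open>N\<close> that vanish by
  \<open>ann\<close> are \<open>card N\<close> times the values of the functions in
  \<open>V\<close>. Normality of the kernel is a premise inside \<open>ann\<close>, so that the
  caller receives it for free; it is proved here for the one kernel that matters.\<close>

lemma (in group) irreducible_character_detects:
  assumes fin: "finite (carrier G)"
    and ann: "\<And>\<chi> g. \<chi> \<in> irreducible_characters G \<Longrightarrow> character_kernel G \<chi> \<lhd> G \<Longrightarrow> g \<in> carrier G \<Longrightarrow>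
       (\<Sum>h\<in>character_kernel G \<chi>. f (g \<otimes> h)) = 0"
    and g0: "g0 \<in> carrier G"
  shows "f g0 = (0 :: complex)"
proof (rule ccontr)
  assume nz: "f g0 \<noteq> 0"
  let ?S = "carrier G"
  \<comment> \<open>Left translation, that is, the regular representation. The conditions defining
    \<open>W\<close> multiply by \<open>h\<close> on the right, so \<open>W\<close> is stable under
    it.\<close>
  define tr where "tr = (\<lambda>x (f :: 'a \<Rightarrow> complex) g. f (inv x \<otimes> g))"
  define W where "W = {f :: 'a \<Rightarrow> complex. \<forall>\<chi>\<in>irreducible_characters G. character_kernel G \<chi> \<lhd> G \<longrightarrow>
     (\<forall>g\<in>?S. (\<Sum>h\<in>character_kernel G \<chi>. f (g \<otimes> h)) = 0)}"
  define good where "good = (\<lambda>V d b. fun_subspace V \<and> V \<subseteq> W \<and> (\<forall>x\<in>?S. \<forall>f\<in>V. tr x f \<in> V) \<and>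
     orthonormal_basis ?S V d b \<and> d > 0)"
  have kerS: "character_kernel G \<chi> \<subseteq> ?S" for \<chi> by (auto simp: character_kernel_def)
  have W: "fun_subspace W"
    unfolding fun_subspace_def W_def
    by (auto simp: sum.distrib simp flip: sum_distrib_left)
  have Wtr: "tr x f \<in> W" if "x \<in> ?S" "f \<in> W" for x f
  proof -
    have "(\<Sum>h\<in>character_kernel G \<chi>. f (inv x \<otimes> (g \<otimes> h)))
        = (\<Sum>h\<in>character_kernel G \<chi>. f ((inv x \<otimes> g) \<otimes> h))"
      if "g \<in> ?S" for g \<chi>
      by (rule sum.cong[OF refl]) (use that \<open>x \<in> ?S\<close> subsetD[OF kerS] in \<open>force simp: m_assoc\<close>)
    then show ?thesis using that by (auto simp: W_def tr_def)
  qed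
  have fW: "f \<in> W" using ann by (auto simp: W_def)
  have "\<exists>d V b. good V d b"
  proof -
    obtain d b where db: "orthonormal_basis ?S W d b" using orthonormal_basis_exists[OF fin W] by blast
    have "d > 0"
    proof (rule ccontr)
      assume "\<not> d > 0"
      then have "f g0 = 0" using db fW g0 unfolding orthonormal_basis_def by auto
      with nz show False by simp
    qed
    then show ?thesis unfolding good_def using W Wtr db by blast
  qed
  \<comment> \<open>A nonzero invariant subspace of least dimension is irreducible. Carrying an
    orthonormal basis in \<open>good\<close> makes the dimension a number that \<open>LEAST\<close>
    can minimise.\<close>
  define d where "d = (LEAST d. \<exists>V b. good V d b)"
  have "\<exists>V b. good V d b" unfolding d_def by (rule LeastI_ex) fact
  then obtain V b where gd: "good V d b" by blast
  have least: "d \<le> d'" if "good V' d' b'" for V' d' b'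
    unfolding d_def by (rule Least_le) (use that in blast)
  have V: "fun_subspace V" "V \<subseteq> W" "\<And>x f. x \<in> ?S \<Longrightarrow> f \<in> V \<Longrightarrow> tr x f \<in> V" "orthonormal_basis ?S V d b"
      "d > 0"
    using gd unfolding good_def by auto
  have b: "orthonormal ?S d b" "\<And>i. i < d \<Longrightarrow> b i \<in> V"
    "\<And>f g. f \<in> V \<Longrightarrow> g \<in> ?S \<Longrightarrow> f g = (\<Sum>i<d. fun_inner ?S (b i) f * b i g)"
    using V(4) unfolding orthonormal_basis_def by auto
  \<comment> \<open>The matrix of left translation by \<open>x\<close> in the basis
    \<open>b\<close>; column \<open>j\<close> holds the coordinates of the translate of
    \<open>b j\<close>. Translation preserves \<open>fun_inner\<close>, so the matrix is unitary,
    which is used below through the norms of its columns.\<close>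
  define \<rho> where "\<rho> = (\<lambda>x. mat d d (\<lambda>(i, j). fun_inner ?S (b i) (tr x (b j))))"
  have \<rho>_dim[simp]: "\<rho> x \<in> carrier_mat d d" "dim_row (\<rho> x) = d" "dim_col (\<rho> x) = d" for x
      by (auto simp: \<rho>_def)
  have exp: "b j (inv x \<otimes> g) = (\<Sum>i<d. \<rho> x $$ (i, j) * b i g)" if "x \<in> ?S" "g \<in> ?S" "j < d" for x g j
    using b(3)[OF V(3)[OF that(1) b(2)[OF that(3)]] that(2)] that(3) by (simp add: \<rho>_def tr_def)
  have \<rho>_eq: "\<rho> x $$ (i, j) = c i" if "i < d" "j < d" "\<And>g. g \<in> ?S \<Longrightarrow> b j (inv x \<otimes> g)
      = (\<Sum>k<d. c k * b k g)" for x i j c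
    using orthonormal_basis_coeff[OF b(1) that(1), of "tr x (b j)" c] that by (simp add: \<rho>_def tr_def)
  have \<rho>_mult: "\<rho> (x \<otimes> y) = \<rho> x * \<rho> y" if "x \<in> ?S" "y \<in> ?S" for x y
  proof (rule eq_matI)
    fix i j assume "i < dim_row (\<rho> x * \<rho> y)" "j < dim_col (\<rho> x * \<rho> y)"
    then have ij: "i < d" "j < d" by auto
    have "\<rho> (x \<otimes> y) $$ (i, j) = (\<Sum>k<d. \<rho> x $$ (i, k) * \<rho> y $$ (k, j))"
    proof (rule \<rho>_eq[OF ij])
      fix g assume g: "g \<in> ?S"
      have "b j (inv (x \<otimes> y) \<otimes> g) = b j (inv y \<otimes> (inv x \<otimes> g))"
        using that g by (simp add: inv_mult_group m_assoc)
      also have "\<dots> = (\<Sum>k<d. \<rho> y $$ (k, j) * b k (inv x \<otimes> g))"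
        using exp that g ij by simp
      also have "\<dots> = (\<Sum>k<d. \<rho> y $$ (k, j) * (\<Sum>l<d. \<rho> x $$ (l, k) * b l g))"
        by (rule sum.cong) (use exp that g in auto)
      also have "\<dots> = (\<Sum>k<d. \<Sum>l<d. \<rho> x $$ (l, k) * \<rho> y $$ (k, j) * b l g)"
        by (simp add: sum_distrib_left algebra_simps)
      also have "\<dots> = (\<Sum>l<d. (\<Sum>k<d. \<rho> x $$ (l, k) * \<rho> y $$ (k, j)) * b l g)"
        by (subst sum.swap) (simp add: sum_distrib_right)
      finally show "b j (inv (x \<otimes> y) \<otimes> g) = (\<Sum>k<d. (\<Sum>ka<d. \<rho> x $$ (k, ka) * \<rho> y $$ (ka, j)) * b k g)" .
    qed
    also have "\<dots> = (\<rho> x * \<rho> y) $$ (i, j)"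
      using ij by (simp add: scalar_prod_def lessThan_atLeast0)
    finally show "\<rho> (x \<otimes> y) $$ (i, j) = (\<rho> x * \<rho> y) $$ (i, j)" .
  qed auto
  have \<rho>_one: "\<rho> \<one> = 1\<^sub>m d"
  proof (rule eq_matI)
    fix i j assume "i < dim_row (1\<^sub>m d :: complex mat)" "j < dim_col (1\<^sub>m d :: complex mat)"
    then have ij: "i < d" "j < d" by auto
    have "\<rho> \<one> $$ (i, j) = (if i = j then 1 else 0)"
    proof (rule \<rho>_eq[OF ij])
      fix g assume "g \<in> ?S"
      have "(\<Sum>k<d. (if k = j then 1 else 0) * b k g) = (\<Sum>k<d. if k = j then b k g else 0)"
        by (rule sum.cong) auto
      then show "b j (inv \<one> \<otimes> g) = (\<Sum>k<d. (if k = j then 1 else 0) * b k g)"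
        using ij \<open>g \<in> ?S\<close> by simp
    qed
    then show "\<rho> \<one> $$ (i, j) = 1\<^sub>m d $$ (i, j)" using ij by simp
  qed auto
  have rep: "representation G d \<rho>"
    unfolding representation_def
  proof (rule homI)
    fix x assume x: "x \<in> ?S"
    have "\<rho> x * \<rho> (inv x) = 1\<^sub>m d" "\<rho> (inv x) * \<rho> x = 1\<^sub>m d"
      using \<rho>_mult[of x "inv x"] \<rho>_mult[of "inv x" x] x \<rho>_one by auto
    then show "\<rho> x \<in> carrier (units_of (ring_mat TYPE(complex) d ()))"
      unfolding units_of_carrier Units_def ring_mat_def by (auto intro!: bexI[of _ "\<rho> (inv x)"])
  next
    fix x y assume "x \<in> ?S" "y \<in> ?S"
    then show "\<rho> (x \<otimes> y) = \<rho> x \<otimes>\<^bsub>units_of (ring_mat TYPE(complex) d ())\<^esub> \<rho> y"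
      by (simp add: units_of_mult ring_mat_def \<rho>_mult)
  qed
  have irr: "irreducible_representation G d \<rho>"
    unfolding irreducible_representation_def
  proof (intro conjI allI impI rep V(5))
    fix U assume U: "VectorSpace.subspace class_ring U (module_vec TYPE(complex) d) \<and>
       (\<forall>g\<in>?S. \<forall>w\<in>U. \<rho> g *\<^sub>v w \<in> U)"
    then have sub: "LinearCombinations.submodule class_ring U (module_vec TYPE(complex) d)"
      by (simp add: VectorSpace.subspace_def)
    have U1: "U \<subseteq> carrier_vec d" "0\<^sub>v d \<in> U" "\<And>u v. u \<in> U \<Longrightarrow> v \<in> U \<Longrightarrow> u + v \<in> U"
      "\<And>a u. u \<in> U \<Longrightarrow> a \<cdot>\<^sub>v u \<in> U"
      using sub unfolding LinearCombinations.submodule_def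
          by (auto simp: module_vec_simps class_ring_simps)
    have U2: "\<And>g w. g \<in> ?S \<Longrightarrow> w \<in> U \<Longrightarrow> \<rho> g *\<^sub>v w \<in> U" using U by blast
    show "U = {0\<^sub>v d} \<or> U = carrier_vec d"
    proof (cases "U = {0\<^sub>v d}")
      case False
      then obtain w0 where w0: "w0 \<in> U" "w0 \<noteq> 0\<^sub>v d" using U1(2) by blast
      \<comment> \<open>The functions of \<open>V\<close> whose coordinate vectors lie in
        \<open>U\<close>: a nonzero invariant subspace, so by minimality its dimension is at least
        \<open>d\<close>.\<close>
      define V' where "V' = {f \<in> V. \<exists>w\<in>U. \<forall>g\<in>?S. f g = (\<Sum>i<d. w $ i * b i g)}"
      have lc: "(\<lambda>g. \<Sum>i<d. w $ i * b i g) \<in> V" for w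
        using fun_subspace_lincomb[OF V(1), of d b "\<lambda>i. w $ i"] b(2) by simp
      have V': "fun_subspace V'"
        unfolding fun_subspace_def
      proof (intro conjI allI ballI)
        have "\<forall>g\<in>?S. 0 = (\<Sum>i<d. 0\<^sub>v d $ i * b i g)" by simp
        then show "(\<lambda>g. 0) \<in> V'" using fun_subspaceD(1)[OF V(1)] U1(2) unfolding V'_def by blast
      next
        fix a f h assume "f \<in> V'" "h \<in> V'"
        then obtain u v where uv: "f \<in> V" "h \<in> V" "u \<in> U" "v \<in> U" "\<forall>g\<in>?S. f g = (\<Sum>i<d. u $ i * b i g)"
          "\<forall>g\<in>?S. h g = (\<Sum>i<d. v $ i * b i g)" unfolding V'_def by blast
        have "a \<cdot>\<^sub>v u + v \<in> U" using U1 uv by blast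
        moreover have "a * f g + h g = (\<Sum>i<d. (a \<cdot>\<^sub>v u + v) $ i * b i g)" if "g \<in> ?S" for g
        proof -
          have dv: "dim_vec u = d" "dim_vec v = d" using U1(1) uv by auto
          have "(\<Sum>i<d. (a \<cdot>\<^sub>v u + v) $ i * b i g) = (\<Sum>i<d. a * (u $ i * b i g) + v $ i * b i g)"
            by (rule sum.cong) (use dv in \<open>auto simp: algebra_simps\<close>)
          then show ?thesis using uv(5,6) that by (simp add: sum.distrib sum_distrib_left)
        qed
        moreover have "(\<lambda>g. a * f g + h g) \<in> V" using V(1) uv unfolding fun_subspace_def by blast
        ultimately show "(\<lambda>g. a * f g + h g) \<in> V'" unfolding V'_def by blast
      qed
      have V'tr: "tr x f \<in> V'" if "x \<in> ?S" and fV': "f \<in> V'" for x f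
      proof -
        obtain u where u: "f \<in> V" "u \<in> U" "\<forall>g\<in>?S. f g = (\<Sum>i<d. u $ i * b i g)"
          using fV' unfolding V'_def by blast
        have du: "dim_vec u = d" using U1(1) u by auto
        have "tr x f g = (\<Sum>i<d. (\<rho> x *\<^sub>v u) $ i * b i g)" if g: "g \<in> ?S" for g
        proof -
          have "tr x f g = (\<Sum>j<d. u $ j * b j (inv x \<otimes> g))" using u(3) g \<open>x \<in> ?S\<close> by (simp add: tr_def)
          also have "\<dots> = (\<Sum>j<d. u $ j * (\<Sum>i<d. \<rho> x $$ (i, j) * b i g))"
            by (rule sum.cong) (use exp g \<open>x \<in> ?S\<close> in auto)
          also have "\<dots> = (\<Sum>j<d. \<Sum>i<d. \<rho> x $$ (i, j) * u $ j * b i g)"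
            by (simp add: sum_distrib_left algebra_simps)
          also have "\<dots> = (\<Sum>i<d. (\<Sum>j<d. \<rho> x $$ (i, j) * u $ j) * b i g)"
            by (subst sum.swap) (simp add: sum_distrib_right)
          also have "\<dots> = (\<Sum>i<d. (\<rho> x *\<^sub>v u) $ i * b i g)"
            by (rule sum.cong) (auto simp: scalar_prod_def lessThan_atLeast0 du)
          finally show ?thesis .
        qed
        then show ?thesis using u V(3) U2 \<open>x \<in> ?S\<close> unfolding V'_def by blast
      qed
      obtain d' b' where b': "orthonormal_basis ?S V' d' b'" using orthonormal_basis_exists[OF fin V']
          by blast
      have "V' \<subseteq> V" unfolding V'_def by blast
      have "d' > 0"
      proof (rule ccontr)
        assume "\<not> d' > 0"
        let ?f = "\<lambda>g. \<Sum>i<d. w0 $ i * b i g"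
        have "?f \<in> V'" unfolding V'_def using lc w0 by blast
        then have "\<forall>g\<in>?S. ?f g = 0" using b' \<open>\<not> d' > 0\<close> unfolding orthonormal_basis_def by auto
        have "w0 $ i = 0" if "i < d" for i
        proof -
          have "w0 $ i = fun_inner ?S (b i) ?f" using orthonormal_basis_coeff[OF b(1) that, of ?f]
              by simp
          also have "\<dots> = 0" using \<open>\<forall>g\<in>?S. ?f g = 0\<close> by (simp add: fun_inner_def)
          finally show ?thesis .
        qed
        then have "w0 = 0\<^sub>v d" using U1(1) w0(1) by (intro eq_vecI) auto
        with w0 show False by simp
      qed
      then have "good V' d' b'" unfolding good_def using V' V'tr b' \<open>V' \<subseteq> V\<close> V(2) by blast
      then have dd: "d \<le> d'" by (rule least)
      have ob': "orthonormal ?S d' b'" "\<forall>i<d'. b' i \<in> V'" using b' by (auto simp: orthonormal_basis_def)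
      have "v \<in> U" if v: "v \<in> carrier_vec d" for v
      proof -
        let ?f = "\<lambda>g. \<Sum>i<d. v $ i * b i g"
        have eq: "?f g = (\<Sum>i<d'. fun_inner ?S (b' i) ?f * b' i g)" if "g \<in> ?S" for g
        proof (rule ccontr)
          \<comment> \<open>Otherwise the basis of \<open>V'\<close> extends to
            \<open>Suc d'\<close> orthonormal vectors of \<open>V\<close>, more than the dimension
            \<open>d\<close> allows.\<close>
          assume "?f g \<noteq> (\<Sum>i<d'. fun_inner ?S (b' i) ?f * b' i g)"
          with orthonormal_extend[OF fin V(1) ob'(1) _ lc that, of v] ob'(2) \<open>V' \<subseteq> V\<close>
          obtain b'' where "orthonormal ?S (Suc d') b''" "\<forall>i<Suc d'. b'' i \<in> V" by blast
          from orthonormal_basis_size[OF V(4) this] dd show False by simp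
        qed
        have "(\<lambda>g. \<Sum>i<d'. fun_inner ?S (b' i) ?f * b' i g) \<in> V'"
          by (rule fun_subspace_lincomb[OF V']) (use ob'(2) in blast)
        then obtain w where w: "w \<in> U" "\<forall>g\<in>?S. (\<Sum>i<d'. fun_inner ?S (b' i) ?f * b' i g)
            = (\<Sum>i<d. w $ i * b i g)"
          unfolding V'_def by blast
        have "v $ i = w $ i" if "i < d" for i
          using orthonormal_basis_coeff[OF b(1) that, of ?f "\<lambda>i. v $ i"] orthonormal_basis_coeff[OF b(1)
              that, of ?f "\<lambda>i. w $ i"] w(2) eq by simp
        then have "v = w" using v w(1) U1(1) by (intro eq_vecI) auto
        with w show ?thesis by simp
      qed
      then show ?thesis using U1(1) by blast
    qed simp
  qed
  define \<chi> where "\<chi> = (\<lambda>g\<in>?S. \<Sum>i<d. \<rho> g $$ (i, i))"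
  have \<chi>: "\<chi> \<in> irreducible_characters G" unfolding irreducible_characters_def \<chi>_def using irr by blast
  have \<chi>1: "\<chi> \<one> = of_nat d" by (simp add: \<chi>_def \<rho>_one)
  define N where "N = character_kernel G \<chi>"
  \<comment> \<open>Forward, the columns of a unitary matrix have norm one, so each diagonal entry
    has modulus at most one. Their sum is \<open>d\<close> only if each of them is one, and then the
    column norms leave nothing for the entries off the diagonal.\<close>
  have N_iff: "g \<in> N \<longleftrightarrow> g \<in> ?S \<and> (\<forall>i<d. \<forall>y\<in>?S. b i (inv g \<otimes> y) = b i y)" for g
  proof
    assume gN: "g \<in> N"
    then have g: "g \<in> ?S" and tr: "(\<Sum>i<d. \<rho> g $$ (i, i)) = of_nat d"
      using \<chi>1 unfolding N_def character_kernel_def \<chi>_def by auto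
    \<comment> \<open>Parseval computes the norm of the translate, which is that of
      \<open>b j\<close> because translation permutes the group.\<close>
    have col: "(\<Sum>i<d. (cmod (\<rho> g $$ (i, j)))\<^sup>2) = 1" if j: "j < d" for j
    proof -
      have "(\<Sum>i<d. (cmod (\<rho> g $$ (i, j)))\<^sup>2) = (\<Sum>i<d. (cmod (fun_inner ?S (b i) (tr g (b j))))\<^sup>2)"
        by (rule sum.cong) (use j in \<open>auto simp: \<rho>_def\<close>)
      also have "\<dots> = (\<Sum>y\<in>?S. (cmod (tr g (b j) y))\<^sup>2)"
        using parseval[OF b(1)] b(3)[OF V(3)[OF g b(2)[OF j]]] by blast
      also have "\<dots> = (\<Sum>y\<in>?S. (cmod (b j y))\<^sup>2)"
        unfolding tr_def
        by (rule sum.reindex_bij_witness[of _ "\<lambda>y. g \<otimes> y" "\<lambda>y. inv g \<otimes> y"]) (use g in \<open>auto simp: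
            m_assoc[symmetric]\<close>)
      also have "\<dots> = 1" using orthonormal_norm[OF b(1) j] .
      finally show ?thesis .
    qed
    have le1: "cmod (\<rho> g $$ (j, j)) \<le> 1" if j: "j < d" for j
    proof -
      have "(cmod (\<rho> g $$ (j, j)))\<^sup>2 \<le> (\<Sum>i<d. (cmod (\<rho> g $$ (i, j)))\<^sup>2)"
        by (rule member_le_sum) (use j in auto)
      then show ?thesis using col[OF j] by (simp add: power2_le_iff_abs_le abs_square_le_1)
    qed
    have sumRe: "(\<Sum>j<d. 1 - Re (\<rho> g $$ (j, j))) = 0"
      using arg_cong[OF tr, of Re] by (simp add: sum_subtractf Re_sum)
    have Re1: "Re (\<rho> g $$ (j, j)) = 1" if j: "j < d" for j
    proof -
      have "\<forall>j\<in>{..<d}. 1 - Re (\<rho> g $$ (j, j)) = 0"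
        using sumRe by (subst (asm) sum_nonneg_eq_0_iff)
          (auto intro: order_trans[OF complex_Re_le_cmod le1])
      then show ?thesis using j by auto
    qed
    have diag: "\<rho> g $$ (j, j) = 1" if j: "j < d" for j
    proof -
      have "(Re (\<rho> g $$ (j, j)))\<^sup>2 + (Im (\<rho> g $$ (j, j)))\<^sup>2 \<le> 1"
        using le1[OF j] by (simp add: cmod_def)
      then have "Im (\<rho> g $$ (j, j)) = 0" using Re1[OF j] by simp
      then show ?thesis using Re1[OF j] by (simp add: complex_eq_iff)
    qed
    have off: "\<rho> g $$ (i, j) = 0" if "i < d" "j < d" "i \<noteq> j" for i j
    proof -
      have "(\<Sum>i\<in>{..<d} - {j}. (cmod (\<rho> g $$ (i, j)))\<^sup>2) = 0"
        using col[OF that(2)] diag[OF that(2)] that(2) by (simp add: sum_diff1)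
      then have "\<forall>i\<in>{..<d} - {j}. (cmod (\<rho> g $$ (i, j)))\<^sup>2 = 0"
        by (subst (asm) sum_nonneg_eq_0_iff) auto
      then show ?thesis using that by auto
    qed
    have "b j (inv g \<otimes> y) = b j y" if "j < d" "y \<in> ?S" for j y
    proof -
      have "b j (inv g \<otimes> y) = (\<Sum>i<d. \<rho> g $$ (i, j) * b i y)" using exp g that by blast
      also have "\<dots> = (\<Sum>i<d. if i = j then b i y else 0)"
        by (rule sum.cong) (use diag off that in auto)
      finally show ?thesis using that by simp
    qed
    then show "g \<in> ?S \<and> (\<forall>i<d. \<forall>y\<in>?S. b i (inv g \<otimes> y) = b i y)" using g by blast
  next
    assume *: "g \<in> ?S \<and> (\<forall>i<d. \<forall>y\<in>?S. b i (inv g \<otimes> y) = b i y)"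
    have "\<rho> g $$ (i, i) = 1" if "i < d" for i
    proof -
      have "\<rho> g $$ (i, i) = (if i = i then 1 else 0)"
      proof (rule \<rho>_eq[where c = "\<lambda>k. if k = i then 1 else 0"])
        fix y assume "y \<in> ?S"
        have "(\<Sum>k<d. (if k = i then 1 else 0) * b k y) = (\<Sum>k<d. if k = i then b k y else 0)"
          by (rule sum.cong) auto
        then show "b i (inv g \<otimes> y) = (\<Sum>k<d. (if k = i then 1 else 0) * b k y)"
          using that * \<open>y \<in> ?S\<close> by simp
      qed (use that in auto)
      then show ?thesis by simp
    qed
    then show "g \<in> N" using * \<chi>1 unfolding N_def character_kernel_def \<chi>_def by simp
  qed
  have NS: "N \<subseteq> ?S" using N_iff by blast
  have sg: "subgroup N G"
  proof (rule subgroupI)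
    show "N \<subseteq> ?S" by fact
    show "N \<noteq> {}" using N_iff[of \<one>] by auto
  next
    fix a assume a: "a \<in> N"
    then have aS: "a \<in> ?S" and eq: "\<And>i y. i < d \<Longrightarrow> y \<in> ?S \<Longrightarrow> b i (inv a \<otimes> y) = b i y" using N_iff by auto
    have "b i (inv (inv a) \<otimes> y) = b i y" if "i < d" "y \<in> ?S" for i y
      using eq[of i "a \<otimes> y"] that aS by (simp add: m_assoc[symmetric])
    then show "inv a \<in> N" using aS N_iff by simp
  next
    fix a c assume a: "a \<in> N" "c \<in> N"
    then show "a \<otimes> c \<in> N" using N_iff by (auto simp: inv_mult_group m_assoc)
  qed
  have nN: "N \<lhd> G"
    unfolding normal_inv_iff
  proof (intro conjI ballI sg)
    fix x g assume x: "x \<in> ?S" and gN: "g \<in> N"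
    have g: "g \<in> ?S" using gN NS by blast
    have "b i (inv (x \<otimes> g \<otimes> inv x) \<otimes> y) = b i y" if i: "i < d" and y: "y \<in> ?S" for i y
    proof -
      have "b i (inv (x \<otimes> g \<otimes> inv x) \<otimes> y) = b i (inv (inv x) \<otimes> (inv g \<otimes> (inv x \<otimes> y)))"
        using x g y by (simp add: inv_mult_group m_assoc)
      also have "\<dots> = (\<Sum>k<d. \<rho> (inv x) $$ (k, i) * b k (inv g \<otimes> (inv x \<otimes> y)))"
        by (rule exp) (use x g y i in auto)
      also have "\<dots> = (\<Sum>k<d. \<rho> (inv x) $$ (k, i) * b k (inv x \<otimes> y))"
        by (rule sum.cong) (use gN N_iff x y in auto)
      also have "\<dots> = b i (inv (inv x) \<otimes> (inv x \<otimes> y))"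
        by (rule exp[symmetric]) (use x y i in auto)
      also have "\<dots> = b i y" using x y by (simp add: m_assoc[symmetric])
      finally show ?thesis .
    qed
    then show "x \<otimes> g \<otimes> inv x \<in> N" using N_iff x g by simp
  qed
  have "b 0 y = 0" if y: "y \<in> ?S" for y
  proof -
    have "b 0 \<in> W" using b(2) V(2,5) by blast
    then have "(\<Sum>h\<in>N. b 0 (y \<otimes> h)) = 0" using \<chi> nN y unfolding W_def N_def by blast
    moreover have "b 0 (y \<otimes> h) = b 0 y" if h: "h \<in> N" for h
    proof -
      have hS: "h \<in> ?S" using h NS by blast
      \<comment> \<open>At \<open>y\<close>, right multiplication by \<open>h\<close> is left
        multiplication by the conjugate of \<open>h\<close> by \<open>y\<close>, which normality
        keeps in \<open>N\<close>; so \<open>b 0\<close> is constant on the coset of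
        \<open>y\<close>.\<close>
      have "y \<otimes> h \<otimes> inv y \<in> N" using nN h y unfolding normal_inv_iff by blast
      then have "inv (y \<otimes> h \<otimes> inv y) \<in> N" using subgroup.m_inv_closed[OF sg] by blast
      then have "b 0 (inv (inv (y \<otimes> h \<otimes> inv y)) \<otimes> y) = b 0 y" using N_iff V(5) y by blast
      then show ?thesis using y hS by (simp add: m_assoc)
    qed
    ultimately have "of_nat (card N) * b 0 y = 0" by simp
    moreover have "card N \<noteq> 0" using sg NS fin finite_subset[OF NS fin] subgroup.one_closed[OF sg]
        by auto
    ultimately show ?thesis by simp
  qed
  then have "(\<Sum>g\<in>?S. (cmod (b 0 g))\<^sup>2) = 0" by simp
  then show False using orthonormal_norm[OF b(1) V(5)] by simp
qed

section \<open>Integral elements\<close>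

definition int_emb :: "('a, 'b) ring_scheme \<Rightarrow> int \<Rightarrow> 'a" where
  "int_emb R k = [k] \<cdot>\<^bsub>R\<^esub> \<one>\<^bsub>R\<^esub>"

text \<open>Polynomials come from the type \<open>int poly\<close> and the ring enters only through
  evaluation. Thus degrees, leading coefficients and characteristic polynomials of integer matrices
  are available, whatever the ring.\<close>

definition int_poly_eval :: "('a, 'b) ring_scheme \<Rightarrow> int poly \<Rightarrow> 'a \<Rightarrow> 'a" where
  "int_poly_eval R q x = fold_coeffs (\<lambda>a r. int_emb R a \<oplus>\<^bsub>R\<^esub> x \<otimes>\<^bsub>R\<^esub> r) q \<zero>\<^bsub>R\<^esub>"

section \<open>Integer polynomials in a commutative ring and integrality of products\<close>

context cring begin

lemma int_emb_closed [simp, intro]: "int_emb R k \<in> carrier R"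
  by (simp add: int_emb_def)

lemma int_emb_0 [simp]: "int_emb R 0 = \<zero>" and int_emb_1 [simp]: "int_emb R 1 = \<one>"
  by (simp_all add: int_emb_def add_pow_int_ge)

lemma int_emb_add: "int_emb R (a + b) = int_emb R a \<oplus> int_emb R b"
  by (simp add: int_emb_def add.int_pow_mult)

lemma int_emb_uminus: "int_emb R (- a) = \<ominus> int_emb R a"
  by (simp add: int_emb_def add.int_pow_neg)

lemma int_emb_diff: "int_emb R (a - b) = int_emb R a \<ominus> int_emb R b"
  by (metis a_minus_def add_uminus_conv_diff int_emb_add int_emb_uminus)

lemma int_emb_mult: "int_emb R (a * b) = int_emb R a \<otimes> int_emb R b"
  unfolding int_emb_def by (simp add: add_pow_ldistr_int add.int_pow_pow mult.commute)

lemma int_emb_of_nat: "int_emb R (int n) = [n] \<cdot> \<one>"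
  by (simp add: int_emb_def add_pow_int_ge)

lemma int_poly_eval_0 [simp]: "int_poly_eval R 0 x = \<zero>"
  by (simp add: int_poly_eval_def)

lemma int_poly_eval_pCons: "x \<in> carrier R \<Longrightarrow> int_poly_eval R (pCons a q) x = int_emb R a \<oplus> x \<otimes>
    int_poly_eval R q x"
proof (cases "q = 0 \<and> a = 0")
  case False
  assume "x \<in> carrier R"
  then show ?thesis using False unfolding int_poly_eval_def
    by (cases "q = 0") (auto simp: fold_coeffs_pCons_not_0_0_eq fold_coeffs_pCons_coeff_not_0_eq)
qed auto

lemma int_poly_eval_closed [simp, intro]: "x \<in> carrier R \<Longrightarrow> int_poly_eval R q x \<in> carrier R"
  by (induction q) (auto simp: int_poly_eval_pCons)

lemma int_poly_eval_const: "x \<in> carrier R \<Longrightarrow> int_poly_eval R [:a:] x = int_emb R a"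
  by (simp add: int_poly_eval_pCons)

lemma int_poly_eval_1 [simp]: "x \<in> carrier R \<Longrightarrow> int_poly_eval R 1 x = \<one>"
  by (simp add: one_pCons int_poly_eval_const)

lemma int_poly_eval_X: "x \<in> carrier R \<Longrightarrow> int_poly_eval R [:0, 1:] x = x"
  by (simp add: int_poly_eval_pCons)

lemma int_poly_eval_add:
  assumes x: "x \<in> carrier R" shows "int_poly_eval R (q + s) x = int_poly_eval R q x \<oplus> int_poly_eval R s
      x"
proof (induction q s rule: poly_induct2)
  case (pCons a q b s)
  have "int_poly_eval R (pCons a q + pCons b s) x = (int_emb R a \<oplus> int_emb R b) \<oplus> x \<otimes>
      (int_poly_eval R q x \<oplus> int_poly_eval R s x)"
    using pCons x by (simp add: int_poly_eval_pCons int_emb_add)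
  also have "\<dots> = (int_emb R a \<oplus> x \<otimes> int_poly_eval R q x) \<oplus> (int_emb R b \<oplus> x \<otimes> int_poly_eval R s x)"
    using x by (simp add: r_distr a_ac)
  finally show ?case using x by (simp add: int_poly_eval_pCons)
qed simp

lemma int_poly_eval_smult: "x \<in> carrier R \<Longrightarrow> int_poly_eval R (Polynomial.smult a q) x = int_emb R a \<otimes>
    int_poly_eval R q x"
  by (induction q) (auto simp: int_poly_eval_pCons int_emb_mult r_distr m_lcomm)

lemma int_poly_eval_mult:
  assumes x: "x \<in> carrier R" shows "int_poly_eval R (q * s) x = int_poly_eval R q x \<otimes> int_poly_eval R s
      x"
proof (induction q)
  case (pCons a q)
  have "int_poly_eval R (pCons a q * s) x = int_emb R a \<otimes> int_poly_eval R s x \<oplus> x \<otimes>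
      (int_poly_eval R q x \<otimes> int_poly_eval R s x)"
    using pCons x by (simp add: int_poly_eval_add int_poly_eval_smult int_poly_eval_pCons)
  then show ?case using x by (simp add: int_poly_eval_pCons l_distr m_assoc)
qed (use x in simp)

lemma int_poly_eval_uminus: "x \<in> carrier R \<Longrightarrow> int_poly_eval R (- q) x = \<ominus> int_poly_eval R q x"
  by (rule sym, rule minus_equality) (simp_all flip: int_poly_eval_add)

lemma int_poly_eval_diff: "x \<in> carrier R \<Longrightarrow> int_poly_eval R (q - s) x = int_poly_eval R q x \<ominus>
    int_poly_eval R s x"
  by (metis a_minus_def add_uminus_conv_diff int_poly_eval_add int_poly_eval_uminus)

lemma int_poly_eval_power: "x \<in> carrier R \<Longrightarrow> int_poly_eval R (q ^ n) x = int_poly_eval R q x [^] n"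
  by (induction n) (simp_all add: int_poly_eval_mult m_comm)

lemma int_poly_eval_monom: "x \<in> carrier R \<Longrightarrow> int_poly_eval R (Polynomial.monom a n) x = int_emb R a \<otimes> x
    [^] n"
  by (induction n) (simp_all add: monom_0 monom_Suc int_poly_eval_pCons m_ac)

lemma generate_ring_empty: "generate_ring R {} = range (int_emb R)"
proof
  show "generate_ring R {} \<subseteq> range (int_emb R)"
  proof
    fix y assume "y \<in> generate_ring R {}"
    then show "y \<in> range (int_emb R)"
    proof induction
      case one then show ?case by (metis rangeI int_emb_1)
    next
      case (a_inv h) then show ?case by (auto simp flip: int_emb_uminus)
    next
      case (eng_add h k) then show ?case by (auto simp flip: int_emb_add)
    next
      case (eng_mult h k) then show ?case by (auto simp flip: int_emb_mult)
    qed simp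
  qed
  have nat: "int_emb R (int n) \<in> generate_ring R {}" for n
  proof (induction n)
    case 0
    have "\<one> \<oplus> \<ominus> \<one> \<in> generate_ring R {}"
      by (intro generate_ring.intros)
    then show ?case by (simp add: r_neg)
  next
    case (Suc n) then show ?case by (auto simp: int_emb_add intro: generate_ring.intros)
  qed
  show "range (int_emb R) \<subseteq> generate_ring R {}"
  proof clarify
    fix k show "int_emb R k \<in> generate_ring R {}"
      using nat[of "nat k"] generate_ring.a_inv[OF nat[of "nat (-k)"]]
          by (cases "k \<ge> 0") (auto simp flip: int_emb_uminus)
  qed
qed

text \<open>The bound on the coefficients keeps \<open>q\<close> below the leading term that
  \<open>integral_element_iff\<close> puts in front of it, so that the resulting polynomial is
  monic.\<close>

lemma eval_int_list_ex_poly: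
  assumes x: "x \<in> carrier R"
  shows "set f \<subseteq> range (int_emb R) \<Longrightarrow> \<exists>q. (\<forall>i\<ge>length f. poly.coeff q i = 0) \<and> eval f x = int_poly_eval R q
      x"
proof (induction f)
  case Nil then show ?case by (intro exI[of _ 0]) simp
next
  case (Cons a f)
  then obtain q where q: "\<forall>i\<ge>length f. poly.coeff q i = 0" "eval f x = int_poly_eval R q x" by auto
  obtain k where k: "a = int_emb R k" using Cons(2) by auto
  show ?case
    by (intro exI[of _ "Polynomial.monom k (length f) + q"]) (use q k x in \<open>auto simp: int_poly_eval_add
        int_poly_eval_monom\<close>)
qed

lemma eval_rev_coeffs:
  assumes x: "x \<in> carrier R"
  shows "eval (map (\<lambda>i. int_emb R (c i)) (rev [0..<n])) x = int_poly_eval R (\<Sum>i<n. Polynomial.monom (c i)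
      i) x"
  by (induction n) (use x in \<open>auto simp: int_poly_eval_add int_poly_eval_monom a_comm\<close>)

lemma integral_element_iff:
  assumes "\<one> \<noteq> \<zero>"
  shows "integral_element R x \<longleftrightarrow> x \<in> carrier R \<and> (\<exists>q. Polynomial.lead_coeff q = 1 \<and> int_poly_eval R q x
      = \<zero>)"
proof
  assume "integral_element R x"
  then obtain f where x: "x \<in> carrier R" and f: "f \<noteq> []" "set f \<subseteq> range (int_emb R)" "hd f = \<one>" "eval f x
      = \<zero>"
    unfolding integral_element_def generate_ring_empty by blast
  obtain f' where f': "f = \<one> # f'" using f(1,3) by (cases f) auto
  obtain q where q: "\<forall>i\<ge>length f'. poly.coeff q i = 0" "eval f' x = int_poly_eval R q x"
    using eval_int_list_ex_poly[OF x, of f'] f(2) f' by auto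
  let ?q = "Polynomial.monom 1 (length f') + q"
  have "poly.coeff ?q (length f') = 1" using q(1) by simp
  moreover have "Polynomial.degree ?q = length f'"
    by (rule antisym[OF Polynomial.degree_le le_degree]) (use q(1) in auto)
  ultimately have "Polynomial.lead_coeff ?q = 1" by simp
  moreover have "int_poly_eval R ?q x = \<zero>" using f(4) f' q(2) x
      by (simp add: int_poly_eval_add int_poly_eval_monom)
  ultimately show "x \<in> carrier R \<and> (\<exists>q. Polynomial.lead_coeff q = 1 \<and> int_poly_eval R q x = \<zero>)" using x
      by blast
next
  assume "x \<in> carrier R \<and> (\<exists>q. Polynomial.lead_coeff q = 1 \<and> int_poly_eval R q x = \<zero>)"
  then obtain q where x: "x \<in> carrier R" and q: "Polynomial.lead_coeff q = 1" "int_poly_eval R q x = \<zero>"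
      by blast
  let ?f = "map (\<lambda>i. int_emb R (poly.coeff q i)) (rev [0..<Suc (Polynomial.degree q)])"
  have "eval ?f x = int_poly_eval R (\<Sum>i\<le>Polynomial.degree q. Polynomial.monom (poly.coeff q i) i) x"
    unfolding eval_rev_coeffs[OF x] lessThan_Suc_atMost ..
  then have "eval ?f x = \<zero>" using q(2) by (simp add: poly_as_sum_of_monoms)
  moreover have "hd ?f = \<one>" using q(1) by simp
  moreover have "set ?f \<subseteq> generate_ring R {}" unfolding generate_ring_empty by auto
  ultimately show "integral_element R x" unfolding integral_element_def using x
    by (intro conjI exI[of _ ?f]) auto
qed

text \<open>The determinant trick, with determinants only of matrices over the integer polynomials.\<close>

lemma det_trick:
  assumes x: "x \<in> carrier R" and b: "\<And>s. s < n \<Longrightarrow> b s \<in> carrier R"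
    and A: "A \<in> carrier_mat n n"
    and eq: "\<And>r. r < n \<Longrightarrow> x \<otimes> b r = (\<Oplus>s\<in>{..<n}. int_emb R (A $$ (r, s)) \<otimes> b s)"
    and r: "r < n"
  shows "int_poly_eval R (char_poly A) x \<otimes> b r = \<zero>"
proof -
  \<comment> \<open>A row \<open>c\<close> of polynomials is evaluated at \<open>x\<close> and
    paired with the vector \<open>b\<close>. The rows of \<open>char_poly_matrix A\<close> pair to
    zero by \<open>eq\<close>, hence so does every combination of them.\<close>
  define \<phi> where "\<phi> = (\<lambda>c. \<Oplus>s\<in>{..<n}. int_poly_eval R (c s) x \<otimes> b s)"
  have \<phi>_closed: "\<phi> c \<in> carrier R" for c unfolding \<phi>_def by (rule finsum_closed) (use x b in auto)
  have \<phi>_add: "\<phi> (\<lambda>s. c s + e s) = \<phi> c \<oplus> \<phi> e" for c e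
  proof -
    have "\<phi> (\<lambda>s. c s + e s) = (\<Oplus>s\<in>{..<n}. int_poly_eval R (c s) x \<otimes> b s \<oplus> int_poly_eval R (e s) x \<otimes> b s)"
      unfolding \<phi>_def by (rule finsum_cong') (use x b in \<open>auto simp: int_poly_eval_add l_distr\<close>)
    also have "\<dots> = \<phi> c \<oplus> \<phi> e" unfolding \<phi>_def by (rule finsum_addf) (use x b in auto)
    finally show ?thesis .
  qed
  have \<phi>_mult: "\<phi> (\<lambda>s. q * c s) = int_poly_eval R q x \<otimes> \<phi> c" for q c
  proof -
    have "\<phi> (\<lambda>s. q * c s) = (\<Oplus>s\<in>{..<n}. int_poly_eval R q x \<otimes> (int_poly_eval R (c s) x \<otimes> b s))"
      unfolding \<phi>_def by (rule finsum_cong') (use x b in \<open>auto simp: int_poly_eval_mult m_assoc\<close>)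
    also have "\<dots> = int_poly_eval R q x \<otimes> \<phi> c" unfolding \<phi>_def by (rule finsum_rdistr[symmetric]) (use x b
        in auto)
    finally show ?thesis .
  qed
  have \<phi>_unit: "\<phi> (\<lambda>s. if s = k then q else 0) = int_poly_eval R q x \<otimes> b k" if "k < n" for q k
  proof -
    have "\<phi> (\<lambda>s. if s = k then q else 0) = (\<Oplus>s\<in>{..<n}. if k = s then int_poly_eval R q x \<otimes> b s else \<zero>)"
      unfolding \<phi>_def by (rule finsum_cong') (use x b in auto)
    also have "\<dots> = int_poly_eval R q x \<otimes> b k"
      by (rule add.finprod_singleton) (use that x b in auto)
    finally show ?thesis .
  qed
  define B where "B = char_poly_matrix A"
  have B: "B \<in> carrier_mat n n" using A unfolding B_def char_poly_matrix_def by simp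
  have row: "\<phi> (\<lambda>s. B $$ (k, s)) = \<zero>" if "k < n" for k
  proof -
    have "\<phi> (\<lambda>s. B $$ (k, s)) = \<phi> (\<lambda>s. (if s = k then [:0, 1:] else 0) + [:- (A $$ (k, s)):])"
      unfolding \<phi>_def by (rule finsum_cong') (use A x b that in \<open>auto simp: B_def char_poly_matrix_def
          one_pCons\<close>)
    also have "\<dots> = x \<otimes> b k \<oplus> \<phi> (\<lambda>s. (-1) * [:A $$ (k, s):])"
      unfolding \<phi>_add \<phi>_unit[OF that] by (simp add: int_poly_eval_X x)
    also have "\<phi> (\<lambda>s. (-1) * [:A $$ (k, s):]) = \<ominus> \<one> \<otimes> \<phi> (\<lambda>s. [:A $$ (k, s):])"
      unfolding \<phi>_mult using x by (simp add: int_poly_eval_uminus)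
    also have "\<phi> (\<lambda>s. [:A $$ (k, s):]) = x \<otimes> b k"
      unfolding eq[OF that] \<phi>_def by (rule finsum_cong') (use x b in \<open>auto simp: int_poly_eval_const\<close>)
    finally show ?thesis using x b[OF that] by (simp add: l_minus r_neg)
  qed
  have comb: "\<phi> (\<lambda>s. \<Sum>k<m. q k * B $$ (k, s)) = \<zero>" if "m \<le> n" for m q
    using that
  proof (induction m)
    case 0
    have "\<phi> (\<lambda>s. \<Sum>k<0. q k * B $$ (k, s)) = (\<Oplus>s\<in>{..<n}. \<zero>)"
      unfolding \<phi>_def by (rule finsum_cong') (use x b in auto)
    then show ?case by simp
  next
    case (Suc m)
    have "\<phi> (\<lambda>s. \<Sum>k<Suc m. q k * B $$ (k, s)) = \<phi> (\<lambda>s. \<Sum>k<m. q k * B $$ (k, s)) \<oplus> \<phi>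
        (\<lambda>s. q m * B $$ (m, s))"
      by (simp add: \<phi>_add)
    then show ?case using Suc row[of m] x by (simp add: \<phi>_mult)
  qed
  \<comment> \<open>The adjugate writes \<open>det B\<close> times a unit row as a combination of
    the rows of \<open>B\<close>.\<close>
  have "\<phi> (\<lambda>s. \<Sum>k<n. adj_mat B $$ (r, k) * B $$ (k, s)) = \<phi> (\<lambda>s. if s = r then det B else 0)"
  proof -
    have "(\<Sum>k<n. adj_mat B $$ (r, k) * B $$ (k, s)) = (if s = r then det B else 0)" if "s < n" for s
    proof -
      have "(\<Sum>k<n. adj_mat B $$ (r, k) * B $$ (k, s)) = (adj_mat B * B) $$ (r, s)"
        using B adj_mat(1)[OF B] r that by (simp add: scalar_prod_def lessThan_atLeast0)
      then show ?thesis using adj_mat(3)[OF B] r that by simp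
    qed
    then show ?thesis unfolding \<phi>_def by (intro finsum_cong') (use x b in auto)
  qed
  then show ?thesis using comb[of n] \<phi>_unit[OF r] by (simp add: B_def char_poly_def)
qed

text \<open>By \<open>det_trick\<close>, the characteristic polynomial of the matrix of
  \<open>x\<close> on the integral span \<open>V\<close> kills every \<open>b r\<close>, hence also
  their combination \<one>. This polynomial is monic.\<close>

lemma integral_if_stable:
  fixes n :: nat
  assumes ne: "\<one> \<noteq> \<zero>" and x: "x \<in> carrier R" and b: "\<And>s. s < n \<Longrightarrow> b s \<in> carrier R"
  defines "V \<equiv> {\<Oplus>s\<in>{..<n}. int_emb R (c s) \<otimes> b s | c. True}"
  assumes one: "\<one> \<in> V" and st: "\<And>r. r < n \<Longrightarrow> x \<otimes> b r \<in> V"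
  shows "integral_element R x"
proof -
  have "\<forall>r. \<exists>c. r < n \<longrightarrow> x \<otimes> b r = (\<Oplus>s\<in>{..<n}. int_emb R (c s) \<otimes> b s)"
    using st unfolding V_def by blast
  then obtain a where a: "\<And>r. r < n \<Longrightarrow> x \<otimes> b r = (\<Oplus>s\<in>{..<n}. int_emb R (a r s) \<otimes> b s)" by metis
  define A where "A = mat n n (\<lambda>(r, s). a r s)"
  have A: "A \<in> carrier_mat n n" by (simp add: A_def)
  have z: "int_poly_eval R (char_poly A) x \<otimes> b r = \<zero>" if "r < n" for r
  proof (rule det_trick[OF x b A _ that])
    fix r assume r: "r < n"
    show "x \<otimes> b r = (\<Oplus>s\<in>{..<n}. int_emb R (A $$ (r, s)) \<otimes> b s)"
      unfolding a[OF r] by (rule finsum_cong') (use r b in \<open>auto simp: A_def\<close>)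
  qed auto
  obtain c where c: "\<one> = (\<Oplus>s\<in>{..<n}. int_emb R (c s) \<otimes> b s)" using one unfolding V_def by blast
  have "int_poly_eval R (char_poly A) x = int_poly_eval R (char_poly A) x \<otimes> (\<Oplus>s\<in>{..<n}. int_emb R (c s) \<otimes>
      b s)"
    using x unfolding c[symmetric] by simp
  also have "\<dots> = (\<Oplus>s\<in>{..<n}. int_poly_eval R (char_poly A) x \<otimes> (int_emb R (c s) \<otimes> b s))"
    by (rule finsum_rdistr) (use x b in auto)
  also have "\<dots> = (\<Oplus>s\<in>{..<n}. \<zero>)"
  proof (rule finsum_cong')
    fix s assume "s \<in> {..<n}"
    then have s: "s < n" by simp
    have "int_poly_eval R (char_poly A) x \<otimes> (int_emb R (c s) \<otimes> b s) = int_emb R (c s) \<otimes>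
        (int_poly_eval R (char_poly A) x \<otimes> b s)"
      using x b[OF s] by (simp add: m_lcomm)
    then show "int_poly_eval R (char_poly A) x \<otimes> (int_emb R (c s) \<otimes> b s) = \<zero>"
      using z[OF s] by simp
  qed auto
  finally have "int_poly_eval R (char_poly A) x = \<zero>" by simp
  then show ?thesis unfolding integral_element_iff[OF ne]
    using x degree_monic_char_poly[OF A] by auto
qed

text \<open>The factor \<open>z\<close> is there for the induction: peeling off the constant
  coefficient moves one power of \<open>x\<close> into \<open>z\<close>.\<close>

lemma int_poly_eval_mult_in_subgroup:
  assumes x: "x \<in> carrier R" and V: "\<zero> \<in> V" "\<And>u v. u \<in> V \<Longrightarrow> v \<in> V \<Longrightarrow> u \<oplus> v \<in> V"
    "\<And>u k. u \<in> V \<Longrightarrow> int_emb R k \<otimes> u \<in> V"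
  shows "z \<in> carrier R \<Longrightarrow> \<forall>i<k. x [^] i \<otimes> z \<in> V \<Longrightarrow> \<forall>i\<ge>k. poly.coeff q i = 0 \<Longrightarrow> int_poly_eval R q x \<otimes> z \<in> V"
proof (induction q arbitrary: z k)
  case 0 then show ?case using V(1) by simp
next
  case (pCons a q)
  have k: "k > 0"
  proof (rule ccontr)
    assume "\<not> k > 0"
    then have "pCons a q = 0" using pCons.prems(3) by (intro poly_eqI) simp
    then show False using pCons.hyps by simp
  qed
  have "int_poly_eval R q x \<otimes> (x \<otimes> z) \<in> V"
  proof (rule pCons.IH[of "x \<otimes> z" "k - 1"])
    show "\<forall>i<k - 1. x [^] i \<otimes> (x \<otimes> z) \<in> V"
    proof (intro allI impI)
      fix i assume "i < k - 1"
      then have "Suc i < k" by simp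
      then have "x [^] Suc i \<otimes> z \<in> V" using pCons.prems(2) by blast
      then show "x [^] i \<otimes> (x \<otimes> z) \<in> V" using x pCons.prems(1) by (simp add: m_assoc)
    qed
    show "\<forall>i\<ge>k - 1. poly.coeff q i = 0"
    proof (intro allI impI)
      fix i assume "k - 1 \<le> i"
      then have "k \<le> Suc i" by simp
      then have "poly.coeff (pCons a q) (Suc i) = 0" using pCons.prems(3) by blast
      then show "poly.coeff q i = 0" by simp
    qed
  qed (use x pCons.prems(1) in auto)
  moreover have "x [^] (0::nat) \<otimes> z \<in> V" using pCons.prems(2) k by blast
  then have "int_emb R a \<otimes> z \<in> V" using pCons.prems(1) V(3)[of z a] by simp
  moreover have "int_poly_eval R (pCons a q) x \<otimes> z = int_emb R a \<otimes> z \<oplus> int_poly_eval R q x \<otimes> (x \<otimes> z)"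
    using x pCons.prems(1) by (simp add: int_poly_eval_pCons l_distr r_distr m_ac)
  ultimately show ?case using V(2) by simp
qed

text \<open>The products of powers of \<open>x\<close> and \<open>y\<close> with exponents below the
  degrees of their monic equations span a group that contains \<one> and is stable under the
  product; \<open>integral_if_stable\<close> applies to it.\<close>

lemma integral_mult:
  assumes ne: "\<one> \<noteq> \<zero>" and ix: "integral_element R x" and iy: "integral_element R y"
  shows "integral_element R (x \<otimes> y)"
proof -
  obtain f where x: "x \<in> carrier R" and f: "Polynomial.lead_coeff f = 1" "int_poly_eval R f x = \<zero>"
    using ix unfolding integral_element_iff[OF ne] by blast
  obtain g where y: "y \<in> carrier R" and g: "Polynomial.lead_coeff g = 1" "int_poly_eval R g y = \<zero>"
    using iy unfolding integral_element_iff[OF ne] by blast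
  have deg: "Polynomial.degree q > 0" if "Polynomial.lead_coeff q = 1" "int_poly_eval R q z = \<zero>"
      "z \<in> carrier R" for q z
  proof (rule ccontr)
    assume "\<not> Polynomial.degree q > 0"
    then have "q = [:1:]" using that(1) by (metis degree_0_id gr0I)
    then show False using that ne by (simp add: int_poly_eval_const)
  qed
  define m n where "m = Polynomial.degree f" and "n = Polynomial.degree g"
  have m: "m > 0" and n: "n > 0" unfolding m_def n_def using deg f g x y by auto
  define b where "b = (\<lambda>s. x [^] (s div n) \<otimes> y [^] (s mod n))"
  have b: "b s \<in> carrier R" for s unfolding b_def using x y by auto
  define V where "V = {\<Oplus>s\<in>{..<m * n}. int_emb R (c s) \<otimes> b s | c. True}"
  have VI: "(\<Oplus>s\<in>{..<m * n}. int_emb R (c s) \<otimes> b s) \<in> V" for c unfolding V_def by blast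
  have V_carr: "v \<in> carrier R" if "v \<in> V" for v
    using that b unfolding V_def by (auto intro!: finsum_closed)
  have V0: "\<zero> \<in> V"
    using VI[of "\<lambda>_. 0"] b by simp
  have Vadd: "u \<oplus> v \<in> V" if "u \<in> V" "v \<in> V" for u v
  proof -
    obtain c where "u = (\<Oplus>s\<in>{..<m * n}. int_emb R (c s) \<otimes> b s)" using \<open>u \<in> V\<close> unfolding V_def by blast
    moreover obtain e where "v = (\<Oplus>s\<in>{..<m * n}. int_emb R (e s) \<otimes> b s)" using \<open>v \<in> V\<close> unfolding V_def
        by blast
    ultimately have "u \<oplus> v = (\<Oplus>s\<in>{..<m * n}. int_emb R (c s) \<otimes> b s \<oplus> int_emb R (e s) \<otimes> b s)"
      using b by (simp add: finsum_addf)
    also have "\<dots> = (\<Oplus>s\<in>{..<m * n}. int_emb R (c s + e s) \<otimes> b s)"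
      by (rule finsum_cong') (use b in \<open>auto simp: int_emb_add l_distr\<close>)
    finally show ?thesis using VI[of "\<lambda>s. c s + e s"] by simp
  qed
  have Vsm: "int_emb R k \<otimes> u \<in> V" if "u \<in> V" for u k
  proof -
    obtain c where "u = (\<Oplus>s\<in>{..<m * n}. int_emb R (c s) \<otimes> b s)" using \<open>u \<in> V\<close> unfolding V_def by blast
    then have "int_emb R k \<otimes> u = (\<Oplus>s\<in>{..<m * n}. int_emb R k \<otimes> (int_emb R (c s) \<otimes> b s))"
      using b by (simp add: finsum_rdistr)
    also have "\<dots> = (\<Oplus>s\<in>{..<m * n}. int_emb R (k * c s) \<otimes> b s)"
      by (rule finsum_cong') (use b in \<open>auto simp: int_emb_mult m_assoc\<close>)
    finally show ?thesis using VI[of "\<lambda>s. k * c s"] by simp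
  qed
  have Vb: "b r \<in> V" if "r < m * n" for r
  proof -
    have "(\<Oplus>s\<in>{..<m * n}. int_emb R (if r = s then 1 else 0) \<otimes> b s)
        = (\<Oplus>s\<in>{..<m * n}. if r = s then b s else \<zero>)"
      by (rule finsum_cong') (use b in auto)
    also have "\<dots> = b r" by (rule add.finprod_singleton) (use that b in auto)
    finally show ?thesis using VI[of "\<lambda>s. if r = s then 1 else 0"] by simp
  qed
  have V00: "x [^] i \<otimes> y [^] j \<in> V" if "i < m" "j < n" for i j
  proof -
    have "i * n + j < m * n"
    proof -
      have "i * n + j < Suc i * n" using that by simp
      also have "\<dots> \<le> m * n" using that by (intro mult_le_mono1) simp
      finally show ?thesis .
    qed
    moreover have "b (i * n + j) = x [^] i \<otimes> y [^] j" unfolding b_def using that by simp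
    ultimately show ?thesis using Vb by metis
  qed
  \<comment> \<open>A monic equation expresses the top power through lower ones, so raising an
    exponent to the degree does not leave \<open>V\<close>.\<close>
  have step: "z [^] Polynomial.degree q \<otimes> w \<in> V"
    if z: "z \<in> carrier R" and w: "w \<in> carrier R"
    and q: "Polynomial.lead_coeff q = 1" "int_poly_eval R q z = \<zero>"
      and lower: "\<forall>i<Polynomial.degree q. z [^] i \<otimes> w \<in> V" for z w q
  proof -
    let ?d = "Polynomial.degree q"
    define s where "s = q - Polynomial.monom 1 ?d"
    have "\<forall>i\<ge>?d. poly.coeff s i = 0" unfolding s_def using q(1) by (auto simp: coeff_eq_0 le_less)
    then have "int_poly_eval R s z \<otimes> w \<in> V"
      using int_poly_eval_mult_in_subgroup[OF z V0 Vadd Vsm w lower] by blast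
    moreover have "int_poly_eval R s z = \<ominus> (z [^] ?d)" unfolding s_def using z q(2)
        by (simp add: int_poly_eval_diff int_poly_eval_monom a_minus_def)
    ultimately have "int_emb R (-1) \<otimes> (\<ominus> (z [^] ?d) \<otimes> w) \<in> V" using Vsm by metis
    moreover have "int_emb R (-1) \<otimes> (\<ominus> (z [^] ?d) \<otimes> w) = z [^] ?d \<otimes> w"
      using z w by (simp add: int_emb_uminus l_minus r_minus)
    ultimately show ?thesis by simp
  qed
  have V10: "x [^] i \<otimes> y [^] j \<in> V" if "i \<le> m" "j < n" for i j
    using V00[of i j] step[OF x _ f, of "y [^] j"] that y V00 by (cases "i = m") (auto simp: m_def)
  have V11: "x [^] i \<otimes> y [^] j \<in> V" if "i \<le> m" "j \<le> n" for i j
  proof (cases "j = n")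
    case True
    have "\<forall>l<n. y [^] l \<otimes> x [^] i \<in> V" using V10[OF that(1)] x y by (simp add: m_comm)
    then have "y [^] n \<otimes> x [^] i \<in> V" using step[OF y _ g, of "x [^] i"] x by (simp add: n_def)
    then show ?thesis using True x y by (simp add: m_comm)
  qed (use V10 that in auto)
  show ?thesis
  proof (rule integral_if_stable[OF ne, where n = "m * n" and b = b])
    show "\<one> \<in> {\<Oplus>s\<in>{..<m * n}. int_emb R (c s) \<otimes> b s |c. True}"
      using V00[of 0 0] m n by (simp add: V_def)
    show "x \<otimes> y \<otimes> b r \<in> {\<Oplus>s\<in>{..<m * n}. int_emb R (c s) \<otimes> b s |c. True}" if "r < m * n" for r
    proof -
      have "r div n < m" using that by (simp add: less_mult_imp_div_less)
      then have "x [^] Suc (r div n) \<otimes> y [^] Suc (r mod n) \<in> V"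
        using n by (intro V11) (auto simp: Suc_leI)
      moreover have "x [^] Suc (r div n) \<otimes> y [^] Suc (r mod n) = x \<otimes> y \<otimes> b r"
        unfolding b_def using x y by (simp add: m_ac)
      ultimately show ?thesis by (simp add: V_def)
    qed
  qed (use x y b in auto)
qed

lemma integral_one: "\<one> \<noteq> \<zero> \<Longrightarrow> integral_element R \<one>"
  unfolding integral_element_iff
  by (intro conjI exI[of _ "[:-1, 1:]"]) (auto simp: int_poly_eval_pCons int_emb_uminus l_neg)

end

lemma ring_hom_int_emb:
  assumes "cring R" "cring S" "h \<in> Ring.ring_hom R S" shows "h (int_emb R k) = int_emb S k"
proof -
  interpret R: cring R by fact
  interpret S: cring S by fact
  interpret h: ring_hom_cring R S h using assms
  by (simp add: ring_hom_cring.intro ring_hom_cring_axioms.intro)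
  have nat: "h (int_emb R (int n)) = int_emb S (int n)" for n
    by (induction n) (simp_all add: R.int_emb_add S.int_emb_add)
  show ?thesis
  proof (cases "k \<ge> 0")
    case True then show ?thesis using nat[of "nat k"] by simp
  next
    case False
    then have *: "h (int_emb R (- k)) = int_emb S (- k)" using nat[of "nat (- k)"] by simp
    have "h (int_emb R k) = h (\<ominus>\<^bsub>R\<^esub> int_emb R (- k))" by (simp flip: R.int_emb_uminus)
    also have "\<dots> = \<ominus>\<^bsub>S\<^esub> int_emb S (- k)" using * by simp
    finally show ?thesis by (simp flip: S.int_emb_uminus)
  qed
qed

lemma ring_hom_int_poly_eval:
  assumes "cring R" "cring S" "h \<in> Ring.ring_hom R S" "x \<in> carrier R"
  shows "h (int_poly_eval R q x) = int_poly_eval S q (h x)"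
proof -
  interpret R: cring R by fact
  interpret S: cring S by fact
  interpret h: ring_hom_cring R S h using assms
  by (simp add: ring_hom_cring.intro ring_hom_cring_axioms.intro)
  show ?thesis by (induction q) (use assms in \<open>auto simp: R.int_poly_eval_pCons S.int_poly_eval_pCons
      ring_hom_int_emb\<close>)
qed

lemma ring_hom_integral:
  assumes "cring R" "cring S" "h \<in> Ring.ring_hom R S" "\<one>\<^bsub>R\<^esub> \<noteq> \<zero>\<^bsub>R\<^esub>" "\<one>\<^bsub>S\<^esub> \<noteq> \<zero>\<^bsub>S\<^esub>" "integral_element R x"
  shows "integral_element S (h x)"
proof -
  interpret R: cring R by fact
  interpret S: cring S by fact
  interpret h: ring_hom_cring R S h using assms
  by (simp add: ring_hom_cring.intro ring_hom_cring_axioms.intro)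
  obtain q where "x \<in> carrier R" "Polynomial.lead_coeff q = 1" "int_poly_eval R q x = \<zero>\<^bsub>R\<^esub>"
    using assms(6) R.integral_element_iff[OF assms(4)] by blast
  then show ?thesis using S.integral_element_iff[OF assms(5)] ring_hom_int_poly_eval[OF assms(1-3), of x
      q] by auto
qed

section \<open>Units and places\<close>

lemma (in field) carrier_unit_group:
  "u \<in> carrier (unit_group R) \<longleftrightarrow> integral_element R u \<and> (\<exists>w. integral_element R w \<and> u \<otimes> w = \<one>)"
proof -
  have "integral_element R x \<Longrightarrow> x \<in> carrier R" for x by (simp add: integral_element_def)
  then show ?thesis
    unfolding unit_group_def units_of_carrier Units_def ring_of_integers_def
    by (auto simp: m_comm)
qed

lemma unit_group_mult [simp]: "monoid.mult (unit_group F) = monoid.mult F"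
  by (simp add: unit_group_def units_of_mult ring_of_integers_def)

lemma unit_group_one [simp]: "\<one>\<^bsub>unit_group F\<^esub> = \<one>\<^bsub>F\<^esub>"
  by (simp add: unit_group_def units_of_one ring_of_integers_def)

lemma nat_pow_unit_group [simp]: "x [^]\<^bsub>unit_group F\<^esub> (n::nat) = x [^]\<^bsub>F\<^esub> n"
  by (simp add: nat_pow_def)

context field begin

lemma unit_group_carrier: "u \<in> carrier (unit_group R) \<Longrightarrow> u \<in> carrier R"
  unfolding carrier_unit_group integral_element_def by blast

text \<open>The unit group is that of the multiplicative monoid of integral elements, which rests on
  \<open>integral_mult\<close> and \<open>integral_one\<close>.\<close>

lemma comm_group_unit_group: "comm_group (unit_group R)"
proof -
  have c: "integral_element R x \<Longrightarrow> x \<in> carrier R" for x by (simp add: integral_element_def)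
  have "comm_monoid (ring_of_integers R)"
    by (rule comm_monoidI)
      (use c in \<open>auto simp: ring_of_integers_def m_assoc intro: integral_mult[OF one_not_zero]
      integral_one[OF one_not_zero] m_comm\<close>)
  then show ?thesis unfolding unit_group_def by (rule comm_monoid.units_comm_group)
qed

lemma inv_unit_group:
  assumes "u \<in> carrier (unit_group R)" shows "inv\<^bsub>unit_group R\<^esub> u = inv u" "u \<noteq> \<zero>"
proof -
  interpret U: comm_group "unit_group R" by (rule comm_group_unit_group)
  have "u \<otimes> inv\<^bsub>unit_group R\<^esub> u = \<one>" using U.r_inv[OF assms] by simp
  moreover have "u \<in> carrier R" "inv\<^bsub>unit_group R\<^esub> u \<in> carrier R"
    using unit_group_carrier[OF assms] unit_group_carrier[OF U.inv_closed[OF assms]] by auto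
  ultimately show "inv\<^bsub>unit_group R\<^esub> u = inv u" by (metis comm_inv_char)
  show "u \<noteq> \<zero>" using \<open>u \<otimes> inv\<^bsub>unit_group R\<^esub> u = \<one>\<close> \<open>inv\<^bsub>unit_group R\<^esub> u \<in> carrier R\<close> by auto
qed

end

text \<open>Modulo \<open>p\<close> this is the Frobenius identity. The constant term (-1) ^ p + 1
  is zero for odd \<open>p\<close> and equals 2 for \<open>p = 2\<close>, a multiple of
  \<open>p\<close> in both cases. It serves to treat \<open>p\<close>-th roots of one in residue
  fields.\<close>

lemma prime_binomial_identity:
  assumes "Factorial_Ring.prime (p::nat)"
  shows "\<exists>h :: int poly. [:- 1, 1:] ^ p = Polynomial.monom 1 p - 1 + Polynomial.smult (int p) h"
proof -
  have p: "p > 0" using assms prime_gt_0_nat by blast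
  let ?X = "[:0, 1:] :: int poly"
  let ?t = "\<lambda>k. of_nat (p choose k) * ?X ^ k * (- 1) ^ (p - k)"
  have dv: "[:int p:] dvd (\<Sum>k\<in>{1..<p}. ?t k)"
  proof (rule dvd_sum)
    fix k assume k: "k \<in> {1..<p}"
    then have "p dvd p choose k" using assms by (intro dvd_choose_prime) auto
    then obtain c where "p choose k = p * c" by blast
    then have "of_nat (p choose k) = [:int p:] * (of_nat c :: int poly)" by (simp add: of_nat_poly)
    then show "[:int p:] dvd ?t k" by (metis dvd_mult2 dvd_triv_left)
  qed
  have dv2: "[:int p:] dvd ((- 1) ^ p + 1 :: int poly)"
  proof (cases "p = 2")
    case True
    have "(- 1) ^ 2 + 1 = [:2:] * (1 :: int poly)" by (simp add: numeral_poly)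
    then show ?thesis using True by (metis dvd_triv_left of_nat_numeral)
  next
    case False
    then have "odd p" using assms primes_dvd_imp_eq two_is_prime_nat by blast
    then show ?thesis by simp
  qed
  have "[:- 1, 1:] ^ p = (?X + (- 1)) ^ p" by (simp add: one_pCons)
  also have "\<dots> = (\<Sum>k\<le>p. ?t k)" by (rule binomial_ring)
  also have "{..p} = insert 0 (insert p {1..<p})" using p by auto
  also have "(\<Sum>k\<in>insert 0 (insert p {1..<p}). ?t k) = (- 1) ^ p + (?X ^ p + (\<Sum>k\<in>{1..<p}. ?t k))"
    using p by simp
  also have "?X ^ p = Polynomial.monom 1 p" by (simp add: monom_altdef)
  finally have "[:- 1, 1:] ^ p = Polynomial.monom 1 p - 1 + ((\<Sum>k\<in>{1..<p}. ?t k) + ((- 1) ^ p + 1))"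
      by simp
  moreover have "[:int p:] dvd (\<Sum>k\<in>{1..<p}. ?t k) + ((- 1) ^ p + 1)" using dv dv2 by (rule dvd_add)
  then obtain h where "(\<Sum>k\<in>{1..<p}. ?t k) + ((- 1) ^ p + 1) = [:int p:] * h" by blast
  ultimately show ?thesis by (intro exI[of _ h]) simp
qed

section \<open>Ultrametric estimates for powers at a place above p\<close>

locale padic_place = field F for F :: "('a, 'b) ring_scheme" (structure) +
  fixes v :: "'a \<Rightarrow> real" and p :: nat
  assumes prime: "Factorial_Ring.prime p" and place: "v \<in> places_above F p"
begin

lemma v_nonneg: "x \<in> carrier F \<Longrightarrow> v x \<ge> 0"
  and v_zero_iff: "x \<in> carrier F \<Longrightarrow> v x = 0 \<longleftrightarrow> x = \<zero>"
  and v_mult: "x \<in> carrier F \<Longrightarrow> y \<in> carrier F \<Longrightarrow> v (x \<otimes> y) = v x * v y"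
  and v_add: "x \<in> carrier F \<Longrightarrow> y \<in> carrier F \<Longrightarrow> v (x \<oplus> y) \<le> max (v x) (v y)"
  and v_p': "v ([p] \<cdot> \<one>) = 1 / real p"
  using place unfolding places_above_def by auto

lemma v_p: "v (int_emb F (int p)) = 1 / real p"
  unfolding int_emb_of_nat by (rule v_p')

lemma p_gt_1: "p > 1" using prime prime_gt_1_nat by blast

lemma inv_p: "0 < 1 / real p" "1 / real p < 1" using p_gt_1 by auto

lemma v_zero [simp]: "v \<zero> = 0" using v_zero_iff by blast

lemma v_one [simp]: "v \<one> = 1"
proof -
  have "v \<one> * v \<one> = v \<one>" using v_mult[of \<one> \<one>] by simp
  then show ?thesis using v_zero_iff[of \<one>] by auto
qed

lemma v_uminus: assumes "x \<in> carrier F" shows "v (\<ominus> x) = v x"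
proof -
  have "v (\<ominus> \<one>) * v (\<ominus> \<one>) = 1" using v_mult[of "\<ominus> \<one>" "\<ominus> \<one>"] by (simp add: l_minus)
  then have "(v (\<ominus> \<one>))\<^sup>2 = 1" by (simp add: power2_eq_square)
  then have "v (\<ominus> \<one>) = 1" using v_nonneg[of "\<ominus> \<one>"] by (auto simp: power2_eq_1_iff)
  then show ?thesis using v_mult[of "\<ominus> \<one>" x] assms by (simp add: l_minus)
qed

lemma v_minus: "x \<in> carrier F \<Longrightarrow> y \<in> carrier F \<Longrightarrow> v (x \<ominus> y) \<le> max (v x) (v y)"
  using v_add[of x "\<ominus> y"] by (simp add: a_minus_def v_uminus)

lemma v_minus_commute: "x \<in> carrier F \<Longrightarrow> y \<in> carrier F \<Longrightarrow> v (x \<ominus> y) = v (y \<ominus> x)"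
  using v_uminus[of "x \<ominus> y"] by (simp add: a_minus_def minus_add a_comm)

lemma v_triangle:
  assumes "x \<in> carrier F" "y \<in> carrier F" "z \<in> carrier F"
  shows "v (x \<ominus> z) \<le> max (v (x \<ominus> y)) (v (y \<ominus> z))"
proof -
  have "x \<ominus> z = (x \<ominus> y) \<oplus> (y \<ominus> z)" using assms by algebra
  then show ?thesis using v_add[of "x \<ominus> y" "y \<ominus> z"] assms by simp
qed

lemma v_pow: "x \<in> carrier F \<Longrightarrow> v (x [^] (n::nat)) = v x ^ n"
  by (induction n) (auto simp: v_mult)

lemma v_inv: assumes "x \<in> carrier F" "x \<noteq> \<zero>" shows "v (inv x) = 1 / v x"
proof -
  have "x \<in> Units F" using assms by (simp add: field_Units)
  then have "v x * v (inv x) = 1" using v_mult[of x "inv x"] assms by simp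
  moreover have "v x \<noteq> 0" using v_zero_iff assms by blast
  ultimately show ?thesis by (simp add: field_simps)
qed

lemma v_int_emb_le: "v (int_emb F k) \<le> 1"
proof -
  have nat: "v (int_emb F (int n)) \<le> 1" for n
  proof (induction n)
    case (Suc n)
    have "v (int_emb F (int (Suc n))) \<le> max (v \<one>) (v (int_emb F (int n)))"
      using v_add[of \<one> "int_emb F (int n)"] by (simp add: int_emb_add)
    then show ?case using Suc by simp
  qed simp
  show ?thesis using nat[of "nat k"] nat[of "nat (- k)"] v_uminus[of "int_emb F k"]
    by (cases "k \<ge> 0") (auto simp: int_emb_uminus)
qed

text \<open>By Bezout, \<one> is an integral combination of \<open>m\<close> and \<open>p\<close>;
  if both had absolute value below one, so would \<one>.\<close>

lemma v_int_emb_coprime: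
  assumes "coprime m (int p)" shows "v (int_emb F m) = 1"
proof (rule ccontr)
  assume "v (int_emb F m) \<noteq> 1"
  then have lt: "v (int_emb F m) < 1" using v_int_emb_le[of m] by simp
  obtain s t where "s * m + t * int p = 1" using assms bezout_int[of m "int p"]
      by (auto simp: coprime_iff_gcd_eq_1)
  then have "int_emb F s \<otimes> int_emb F m \<oplus> int_emb F t \<otimes> int_emb F (int p) = \<one>"
      by (simp flip: int_emb_add int_emb_mult)
  then have "1 \<le> max (v (int_emb F s) * v (int_emb F m)) (v (int_emb F t) * v (int_emb F (int p)))"
    using v_add[of "int_emb F s \<otimes> int_emb F m" "int_emb F t \<otimes> int_emb F (int p)"] by (simp add: v_mult)
  moreover have "v (int_emb F s) * v (int_emb F m) < 1"
    using mult_left_le_one_le[of "v (int_emb F m)" "v (int_emb F s)"] v_int_emb_le[of s] v_nonneg[of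
        "int_emb F s"] v_nonneg[of "int_emb F m"] lt by simp
  moreover have "v (int_emb F t) * v (int_emb F (int p)) < 1"
    using mult_left_le_one_le[of "v (int_emb F (int p))" "v (int_emb F t)"] v_int_emb_le[of t]
        v_nonneg[of "int_emb F t"] inv_p by (simp add: v_p)
  ultimately show False by simp
qed

lemma v_add_eq:
  assumes "x \<in> carrier F" "y \<in> carrier F" "v x < v y" shows "v (x \<oplus> y) = v y"
proof -
  have "y = (x \<oplus> y) \<ominus> x" using assms by algebra
  then have "v y \<le> max (v (x \<oplus> y)) (v x)" using v_minus[of "x \<oplus> y" x] assms by simp
  then show ?thesis using v_add[OF assms(1,2)] assms(3) by auto
qed

lemma v_near: assumes "x \<in> carrier F" "y \<in> carrier F" "v (x \<ominus> y) < v y" shows "v x = v y"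
proof -
  have "x = (x \<ominus> y) \<oplus> y" using assms by algebra
  then show ?thesis using v_add_eq[of "x \<ominus> y" y] assms by simp
qed

lemma v_near_one: "x \<in> carrier F \<Longrightarrow> v (x \<ominus> \<one>) < 1 \<Longrightarrow> v x = 1"
  using v_near[of x \<one>] by simp

lemma v_int_poly_eval_le_one:
  assumes "x \<in> carrier F" "v x \<le> 1" shows "v (int_poly_eval F q x) \<le> 1"
proof (induction q)
  case (pCons a q)
  have "v (x \<otimes> int_poly_eval F q x) \<le> 1"
    using mult_mono[OF assms(2) pCons(2)] v_nonneg assms by (simp add: v_mult)
  then show ?case using v_add[of "int_emb F a" "x \<otimes> int_poly_eval F q x"] v_int_emb_le[of a] assms
      by (simp add: int_poly_eval_pCons)
qed simp

lemma v_int_poly_eval_le: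
  assumes x: "x \<in> carrier F" "v x \<ge> 1"
  shows "\<forall>i>k. poly.coeff q i = 0 \<Longrightarrow> v (int_poly_eval F q x) \<le> v x ^ k"
proof (induction q arbitrary: k)
  case 0 then show ?case using x by simp
next
  case (pCons a q)
  show ?case
  proof (cases k)
    case 0
    have "q = 0" using pCons.prems 0 by (intro poly_eqI) (metis Suc_neq_Zero coeff_0 coeff_pCons_Suc
        gr0I)
    then show ?thesis using 0 x v_int_emb_le[of a] by (simp add: int_poly_eval_pCons)
  next
    case (Suc k')
    have "v (int_poly_eval F q x) \<le> v x ^ k'"
    proof (rule pCons.IH, intro allI impI)
      fix i assume "k' < i"
      then have "poly.coeff (pCons a q) (Suc i) = 0" using pCons.prems Suc by blast
      then show "poly.coeff q i = 0" by simp
    qed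
    then have "v (x \<otimes> int_poly_eval F q x) \<le> v x ^ k" using x Suc v_nonneg[of x]
        by (simp add: v_mult mult_left_mono)
    moreover have "v (int_emb F a) \<le> v x ^ k" using v_int_emb_le[of a] one_le_power[OF x(2), of k]
        by simp
    ultimately show ?thesis using v_add[of "int_emb F a" "x \<otimes> int_poly_eval F q x"] x
        by (simp add: int_poly_eval_pCons)
  qed
qed

lemma monic_integral:
  assumes "integral_element F x"
  obtains q where "Polynomial.lead_coeff q = 1" "int_poly_eval F q x = \<zero>" "Polynomial.degree q > 0"
proof -
  obtain q where x: "x \<in> carrier F" and q: "Polynomial.lead_coeff q = 1" "int_poly_eval F q x = \<zero>"
    using assms unfolding integral_element_iff[OF one_not_zero] by blast
  have "Polynomial.degree q > 0"
  proof (rule ccontr)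
    assume "\<not> Polynomial.degree q > 0"
    then have "q = [:1:]" using q(1) by (metis degree_0_id gr0I)
    then show False using q x by (simp add: int_poly_eval_const)
  qed
  with q that show thesis by blast
qed

text \<open>If the absolute value exceeded one, the leading term of a monic equation would strictly
  dominate all others and the sum could not vanish.\<close>

lemma v_integral:
  assumes "integral_element F x" shows "v x \<le> 1"
proof (rule ccontr)
  assume "\<not> v x \<le> 1"
  then have gt: "v x > 1" by simp
  have x: "x \<in> carrier F" using assms by (simp add: integral_element_def)
  obtain q where q: "Polynomial.lead_coeff q = 1" "int_poly_eval F q x = \<zero>" "Polynomial.degree q > 0"
    using monic_integral[OF assms] .
  let ?d = "Polynomial.degree q"
  define s where "s = q - Polynomial.monom 1 ?d"
  have "poly.coeff s i = 0" if "i > ?d - 1" for i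
  proof (cases "i = ?d")
    case True then show ?thesis using q(1) by (simp add: s_def)
  next
    case False then show ?thesis using that by (simp add: s_def coeff_eq_0)
  qed
  then have "v (int_poly_eval F s x) \<le> v x ^ (?d - 1)" using v_int_poly_eval_le[OF x, of "?d - 1" s] gt
      by auto
  moreover have "int_poly_eval F s x = \<ominus> (x [^] ?d)" unfolding s_def using x q(2)
      by (simp add: int_poly_eval_diff int_poly_eval_monom a_minus_def)
  ultimately have "v x ^ ?d \<le> v x ^ (?d - 1)" using x by (simp add: v_uminus v_pow)
  moreover have "v x ^ (?d - 1) < v x ^ ?d" using gt q(3) by (intro power_strict_increasing) auto
  ultimately show False by simp
qed

lemma v_unit:
  assumes "u \<in> carrier (unit_group F)" shows "v u = 1"
proof -
  obtain w where w: "integral_element F u" "integral_element F w" "u \<otimes> w = \<one>"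
    using assms unfolding carrier_unit_group by blast
  then have c: "u \<in> carrier F" "w \<in> carrier F" by (simp_all add: integral_element_def)
  have "v u * v w = 1" using v_mult[OF c] w(3) by simp
  moreover have "v u \<le> 1" "v w \<le> 1" using v_integral w by auto
  ultimately show ?thesis using v_nonneg[OF c(1)] v_nonneg[OF c(2)]
    by (metis mult_left_le order_antisym mult.commute)
qed

text \<open>The cofactor \<open>s\<close> is 1 + x + ... + x ^ (n - 1), which is congruent to
  \<open>n\<close> modulo x - 1. So it has absolute value one if \<open>n\<close> is prime to
  \<open>p\<close> and \<open>x\<close> is near one, and it is small if \<open>n = p\<close>; the
  two following estimates of powers come from this.\<close>

lemma geometric:
  assumes x: "x \<in> carrier F" "v x \<le> 1"
  shows "\<exists>s\<in>carrier F. x [^] (n::nat) \<ominus> \<one> = (x \<ominus> \<one>) \<otimes> s \<and> v s \<le> 1 \<and> v (s \<ominus> int_emb F (int n))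
      \<le> v (x \<ominus> \<one>)"
proof (induction n)
  case 0
  show ?case by (intro bexI[of _ \<zero>]) (use x v_nonneg[of "x \<ominus> \<one>"] in \<open>auto simp: a_minus_def r_neg\<close>)
next
  case (Suc n)
  then obtain s where s: "s \<in> carrier F" "x [^] n \<ominus> \<one> = (x \<ominus> \<one>) \<otimes> s" "v s \<le> 1"
    "v (s \<ominus> int_emb F (int n)) \<le> v (x \<ominus> \<one>)" by blast
  have xn: "x [^] n \<in> carrier F" using x by simp
  have "x [^] Suc n \<ominus> \<one> = (x [^] n \<ominus> \<one>) \<oplus> (x \<ominus> \<one>) \<otimes> x [^] n"
    unfolding nat_pow_Suc using x(1) xn by algebra
  also have "\<dots> = (x \<ominus> \<one>) \<otimes> (s \<oplus> x [^] n)" unfolding s(2) using x s xn by algebra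
  finally have 1: "x [^] Suc n \<ominus> \<one> = (x \<ominus> \<one>) \<otimes> (s \<oplus> x [^] n)" .
  have "v (x [^] n) \<le> 1" using x v_nonneg[of x] by (simp add: v_pow power_le_one)
  then have 2: "v (s \<oplus> x [^] n) \<le> 1" using v_add[of s "x [^] n"] s(1,3) xn by simp
  have "v (x [^] n \<ominus> \<one>) \<le> v (x \<ominus> \<one>)"
    unfolding s(2) using s(1,3) x v_nonneg[of "x \<ominus> \<one>"] by (simp add: v_mult mult_left_le)
  moreover have "(s \<oplus> x [^] n) \<ominus> int_emb F (int (Suc n)) = (s \<ominus> int_emb F (int n)) \<oplus> (x [^] n \<ominus> \<one>)"
  proof -
    have z: "int_emb F (int n) \<in> carrier F" by simp
    have "int_emb F (int (Suc n)) = \<one> \<oplus> int_emb F (int n)" by (simp add: int_emb_add)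
    then show ?thesis using s(1) xn z by (simp only:) algebra
  qed
  ultimately have 3: "v ((s \<oplus> x [^] n) \<ominus> int_emb F (int (Suc n))) \<le> v (x \<ominus> \<one>)"
    using v_add[of "s \<ominus> int_emb F (int n)" "x [^] n \<ominus> \<one>"] s(1,4) xn by simp
  show ?case by (intro bexI[of _ "s \<oplus> x [^] n"] conjI 1 2 3) (use s xn in auto)
qed

lemma v_pow_minus_one_le:
  assumes "x \<in> carrier F" "v x \<le> 1" shows "v (x [^] (n::nat) \<ominus> \<one>) \<le> v (x \<ominus> \<one>)"
  using geometric[OF assms, of n] v_nonneg[of "x \<ominus> \<one>"] assms by (auto simp: v_mult mult_left_le)

lemma v_pow_coprime:
  assumes x: "x \<in> carrier F" "v (x \<ominus> \<one>) < 1" and m: "coprime m p"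
  shows "v (x [^] (m::nat) \<ominus> \<one>) = v (x \<ominus> \<one>)"
proof -
  obtain s where s: "s \<in> carrier F" "x [^] m \<ominus> \<one> = (x \<ominus> \<one>) \<otimes> s" "v (s \<ominus> int_emb F (int m)) \<le> v (x \<ominus> \<one>)"
    using geometric[of x m] v_near_one[OF x] x by auto
  have "v (int_emb F (int m)) = 1" using m by (intro v_int_emb_coprime) (simp add: coprime_int_iff)
  then have "v s = 1" using v_near[of s "int_emb F (int m)"] s x by simp
  then show ?thesis unfolding s(2) using s x by (simp add: v_mult)
qed

text \<open>The number \<open>r\<close> bounds both x - 1 and \<open>p\<close>, hence the cofactor
  in \<open>geometric\<close>: raising to the power \<open>p\<close> shrinks the distance to one by
  the factor \<open>r\<close>.\<close>

lemma v_pow_prime: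
  assumes x: "x \<in> carrier F" "v (x \<ominus> \<one>) \<le> r" and r: "1 / real p \<le> r" "r < 1"
  shows "v (x [^] p \<ominus> \<one>) \<le> v (x \<ominus> \<one>) * r"
proof -
  obtain s where s: "s \<in> carrier F" "x [^] p \<ominus> \<one> = (x \<ominus> \<one>) \<otimes> s" "v (s \<ominus> int_emb F (int p)) \<le> v (x \<ominus> \<one>)"
    using geometric[of x p] v_near_one[of x] x r by auto
  have z: "int_emb F (int p) \<in> carrier F" by simp
  have "s = (s \<ominus> int_emb F (int p)) \<oplus> int_emb F (int p)" using s(1) z by algebra
  then have "v s \<le> max (v (s \<ominus> int_emb F (int p))) (v (int_emb F (int p)))"
    using v_add[of "s \<ominus> int_emb F (int p)" "int_emb F (int p)"] s(1) by simp
  then have "v s \<le> r" using s(3) x r by (auto simp: v_p)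
  then show ?thesis unfolding s(2) using s(1) x v_nonneg[of "x \<ominus> \<one>"] by (simp add: v_mult mult_left_mono)
qed

lemma v_pow_prime_power:
  assumes x: "x \<in> carrier F" "v (x \<ominus> \<one>) \<le> r" and r: "1 / real p \<le> r" "r < 1"
  shows "v (x [^] (p ^ n) \<ominus> \<one>) \<le> r ^ Suc n"
proof (induction n)
  case 0 then show ?case using x by simp
next
  case (Suc n)
  have r0: "r \<ge> 0" using r inv_p by linarith
  have "r ^ Suc n \<le> r" using r0 r by (simp add: mult_left_le power_le_one)
  then have le: "v (x [^] (p ^ n) \<ominus> \<one>) \<le> r" using Suc by linarith
  have "x [^] (p ^ Suc n) = (x [^] (p ^ n)) [^] p" using x by (simp add: nat_pow_pow mult.commute)
  then have "v (x [^] (p ^ Suc n) \<ominus> \<one>) \<le> v (x [^] (p ^ n) \<ominus> \<one>) * r"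
    using v_pow_prime[OF _ le r] x by simp
  also have "\<dots> \<le> r ^ Suc n * r" using Suc r0 by (rule mult_right_mono)
  also have "\<dots> = r ^ Suc (Suc n)" by (simp add: mult_ac)
  finally show ?case .
qed

text \<open>Powers of a principal unit depend continuously on the exponent in the
  \<open>p\<close>-adic topology, at the geometric rate \<open>r\<close>. All limits over residues
  modulo \<open>p ^ n\<close> below converge for this reason.\<close>

lemma v_pow_cong:
  assumes x: "x \<in> carrier F" "v (x \<ominus> \<one>) \<le> r" and r: "1 / real p \<le> r" "r < 1"
    and ij: "i mod p ^ n = j mod p ^ n"
  shows "v (x [^] (i::nat) \<ominus> x [^] j) \<le> r ^ Suc n"
proof -
  have *: "v (x [^] i \<ominus> x [^] j) \<le> r ^ Suc n" if le: "j \<le> i" and ij: "i mod p ^ n = j mod p ^ n" for i j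
  proof -
    obtain k where k: "i = j + p ^ n * k"
    proof -
      have "p ^ n dvd i - j" using mod_eq_dvd_iff_nat[OF le] ij by blast
      then obtain k where "i - j = p ^ n * k" by blast
      with le that[of k] show thesis by simp
    qed
    have vx: "v x = 1" using v_near_one x r by simp
    let ?y = "x [^] (p ^ n)"
    have "x [^] i = x [^] j \<otimes> ?y [^] k" unfolding k using x by (simp add: nat_pow_mult nat_pow_pow)
    then have "x [^] i \<ominus> x [^] j = x [^] j \<otimes> (?y [^] k \<ominus> \<one>)" using x(1)
      by (simp add: a_minus_def r_distr r_minus)
    then have "v (x [^] i \<ominus> x [^] j) = v (?y [^] k \<ominus> \<one>)" using x vx by (simp add: v_mult v_pow)
    also have "\<dots> \<le> v (?y \<ominus> \<one>)" by (rule v_pow_minus_one_le) (use x vx in \<open>auto simp: v_pow\<close>)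
    also have "\<dots> \<le> r ^ Suc n" by (rule v_pow_prime_power[OF x r])
    finally show ?thesis .
  qed
  show ?thesis
    using *[of j i] *[of i j] ij x v_minus_commute[of "x [^] i" "x [^] j"] by (cases "j \<le> i") auto
qed

text \<open>The residue field has characteristic \<open>p\<close>, so x ^ p - 1 and (x - 1) ^ p
  agree in it, and a field has no nilpotent elements.\<close>

lemma residue_prime_root:
  assumes x: "x \<in> carrier F" "v x \<le> 1" "v (x [^] p \<ominus> \<one>) < 1" shows "v (x \<ominus> \<one>) < 1"
proof -
  obtain h :: "int poly" where h: "[:- 1, 1:] ^ p = Polynomial.monom 1 p - 1 + Polynomial.smult (int p)
      h"
    using prime_binomial_identity[OF prime] by blast
  have "int_poly_eval F [:- 1, 1:] x = x \<ominus> \<one>" using x by (simp add: int_poly_eval_pCons int_emb_uminus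
      a_minus_def a_comm)
  then have "(x \<ominus> \<one>) [^] p = int_poly_eval F ([:- 1, 1:] ^ p) x" using x
      by (simp add: int_poly_eval_power)
  also have "\<dots> = (x [^] p \<ominus> \<one>) \<oplus> int_emb F (int p) \<otimes> int_poly_eval F h x"
    unfolding h using x by (simp add: int_poly_eval_add int_poly_eval_diff int_poly_eval_smult
        int_poly_eval_monom)
  finally have "v (x \<ominus> \<one>) ^ p \<le> max (v (x [^] p \<ominus> \<one>)) (v (int_emb F (int p)) * v (int_poly_eval F h x))"
    using v_add[of "x [^] p \<ominus> \<one>" "int_emb F (int p) \<otimes> int_poly_eval F h x"] x
    by (metis minus_closed nat_pow_closed one_closed v_mult v_pow int_emb_closed int_poly_eval_closed
        m_closed)
  moreover have "v (int_emb F (int p)) * v (int_poly_eval F h x) < 1"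
    using v_int_poly_eval_le_one[OF x(1,2), of h] inv_p v_nonneg[of "int_poly_eval F h x"] x
    unfolding v_p by (metis int_poly_eval_closed less_eq_real_def mult_left_le order.strict_trans1)
  ultimately have "v (x \<ominus> \<one>) ^ p < 1" using x(3) by simp
  then show ?thesis using v_nonneg[of "x \<ominus> \<one>"] x one_le_power[of "v (x \<ominus> \<one>)" p] by (meson not_le)
qed

text \<open>Modulo \<open>p\<close>, the ring generated by \<open>u\<close> is finite, so two powers
  of \<open>u\<close> have the same residue. This yields some positive exponent, from which
  \<open>residue_prime_root\<close> strips all factors \<open>p\<close>.\<close>

lemma residue_order:
  assumes u: "integral_element F u" "v u = 1"
  shows "\<exists>m>0. coprime m p \<and> v (u [^] (m::nat) \<ominus> \<one>) < 1"
proof -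
  have uc: "u \<in> carrier F" using u by (simp add: integral_element_def)
  obtain q where q: "Polynomial.lead_coeff q = 1" "int_poly_eval F q u = \<zero>" "Polynomial.degree q > 0"
    using monic_integral[OF u(1)] .
  let ?d = "Polynomial.degree q"
  \<comment> \<open>Reducing by the monic equation keeps every power of \<open>u\<close> among the
    polynomials of degree below \<open>?d\<close>.\<close>
  have ex: "\<exists>s. (\<forall>i\<ge>?d. poly.coeff s i = 0) \<and> int_poly_eval F s u = u [^] n" for n :: nat
  proof (induction n)
    case 0 show ?case by (intro exI[of _ 1]) (use q uc in auto)
  next
    case (Suc n)
    then obtain s where s: "\<forall>i\<ge>?d. poly.coeff s i = 0" "int_poly_eval F s u = u [^] n" by blast
    let ?s = "pCons 0 s - Polynomial.smult (poly.coeff s (?d - 1)) q"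
    have "poly.coeff ?s i = 0" if "i \<ge> ?d" for i
    proof (cases "i = ?d")
      case True
      then obtain e where "?d = Suc e" using q(3) gr0_implies_Suc by blast
      then show ?thesis using True q(1) by simp
    next
      case False
      with that obtain e where e: "i = Suc e" "e \<ge> ?d" by (cases i) auto
      then show ?thesis using s(1) by (simp add: coeff_eq_0)
    qed
    moreover have "int_poly_eval F ?s u = u [^] Suc n"
      using s(2) q(2) uc by (simp add: int_poly_eval_diff int_poly_eval_smult int_poly_eval_pCons m_comm
          a_minus_def)
    ultimately show ?case by blast
  qed
  \<comment> \<open>Reducing the coefficients modulo \<open>p\<close> leaves finitely many
    polynomials, the pigeonholes for the powers of \<open>u\<close>.\<close>
  define T where "T = (\<lambda>c. \<Sum>i<?d. Polynomial.monom (c i) i) ` (PiE {..<?d} (\<lambda>_. {0..<int p}))"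
  have finT: "finite T" unfolding T_def by (intro finite_imageI finite_PiE) auto
  have "\<exists>t\<in>T. v (u [^] n \<ominus> int_poly_eval F t u) < 1" for n :: nat
  proof -
    obtain s where s: "\<forall>i\<ge>?d. poly.coeff s i = 0" "int_poly_eval F s u = u [^] n" using ex by blast
    let ?t = "\<Sum>i<?d. Polynomial.monom (restrict (\<lambda>i. poly.coeff s i mod int p) {..<?d} i) i"
    let ?r = "\<Sum>i<?d. Polynomial.monom (poly.coeff s i div int p) i"
    have t: "?t \<in> T" unfolding T_def using p_gt_1 by (intro imageI) auto
    have "s = ?t + Polynomial.smult (int p) ?r"
    proof (rule poly_eqI)
      fix i
      have "poly.coeff ?t i = (if i < ?d then poly.coeff s i mod int p else 0)"
        "poly.coeff ?r i = (if i < ?d then poly.coeff s i div int p else 0)"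
        by (auto simp: coeff_sum if_distrib cong: if_cong)
      then show "poly.coeff s i = poly.coeff (?t + Polynomial.smult (int p) ?r) i" using s(1) by auto
    qed
    then have "int_poly_eval F s u = int_poly_eval F (?t + Polynomial.smult (int p) ?r) u"
        by (rule arg_cong)
    then have "u [^] n = int_poly_eval F ?t u \<oplus> int_emb F (int p) \<otimes> int_poly_eval F ?r u"
      unfolding s(2) int_poly_eval_add[OF uc] int_poly_eval_smult[OF uc] .
    moreover have "(a \<oplus> b) \<ominus> a = b" if "a \<in> carrier F" "b \<in> carrier F" for a b using that by algebra
    ultimately have "u [^] n \<ominus> int_poly_eval F ?t u = int_emb F (int p) \<otimes> int_poly_eval F ?r u" using uc
        by simp
    then have "v (u [^] n \<ominus> int_poly_eval F ?t u) = 1 / real p * v (int_poly_eval F ?r u)" using uc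
        by (simp add: v_mult v_p)
    also have "\<dots> \<le> 1 / real p" using v_int_poly_eval_le_one[of u ?r] uc u inv_p
        by (intro mult_left_le) auto
    finally have "v (u [^] n \<ominus> int_poly_eval F ?t u) < 1" using inv_p(2) by linarith
    then show ?thesis using t by blast
  qed
  then have "\<forall>n :: nat. \<exists>t. t \<in> T \<and> v (u [^] n \<ominus> int_poly_eval F t u) < 1" by blast
  then obtain t where "\<forall>n :: nat. t n \<in> T \<and> v (u [^] n \<ominus> int_poly_eval F (t n) u) < 1"
    using choice[of "\<lambda>n t. t \<in> T \<and> v (u [^] (n :: nat) \<ominus> int_poly_eval F t u) < 1"] by blast
  then have t: "\<And>n. t n \<in> T" "\<And>n. v (u [^] n \<ominus> int_poly_eval F (t n) u) < 1" by blast+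
  have "\<not> inj t"
  proof
    assume "inj t"
    then have "infinite (range t)" using finite_imageD infinite_UNIV_nat by blast
    moreover have "range t \<subseteq> T" using t(1) by blast
    ultimately show False using finT finite_subset by blast
  qed
  then obtain i0 j0 where ij0: "i0 \<noteq> j0" "t i0 = t j0" unfolding inj_def by blast
  obtain i j where ij: "i < j" "t i = t j" by (cases "i0 < j0") (use ij0 in \<open>auto simp: neq_iff\<close>)
  have "v (u [^] i \<ominus> u [^] j) < 1"
    using v_triangle[of "u [^] i" "int_poly_eval F (t i) u" "u [^] j"] t(2)[of i] t(2)[of j] ij(2) uc
      v_minus_commute[of "u [^] j" "int_poly_eval F (t j) u"] by simp
  moreover have "u [^] j \<ominus> u [^] i = u [^] i \<otimes> (u [^] (j - i) \<ominus> \<one>)"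
  proof -
    have "u [^] j = u [^] i \<otimes> u [^] (j - i)" using ij uc by (simp add: nat_pow_mult)
    then show ?thesis using uc by (simp add: a_minus_def r_distr r_minus)
  qed
  ultimately have "v (u [^] (j - i) \<ominus> \<one>) < 1"
    using uc u(2) v_minus_commute[of "u [^] j" "u [^] i"] by (simp add: v_mult v_pow)
  moreover have "j - i > 0" using ij by simp
  moreover have "\<exists>m>0. coprime m p \<and> v (u [^] m \<ominus> \<one>) < 1" if "k > 0" "v (u [^] k \<ominus> \<one>) < 1" for k :: nat
    using that
  proof (induction k rule: less_induct)
    case (less k)
    show ?case
    proof (cases "p dvd k")
      case False
      then have "coprime k p" using prime prime_imp_coprime coprime_commute by blast
      then show ?thesis using less.prems by blast
    next
      case True
      then obtain k' where k': "k = k' * p" by (metis dvd_def mult.commute)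
      then have "k' < k" "k' > 0" using less.prems(1) p_gt_1 by auto
      moreover have "v (u [^] k' \<ominus> \<one>) < 1"
        by (rule residue_prime_root) (use less.prems k' uc u(2) in \<open>auto simp: v_pow nat_pow_pow\<close>)
      ultimately show ?thesis using less.IH by blast
    qed
  qed
  ultimately show ?thesis by blast
qed

lemma unit_order:
  assumes "u \<in> carrier (unit_group F)"
  shows "\<exists>m>0. coprime m p \<and> v (u [^] (m::nat) \<ominus> \<one>) < 1"
  using residue_order[OF _ v_unit[OF assms]] assms unfolding carrier_unit_group by blast

end

lemma tendsto_zero_squeeze:
  fixes f g :: "nat \<Rightarrow> real"
  assumes "\<And>n. 0 \<le> f n" "\<And>n. f n \<le> g n" "g \<longlonglongrightarrow> 0" shows "f \<longlonglongrightarrow> 0"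
  by (rule real_tendsto_sandwich[of "\<lambda>_. 0" f sequentially g 0]) (use assms in auto)

section \<open>Completions as classes of Cauchy sequences\<close>

context padic_place begin

abbreviation "CR \<equiv> cauchy_ring F v"
abbreviation "NS \<equiv> null_sequences F v"
abbreviation "CF \<equiv> completion F v"
abbreviation "PU \<equiv> principal_units F v"

definition cauchy_class :: "(nat \<Rightarrow> 'a) \<Rightarrow> (nat \<Rightarrow> 'a) set" where
  "cauchy_class x = NS +>\<^bsub>CR\<^esub> x"

lemma cauchy_ring_simps [simp]:
  "monoid.mult CR = (\<lambda>x y n. x n \<otimes> y n)" "\<one>\<^bsub>CR\<^esub> = (\<lambda>n. \<one>)" "\<zero>\<^bsub>CR\<^esub> = (\<lambda>n. \<zero>)"
  "ring.add CR = (\<lambda>x y n. x n \<oplus> y n)"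
  by (simp_all add: cauchy_ring_def)

lemma carrier_CR: "x \<in> carrier CR \<longleftrightarrow>
    (\<forall>n. x n \<in> carrier F) \<and> (\<forall>e>0. \<exists>N. \<forall>m\<ge>N. \<forall>n\<ge>N. v (x m \<ominus> x n) < e)"
  by (simp add: cauchy_ring_def)

lemma CR_cauchy:
  assumes "x \<in> carrier CR" "e > 0"
  obtains N where "\<And>m n. m \<ge> N \<Longrightarrow> n \<ge> N \<Longrightarrow> v (x m \<ominus> x n) < e"
  using assms unfolding carrier_CR by blast

lemma CR_closed: "x \<in> carrier CR \<Longrightarrow> x n \<in> carrier F"
  by (simp add: carrier_CR)

lemma null_seq_CR:
  assumes "\<And>n. x n \<in> carrier F" "(\<lambda>n. v (x n)) \<longlonglongrightarrow> 0" shows "x \<in> carrier CR"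
  unfolding carrier_CR
proof (intro conjI allI impI)
  fix e :: real assume "e > 0"
  then obtain N where N: "\<And>n. n \<ge> N \<Longrightarrow> \<bar>v (x n)\<bar> < e"
    using LIMSEQ_D[OF assms(2), of e] by (auto simp: real_norm_def)
  have "v (x m \<ominus> x n) < e" if "m \<ge> N" "n \<ge> N" for m n
    using v_minus[of "x m" "x n"] N[OF that(1)] N[OF that(2)] assms(1) by auto
  then show "\<exists>N. \<forall>m\<ge>N. \<forall>n\<ge>N. v (x m \<ominus> x n) < e" by blast
qed (use assms in auto)

lemma NS_iff: "x \<in> NS \<longleftrightarrow> (\<forall>n. x n \<in> carrier F) \<and> (\<lambda>n. v (x n)) \<longlonglongrightarrow> 0"
  using null_seq_CR unfolding null_sequences_def by (auto dest: CR_closed)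

lemma CR_bounded:
  assumes "x \<in> carrier CR" shows "\<exists>B>0. \<forall>n. v (x n) \<le> B"
proof -
  obtain N where N: "\<And>m n. m \<ge> N \<Longrightarrow> n \<ge> N \<Longrightarrow> v (x m \<ominus> x n) < 1"
    using CR_cauchy[OF assms, of 1] by auto
  define B where "B = Max (insert 1 ((\<lambda>n. v (x n)) ` {..N}))"
  have B: "1 \<le> B" "\<And>n. n \<le> N \<Longrightarrow> v (x n) \<le> B" unfolding B_def by (rule Max_ge, simp, simp)+
  have "v (x n) \<le> B" for n
  proof (cases "n \<le> N")
    case False
    have c: "x n \<in> carrier F" "x N \<in> carrier F" using assms by (auto dest: CR_closed)
    have "x n = (x n \<ominus> x N) \<oplus> x N" using c by algebra
    then have "v (x n) \<le> max (v (x n \<ominus> x N)) (v (x N))" using v_add[of "x n \<ominus> x N" "x N"] c by simp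
    then show ?thesis using N[of n N] False B by force
  qed (use B in auto)
  then show ?thesis using B(1) by (intro exI[of _ B]) auto
qed

lemma CR_mult:
  assumes x: "x \<in> carrier CR" and y: "y \<in> carrier CR" shows "(\<lambda>n. x n \<otimes> y n) \<in> carrier CR"
  unfolding carrier_CR
proof (intro conjI allI impI)
  have c: "x n \<in> carrier F" "y n \<in> carrier F" for n using x y by (auto dest: CR_closed)
  then show "x n \<otimes> y n \<in> carrier F" for n by simp
  fix e :: real assume e: "e > 0"
  obtain A where A: "A > 0" "\<And>n. v (x n) \<le> A" using CR_bounded[OF x] by blast
  obtain B where B: "B > 0" "\<And>n. v (y n) \<le> B" using CR_bounded[OF y] by blast
  obtain M where M: "\<And>m n. m \<ge> M \<Longrightarrow> n \<ge> M \<Longrightarrow> v (x m \<ominus> x n) < e / B"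
    using CR_cauchy[OF x divide_pos_pos[OF e B(1)]] by blast
  obtain N where N: "\<And>m n. m \<ge> N \<Longrightarrow> n \<ge> N \<Longrightarrow> v (y m \<ominus> y n) < e / A"
    using CR_cauchy[OF y divide_pos_pos[OF e A(1)]] by blast
  have "v (x m \<otimes> y m \<ominus> x n \<otimes> y n) < e" if "m \<ge> max M N" "n \<ge> max M N" for m n
  proof -
    have "x m \<otimes> y m \<ominus> x n \<otimes> y n = (x m \<ominus> x n) \<otimes> y m \<oplus> x n \<otimes> (y m \<ominus> y n)"
      using c(1)[of m] c(1)[of n] c(2)[of m] c(2)[of n] by algebra
    then have "v (x m \<otimes> y m \<ominus> x n \<otimes> y n) \<le> max (v (x m \<ominus> x n) * v (y m)) (v (x n) * v (y m \<ominus> y n))"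
      using v_add[of "(x m \<ominus> x n) \<otimes> y m" "x n \<otimes> (y m \<ominus> y n)"] c by (simp add: v_mult)
    moreover have "v (x m \<ominus> x n) * v (y m) < e"
    proof -
      have "v (x m \<ominus> x n) * v (y m) \<le> v (x m \<ominus> x n) * B"
        using B(2) v_nonneg[of "x m \<ominus> x n"] c by (intro mult_left_mono) auto
      also have "\<dots> < e" using M[of m n] that B(1) by (simp add: pos_less_divide_eq)
      finally show ?thesis .
    qed
    moreover have "v (x n) * v (y m \<ominus> y n) < e"
    proof -
      have "v (x n) * v (y m \<ominus> y n) \<le> A * v (y m \<ominus> y n)"
        using A(2) v_nonneg[of "y m \<ominus> y n"] c by (intro mult_right_mono) auto
      also have "\<dots> < e" using N[of m n] that A(1) by (simp add: pos_less_divide_eq mult.commute)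
      finally show ?thesis .
    qed
    ultimately show ?thesis by simp
  qed
  then show "\<exists>N. \<forall>m\<ge>N. \<forall>n\<ge>N. v (x m \<otimes> y m \<ominus> x n \<otimes> y n) < e" by blast
qed

lemma CR_add:
  assumes x: "x \<in> carrier CR" and y: "y \<in> carrier CR" shows "(\<lambda>n. x n \<oplus> y n) \<in> carrier CR"
  unfolding carrier_CR
proof (intro conjI allI impI)
  have c: "x n \<in> carrier F" "y n \<in> carrier F" for n using x y by (auto dest: CR_closed)
  then show "x n \<oplus> y n \<in> carrier F" for n by simp
  fix e :: real assume e: "e > 0"
  obtain M where M: "\<And>m n. m \<ge> M \<Longrightarrow> n \<ge> M \<Longrightarrow> v (x m \<ominus> x n) < e"
    using CR_cauchy[OF x e] by blast
  obtain N where N: "\<And>m n. m \<ge> N \<Longrightarrow> n \<ge> N \<Longrightarrow> v (y m \<ominus> y n) < e"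
    using CR_cauchy[OF y e] by blast
  have "v (x m \<oplus> y m \<ominus> (x n \<oplus> y n)) < e" if "m \<ge> max M N" "n \<ge> max M N" for m n
  proof -
    have "x m \<oplus> y m \<ominus> (x n \<oplus> y n) = (x m \<ominus> x n) \<oplus> (y m \<ominus> y n)"
      using c(1)[of m] c(1)[of n] c(2)[of m] c(2)[of n] by algebra
    then have "v (x m \<oplus> y m \<ominus> (x n \<oplus> y n)) \<le> max (v (x m \<ominus> x n)) (v (y m \<ominus> y n))"
      using v_add[of "x m \<ominus> x n" "y m \<ominus> y n"] c by simp
    then show ?thesis using M[of m n] N[of m n] that by auto
  qed
  then show "\<exists>N. \<forall>m\<ge>N. \<forall>n\<ge>N. v (x m \<oplus> y m \<ominus> (x n \<oplus> y n)) < e" by blast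
qed

lemma CR_const: "a \<in> carrier F \<Longrightarrow> (\<lambda>n. a) \<in> carrier CR"
  by (simp add: carrier_CR a_minus_def r_neg)

lemma CR_uminus: assumes "x \<in> carrier CR" shows "(\<lambda>n. \<ominus> x n) \<in> carrier CR"
proof -
  have "(\<lambda>n. \<ominus> \<one> \<otimes> x n) \<in> carrier CR" using CR_mult[OF CR_const[of "\<ominus> \<one>"] assms] by simp
  moreover have "(\<lambda>n. \<ominus> \<one> \<otimes> x n) = (\<lambda>n. \<ominus> x n)" using CR_closed[OF assms] by (simp add: l_minus)
  ultimately show ?thesis by simp
qed

lemma cring_CR: "cring CR"
proof (rule cringI)
  show "abelian_group CR"
    by (rule abelian_groupI)
      (auto simp: CR_add CR_const a_assoc CR_closed a_comm a_lcomm l_neg r_neg intro!: bexI[OF _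
      CR_uminus])
  show "comm_monoid CR"
    by (rule comm_monoidI) (auto simp: CR_mult CR_const m_assoc CR_closed m_comm m_lcomm)
qed (auto simp: CR_closed l_distr)

lemma CR_a_inv: "x \<in> carrier CR \<Longrightarrow> \<ominus>\<^bsub>CR\<^esub> x = (\<lambda>n. \<ominus> x n)"
proof -
  interpret C: cring CR by (rule cring_CR)
  assume x: "x \<in> carrier CR"
  show "\<ominus>\<^bsub>CR\<^esub> x = (\<lambda>n. \<ominus> x n)"
    by (rule C.minus_equality) (use x CR_uminus[OF x] CR_closed[OF x] in \<open>auto simp: l_neg\<close>)
qed

lemma CR_a_minus: "x \<in> carrier CR \<Longrightarrow> y \<in> carrier CR \<Longrightarrow> x \<ominus>\<^bsub>CR\<^esub> y = (\<lambda>n. x n \<ominus> y n)"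
  by (simp add: a_minus_def CR_a_inv)

lemma CR_pow: "x [^]\<^bsub>CR\<^esub> (k::nat) = (\<lambda>n. x n [^] k)"
  by (induction k) (simp_all add: nat_pow_def)

lemma ideal_NS: "ideal NS CR"
proof (rule idealI)
  interpret C: cring CR by (rule cring_CR)
  show "Ring.ring CR" by (rule C.ring_axioms)
  show "subgroup NS (add_monoid CR)"
  proof (rule C.add.subgroupI)
    show "NS \<subseteq> carrier CR" by (auto simp: null_sequences_def)
    show "NS \<noteq> {}" using NS_iff[of "\<lambda>n. \<zero>"] by auto
    show "\<ominus>\<^bsub>CR\<^esub> x \<in> NS" if "x \<in> NS" for x
      using that CR_a_inv[of x] unfolding NS_iff by (simp add: v_uminus null_seq_CR)
    show "x \<oplus>\<^bsub>CR\<^esub> y \<in> NS" if "x \<in> NS" "y \<in> NS" for x y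
    proof -
      have c: "x n \<in> carrier F" "y n \<in> carrier F" for n using that by (auto simp: NS_iff)
      have l: "(\<lambda>n. v (x n)) \<longlonglongrightarrow> 0" "(\<lambda>n. v (y n)) \<longlonglongrightarrow> 0" using that by (auto simp: NS_iff)
      have "(\<lambda>n. v (x n \<oplus> y n)) \<longlonglongrightarrow> 0"
        by (rule tendsto_zero_squeeze[OF _ _ tendsto_max[OF l, simplified]]) (use c v_add v_nonneg in
            auto)
      then show ?thesis using c by (simp add: NS_iff)
    qed
  qed
  show "x \<otimes>\<^bsub>CR\<^esub> a \<in> NS" if "a \<in> NS" and xC: "x \<in> carrier CR" for a x
  proof -
    have c: "a n \<in> carrier F" "x n \<in> carrier F" for n using that by (auto simp: NS_iff CR_closed)
    obtain B where B: "B > 0" "\<And>n. v (x n) \<le> B" using CR_bounded[OF xC] by blast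
    have l: "(\<lambda>n. v (a n)) \<longlonglongrightarrow> 0" using that by (auto simp: NS_iff)
    have "(\<lambda>n. v (x n \<otimes> a n)) \<longlonglongrightarrow> 0"
    proof (rule tendsto_zero_squeeze[OF _ _ tendsto_mult_right_zero[OF l]])
      show "v (x n \<otimes> a n) \<le> B * v (a n)" for n
        using c[of n] B(2)[of n] v_nonneg[of "a n"] by (simp add: v_mult mult_right_mono)
    qed (use c v_nonneg in auto)
    then show ?thesis using c by (simp add: NS_iff)
  qed
  then show "a \<otimes>\<^bsub>CR\<^esub> x \<in> NS" if "a \<in> NS" "x \<in> carrier CR" for a x
    using that C.m_comm[of a x] by (auto simp: null_sequences_def)
qed

lemma cring_CF: "cring CF"
  unfolding completion_def using ideal.quotient_is_cring[OF ideal_NS cring_CR] .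

lemma cauchy_class_hom: "ring_hom_cring CR CF cauchy_class"
  using ideal.rcos_ring_hom_cring[OF ideal_NS cring_CR]
      unfolding completion_def cauchy_class_def[abs_def] .

lemma cauchy_class_eq_iff:
  assumes "x \<in> carrier CR" "y \<in> carrier CR"
  shows "cauchy_class x = cauchy_class y \<longleftrightarrow> (\<lambda>n. v (x n \<ominus> y n)) \<longlonglongrightarrow> 0"
proof -
  interpret C: cring CR by (rule cring_CR)
  have "cauchy_class x = cauchy_class y \<longleftrightarrow> x \<ominus>\<^bsub>CR\<^esub> y \<in> NS"
    unfolding cauchy_class_def using C.quotient_eq_iff_same_a_r_cos[OF ideal_NS assms] by simp
  then show ?thesis using assms by (simp add: CR_a_minus NS_iff CR_closed)
qed

lemma carrier_CF: "W \<in> carrier CF \<longleftrightarrow> (\<exists>x\<in>carrier CR. W = cauchy_class x)"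
  unfolding completion_def FactRing_def A_RCOSETS_def' cauchy_class_def by auto

lemma cauchy_class_closed: "x \<in> carrier CR \<Longrightarrow> cauchy_class x \<in> carrier CF"
  using carrier_CF by blast

lemma cauchy_class_mult: "x \<in> carrier CR \<Longrightarrow> y \<in> carrier CR \<Longrightarrow> cauchy_class x \<otimes>\<^bsub>CF\<^esub> cauchy_class y
    = cauchy_class (\<lambda>n. x n \<otimes> y n)"
proof -
  interpret h: ring_hom_cring CR CF cauchy_class by (rule cauchy_class_hom)
  assume "x \<in> carrier CR" "y \<in> carrier CR"
  from h.hom_mult[OF this] show ?thesis by simp
qed

lemma cauchy_class_one: "\<one>\<^bsub>CF\<^esub> = cauchy_class (\<lambda>n. \<one>)"
proof -
  interpret h: ring_hom_cring CR CF cauchy_class by (rule cauchy_class_hom)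
  show ?thesis using h.hom_one by simp
qed

lemma cauchy_class_minus:
  assumes "x \<in> carrier CR" "y \<in> carrier CR"
  shows "cauchy_class x \<ominus>\<^bsub>CF\<^esub> cauchy_class y = cauchy_class (\<lambda>n. x n \<ominus> y n)"
proof -
  interpret h: ring_hom_cring CR CF cauchy_class by (rule cauchy_class_hom)
  have "cauchy_class x \<ominus>\<^bsub>CF\<^esub> cauchy_class y = cauchy_class (x \<ominus>\<^bsub>CR\<^esub> y)" using assms
      by (simp add: a_minus_def del: cauchy_ring_simps)
  then show ?thesis using assms by (simp add: CR_a_minus)
qed

lemma CR_pow_closed: "x \<in> carrier CR \<Longrightarrow> (\<lambda>n. x n [^] (k::nat)) \<in> carrier CR"
  using monoid.nat_pow_closed[OF cring.axioms(1)[THEN Ring.ring.axioms(2)], OF cring_CR, of x k]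
      CR_pow[of x k] by simp

lemma cauchy_class_pow:
  assumes "x \<in> carrier CR" shows "cauchy_class x [^]\<^bsub>CF\<^esub> (k::nat) = cauchy_class (\<lambda>n. x n [^] k)"
proof (induction k)
  case 0 then show ?case by (simp add: cauchy_class_one)
next
  case (Suc k)
  then show ?case using assms CR_pow_closed[OF assms, of k] by (simp add: cauchy_class_mult)
qed

lemma v_diff_le:
  assumes "x \<in> carrier F" "y \<in> carrier F" shows "\<bar>v x - v y\<bar> \<le> v (x \<ominus> y)"
proof -
  have *: "v x - v y \<le> v (x \<ominus> y)" if "x \<in> carrier F" "y \<in> carrier F" for x y
  proof -
    have "x = (x \<ominus> y) \<oplus> y" using that by algebra
    then have "v x \<le> max (v (x \<ominus> y)) (v y)" using v_add[of "x \<ominus> y" y] that by simp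
    then show ?thesis using v_nonneg[of y] v_nonneg[of "x \<ominus> y"] that by auto
  qed
  show ?thesis using *[OF assms] *[OF assms(2,1)] v_minus_commute[OF assms] by auto
qed

lemma CR_convergent:
  assumes "x \<in> carrier CR" shows "convergent (\<lambda>n. v (x n))"
proof -
  have "Cauchy (\<lambda>n. v (x n))"
    unfolding Cauchy_def dist_real_def
  proof (intro allI impI)
    fix e :: real assume "e > 0"
    then obtain N where "\<And>m n. m \<ge> N \<Longrightarrow> n \<ge> N \<Longrightarrow> v (x m \<ominus> x n) < e"
      using CR_cauchy[OF assms] by blast
    then show "\<exists>M. \<forall>m\<ge>M. \<forall>n\<ge>M. \<bar>v (x m) - v (x n)\<bar> < e"
      using v_diff_le CR_closed[OF assms] by (meson le_less_trans)
  qed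
  then show ?thesis by (rule Cauchy_convergent)
qed

text \<open>Representatives of a class differ by a null sequence and so have the same limit:
  \<open>the_elem\<close> in \<open>completion_abs\<close> is applied to a singleton.\<close>

lemma abs_cauchy_class:
  assumes x: "x \<in> carrier CR" shows "(\<lambda>n. v (x n)) \<longlonglongrightarrow> completion_abs v (cauchy_class x)"
proof -
  have lx: "(\<lambda>n. v (x n)) \<longlonglongrightarrow> lim (\<lambda>n. v (x n))" using CR_convergent[OF x]
      by (simp add: convergent_LIMSEQ_iff)
  have same: "lim (\<lambda>n. v (y n)) = lim (\<lambda>n. v (x n))" if y: "y \<in> cauchy_class x" for y
  proof -
    obtain h where h: "h \<in> NS" "y = (\<lambda>n. h n \<oplus> x n)" using y unfolding cauchy_class_def a_r_coset_def'
        by auto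
    have c: "h n \<in> carrier F" "x n \<in> carrier F" for n using h(1) x by (auto simp: NS_iff CR_closed)
    have e: "y n \<ominus> x n = h n" for n unfolding h(2) using c[of n] by algebra
    have le: "\<bar>v (y n) - v (x n)\<bar> \<le> v (h n)" for n
      using v_diff_le[of "y n" "x n"] c unfolding e by (simp add: h(2))
    have "(\<lambda>n. v (h n)) \<longlonglongrightarrow> 0" using h(1) by (simp add: NS_iff)
    then have "(\<lambda>n. \<bar>v (y n) - v (x n)\<bar>) \<longlonglongrightarrow> 0" by (rule tendsto_zero_squeeze[OF abs_ge_zero le])
    then have "(\<lambda>n. v (y n) - v (x n)) \<longlonglongrightarrow> 0" by (rule tendsto_rabs_zero_cancel)
    then have "(\<lambda>n. (v (y n) - v (x n)) + v (x n)) \<longlonglongrightarrow> 0 + lim (\<lambda>n. v (x n))" using lx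
        by (rule tendsto_add)
    then show ?thesis by (intro limI) simp
  qed
  have "x \<in> cauchy_class x"
    unfolding cauchy_class_def a_r_coset_def' using NS_iff[of "\<lambda>n. \<zero>"] CR_closed[OF x]
        by (intro UN_I[of "\<lambda>n. \<zero>"]) auto
  then have "(\<lambda>x. lim (\<lambda>n. v (x n))) ` cauchy_class x = {lim (\<lambda>n. v (x n))}" using same by blast
  then show ?thesis using lx by (simp add: completion_abs_def)
qed

lemma abs_triangle:
  assumes "W \<in> carrier CF" "Y \<in> carrier CF" "Z \<in> carrier CF"
  shows "completion_abs v (W \<ominus>\<^bsub>CF\<^esub> Z) \<le> max (completion_abs v (W \<ominus>\<^bsub>CF\<^esub> Y))
      (completion_abs v (Y \<ominus>\<^bsub>CF\<^esub> Z))"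
proof -
  obtain x y z where xyz: "x \<in> carrier CR" "y \<in> carrier CR" "z \<in> carrier CR" "W = cauchy_class x"
      "Y = cauchy_class y" "Z = cauchy_class z"
    using assms unfolding carrier_CF by blast
  have mC: "(\<lambda>n. a n \<ominus> b n) \<in> carrier CR" if "a \<in> carrier CR" "b \<in> carrier CR" for a b
    using that CR_add[OF _ CR_uminus] by (simp add: a_minus_def)
  show ?thesis
    unfolding xyz(4-6) cauchy_class_minus[OF xyz(1,2)] cauchy_class_minus[OF xyz(2,3)]
        cauchy_class_minus[OF xyz(1,3)]
  proof (rule tendsto_le[OF trivial_limit_sequentially])
    show "(\<lambda>n. v (x n \<ominus> z n)) \<longlonglongrightarrow> completion_abs v (cauchy_class (\<lambda>n. x n \<ominus> z n))"
      by (rule abs_cauchy_class) (use mC xyz in auto)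
    show "(\<lambda>n. max (v (x n \<ominus> y n)) (v (y n \<ominus> z n))) \<longlonglongrightarrow>
      max (completion_abs v (cauchy_class (\<lambda>n. x n \<ominus> y n))) (completion_abs v (cauchy_class (\<lambda>n. y n \<ominus> z
      n)))"
      by (intro tendsto_max abs_cauchy_class) (use mC xyz in auto)
    show "\<forall>\<^sub>F n in sequentially. v (x n \<ominus> z n) \<le> max (v (x n \<ominus> y n)) (v (y n \<ominus> z n))"
      by (intro always_eventually allI v_triangle) (use xyz CR_closed in auto)
  qed
qed

lemma abs_minus_zero:
  assumes "W \<in> carrier CF" "Y \<in> carrier CF" "completion_abs v (W \<ominus>\<^bsub>CF\<^esub> Y) = 0" shows "W = Y"
proof -
  obtain x y where xy: "x \<in> carrier CR" "y \<in> carrier CR" "W = cauchy_class x" "Y = cauchy_class y"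
    using assms unfolding carrier_CF by blast
  have "(\<lambda>n. x n \<ominus> y n) \<in> carrier CR" using xy CR_add[OF _ CR_uminus] by (simp add: a_minus_def)
  from abs_cauchy_class[OF this] have "(\<lambda>n. v (x n \<ominus> y n)) \<longlonglongrightarrow> 0"
    using assms(3) unfolding xy(3,4) cauchy_class_minus[OF xy(1,2)] by simp
  then show ?thesis unfolding xy(3,4) cauchy_class_eq_iff[OF xy(1,2)] .
qed

lemma abs_minus_nonneg:
  assumes "W \<in> carrier CF" "Y \<in> carrier CF" shows "completion_abs v (W \<ominus>\<^bsub>CF\<^esub> Y) \<ge> 0"
proof -
  obtain x y where xy: "x \<in> carrier CR" "y \<in> carrier CR" "W = cauchy_class x" "Y = cauchy_class y"
    using assms unfolding carrier_CF by blast
  have "(\<lambda>n. x n \<ominus> y n) \<in> carrier CR" using xy CR_add[OF _ CR_uminus] by (simp add: a_minus_def)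
  from abs_cauchy_class[OF this] show ?thesis
    unfolding xy(3,4) cauchy_class_minus[OF xy(1,2)] by (rule LIMSEQ_le_const) (use xy in \<open>auto simp:
        v_nonneg CR_closed\<close>)
qed

lemma abs_minus_commute:
  assumes "W \<in> carrier CF" "Y \<in> carrier CF" 
  shows "completion_abs v (W \<ominus>\<^bsub>CF\<^esub> Y) = completion_abs v (Y \<ominus>\<^bsub>CF\<^esub> W)"
proof -
  obtain x y where xy: "x \<in> carrier CR" "y \<in> carrier CR" "W = cauchy_class x" "Y = cauchy_class y"
    using assms unfolding carrier_CF by blast
  have c: "(\<lambda>n. x n \<ominus> y n) \<in> carrier CR" "(\<lambda>n. y n \<ominus> x n) \<in> carrier CR"
    using xy CR_add[OF _ CR_uminus] by (simp_all add: a_minus_def)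
  have "v (x n \<ominus> y n) = v (y n \<ominus> x n)" for n using v_minus_commute xy by (simp add: CR_closed)
  then show ?thesis
    unfolding xy(3,4) cauchy_class_minus[OF xy(1,2)] cauchy_class_minus[OF xy(2,1)]
    using LIMSEQ_unique[OF abs_cauchy_class[OF c(1)]] abs_cauchy_class[OF c(2)] by simp
qed

lemma PU_simps [simp]: "monoid.mult PU = monoid.mult CF" "\<one>\<^bsub>PU\<^esub> = \<one>\<^bsub>CF\<^esub>"
  by (simp_all add: principal_units_def)

lemma PU_pow [simp]: "x [^]\<^bsub>PU\<^esub> (k::nat) = x [^]\<^bsub>CF\<^esub> k"
  by (simp add: nat_pow_def)

text \<open>A limit below one leaves room for a bound between it and one that holds eventually. The
  estimates for powers need such an \<open>r\<close> that does not vary with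
  \<open>n\<close>.\<close>

lemma cauchy_class_PU_iff:
  assumes "x \<in> carrier CR"
  shows "cauchy_class x \<in> carrier PU \<longleftrightarrow> (\<exists>r<1. \<forall>\<^sub>F n in sequentially. v (x n \<ominus> \<one>) \<le> r)"
proof -
  have c: "(\<lambda>n. x n \<ominus> \<one>) \<in> carrier CR" using CR_add[OF assms CR_uminus[OF CR_const[of \<one>]]]
      by (simp add: a_minus_def)
  have "cauchy_class x \<in> carrier PU \<longleftrightarrow> completion_abs v (cauchy_class (\<lambda>n. x n \<ominus> \<one>)) < 1"
    unfolding principal_units_def using cauchy_class_closed[OF assms] cauchy_class_minus[OF assms
        CR_const[of \<one>]]
    by (simp add: cauchy_class_one)
  also have "\<dots> \<longleftrightarrow> (\<exists>r<1. \<forall>\<^sub>F n in sequentially. v (x n \<ominus> \<one>) \<le> r)"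
  proof
    let ?a = "completion_abs v (cauchy_class (\<lambda>n. x n \<ominus> \<one>))"
    assume a: "?a < 1"
    then have "?a < (?a + 1) / 2" by simp
    from order_tendstoD(2)[OF abs_cauchy_class[OF c] this]
    have "\<forall>\<^sub>F n in sequentially. v (x n \<ominus> \<one>) \<le> (?a + 1) / 2" by (rule eventually_mono) simp
    then show "\<exists>r<1. \<forall>\<^sub>F n in sequentially. v (x n \<ominus> \<one>) \<le> r" using a
        by (intro exI[of _ "(?a + 1) / 2"]) simp
  next
    assume "\<exists>r<1. \<forall>\<^sub>F n in sequentially. v (x n \<ominus> \<one>) \<le> r"
    then obtain r where r: "r < 1" "\<forall>\<^sub>F n in sequentially. v (x n \<ominus> \<one>) \<le> r" by blast
    have "completion_abs v (cauchy_class (\<lambda>n. x n \<ominus> \<one>)) \<le> r"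
      by (rule tendsto_upperbound[OF abs_cauchy_class[OF c] r(2)]) simp
    then show "completion_abs v (cauchy_class (\<lambda>n. x n \<ominus> \<one>)) < 1" using r(1) by simp
  qed
  finally show ?thesis .
qed

lemma PU_carrier_CF: "W \<in> carrier PU \<Longrightarrow> W \<in> carrier CF"
  by (simp add: principal_units_def)

lemma comm_group_PU: "comm_group PU"
proof (rule comm_groupI)
  interpret K: cring CF by (rule cring_CF)
  show "\<one>\<^bsub>PU\<^esub> \<in> carrier PU"
    using cauchy_class_PU_iff[OF CR_const[of \<one>]] by (auto simp: cauchy_class_one a_minus_def r_neg
        intro!: exI[of _ 0])
  show "x \<otimes>\<^bsub>PU\<^esub> y \<otimes>\<^bsub>PU\<^esub> z = x \<otimes>\<^bsub>PU\<^esub> (y \<otimes>\<^bsub>PU\<^esub> z)"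
    if "x \<in> carrier PU" "y \<in> carrier PU" "z \<in> carrier PU" for x y z
    using that[THEN PU_carrier_CF] by (simp add: K.m_assoc)
  show "x \<otimes>\<^bsub>PU\<^esub> y = y \<otimes>\<^bsub>PU\<^esub> x" if "x \<in> carrier PU" "y \<in> carrier PU" for x y
    using that[THEN PU_carrier_CF] by (simp add: K.m_comm)
  show "\<one>\<^bsub>PU\<^esub> \<otimes>\<^bsub>PU\<^esub> x = x" if "x \<in> carrier PU" for x
    using that[THEN PU_carrier_CF] by simp
  fix W assume W: "W \<in> carrier PU"
  then obtain x where x: "x \<in> carrier CR" "W = cauchy_class x" using PU_carrier_CF carrier_CF by blast
  obtain r where r: "r < 1" "\<forall>\<^sub>F n in sequentially. v (x n \<ominus> \<one>) \<le> r" using W cauchy_class_PU_iff x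
      by blast
  have xc: "x n \<in> carrier F" for n using x CR_closed by blast
  {
    fix Y assume Y: "Y \<in> carrier PU"
    then obtain y where y: "y \<in> carrier CR" "Y = cauchy_class y" using PU_carrier_CF carrier_CF by blast
    obtain s where s: "s < 1" "\<forall>\<^sub>F n in sequentially. v (y n \<ominus> \<one>) \<le> s" using Y cauchy_class_PU_iff y
        by blast
    have yc: "y n \<in> carrier F" for n using y CR_closed by blast
    have "\<forall>\<^sub>F n in sequentially. v (x n \<otimes> y n \<ominus> \<one>) \<le> max r s"
      using r(2) s(2)
    proof eventually_elim
      case (elim n)
      have c: "x n \<in> carrier F" "y n \<in> carrier F" using xc yc by auto
      have "x n \<otimes> y n \<ominus> \<one> = x n \<otimes> (y n \<ominus> \<one>) \<oplus> (x n \<ominus> \<one>)" using c by algebra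
      then have "v (x n \<otimes> y n \<ominus> \<one>) \<le> max (v (x n) * v (y n \<ominus> \<one>)) (v (x n \<ominus> \<one>))"
        using v_add[of "x n \<otimes> (y n \<ominus> \<one>)" "x n \<ominus> \<one>"] c by (simp add: v_mult)
      moreover have "v (x n) = 1" using v_near_one[OF c(1)] elim r(1) by simp
      ultimately show ?case using elim by auto
    qed
    then show "W \<otimes>\<^bsub>PU\<^esub> Y \<in> carrier PU"
      using cauchy_class_PU_iff[OF CR_mult[OF x(1) y(1)]] r(1) s(1) cauchy_class_mult[OF x(1) y(1)] x(2)
          y(2)
      by (auto intro!: exI[of _ "max r s"])
  }
  obtain N where N: "\<And>n. n \<ge> N \<Longrightarrow> v (x n \<ominus> \<one>) \<le> r" using r(2) unfolding eventually_sequentially by blast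
  have vx: "v (x n) = 1" "x n \<noteq> \<zero>" if "n \<ge> N" for n
  proof -
    show "v (x n) = 1" using v_near_one[OF xc] N[OF that] r(1) by simp
    then show "x n \<noteq> \<zero>" by auto
  qed
  \<comment> \<open>Finitely many early terms may be zero; they are replaced by \<one>, which does
    not affect the class.\<close>
  define z where "z = (\<lambda>n. if n \<ge> N then inv (x n) else \<one>)"
  have iv: "inv (x n) \<in> carrier F" "x n \<otimes> inv (x n) = \<one>" "v (inv (x n)) = 1" if "n \<ge> N" for n
    using vx[OF that] xc[of n] v_inv[of "x n"] by (auto simp: field_Units)
  have zc: "z n \<in> carrier F" for n using iv by (simp add: z_def)
  have zC: "z \<in> carrier CR"
    unfolding carrier_CR
  proof (intro conjI allI impI zc)
    fix e :: real assume "e > 0"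
    then obtain M where M: "\<And>m n. m \<ge> M \<Longrightarrow> n \<ge> M \<Longrightarrow> v (x m \<ominus> x n) < e"
      using CR_cauchy[OF x(1)] by blast
    have "v (z m \<ominus> z n) < e" if mn: "m \<ge> max M N" "n \<ge> max M N" for m n
    proof -
      have c: "x m \<in> carrier F" "x n \<in> carrier F" "inv (x m) \<in> carrier F" "inv (x n) \<in> carrier F"
        "x m \<otimes> inv (x m) = \<one>" "x n \<otimes> inv (x n) = \<one>" using xc iv mn by auto
      have "inv (x m) \<ominus> inv (x n) = inv (x m) \<otimes> (x n \<otimes> inv (x n)) \<ominus> (x m \<otimes> inv (x m)) \<otimes> inv (x n)"
        using c by simp
      also have "\<dots> = inv (x m) \<otimes> inv (x n) \<otimes> (x n \<ominus> x m)" using c(1-4) by algebra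
      finally have "v (inv (x m) \<ominus> inv (x n)) = v (x n \<ominus> x m)" using c iv mn by (simp add: v_mult)
      then show ?thesis using M[of n m] mn by (simp add: z_def)
    qed
    then show "\<exists>N. \<forall>m\<ge>N. \<forall>n\<ge>N. v (z m \<ominus> z n) < e" by blast
  qed
  have "\<forall>\<^sub>F n in sequentially. v (z n \<ominus> \<one>) \<le> r"
    unfolding eventually_sequentially
  proof (intro exI[of _ N] allI impI)
    fix n assume n: "n \<ge> N"
    have c: "x n \<in> carrier F" "inv (x n) \<in> carrier F" "x n \<otimes> inv (x n) = \<one>" using xc iv n by auto
    have "inv (x n) \<ominus> \<one> = inv (x n) \<ominus> x n \<otimes> inv (x n)" using c by simp
    also have "\<dots> = inv (x n) \<otimes> (\<one> \<ominus> x n)" using c(1,2) by algebra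
    finally have "v (z n \<ominus> \<one>) = v (\<one> \<ominus> x n)" using c iv n by (simp add: z_def v_mult)
    then show "v (z n \<ominus> \<one>) \<le> r" using N[OF n] v_minus_commute[of \<one> "x n"] c by simp
  qed
  then have "cauchy_class z \<in> carrier PU" using cauchy_class_PU_iff[OF zC] r(1) by blast
  moreover have "cauchy_class z \<otimes>\<^bsub>PU\<^esub> W = \<one>\<^bsub>PU\<^esub>"
  proof -
    have "\<forall>\<^sub>F n in sequentially. v (z n \<otimes> x n \<ominus> \<one>) = 0"
      unfolding eventually_sequentially
    proof (intro exI[of _ N] allI impI)
      fix n assume n: "n \<ge> N"
      have "z n \<otimes> x n = \<one>" using iv(2)[OF n] iv(1)[OF n] xc[of n] n by (simp add: z_def m_comm)
      then show "v (z n \<otimes> x n \<ominus> \<one>) = 0" by (simp add: a_minus_def r_neg)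
    qed
    then have "(\<lambda>n. v (z n \<otimes> x n \<ominus> \<one>)) \<longlonglongrightarrow> 0" by (rule tendsto_eventually)
    then show ?thesis using cauchy_class_mult[OF zC x(1)] cauchy_class_eq_iff[OF CR_mult[OF zC x(1)]
        CR_const[of \<one>]]
      by (simp add: x(2) cauchy_class_one)
  qed
  ultimately show "\<exists>y\<in>carrier PU. y \<otimes>\<^bsub>PU\<^esub> W = \<one>\<^bsub>PU\<^esub>" by blast
qed

text \<open>Near one, raising to a power prime to \<open>p\<close> preserves the distance to one, so
  this distance tends to zero already for a sequence representing \<open>W\<close>.\<close>

lemma PU_torsion:
  assumes "W \<in> carrier PU" "coprime m p" "W [^]\<^bsub>CF\<^esub> (m::nat) = \<one>\<^bsub>CF\<^esub>" shows "W = \<one>\<^bsub>CF\<^esub>"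
proof -
  obtain x where x: "x \<in> carrier CR" "W = cauchy_class x" using assms(1) PU_carrier_CF carrier_CF
      by blast
  obtain r where r: "r < 1" "\<forall>\<^sub>F n in sequentially. v (x n \<ominus> \<one>) \<le> r" using assms(1) cauchy_class_PU_iff x
      by blast
  have "(\<lambda>n. v (x n [^] m \<ominus> \<one>)) \<longlonglongrightarrow> 0"
    using assms(3) cauchy_class_eq_iff[OF CR_pow_closed[OF x(1), of m] CR_const[of \<one>]]
        by (simp add: x cauchy_class_pow cauchy_class_one)
  moreover have "\<forall>\<^sub>F n in sequentially. v (x n [^] m \<ominus> \<one>) = v (x n \<ominus> \<one>)"
    using r(2)
  proof eventually_elim
    case (elim n) then show ?case using v_pow_coprime[OF CR_closed[OF x(1)] _ assms(2)] r(1) by simp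
  qed
  ultimately have "(\<lambda>n. v (x n \<ominus> \<one>)) \<longlonglongrightarrow> 0" by (simp add: tendsto_cong)
  then show ?thesis using cauchy_class_eq_iff[OF x(1) CR_const[of \<one>]] by (simp add: x cauchy_class_one)
qed

text \<open>The uniqueness behind the \<open>THE\<close> of \<open>principal_part\<close>: the
  quotient of two roots is torsion of order prime to \<open>p\<close>.\<close>

lemma PU_root_unique:
  assumes W: "W \<in> carrier PU" and Y: "Y \<in> carrier PU" and m: "coprime m p"
    and eq: "W [^]\<^bsub>CF\<^esub> (m::nat) = Y [^]\<^bsub>CF\<^esub> m"
  shows "W = Y"
proof -
  interpret U: comm_group PU by (rule comm_group_PU)
  let ?Z = "W \<otimes>\<^bsub>PU\<^esub> inv\<^bsub>PU\<^esub> Y"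
  have "?Z [^]\<^bsub>PU\<^esub> m = W [^]\<^bsub>PU\<^esub> m \<otimes>\<^bsub>PU\<^esub> inv\<^bsub>PU\<^esub> (Y [^]\<^bsub>PU\<^esub> m)"
    using W Y by (simp add: U.nat_pow_distrib U.nat_pow_inv del: PU_simps PU_pow)
  also have "\<dots> = \<one>\<^bsub>PU\<^esub>" using eq U.nat_pow_closed[OF Y, of m] U.r_inv[of "Y [^]\<^bsub>PU\<^esub> m"] by simp
  finally have "?Z = \<one>\<^bsub>PU\<^esub>" using PU_torsion[of ?Z m] W Y m by (simp add: U.m_closed[simplified])
  then show ?thesis using W Y U.inv_solve_right'[of "\<one>\<^bsub>PU\<^esub>" W Y] U.l_one[OF Y] U.one_closed by simp
qed

end

section \<open>Powers with p-adic exponents and the image of a pure tensor\<close>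

lemma padic_cong:
  assumes "a \<in> carrier (padic_integers p)" "n \<le> k" shows "a k mod p ^ n = a n"
proof -
  have *: "\<And>n. a n < p ^ n \<and> a (Suc n) mod p ^ n = a n" using assms(1) by (simp add: padic_integers_def)
  show ?thesis
    using assms(2)
  proof (induction rule: dec_induct)
    case base then show ?case using * by simp
  next
    case (step k)
    have "a (Suc k) mod p ^ n = a (Suc k) mod p ^ k mod p ^ n"
      using step(1) by (simp add: mod_mod_cancel le_imp_power_dvd)
    then show ?case using * step by simp
  qed
qed

context padic_place begin

lemma pow_seq_CR:
  assumes w: "w \<in> carrier F" "v (w \<ominus> \<one>) < 1"
    and s: "\<And>n k. n \<le> k \<Longrightarrow> s k mod p ^ n = s n mod p ^ n"
  shows "(\<lambda>n. w [^] (s n :: nat)) \<in> carrier CR"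
  unfolding carrier_CR
proof (intro conjI allI impI)
  fix e :: real assume e: "e > 0"
  \<comment> \<open>The rate satisfies both demands of \<open>v_pow_cong\<close>: it bounds w - 1,
    and it is at least 1 / p.\<close>
  let ?r = "max (v (w \<ominus> \<one>)) (1 / real p)"
  have r: "?r < 1" "?r \<ge> 0" using w inv_p by (simp_all add: le_max_iff_disj)
  then obtain N where N: "?r ^ N < e" using real_arch_pow_inv[OF e, of ?r] by blast
  have "v (w [^] s m \<ominus> w [^] s n) < e" if "m \<ge> N" "n \<ge> N" for m n
  proof -
    have "v (w [^] s m \<ominus> w [^] s n) \<le> ?r ^ Suc N"
      by (rule v_pow_cong) (use w r s[of N m] s[of N n] that in auto)
    also have "\<dots> \<le> ?r ^ N" using r by (intro power_decreasing) auto
    finally show ?thesis using N by simp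
  qed
  then show "\<exists>N. \<forall>m\<ge>N. \<forall>n\<ge>N. v (w [^] s m \<ominus> w [^] s n) < e" by blast
qed (use w in auto)

lemma pow_seq_null:
  assumes w: "w \<in> carrier F" "v (w \<ominus> \<one>) < 1" and st: "\<And>n. s n mod p ^ n = t n mod p ^ n"
  shows "(\<lambda>n. v (w [^] (s n :: nat) \<ominus> w [^] (t n :: nat))) \<longlonglongrightarrow> 0"
proof -
  let ?r = "max (v (w \<ominus> \<one>)) (1 / real p)"
  have r: "?r < 1" "?r \<ge> 0" using w inv_p by (simp_all add: le_max_iff_disj)
  have le: "v (w [^] s n \<ominus> w [^] t n) \<le> ?r ^ Suc n" for n
    by (rule v_pow_cong) (use w r st in auto)
  have lim: "(\<lambda>n. ?r ^ Suc n) \<longlonglongrightarrow> 0" using r by (intro LIMSEQ_Suc LIMSEQ_power_zero) auto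
  show ?thesis by (rule tendsto_zero_squeeze[OF _ le lim]) (use w v_nonneg in simp)
qed

text \<open>The image of a pure tensor is pinned down by its \<open>m\<close>-th power, which is a limit of elements of the
field.\<close>

lemma leopoldt_local:
  assumes u: "u \<in> carrier (unit_group F)" and a: "a \<in> carrier (padic_integers p)"
  defines "z \<equiv> padic_power F v (principal_part F p v (completion_embed F v u)) a"
  shows "z \<in> carrier PU \<and> (\<exists>m>0. coprime m p \<and> (\<lambda>n. (u [^] a n) [^] m) \<in> carrier CR \<and>
     z [^]\<^bsub>CF\<^esub> (m::nat) = cauchy_class (\<lambda>n. (u [^] a n) [^] m))"
proof -
  obtain m where m: "m > 0" "coprime m p" "v (u [^] m \<ominus> \<one>) < 1" using unit_order[OF u] by blast
  have uF: "u \<in> carrier F" using u by (rule unit_group_carrier)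
  \<comment> \<open>This power is near one. Its \<open>m\<close>-th root among the principal units
    will be the principal part of \<open>u\<close>.\<close>
  define w where "w = u [^] m"
  have w: "w \<in> carrier F" "v (w \<ominus> \<one>) < 1" using uF m by (simp_all add: w_def)
  have vw: "v w = 1" using v_near_one[OF w] .
  have "\<exists>x. [m * x = Suc 0] (mod p ^ n)" for n
    using m(2) by (intro cong_solve_coprime_nat) simp
  \<comment> \<open>The exponents \<open>b n\<close> converge to the inverse of \<open>m\<close> in
    the \<open>p\<close>-adic integers, so \<open>w [^] b n\<close> converges to the required
    root.\<close>
  then obtain b where b: "\<And>n. [m * b n = Suc 0] (mod p ^ n)" by metis
  have b_mod: "b k mod p ^ n = b n mod p ^ n" if "n \<le> k" for n k
  proof -
    have "[m * b k = Suc 0] (mod p ^ n)" using b[of k] that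
        by (rule cong_dvd_modulus_nat[OF _ le_imp_power_dvd])
    then have "[m * b k = m * b n] (mod p ^ n)" using b[of n] by (metis cong_sym cong_trans)
    then show ?thesis using m(2) unfolding cong_def[symmetric]
        by (subst (asm) cong_mult_lcancel_nat) auto
  qed
  have a_mod: "a k mod p ^ n = a n mod p ^ n" if "n \<le> k" for n k
    using padic_cong[OF a that] padic_cong[OF a order_refl, of n] by simp
  have yC: "(\<lambda>n. w [^] b n) \<in> carrier CR" by (rule pow_seq_CR[OF w b_mod])
  define y where "y = cauchy_class (\<lambda>n. w [^] b n)"
  have pow_near: "v (w [^] k \<ominus> \<one>) \<le> v (w \<ominus> \<one>)" for k :: nat using v_pow_minus_one_le[of w k] w vw by simp
  have yU: "y \<in> carrier PU"
    unfolding y_def cauchy_class_PU_iff[OF yC] using w pow_near by (intro exI[of _ "v (w \<ominus> \<one>)"]) auto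
  have uC: "(\<lambda>n. u) \<in> carrier CR" using CR_const[OF uF] .
  have emb: "completion_embed F v u = cauchy_class (\<lambda>n. u)"
      by (simp add: completion_embed_def cauchy_class_def)
  have bm: "(b n * m) mod p ^ n = Suc 0 mod p ^ n" for n using b[of n]
      by (simp add: cong_def mult.commute)
  have ym: "cauchy_class (\<lambda>n. u) [^]\<^bsub>CF\<^esub> m = y [^]\<^bsub>CF\<^esub> m"
  proof -
    have "(\<lambda>n. v (w [^] (b n * m) \<ominus> w [^] Suc 0)) \<longlonglongrightarrow> 0" using bm by (rule pow_seq_null[OF w])
    then have "(\<lambda>n. v ((w [^] b n) [^] m \<ominus> w)) \<longlonglongrightarrow> 0" using w by (simp add: nat_pow_pow)
    then have "cauchy_class (\<lambda>n. (w [^] b n) [^] m) = cauchy_class (\<lambda>n. w)"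
      using cauchy_class_eq_iff[OF CR_pow_closed[OF yC, of m] CR_const[OF w(1)]] by simp
    then show ?thesis using cauchy_class_pow[OF yC, of m] cauchy_class_pow[OF uC, of m]
        unfolding y_def w_def by simp
  qed
  have pp: "principal_part F p v (completion_embed F v u) = y"
    unfolding principal_part_def emb
  proof (rule the_equality)
    show "y \<in> carrier PU \<and> (\<exists>m>0. coprime m p \<and> cauchy_class (\<lambda>n. u) [^]\<^bsub>CF\<^esub> m = y [^]\<^bsub>CF\<^esub> (m::nat))"
      using yU m ym by blast
  next
    fix y' assume "y' \<in> carrier PU \<and> (\<exists>m>0. coprime m p \<and> cauchy_class (\<lambda>n. u) [^]\<^bsub>CF\<^esub> m
        = y' [^]\<^bsub>CF\<^esub> (m::nat))"
    then obtain m' where y': "y' \<in> carrier PU" and m': "m' > 0" "coprime m' p"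
      "cauchy_class (\<lambda>n. u) [^]\<^bsub>CF\<^esub> m' = y' [^]\<^bsub>CF\<^esub> m'" by blast
    interpret K: cring CF by (rule cring_CF)
    have cc: "y \<in> carrier CF" "y' \<in> carrier CF" "cauchy_class (\<lambda>n. u) \<in> carrier CF"
      using yU y' PU_carrier_CF cauchy_class_closed[OF uC] by auto
    \<comment> \<open>The two roots belong to different exponents; they are compared after raising
      both to the product of these.\<close>
    have "y' [^]\<^bsub>CF\<^esub> (m' * m) = (cauchy_class (\<lambda>n. u) [^]\<^bsub>CF\<^esub> m') [^]\<^bsub>CF\<^esub> m" using cc m'(3)
        by (simp add: K.nat_pow_pow)
    also have "\<dots> = (cauchy_class (\<lambda>n. u) [^]\<^bsub>CF\<^esub> m) [^]\<^bsub>CF\<^esub> m'" using cc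
        by (simp add: K.nat_pow_pow mult.commute)
    also have "\<dots> = y [^]\<^bsub>CF\<^esub> (m' * m)" unfolding ym using cc by (simp add: K.nat_pow_pow mult.commute)
    finally show "y' = y" by (rule PU_root_unique[OF y' yU, rotated]) (use m m' in simp)
  qed
  \<comment> \<open>These exponents converge to a / m, so the powers of \<open>w\<close> converge to
    the \<open>p\<close>-adic power of the principal part with exponent \<open>a\<close>.\<close>
  define s where "s = (\<lambda>n. b n * a n)"
  have s_mod: "s k mod p ^ n = s n mod p ^ n" if "n \<le> k" for n k
    unfolding s_def using a_mod[OF that] b_mod[OF that] by (metis mod_mult_eq)
  have zC: "(\<lambda>n. w [^] s n) \<in> carrier CR" by (rule pow_seq_CR[OF w s_mod])
  let ?z = "cauchy_class (\<lambda>n. w [^] s n)"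
  have zK: "?z \<in> carrier CF" by (rule cauchy_class_closed[OF zC])
  have yaK: "y [^]\<^bsub>CF\<^esub> a n \<in> carrier CF" for n
    using monoid.nat_pow_closed[OF cring.axioms(1)[THEN Ring.ring.axioms(2)], OF cring_CF] yU
        PU_carrier_CF by blast
  let ?r = "max (v (w \<ominus> \<one>)) (1 / real p)"
  have r: "?r < 1" "?r \<ge> 0" using w inv_p by (simp_all add: le_max_iff_disj)
  have lim: "(\<lambda>n. completion_abs v (y [^]\<^bsub>CF\<^esub> a n \<ominus>\<^bsub>CF\<^esub> ?z)) \<longlonglongrightarrow> 0"
  proof -
    have le: "completion_abs v (y [^]\<^bsub>CF\<^esub> a n \<ominus>\<^bsub>CF\<^esub> ?z) \<le> ?r ^ Suc n" for n
    proof -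
      have c: "(\<lambda>k. (w [^] b k) [^] a n \<ominus> w [^] s k) \<in> carrier CR"
        using CR_add[OF CR_pow_closed[OF yC] CR_uminus[OF zC]] by (simp add: a_minus_def)
      have eq: "y [^]\<^bsub>CF\<^esub> a n \<ominus>\<^bsub>CF\<^esub> ?z = cauchy_class (\<lambda>k. (w [^] b k) [^] a n \<ominus> w [^] s k)"
        unfolding y_def cauchy_class_pow[OF yC] by (rule cauchy_class_minus[OF CR_pow_closed[OF yC] zC])
      \<comment> \<open>For \<open>k\<close> at least \<open>n\<close>, the exponents
        \<open>b k * a n\<close> and \<open>s k\<close> agree modulo \<open>p ^ n\<close>. This
        bounds the representing sequence from the index \<open>n\<close> on, hence its
        limit.\<close>
      have ev: "\<forall>\<^sub>F k in sequentially. v ((w [^] b k) [^] a n \<ominus> w [^] s k) \<le> ?r ^ Suc n"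
        unfolding eventually_sequentially
      proof (intro exI[of _ n] allI impI)
        fix k assume "n \<le> k"
        then have "(b k * a n) mod p ^ n = s k mod p ^ n" unfolding s_def using a_mod
            by (metis mod_mult_right_eq)
        then have "v (w [^] (b k * a n) \<ominus> w [^] s k) \<le> ?r ^ Suc n"
          by (intro v_pow_cong) (use w r in auto)
        then show "v ((w [^] b k) [^] a n \<ominus> w [^] s k) \<le> ?r ^ Suc n" using w by (simp add: nat_pow_pow)
      qed
      show ?thesis unfolding eq by (rule tendsto_upperbound[OF abs_cauchy_class[OF c] ev]) simp
    qed
    have lim: "(\<lambda>n. ?r ^ Suc n) \<longlonglongrightarrow> 0" using r by (intro LIMSEQ_Suc LIMSEQ_power_zero) auto
    show ?thesis by (rule tendsto_zero_squeeze[OF abs_minus_nonneg[OF yaK zK] le lim])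
  qed
  have z: "z = ?z"
    unfolding z_def pp padic_power_def
  proof (rule the_equality)
    show "?z \<in> carrier CF \<and> (\<lambda>n. completion_abs v (y [^]\<^bsub>CF\<^esub> a n \<ominus>\<^bsub>CF\<^esub> ?z)) \<longlonglongrightarrow> 0" using zK lim by blast
  next
    fix z' assume z': "z' \<in> carrier CF \<and> (\<lambda>n. completion_abs v (y [^]\<^bsub>CF\<^esub> a n \<ominus>\<^bsub>CF\<^esub> z')) \<longlonglongrightarrow> 0"
    let ?g = "\<lambda>n. max (completion_abs v (y [^]\<^bsub>CF\<^esub> a n \<ominus>\<^bsub>CF\<^esub> z'))
    (completion_abs v (y [^]\<^bsub>CF\<^esub> a n \<ominus>\<^bsub>CF\<^esub> ?z))"
    have "?g \<longlonglongrightarrow> max 0 0" using z' lim by (intro tendsto_max) auto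
    moreover have "completion_abs v (z' \<ominus>\<^bsub>CF\<^esub> ?z) \<le> ?g n" for n
      using abs_triangle[of z' "y [^]\<^bsub>CF\<^esub> a n" ?z] abs_minus_commute[of z' "y [^]\<^bsub>CF\<^esub> a n"] z' zK yaK
          by simp
    ultimately have "completion_abs v (z' \<ominus>\<^bsub>CF\<^esub> ?z) \<le> max 0 0" by (intro LIMSEQ_le_const) auto
    then have "completion_abs v (z' \<ominus>\<^bsub>CF\<^esub> ?z) = 0" using abs_minus_nonneg[of z' ?z] z' zK by simp
    then show "z' = ?z" using abs_minus_zero z' zK by blast
  qed
  have wC: "(\<lambda>n. w [^] a n) \<in> carrier CR" by (rule pow_seq_CR[OF w a_mod])
  have eq: "w [^] a n = (u [^] a n) [^] m" for n unfolding w_def using uF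
      by (simp add: nat_pow_pow mult.commute)
  have "(s n * m) mod p ^ n = a n mod p ^ n" for n
  proof -
    have "(s n * m) mod p ^ n = (b n * m * a n) mod p ^ n" by (simp add: s_def mult_ac)
    also have "\<dots> = (Suc 0 * a n) mod p ^ n" using bm[of n] by (metis mod_mult_left_eq)
    finally show ?thesis by simp
  qed
  then have "(\<lambda>n. v (w [^] (s n * m) \<ominus> w [^] a n)) \<longlonglongrightarrow> 0" by (rule pow_seq_null[OF w])
  then have "(\<lambda>n. v ((w [^] s n) [^] m \<ominus> w [^] a n)) \<longlonglongrightarrow> 0" using w by (simp add: nat_pow_pow)
  then have "?z [^]\<^bsub>CF\<^esub> m = cauchy_class (\<lambda>n. w [^] a n)"
    using cauchy_class_eq_iff[OF CR_pow_closed[OF zC, of m] wC] cauchy_class_pow[OF zC, of m] by simp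
  moreover have "?z \<in> carrier PU"
    unfolding cauchy_class_PU_iff[OF zC] using w pow_near by (intro exI[of _ "v (w \<ominus> \<one>)"]) auto
  ultimately show ?thesis unfolding z using m wC eq by (auto intro!: exI[of _ m])
qed

end

section \<open>Units tensored with the \<open>p\<close>-adic integers\<close>

text \<open>The multiplicative extension of a map to formal sums, in the very form in which it
  occurs in \<open>leopoldt_map\<close>. It is used for the codomain of the Leopoldt homomorphism
  and for the unit group.\<close>

definition frag_product :: "('g, 'b) monoid_scheme \<Rightarrow> ('t \<Rightarrow> 'g) \<Rightarrow> ('t \<Rightarrow>\<^sub>0 int) \<Rightarrow> 'g" where
  "frag_product G f c = (\<Otimes>\<^bsub>G\<^esub>t\<in>Poly_Mapping.keys c. f t [^]\<^bsub>G\<^esub> Poly_Mapping.lookup c t)"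

context comm_group begin

lemma frag_product_superset:
  assumes "finite K" "Poly_Mapping.keys c \<subseteq> K" "f \<in> K \<rightarrow> carrier G"
  shows "frag_product G f c = (\<Otimes>t\<in>K. f t [^] Poly_Mapping.lookup c t)"
  unfolding frag_product_def
  by (rule finprod_mono_neutral_cong_left) (use assms in \<open>auto simp: in_keys_iff\<close>)

lemma frag_product_hom:
  assumes f: "f \<in> S \<rightarrow> carrier G"
  shows "frag_product G f \<in> hom (free_Abelian_group S) G"
proof (rule homI)
  fix c assume "c \<in> carrier (free_Abelian_group S)"
  then show "frag_product G f c \<in> carrier G" unfolding frag_product_def
      by (intro finprod_closed) (use f in auto)
next
  fix c d assume cd: "c \<in> carrier (free_Abelian_group S)" "d \<in> carrier (free_Abelian_group S)"
  let ?K = "Poly_Mapping.keys c \<union> Poly_Mapping.keys d"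
  have K: "f \<in> ?K \<rightarrow> carrier G" using f cd by auto
  have "frag_product G f (c + d) = (\<Otimes>t\<in>?K. f t [^] Poly_Mapping.lookup (c + d) t)"
    by (rule frag_product_superset) (use K Poly_Mapping.keys_add[of c d] in auto)
  also have "\<dots> = (\<Otimes>t\<in>?K. f t [^] Poly_Mapping.lookup c t \<otimes> f t [^] Poly_Mapping.lookup d t)"
    by (rule finprod_cong') (use K in \<open>auto simp: Poly_Mapping.lookup_add int_pow_mult Pi_iff\<close>)
  also have "\<dots> = (\<Otimes>t\<in>?K. f t [^] Poly_Mapping.lookup c t) \<otimes> (\<Otimes>t\<in>?K. f t [^] Poly_Mapping.lookup d t)"
    by (rule finprod_multf) (use K in auto)
  also have "\<dots> = frag_product G f c \<otimes> frag_product G f d"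
    using frag_product_superset[of ?K c f] frag_product_superset[of ?K d f] K by simp
  finally show "frag_product G f (c \<otimes>\<^bsub>free_Abelian_group S\<^esub> d) = frag_product G f c \<otimes> frag_product G f d"
      by simp
qed

lemma frag_product_of: "f t \<in> carrier G \<Longrightarrow> frag_product G f (frag_of t) = f t"
  by (simp add: frag_product_def)

lemma frag_product_closed: "f \<in> S \<rightarrow> carrier G \<Longrightarrow> Poly_Mapping.keys c \<subseteq> S \<Longrightarrow> frag_product G f c \<in> carrier G"
  using hom_in_carrier[OF frag_product_hom[of f S], of c] by simp

lemma frag_product_add:
  "f \<in> S \<rightarrow> carrier G \<Longrightarrow> Poly_Mapping.keys c \<subseteq> S \<Longrightarrow> Poly_Mapping.keys d \<subseteq> S \<Longrightarrow>
    frag_product G f (c + d) = frag_product G f c \<otimes> frag_product G f d"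
  using hom_mult[OF frag_product_hom[of f S], of c d] by simp

lemma frag_product_0: "frag_product G f 0 = \<one>"
  by (simp add: frag_product_def)

lemma frag_product_uminus:
  assumes "f \<in> S \<rightarrow> carrier G" "Poly_Mapping.keys c \<subseteq> S"
      shows "frag_product G f (- c) = inv (frag_product G f c)"
proof -
  interpret h: group_hom "free_Abelian_group S" G "frag_product G f"
    using frag_product_hom[OF assms(1)] by (simp add: group_hom_def group_hom_axioms_def)
  show ?thesis using h.hom_inv[of c] assms(2) by simp
qed

lemma frag_product_diff:
  assumes "f \<in> S \<rightarrow> carrier G" "Poly_Mapping.keys c \<subseteq> S" "Poly_Mapping.keys d \<subseteq> S"
  shows "frag_product G f (c - d) = frag_product G f c \<otimes> inv (frag_product G f d)"
  using frag_product_add[OF assms(1,2), of "- d"] frag_product_uminus[OF assms(1,3)] assms(3) by simp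

end

lemma frag_cmul_diff_distrib2: "frag_cmul k (a - b) = frag_cmul k a - frag_cmul k b"
  by (rule poly_mapping_eqI) (simp add: lookup_minus right_diff_distrib)

section \<open>Relators of the tensor product and its torsion\<close>

definition tensor_generators :: "('a, 'b) ring_scheme \<Rightarrow> nat \<Rightarrow> ((nat \<Rightarrow> nat) \<times> 'a) set" where
  "tensor_generators F p = carrier (padic_integers p) \<times> carrier (unit_group F)"

definition tensor_relators :: "('a, 'b) ring_scheme \<Rightarrow> nat \<Rightarrow> ((nat \<Rightarrow> nat) \<times> 'a \<Rightarrow>\<^sub>0 int) set" where
  "tensor_relators F p = generate (free_Abelian_group (tensor_generators F p))
     (tensor_relations (add_monoid (padic_integers p)) (unit_group F))"

definition approx_unit :: "('a, 'b) ring_scheme \<Rightarrow> nat \<Rightarrow> ((nat \<Rightarrow> nat) \<times> 'a \<Rightarrow>\<^sub>0 int) \<Rightarrow> 'a" where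
  "approx_unit F n = frag_product (unit_group F) (\<lambda>t. snd t [^]\<^bsub>F\<^esub> fst t n)"

text \<open>The exponent \<open>m\<close> may depend on \<open>c\<close>; it removes the roots of
  unity of order prime to \<open>p\<close> that \<open>principal_part\<close> discards. The
  condition is stated inside the field, without its completion.\<close>

definition vanishes_at :: "('a, 'b) ring_scheme \<Rightarrow> nat \<Rightarrow> ('a \<Rightarrow> real) \<Rightarrow> ((nat \<Rightarrow> nat) \<times> 'a \<Rightarrow>\<^sub>0 int) \<Rightarrow> bool"
    where
  "vanishes_at F p v c \<longleftrightarrow> (\<exists>m>0. coprime m p \<and>
     (\<lambda>n. v (approx_unit F n c [^]\<^bsub>F\<^esub> (m::nat) \<ominus>\<^bsub>F\<^esub> \<one>\<^bsub>F\<^esub>)) \<longlonglongrightarrow> 0)"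

locale unit_tensor = field F for F :: "('a, 'b) ring_scheme" (structure) +
  fixes p :: nat
  assumes prime: "Factorial_Ring.prime p"
begin

abbreviation "Zp \<equiv> padic_integers p"
abbreviation "U \<equiv> unit_group F"
abbreviation "S \<equiv> tensor_generators F p"
abbreviation "Rel \<equiv> tensor_relators F p"

sublocale U: comm_group U by (rule comm_group_unit_group)

lemma p_pos: "p > 0" using prime prime_gt_0_nat by blast

lemma Zp_iff: "a \<in> carrier Zp \<longleftrightarrow> (\<forall>n. a n < p ^ n \<and> a (Suc n) mod p ^ n = a n)"
  by (simp add: padic_integers_def)

lemma Zp_add: "a \<oplus>\<^bsub>Zp\<^esub> b = (\<lambda>n. (a n + b n) mod p ^ n)"
  by (simp add: padic_integers_def)

lemma ZpI:
  assumes "\<And>n. s (Suc n) mod p ^ n = s n mod p ^ n" shows "(\<lambda>n. s n mod p ^ n) \<in> carrier Zp"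
  unfolding Zp_iff
proof (intro allI conjI)
  fix n
  show "s n mod p ^ n < p ^ n" using p_pos by simp
  have "s (Suc n) mod p ^ Suc n mod p ^ n = s (Suc n) mod p ^ n" by (simp add: mod_mod_cancel)
  then show "s (Suc n) mod p ^ Suc n mod p ^ n = s n mod p ^ n" using assms by simp
qed

lemma Zp_mod: "a \<in> carrier Zp \<Longrightarrow> a (Suc n) mod p ^ n = a n" and Zp_mod_same: "a \<in> carrier Zp \<Longrightarrow>
    a n mod p ^ n = a n"
  by (simp_all add: Zp_iff)

lemma Zp_add_closed: "a \<in> carrier Zp \<Longrightarrow> b \<in> carrier Zp \<Longrightarrow> a \<oplus>\<^bsub>Zp\<^esub> b \<in> carrier Zp"
  unfolding Zp_add by (rule ZpI) (metis Zp_mod mod_add_eq)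

lemma approx_in: "(\<lambda>t. snd t [^] (fst t n :: nat)) \<in> S \<rightarrow> carrier U"
  using U.nat_pow_closed by (auto simp: tensor_generators_def)

lemma approx_closed: "Poly_Mapping.keys c \<subseteq> S \<Longrightarrow> approx_unit F n c \<in> carrier U"
  unfolding approx_unit_def by (rule U.frag_product_closed[OF approx_in])

lemma approx_add: "Poly_Mapping.keys c \<subseteq> S \<Longrightarrow> Poly_Mapping.keys d \<subseteq> S \<Longrightarrow>
    approx_unit F n (c + d) = approx_unit F n c \<otimes> approx_unit F n d"
  unfolding approx_unit_def using U.frag_product_add[OF approx_in] by simp

lemma approx_diff: "Poly_Mapping.keys c \<subseteq> S \<Longrightarrow> Poly_Mapping.keys d \<subseteq> S \<Longrightarrow>
    approx_unit F n (c - d) = approx_unit F n c \<otimes> inv\<^bsub>U\<^esub> approx_unit F n d"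
  unfolding approx_unit_def using U.frag_product_diff[OF approx_in] by simp

lemma approx_of: "t \<in> S \<Longrightarrow> approx_unit F n (frag_of t) = snd t [^] fst t n"
  unfolding approx_unit_def using U.frag_product_of[of "\<lambda>t. snd t [^] fst t n" t] approx_in[of n] by auto

lemma approx_0: "approx_unit F n 0 = \<one>"
  unfolding approx_unit_def U.frag_product_0 by simp

lemma keys_S_diff: "Poly_Mapping.keys c \<subseteq> S \<Longrightarrow> Poly_Mapping.keys d \<subseteq> S \<Longrightarrow> Poly_Mapping.keys (c - d) \<subseteq> S"
  using keys_diff[of c d] by blast

lemma keys_S_add: "Poly_Mapping.keys c \<subseteq> S \<Longrightarrow> Poly_Mapping.keys d \<subseteq> S \<Longrightarrow> Poly_Mapping.keys (c + d) \<subseteq> S"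
  using Poly_Mapping.keys_add[of c d] by blast

lemma keys_S_cmul: "Poly_Mapping.keys c \<subseteq> S \<Longrightarrow> Poly_Mapping.keys (frag_cmul k c) \<subseteq> S"
  using keys_cmul[of k c] by blast

lemma tensor_relations_subset: "tensor_relations (add_monoid Zp) U \<subseteq> carrier (free_Abelian_group S)"
proof
  fix c assume "c \<in> tensor_relations (add_monoid Zp) U"
  then consider a b u where "a \<in> carrier Zp" "b \<in> carrier Zp" "u \<in> carrier U"
      "c = frag_of (a \<oplus>\<^bsub>Zp\<^esub> b, u) - frag_of (a, u) - frag_of (b, u)"
    | a u w where "a \<in> carrier Zp" "w \<in> carrier U" "u \<in> carrier U"
      "c = frag_of (a, u \<otimes>\<^bsub>U\<^esub> w) - frag_of (a, u) - frag_of (a, w)"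
    unfolding tensor_relations_def by auto
  then show "c \<in> carrier (free_Abelian_group S)"
  proof cases
    case 1
    then show ?thesis by (simp add: keys_S_diff tensor_generators_def[symmetric]) (intro keys_S_diff;
        simp add: tensor_generators_def Zp_add_closed)
  next
    case 2
    then have "u \<otimes>\<^bsub>U\<^esub> w \<in> carrier U" by (intro U.m_closed)
    then show ?thesis using 2 by simp (intro keys_S_diff; simp add: tensor_generators_def)
  qed
qed

lemma subgroup_Rel: "subgroup Rel (free_Abelian_group S)"
  unfolding tensor_relators_def by (rule group.generate_is_subgroup[OF group_free_Abelian_group
      tensor_relations_subset])

lemma Rel_keys: "c \<in> Rel \<Longrightarrow> Poly_Mapping.keys c \<subseteq> S"
  using subgroup.mem_carrier[OF subgroup_Rel] by simp

lemma Rel_zero: "0 \<in> Rel"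
  using subgroup.one_closed[OF subgroup_Rel] by simp

lemma Rel_add: "c \<in> Rel \<Longrightarrow> d \<in> Rel \<Longrightarrow> c + d \<in> Rel"
  using subgroup.m_closed[OF subgroup_Rel] by simp

lemma Rel_uminus: "c \<in> Rel \<Longrightarrow> - c \<in> Rel"
  using subgroup.m_inv_closed[OF subgroup_Rel, of c] Rel_keys[of c] by simp

lemma Rel_diff: "c \<in> Rel \<Longrightarrow> d \<in> Rel \<Longrightarrow> c - d \<in> Rel"
  using Rel_add[OF _ Rel_uminus] by simp

lemma Rel_cmul: "c \<in> Rel \<Longrightarrow> frag_cmul k c \<in> Rel"
  by (rule frag_closure_minus_cmul[of "\<lambda>c. c \<in> Rel"]) (auto intro: Rel_zero Rel_diff)

lemma Rel_left: "a \<in> carrier Zp \<Longrightarrow> b \<in> carrier Zp \<Longrightarrow> u \<in> carrier U \<Longrightarrow>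
    frag_of (a \<oplus>\<^bsub>Zp\<^esub> b, u) - frag_of (a, u) - frag_of (b, u) \<in> Rel"
  unfolding tensor_relators_def by (rule generate.incl) (auto simp: tensor_relations_def)

lemma Rel_right: "a \<in> carrier Zp \<Longrightarrow> u \<in> carrier U \<Longrightarrow> w \<in> carrier U \<Longrightarrow>
    frag_of (a, u \<otimes> w) - frag_of (a, u) - frag_of (a, w) \<in> Rel"
  unfolding tensor_relators_def by (rule generate.incl) (auto simp: tensor_relations_def)

text \<open>An induction rule for the generated subgroup: closure under differences includes sums
  and inverses, so only the two kinds of relators remain to be checked.\<close>

lemma Rel_least:
  assumes c: "c \<in> Rel" and z: "0 \<in> B" and d: "\<And>c d. c \<in> B \<Longrightarrow> d \<in> B \<Longrightarrow> c - d \<in> B"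
    and l: "\<And>a b u. a \<in> carrier Zp \<Longrightarrow> b \<in> carrier Zp \<Longrightarrow> u \<in> carrier U \<Longrightarrow>
      frag_of (a \<oplus>\<^bsub>Zp\<^esub> b, u) - frag_of (a, u) - frag_of (b, u) \<in> B"
    and r: "\<And>a u w. a \<in> carrier Zp \<Longrightarrow> u \<in> carrier U \<Longrightarrow> w \<in> carrier U \<Longrightarrow>
      frag_of (a, u \<otimes> w) - frag_of (a, u) - frag_of (a, w) \<in> B"
  shows "c \<in> B"
proof -
  have u: "- c \<in> B" if "c \<in> B" for c using d[OF z that] by simp
  have a: "c + e \<in> B" if "c \<in> B" "e \<in> B" for c e using d[OF that(1) u[OF that(2)]] by simp
  have rel: "tensor_relations (add_monoid Zp) U \<subseteq> B"
    unfolding tensor_relations_def using l r by auto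
  from c show ?thesis
    unfolding tensor_relators_def
  proof (induction rule: generate.induct)
    case one then show ?case using z by simp
  next
    case (incl h) then show ?case using rel by blast
  next
    case (inv h)
    then have "h \<in> carrier (free_Abelian_group S)" by (rule subsetD[OF tensor_relations_subset])
    then have "Poly_Mapping.keys h \<subseteq> S" by simp
    moreover have "- h \<in> B" using u rel inv by blast
    ultimately show ?case by simp
  next
    case (eng h1 h2) then show ?case using a by simp
  qed
qed

lemma zero_Zp: "(\<lambda>n. 0) \<in> carrier Zp"
  by (simp add: Zp_iff p_pos)

lemma Rel_zero_left: assumes "u \<in> carrier U" shows "frag_of (\<lambda>n. 0, u) \<in> Rel"
proof -
  have "(\<lambda>n. 0) \<oplus>\<^bsub>Zp\<^esub> (\<lambda>n. 0) = (\<lambda>n. 0)" by (simp add: Zp_add)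
  then show ?thesis using Rel_uminus[OF Rel_left[OF zero_Zp zero_Zp assms]] by simp
qed

lemma Rel_one_right: assumes "a \<in> carrier Zp" shows "frag_of (a, \<one>) \<in> Rel"
  using Rel_uminus[OF Rel_right[OF assms, of \<one> \<one>]] U.one_closed by simp

definition zp_times :: "nat \<Rightarrow> (nat \<Rightarrow> nat) \<Rightarrow> nat \<Rightarrow> nat" where
  "zp_times D a = (\<lambda>n. (D * a n) mod p ^ n)"

lemma zp_times_closed: "a \<in> carrier Zp \<Longrightarrow> zp_times D a \<in> carrier Zp"
  unfolding zp_times_def by (rule ZpI) (metis Zp_mod mod_mult_right_eq)

lemma Rel_times_left:
  assumes a: "a \<in> carrier Zp" and u: "u \<in> carrier U"
  shows "frag_cmul (int D) (frag_of (a, u)) - frag_of (zp_times D a, u) \<in> Rel"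
proof (induction D)
  case 0 then show ?case using Rel_uminus[OF Rel_zero_left[OF u]] by (simp add: zp_times_def)
next
  case (Suc D)
  have "zp_times (Suc D) a = zp_times D a \<oplus>\<^bsub>Zp\<^esub> a"
    unfolding zp_times_def Zp_add by (simp add: mod_add_right_eq add.commute)
  then have "frag_of (zp_times (Suc D) a, u) - frag_of (zp_times D a, u) - frag_of (a, u) \<in> Rel"
    using Rel_left[OF zp_times_closed[OF a] a u] by simp
  from Rel_diff[OF Suc this] show ?case by (simp add: frag_cmul_distrib algebra_simps)
qed

lemma Rel_times_right:
  assumes a: "a \<in> carrier Zp" and u: "u \<in> carrier U"
  shows "frag_cmul (int D) (frag_of (a, u)) - frag_of (a, u [^] D) \<in> Rel"
proof (induction D)
  case 0 then show ?case using Rel_uminus[OF Rel_one_right[OF a]] by simp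
next
  case (Suc D)
  have "u [^] D \<in> carrier U" using U.nat_pow_closed[OF u] by simp
  then have "frag_of (a, u [^] Suc D) - frag_of (a, u [^] D) - frag_of (a, u) \<in> Rel"
    using Rel_right[OF a _ u] by simp
  from Rel_diff[OF Suc this] show ?case by (simp add: frag_cmul_distrib algebra_simps)
qed

text \<open>A map of the \<open>p\<close>-adic integers that is additive and inverse to multiplication by \<open>D\<close> modulo
  the subgroup \<open>B\<close> shows that \<open>B\<close> contains the \<open>D\<close>-torsion of the tensor product.\<close>

lemma divide_modulo:
  assumes c: "Poly_Mapping.keys c \<subseteq> S" "frag_cmul (int D) c \<in> Rel"
    and f: "\<And>a. a \<in> carrier Zp \<Longrightarrow> f a \<in> carrier Zp"
    and B: "Rel \<subseteq> B" "\<And>c d. c \<in> B \<Longrightarrow> d \<in> B \<Longrightarrow> c - d \<in> B"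
    and add: "\<And>a b u. a \<in> carrier Zp \<Longrightarrow> b \<in> carrier Zp \<Longrightarrow> u \<in> carrier U \<Longrightarrow>
      frag_of (f (a \<oplus>\<^bsub>Zp\<^esub> b), u) - frag_of (f a, u) - frag_of (f b, u) \<in> B"
    and div: "\<And>a u. a \<in> carrier Zp \<Longrightarrow> u \<in> carrier U \<Longrightarrow> frag_of (zp_times D (f a), u) - frag_of (a, u) \<in> B"
  shows "c \<in> B"
proof -
  have z: "0 \<in> B" using B(1) Rel_zero by blast
  have ua: "c + e \<in> B" if "c \<in> B" "e \<in> B" for c e using B(2)[OF that(1) B(2)[OF z that(2)]] by simp
  \<comment> \<open>The map \<open>f\<close> applied to the \<open>p\<close>-adic factor. It carries
    relators into \<open>B\<close>, and following it by multiplication by \<open>D\<close> gives the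
    identity modulo \<open>B\<close>. Since \<open>D\<close> times \<open>c\<close> is a relator,
    \<open>c\<close> lies in \<open>B\<close>.\<close>
  define g :: "((nat \<Rightarrow> nat) \<times> 'a \<Rightarrow>\<^sub>0 int) \<Rightarrow> _"
    where "g = frag_extend (\<lambda>t. frag_of (f (fst t), snd t))"
  have gR: "g c \<in> B" if "c \<in> Rel" for c
  proof -
    have "c \<in> {c. g c \<in> B}"
    proof (rule Rel_least[OF that])
      show "0 \<in> {c. g c \<in> B}" using z by (simp add: g_def)
      show "c - d \<in> {c. g c \<in> B}" if "c \<in> {c. g c \<in> B}" "d \<in> {c. g c \<in> B}" for c d
        using B(2) that by (simp add: g_def frag_extend_diff)
      show "frag_of (a \<oplus>\<^bsub>Zp\<^esub> b, u) - frag_of (a, u) - frag_of (b, u) \<in> {c. g c \<in> B}"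
        if "a \<in> carrier Zp" "b \<in> carrier Zp" "u \<in> carrier U" for a b u
        using add[OF that] by (simp add: g_def frag_extend_diff)
      show "frag_of (a, u \<otimes> w) - frag_of (a, u) - frag_of (a, w) \<in> {c. g c \<in> B}"
        if "a \<in> carrier Zp" "u \<in> carrier U" "w \<in> carrier U" for a u w
        using Rel_right[OF f that(2,3)] that B(1) by (auto simp: g_def frag_extend_diff)
    qed
    then show ?thesis by simp
  qed
  have "frag_cmul (int D) (g c) - c \<in> B"
    using c(1)
  proof (induction c rule: free_Abelian_group_induct[consumes 1, case_names zero diff of])
    case zero then show ?case using z by (simp add: g_def)
  next
    case (diff c d)
    have eq: "frag_cmul (int D) (g (c - d)) - (c - d) = (frag_cmul (int D) (g c) - c) -
        (frag_cmul (int D) (g d) - d)"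
      unfolding g_def frag_extend_diff frag_cmul_diff_distrib2 by (simp add: algebra_simps)
    show ?case unfolding eq by (rule B(2)[OF diff(3,4)])
  next
    case (of t)
    obtain a u where t: "t = (a, u)" "a \<in> carrier Zp" "u \<in> carrier U" using of
        by (auto simp: tensor_generators_def)
    have "frag_cmul (int D) (frag_of (f a, u)) - frag_of (zp_times D (f a), u) \<in> B"
      using Rel_times_left[OF f[OF t(2)] t(3)] B(1) by blast
    from ua[OF this div[OF t(2,3)]] show ?case by (simp add: g_def t(1))
  qed
  moreover have "frag_cmul (int D) (g c) \<in> B"
    using gR[OF c(2)] by (simp add: g_def frag_extend_cmul)
  ultimately have "frag_cmul (int D) (g c) - (frag_cmul (int D) (g c) - c) \<in> B" using B(2) by blast
  then show ?thesis by simp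
qed

text \<open>As \<open>m\<close> is invertible in the \<open>p\<close>-adic integers, division by
  \<open>m\<close> is an additive map and \<open>divide_modulo\<close> applies with the relators
  themselves as \<open>B\<close>.\<close>

lemma coprime_torsion:
  assumes c: "Poly_Mapping.keys c \<subseteq> S" "frag_cmul (int m) c \<in> Rel" and m: "coprime m p"
  shows "c \<in> Rel"
proof -
  have "\<exists>x. [m * x = Suc 0] (mod p ^ n)" for n
    using m by (intro cong_solve_coprime_nat) simp
  then obtain i where i: "\<And>n. [m * i n = Suc 0] (mod p ^ n)" by metis
  have i_mod: "i (Suc n) mod p ^ n = i n mod p ^ n" for n
  proof -
    have "[m * i (Suc n) = Suc 0] (mod p ^ n)" using i[of "Suc n"] by (rule cong_dvd_modulus_nat) simp
    then have "[m * i (Suc n) = m * i n] (mod p ^ n)" using i[of n] by (metis cong_sym cong_trans)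
    then show ?thesis using m unfolding cong_def[symmetric] by (subst (asm) cong_mult_lcancel_nat) auto
  qed
  define f where "f = (\<lambda>a n. (i n * a n) mod p ^ n)"
  have f: "f a \<in> carrier Zp" if "a \<in> carrier Zp" for a
    unfolding f_def by (intro ZpI mod_mult_cong i_mod) (simp add: Zp_mod[OF that] Zp_mod_same[OF that])
  show ?thesis
  proof (rule divide_modulo[OF c f order_refl Rel_diff])
    fix a b u assume ab: "a \<in> carrier Zp" "b \<in> carrier Zp" "u \<in> carrier U"
    have "f (a \<oplus>\<^bsub>Zp\<^esub> b) = f a \<oplus>\<^bsub>Zp\<^esub> f b"
      unfolding f_def Zp_add by (intro ext) (metis distrib_left mod_add_eq mod_mult_right_eq)
    then show "frag_of (f (a \<oplus>\<^bsub>Zp\<^esub> b), u) - frag_of (f a, u) - frag_of (f b, u) \<in> Rel"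
      using Rel_left[OF f[OF ab(1)] f[OF ab(2)] ab(3)] by simp
  next
    fix a u assume a: "a \<in> carrier Zp" "u \<in> carrier U"
    have "zp_times m (f a) = a"
    proof
      fix n
      have "zp_times m (f a) n = (m * i n) * a n mod p ^ n"
        unfolding zp_times_def f_def by (simp add: mod_mult_right_eq mult.assoc)
      also have "\<dots> = (m * i n mod p ^ n) * a n mod p ^ n" by (simp add: mod_mult_left_eq)
      also have "\<dots> = (Suc 0 mod p ^ n) * a n mod p ^ n" using i[of n] by (simp add: cong_def)
      also have "\<dots> = Suc 0 * a n mod p ^ n" by (simp only: mod_mult_left_eq)
      also have "\<dots> = a n" using Zp_mod_same[OF a(1), of n] by simp
      finally show "zp_times m (f a) n = a n" .
    qed
    then show "frag_of (zp_times m (f a), u) - frag_of (a, u) \<in> Rel" using Rel_zero by simp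
  qed
qed

definition zp_nat :: "nat \<Rightarrow> nat \<Rightarrow> nat" where "zp_nat j = (\<lambda>n. j mod p ^ n)"

lemma zp_nat_closed: "zp_nat j \<in> carrier Zp"
  unfolding zp_nat_def by (rule ZpI) simp

lemma Rel_zp_nat:
  assumes "u \<in> carrier U" shows "frag_of (zp_nat j, u) - frag_of (zp_nat 1, u [^] j) \<in> Rel"
proof -
  have "zp_times j (zp_nat 1) = zp_nat j" unfolding zp_times_def zp_nat_def
      by (simp only: mod_mult_right_eq mult_1_right)
  then have "frag_cmul (int j) (frag_of (zp_nat 1, u)) - frag_of (zp_nat j, u) \<in> Rel"
    using Rel_times_left[OF zp_nat_closed assms, of j 1] by simp
  from Rel_diff[OF Rel_times_right[OF zp_nat_closed assms, of j 1] this] show ?thesis by simp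
qed

text \<open>Division by \<open>p ^ k\<close> drops the last \<open>k\<close> digits of a
  \<open>p\<close>-adic integer. This is additive and inverse to multiplication only up to natural
  numbers, the carries and remainders. Hence \<open>divide_modulo\<close> is used with the subgroup
  \<open>B\<close> of formal sums equivalent to the tensor of the \<open>p\<close>-adic integer one
  with a unit.\<close>

lemma prime_power_torsion:
  assumes c: "Poly_Mapping.keys c \<subseteq> S" "frag_cmul (int (p ^ k)) c \<in> Rel"
  shows "\<exists>u\<in>carrier U. c - frag_of (zp_nat 1, u) \<in> Rel"
proof -
  define B where "B = {c. \<exists>u\<in>carrier U. c - frag_of (zp_nat 1, u) \<in> Rel}"
  have RB: "Rel \<subseteq> B"
  proof
    fix c assume "c \<in> Rel"
    then show "c \<in> B" unfolding B_def using Rel_diff[OF _ Rel_one_right[OF zp_nat_closed]] U.one_closed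
        by auto
  qed
  have BD: "c - d \<in> B" if "c \<in> B" "d \<in> B" for c d
  proof -
    obtain u where u: "u \<in> carrier U" "c - frag_of (zp_nat 1, u) \<in> Rel" using \<open>c \<in> B\<close> unfolding B_def
        by blast
    obtain w where w: "w \<in> carrier U" "d - frag_of (zp_nat 1, w) \<in> Rel" using \<open>d \<in> B\<close> unfolding B_def
        by blast
    let ?x = "u \<otimes>\<^bsub>U\<^esub> inv\<^bsub>U\<^esub> w"
    have x: "?x \<in> carrier U" using u w by (intro U.m_closed U.inv_closed)
    have "?x \<otimes>\<^bsub>U\<^esub> w = u" using u w by (simp add: U.m_assoc del: unit_group_mult unit_group_one)
    then have "frag_of (zp_nat 1, u) - frag_of (zp_nat 1, ?x) - frag_of (zp_nat 1, w) \<in> Rel"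
      using Rel_right[OF zp_nat_closed x w(1), of 1] by simp
    from Rel_add[OF Rel_diff[OF u(2) w(2)] this]
    have "(c - d) - frag_of (zp_nat 1, ?x) \<in> Rel" by (simp add: algebra_simps)
    then show ?thesis unfolding B_def using x by blast
  qed
  have Bnat: "frag_of (zp_nat j, u) \<in> B" if "u \<in> carrier U" for j u
    unfolding B_def using Rel_zp_nat[OF that, of j] U.nat_pow_closed[OF that, of j] by auto
  have BA: "c + d \<in> B" if "c \<in> B" "d \<in> B" for c d
  proof -
    have "0 - d \<in> B" using BD[OF _ that(2)] RB Rel_zero by blast
    then show ?thesis using BD[OF that(1), of "- d"] by simp
  qed
  define f where "f = (\<lambda>a n. a (n + k) div p ^ k :: nat)"
  have split: "a (n + k) = p ^ k * f a n + a k" if "a \<in> carrier Zp" for a n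
  proof -
    have "a (n + k) mod p ^ k = a k" using padic_cong[OF that, of k "n + k"] by simp
    then show ?thesis unfolding f_def by (metis mult_div_mod_eq)
  qed
  \<comment> \<open>Dropping the last \<open>k\<close> digits and keeping the next \<open>n\<close>
    may be done in either order.\<close>
  have dm: "(x div p ^ k) mod p ^ n = (x mod p ^ (n + k)) div p ^ k" for x n
    using p_pos by (simp add: power_add mult.commute[of "p ^ n"] mod_mult2_eq div_mult_self2)
  have f: "f a \<in> carrier Zp" if a: "a \<in> carrier Zp" for a
    unfolding Zp_iff
  proof (intro allI conjI)
    fix n
    have "a (n + k) < p ^ n * p ^ k" using a by (simp add: Zp_iff power_add[symmetric])
    then show "f a n < p ^ n" unfolding f_def using p_pos by (simp add: less_mult_imp_div_less)
    show "f a (Suc n) mod p ^ n = f a n" unfolding f_def dm using Zp_mod[OF a, of "n + k"] by simp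
  qed
  have "c \<in> B"
  proof (rule divide_modulo[OF c f RB BD])
    fix a b u assume ab: "a \<in> carrier Zp" "b \<in> carrier Zp" and u: "u \<in> carrier U"
    \<comment> \<open>The carry out of the last \<open>k\<close> digits when \<open>a\<close> and
      \<open>b\<close> are added.\<close>
    define j where "j = (a k + b k) div p ^ k"
    have "f (a \<oplus>\<^bsub>Zp\<^esub> b) = (f a \<oplus>\<^bsub>Zp\<^esub> f b) \<oplus>\<^bsub>Zp\<^esub> zp_nat j"
    proof
      fix n
      have "f (a \<oplus>\<^bsub>Zp\<^esub> b) n = ((a (n + k) + b (n + k)) div p ^ k) mod p ^ n" unfolding f_def Zp_add dm ..
      also have "a (n + k) + b (n + k) = (a k + b k) + (f a n + f b n) * p ^ k"
        using split[OF ab(1), of n] split[OF ab(2), of n] by (simp add: algebra_simps)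
      also have "\<dots> div p ^ k = (f a n + f b n) + j"
        unfolding j_def using p_pos by (subst div_mult_self1) auto
      finally show "f (a \<oplus>\<^bsub>Zp\<^esub> b) n = ((f a \<oplus>\<^bsub>Zp\<^esub> f b) \<oplus>\<^bsub>Zp\<^esub> zp_nat j) n"
        unfolding Zp_add zp_nat_def by (simp add: mod_add_eq)
    qed
    then have "frag_of (f (a \<oplus>\<^bsub>Zp\<^esub> b), u) - frag_of (f a \<oplus>\<^bsub>Zp\<^esub> f b, u) - frag_of (zp_nat j, u) \<in> Rel"
      using Rel_left[OF Zp_add_closed[OF f[OF ab(1)] f[OF ab(2)]] zp_nat_closed u] by simp
    from Rel_add[OF this Rel_left[OF f[OF ab(1)] f[OF ab(2)] u]]
    have "(frag_of (f (a \<oplus>\<^bsub>Zp\<^esub> b), u) - frag_of (f a, u) - frag_of (f b, u)) - frag_of (zp_nat j, u) \<in> B"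
      using RB by (auto simp: algebra_simps)
    from BA[OF this Bnat[OF u, of j]]
    show "frag_of (f (a \<oplus>\<^bsub>Zp\<^esub> b), u) - frag_of (f a, u) - frag_of (f b, u) \<in> B" by simp
  next
    fix a u assume a: "a \<in> carrier Zp" and u: "u \<in> carrier U"
    \<comment> \<open>Division with remainder by \<open>p ^ k\<close>; the remainder is the natural
      number \<open>a k\<close>.\<close>
    have "a = zp_times (p ^ k) (f a) \<oplus>\<^bsub>Zp\<^esub> zp_nat (a k)"
    proof
      fix n
      have "(zp_times (p ^ k) (f a) \<oplus>\<^bsub>Zp\<^esub> zp_nat (a k)) n = a (n + k) mod p ^ n"
        unfolding split[OF a] Zp_add zp_times_def zp_nat_def by (simp add: mod_add_eq)
      then show "a n = (zp_times (p ^ k) (f a) \<oplus>\<^bsub>Zp\<^esub> zp_nat (a k)) n"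
        using padic_cong[OF a, of n "n + k"] by simp
    qed
    then have "frag_of (a, u) - frag_of (zp_times (p ^ k) (f a), u) - frag_of (zp_nat (a k), u) \<in> Rel"
      using Rel_left[OF zp_times_closed[OF f[OF a]] zp_nat_closed u, of "p ^ k" "a k"] by simp
    then have "(frag_of (a, u) - frag_of (zp_times (p ^ k) (f a), u)) - frag_of (zp_nat (a k), u) \<in> B"
        using RB by blast
    from BA[OF this Bnat[OF u, of "a k"]] have "frag_of (a, u) - frag_of (zp_times (p ^ k) (f a), u) \<in> B"
        by simp
    from BD[OF _ this, of 0] show "frag_of (zp_times (p ^ k) (f a), u) - frag_of (a, u) \<in> B"
      using RB Rel_zero by auto
  qed
  then show ?thesis unfolding B_def by blast
qed

end

section \<open>Triviality of the image at one place\<close>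

context padic_place begin

sublocale unit_tensor F p by unfold_locales (rule prime)

lemma CR_inv:
  assumes x: "x \<in> carrier CR" and v1: "\<And>n. v (x n) = 1"
  shows "(\<lambda>n. inv (x n)) \<in> carrier CR"
  unfolding carrier_CR
proof (intro conjI allI impI)
  have xc: "x n \<in> carrier F" for n using x CR_closed by blast
  have nz: "x n \<noteq> \<zero>" for n using v1[of n] by auto
  have iv: "inv (x n) \<in> carrier F" "x n \<otimes> inv (x n) = \<one>" "v (inv (x n)) = 1" for n
    using v1[of n] nz[of n] xc[of n] v_inv[of "x n"] by (auto simp: field_Units)
  then show "inv (x n) \<in> carrier F" for n by simp
  fix e :: real assume "e > 0"
  then obtain M where M: "\<And>m n. m \<ge> M \<Longrightarrow> n \<ge> M \<Longrightarrow> v (x m \<ominus> x n) < e"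
    using CR_cauchy[OF x] by blast
  have "v (inv (x m) \<ominus> inv (x n)) = v (x n \<ominus> x m)" for m n
  proof -
    have c: "x m \<in> carrier F" "x n \<in> carrier F" "inv (x m) \<in> carrier F" "inv (x n) \<in> carrier F"
      using xc iv by auto
    have "inv (x m) \<ominus> inv (x n) = inv (x m) \<otimes> (x n \<otimes> inv (x n)) \<ominus> (x m \<otimes> inv (x m)) \<otimes> inv (x n)"
      using c iv by simp
    also have "\<dots> = inv (x m) \<otimes> inv (x n) \<otimes> (x n \<ominus> x m)" using c by algebra
    finally show ?thesis using c iv by (simp add: v_mult)
  qed
  then show "\<exists>N. \<forall>m\<ge>N. \<forall>n\<ge>N. v (inv (x m) \<ominus> inv (x n)) < e"
    using M by (intro exI[of _ M]) simp
qed

lemma unit_seq: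
  assumes "Poly_Mapping.keys c \<subseteq> S"
  shows "approx_unit F n c \<in> carrier F" "v (approx_unit F n c) = 1" "approx_unit F n c \<noteq> \<zero>"
  using approx_closed[OF assms, of n] unit_group_carrier v_unit inv_unit_group(2) by blast+

lemma pure_local:
  assumes u: "u \<in> carrier U" and a: "a \<in> carrier Zp"
  shows "leopoldt_pure F p a u v \<in> carrier PU"
    and "\<exists>m>0. coprime m p \<and> (\<lambda>n. approx_unit F n (frag_of (a, u)) [^] m) \<in> carrier CR \<and>
      leopoldt_pure F p a u v [^]\<^bsub>CF\<^esub> (m::nat) = cauchy_class (\<lambda>n. approx_unit F n (frag_of (a, u)) [^]
      m)"
proof -
  have e: "approx_unit F n (frag_of (a, u)) = u [^] a n" for n
    using u a by (subst approx_of) (auto simp: tensor_generators_def)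
  have l: "leopoldt_pure F p a u v = padic_power F v (principal_part F p v (completion_embed F v u)) a"
    using place by (simp add: leopoldt_pure_def)
  show "leopoldt_pure F p a u v \<in> carrier PU"
    and "\<exists>m>0. coprime m p \<and> (\<lambda>n. approx_unit F n (frag_of (a, u)) [^] m) \<in> carrier CR \<and>
      leopoldt_pure F p a u v [^]\<^bsub>CF\<^esub> (m::nat) = cauchy_class (\<lambda>n. approx_unit F n (frag_of (a, u)) [^]
      m)"
    using leopoldt_local[OF u a] unfolding l e by auto
qed

text \<open>Pure tensors come with an exponent \<open>m\<close> from \<open>pure_local\<close>. For
  a difference of two formal sums the product of their exponents serves both.\<close>

lemma local_component:
  assumes \<phi>: "\<phi> \<in> hom (free_Abelian_group S) PU"
    and gen: "\<And>a u. a \<in> carrier Zp \<Longrightarrow> u \<in> carrier U \<Longrightarrow> \<phi> (frag_of (a, u)) = leopoldt_pure F p a u v"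
    and c: "Poly_Mapping.keys c \<subseteq> S"
  shows "\<exists>m>0. coprime m p \<and> (\<lambda>n. approx_unit F n c [^] m) \<in> carrier CR \<and>
      \<phi> c [^]\<^bsub>CF\<^esub> (m::nat) = cauchy_class (\<lambda>n. approx_unit F n c [^] m)"
  using c
proof (induction c rule: free_Abelian_group_induct[consumes 1, case_names zero diff of])
  interpret P: comm_group PU by (rule comm_group_PU)
  interpret h: group_hom "free_Abelian_group S" PU \<phi>
    using \<phi> by (simp add: group_hom_def group_hom_axioms_def)
  {
    case zero
    interpret K: cring CF by (rule cring_CF)
    have "\<phi> 0 [^]\<^bsub>CF\<^esub> (1::nat) = cauchy_class (\<lambda>n. \<one>)" using h.hom_one by (simp flip: cauchy_class_one)
    then show ?case by (intro exI[of _ 1]) (simp add: approx_0 CR_const)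
  next
    case (of t)
    then obtain a u where t: "t = (a, u)" "a \<in> carrier Zp" "u \<in> carrier U"
        by (auto simp: tensor_generators_def)
    show ?case unfolding t(1) gen[OF t(2,3)] by (rule pure_local(2)[OF t(3,2)])
  next
    case (diff c d)
    obtain k where k: "k > 0" "coprime k p" "(\<lambda>n. approx_unit F n c [^] k) \<in> carrier CR"
      "\<phi> c [^]\<^bsub>CF\<^esub> (k::nat) = cauchy_class (\<lambda>n. approx_unit F n c [^] k)" using diff.IH(1) by blast
    obtain l where l: "l > 0" "coprime l p" "(\<lambda>n. approx_unit F n d [^] l) \<in> carrier CR"
      "\<phi> d [^]\<^bsub>CF\<^esub> (l::nat) = cauchy_class (\<lambda>n. approx_unit F n d [^] l)" using diff.IH(2) by blast
    interpret K: cring CF by (rule cring_CF)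
    let ?m = "k * l"
    let ?x = "\<lambda>n. approx_unit F n c [^] ?m" and ?y = "\<lambda>n. approx_unit F n d [^] ?m"
      and ?w = "\<lambda>n. approx_unit F n (c - d) [^] ?m"
    have fc: "\<phi> c \<in> carrier PU" "\<phi> d \<in> carrier PU" using h.hom_closed diff.hyps by auto
    note cC = unit_seq[OF diff.hyps(1)] and dC = unit_seq[OF diff.hyps(2)]
    have x: "?x \<in> carrier CR" "\<phi> c [^]\<^bsub>CF\<^esub> ?m = cauchy_class ?x"
      using CR_pow_closed[OF k(3), of l] cauchy_class_pow[OF k(3), of l] k(4) K.nat_pow_pow[OF
          PU_carrier_CF[OF fc(1)], of k l] cC
      by (simp_all add: nat_pow_pow)
    have y: "?y \<in> carrier CR" "\<phi> d [^]\<^bsub>CF\<^esub> ?m = cauchy_class ?y"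
      using CR_pow_closed[OF l(3), of k] cauchy_class_pow[OF l(3), of k] l(4) K.nat_pow_pow[OF
          PU_carrier_CF[OF fc(2)], of l k] dC
      by (simp_all add: nat_pow_pow mult.commute)
    have w: "?w = (\<lambda>n. ?x n \<otimes> inv (?y n))" "\<And>n. ?w n \<otimes> ?y n = ?x n"
    proof -
      have "?w n = ?x n \<otimes> inv (?y n) \<and> ?w n \<otimes> ?y n = ?x n" for n
      proof -
        let ?a = "approx_unit F n c" and ?b = "approx_unit F n d"
        have e: "approx_unit F n (c - d) = ?a \<otimes> inv ?b"
          using approx_diff[OF diff.hyps] inv_unit_group(1)[OF approx_closed[OF diff.hyps(2)]] by simp
        have bu: "?b \<in> Units F" using dC[of n] by (simp add: field_Units)
        have bi: "inv ?b \<in> carrier F" using bu by simp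
        have "?w n = ?x n \<otimes> (inv ?b) [^] ?m" unfolding e using cC[of n] bi by (simp add: nat_pow_distrib)
        moreover have "(inv ?b) [^] ?m \<otimes> ?y n = \<one>"
          using bu bi dC[of n] by (simp add: nat_pow_distrib[symmetric])
        moreover have "inv (?y n) = (inv ?b) [^] ?m"
          using calculation(2) bi dC[of n] by (intro comm_inv_char) (auto simp: m_comm)
        ultimately show ?thesis using cC[of n] dC[of n] bi by (simp add: m_assoc)
      qed
      then show "?w = (\<lambda>n. ?x n \<otimes> inv (?y n))" "\<And>n. ?w n \<otimes> ?y n = ?x n" by blast+
    qed
    have wC: "?w \<in> carrier CR"
      unfolding w(1) by (rule CR_mult[OF x(1) CR_inv[OF y(1)]]) (use dC in \<open>simp add: v_pow\<close>)
    have "\<phi> (c - d) = \<phi> c \<otimes>\<^bsub>PU\<^esub> inv\<^bsub>PU\<^esub> (\<phi> d)"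
      using h.hom_mult[of c "- d"] h.hom_inv[of d] diff.hyps by simp
    then have "\<phi> (c - d) \<otimes>\<^bsub>PU\<^esub> \<phi> d = \<phi> c" "\<phi> (c - d) \<in> carrier PU"
      using fc by (simp_all add: P.m_assoc del: PU_simps)
    then have "\<phi> (c - d) [^]\<^bsub>PU\<^esub> ?m \<otimes>\<^bsub>PU\<^esub> \<phi> d [^]\<^bsub>PU\<^esub> ?m = \<phi> c [^]\<^bsub>PU\<^esub> ?m"
      using fc P.nat_pow_distrib[of "\<phi> (c - d)" "\<phi> d" ?m] by (simp del: PU_simps PU_pow)
    then have 1: "\<phi> (c - d) [^]\<^bsub>CF\<^esub> ?m \<otimes>\<^bsub>CF\<^esub> cauchy_class ?y = cauchy_class ?x" using x y by simp
    have 2: "cauchy_class ?w \<otimes>\<^bsub>CF\<^esub> cauchy_class ?y = cauchy_class ?x"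
        using cauchy_class_mult[OF wC y(1)] w(2) by simp
    have yP: "cauchy_class ?y \<in> carrier PU" using P.nat_pow_closed[OF fc(2), of ?m] y by simp
    let ?i = "inv\<^bsub>PU\<^esub> (cauchy_class ?y)"
    have i: "cauchy_class ?y \<otimes>\<^bsub>CF\<^esub> ?i = \<one>\<^bsub>CF\<^esub>" "?i \<in> carrier CF" "cauchy_class ?y \<in> carrier CF"
      using P.r_inv[OF yP] P.inv_closed[OF yP] PU_carrier_CF yP by auto
    \<comment> \<open>The completion is at hand only as a commutative ring, so the factor is
      cancelled by means of its inverse among the principal units.\<close>
    have cancel: "A = B" if "A \<in> carrier CF" "B \<in> carrier CF" "A \<otimes>\<^bsub>CF\<^esub> cauchy_class ?y
        = B \<otimes>\<^bsub>CF\<^esub> cauchy_class ?y" for A B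
    proof -
      have "A = (A \<otimes>\<^bsub>CF\<^esub> cauchy_class ?y) \<otimes>\<^bsub>CF\<^esub> ?i" using that(1) i by (simp add: K.m_assoc)
      also have "\<dots> = B" unfolding that(3) using that(2) i by (simp add: K.m_assoc)
      finally show ?thesis .
    qed
    have "\<phi> (c - d) [^]\<^bsub>CF\<^esub> ?m = cauchy_class ?w"
      by (rule cancel[OF K.nat_pow_closed[OF PU_carrier_CF[OF \<open>\<phi> (c - d) \<in> carrier PU\<close>]]
          cauchy_class_closed[OF wC]])
        (simp only: 1 2)
    then show ?case using k l wC by (intro exI[of _ ?m]) simp
  }
qed

text \<open>The passage from the completion to the field. Taking the \<open>m\<close>-th power loses
  nothing because principal units have no torsion of order prime to \<open>p\<close>; different
  exponents on the two sides are multiplied together.\<close>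

lemma local_component_trivial_iff:
  assumes \<phi>: "\<phi> \<in> hom (free_Abelian_group S) PU"
    and gen: "\<And>a u. a \<in> carrier Zp \<Longrightarrow> u \<in> carrier U \<Longrightarrow> \<phi> (frag_of (a, u)) = leopoldt_pure F p a u v"
    and c: "Poly_Mapping.keys c \<subseteq> S"
  shows "\<phi> c = \<one>\<^bsub>CF\<^esub> \<longleftrightarrow> vanishes_at F p v c"
proof -
  interpret K: cring CF by (rule cring_CF)
  obtain m where m: "m > 0" "coprime m p" "(\<lambda>n. approx_unit F n c [^] m) \<in> carrier CR"
    "\<phi> c [^]\<^bsub>CF\<^esub> (m::nat) = cauchy_class (\<lambda>n. approx_unit F n c [^] m)" using local_component[OF assms]
    by blast
  have fc: "\<phi> c \<in> carrier PU" using hom_in_carrier[OF \<phi>] c by simp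
  show ?thesis
  proof
    assume "\<phi> c = \<one>\<^bsub>CF\<^esub>"
    then have "\<phi> c [^]\<^bsub>CF\<^esub> m = \<one>\<^bsub>CF\<^esub>" by simp
    then have "cauchy_class (\<lambda>n. approx_unit F n c [^] m) = cauchy_class (\<lambda>n. \<one>)"
        using m(4) cauchy_class_one by simp
    then have "(\<lambda>n. v (approx_unit F n c [^] m \<ominus> \<one>)) \<longlonglongrightarrow> 0" using cauchy_class_eq_iff[OF m(3) CR_const[of
        \<one>]] by simp
    then show "vanishes_at F p v c" unfolding vanishes_at_def using m by blast
  next
    assume "vanishes_at F p v c"
    then obtain k where k: "k > 0" "coprime k p" "(\<lambda>n. v (approx_unit F n c [^] (k::nat) \<ominus> \<one>)) \<longlonglongrightarrow> 0"
      unfolding vanishes_at_def by blast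
    note cC = unit_seq[OF c]
    have le: "v ((approx_unit F n c [^] m) [^] k \<ominus> \<one>) \<le> v (approx_unit F n c [^] k \<ominus> \<one>)" for n
      using v_pow_minus_one_le[of "approx_unit F n c [^] k" m] cC[of n]
          by (simp add: nat_pow_pow v_pow mult.commute)
    have "(\<lambda>n. v ((approx_unit F n c [^] m) [^] k \<ominus> \<one>)) \<longlonglongrightarrow> 0"
      by (rule tendsto_zero_squeeze[OF _ le k(3)]) (use cC v_nonneg in simp)
    then have "cauchy_class (\<lambda>n. (approx_unit F n c [^] m) [^] k) = cauchy_class (\<lambda>n. \<one>)"
      using cauchy_class_eq_iff[OF CR_pow_closed[OF m(3), of k] CR_const[of \<one>]] by simp
    then have "\<phi> c [^]\<^bsub>CF\<^esub> (m * k) = \<one>\<^bsub>CF\<^esub>"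
      using cauchy_class_pow[OF m(3), of k] m(4) K.nat_pow_pow[OF PU_carrier_CF[OF fc], of m k]
          by (simp add: cauchy_class_one)
    then show "\<phi> c = \<one>\<^bsub>CF\<^esub>" by (rule PU_torsion[OF fc, rotated]) (use m k in simp)
  qed
qed

lemma vanishes_0: "vanishes_at F p v 0"
  unfolding vanishes_at_def approx_0 by (intro exI[of _ 1]) (simp add: a_minus_def r_neg)

lemma vanishes_diff:
  assumes c: "Poly_Mapping.keys c \<subseteq> S" "vanishes_at F p v c"
      and d: "Poly_Mapping.keys d \<subseteq> S" "vanishes_at F p v d"
  shows "vanishes_at F p v (c - d)"
proof -
  obtain k where k: "k > 0" "coprime k p" "(\<lambda>n. v (approx_unit F n c [^] (k::nat) \<ominus> \<one>)) \<longlonglongrightarrow> 0"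
    using c(2) unfolding vanishes_at_def by blast
  obtain l where l: "l > 0" "coprime l p" "(\<lambda>n. v (approx_unit F n d [^] (l::nat) \<ominus> \<one>)) \<longlonglongrightarrow> 0"
    using d(2) unfolding vanishes_at_def by blast
  note cC = unit_seq[OF c(1)] and dC = unit_seq[OF d(1)] and wC = unit_seq[OF keys_S_diff[OF c(1) d(1)]]
  have le: "v (approx_unit F n (c - d) [^] (k * l) \<ominus> \<one>) \<le>
     max (v (approx_unit F n c [^] k \<ominus> \<one>)) (v (approx_unit F n d [^] l \<ominus> \<one>))" for n
  proof -
    let ?a = "approx_unit F n c" and ?b = "approx_unit F n d" and ?w = "approx_unit F n (c - d)"
    have "approx_unit F n ((c - d) + d) = ?w \<otimes> ?b" using approx_add[OF keys_S_diff[OF c(1) d(1)] d(1)] .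
    then have e: "?w \<otimes> ?b = ?a" by simp
    have e': "?w [^] (k * l) \<otimes> ?b [^] (k * l) = ?a [^] (k * l)"
      using e wC[of n] dC[of n] by (simp add: nat_pow_distrib[symmetric])
    let ?W = "?w [^] (k * l)" and ?B = "?b [^] (k * l)" and ?A = "?a [^] (k * l)"
    have cc: "?W \<in> carrier F" "?B \<in> carrier F" "?A \<in> carrier F" using wC[of n] dC[of n] cC[of n] by auto
    \<comment> \<open>Multiplication by \<open>?B\<close>, which has absolute value one, clears the
      denominator of \<open>?W\<close>.\<close>
    have "(?W \<ominus> \<one>) \<otimes> ?B = (?A \<ominus> \<one>) \<ominus> (?B \<ominus> \<one>)"
      unfolding e'[symmetric] using cc(1,2) by algebra
    then have "v (?W \<ominus> \<one>) = v ((?A \<ominus> \<one>) \<ominus> (?B \<ominus> \<one>))"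
      using cc dC[of n] v_mult[of "?W \<ominus> \<one>" ?B] by (simp add: v_pow)
    also have "\<dots> \<le> max (v (?A \<ominus> \<one>)) (v (?B \<ominus> \<one>))" using v_minus cc by simp
    also have "v (?A \<ominus> \<one>) \<le> v (?a [^] k \<ominus> \<one>)"
      using v_pow_minus_one_le[of "?a [^] k" l] cC[of n] by (simp add: nat_pow_pow v_pow)
    also have "v (?B \<ominus> \<one>) \<le> v (?b [^] l \<ominus> \<one>)"
      using v_pow_minus_one_le[of "?b [^] l" k] dC[of n] by (simp add: nat_pow_pow v_pow mult.commute)
    finally show ?thesis by (simp add: max.mono)
  qed
  have "(\<lambda>n. v (approx_unit F n (c - d) [^] (k * l) \<ominus> \<one>)) \<longlonglongrightarrow> 0"
    by (rule tendsto_zero_squeeze[OF _ le tendsto_max[OF k(3) l(3), simplified]]) (use wC v_nonneg in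
        simp)
  then show ?thesis unfolding vanishes_at_def using k l by (intro exI[of _ "k * l"]) simp
qed

lemma vanishes_cmul:
  assumes c: "Poly_Mapping.keys c \<subseteq> S" "vanishes_at F p v c"
  shows "vanishes_at F p v (frag_cmul k c)"
proof -
  have "Poly_Mapping.keys (frag_cmul k c) \<subseteq> S \<and> vanishes_at F p v (frag_cmul k c)"
    by (rule frag_closure_minus_cmul[where P = "\<lambda>c. Poly_Mapping.keys c \<subseteq> S \<and> vanishes_at F p v c"])
      (simp add: vanishes_0, meson vanishes_diff keys_S_diff, simp add: c)
  then show ?thesis by blast
qed

text \<open>A relator in the unit argument is approximated by \<one> at every level. A relator in
  the \<open>p\<close>-adic argument compares the sum of two residues with its reduction modulo
  \<open>p ^ n\<close> as exponents, and \<open>pow_seq_null\<close> makes the discrepancy tend to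
  zero.\<close>

lemma vanishes_Rel:
  assumes "c \<in> Rel" shows "vanishes_at F p v c"
proof -
  have "c \<in> {c. Poly_Mapping.keys c \<subseteq> S \<and> vanishes_at F p v c}"
  proof (rule Rel_least[OF assms])
    show "0 \<in> {c. Poly_Mapping.keys c \<subseteq> S \<and> vanishes_at F p v c}" using vanishes_0 by simp
    show "c - d \<in> {c. Poly_Mapping.keys c \<subseteq> S \<and> vanishes_at F p v c}"
      if "c \<in> {c. Poly_Mapping.keys c \<subseteq> S \<and> vanishes_at F p v c}"
        "d \<in> {c. Poly_Mapping.keys c \<subseteq> S \<and> vanishes_at F p v c}" for c d
      using that vanishes_diff[of c d] keys_S_diff[of c d] by simp
  next
    fix a u w assume a: "a \<in> carrier Zp" and u: "u \<in> carrier U" and w: "w \<in> carrier U"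
    let ?r = "frag_of (a, u \<otimes> w) - frag_of (a, u) - frag_of (a, w)"
    have uw: "u \<otimes> w \<in> carrier U" using U.m_closed[OF u w] by simp
    have S: "(a, u) \<in> S" "(a, w) \<in> S" "(a, u \<otimes> w) \<in> S" using a u w uw
        by (auto simp: tensor_generators_def)
    have r: "Poly_Mapping.keys ?r \<subseteq> S" using Rel_keys[OF Rel_right[OF a u w]] .
    have "approx_unit F n ?r = \<one>" for n
    proof -
      have "approx_unit F n (?r + frag_of (a, w) + frag_of (a, u)) =
          approx_unit F n ?r \<otimes> w [^] a n \<otimes> u [^] a n"
        using approx_add[OF keys_S_add[OF r] , of "frag_of (a, w)" "frag_of (a, u)" n] approx_add[OF r,
            of "frag_of (a, w)" n]
          S by (simp add: approx_of)
      moreover have "approx_unit F n (?r + frag_of (a, w) + frag_of (a, u)) = u [^] a n \<otimes> w [^] a n"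
        using S u w unit_group_carrier by (simp add: approx_of nat_pow_distrib)
      moreover have c: "u [^] a n \<in> carrier F" "w [^] a n \<in> carrier F" "approx_unit F n ?r \<in> carrier F"
        using u w unit_group_carrier unit_seq(1)[OF r] by auto
      moreover have "u [^] a n \<otimes> w [^] a n \<noteq> \<zero>"
        using v_unit[OF u] v_unit[OF w] u w unit_group_carrier c v_mult[OF c(1,2)] by (auto simp: v_pow)
      moreover have "u [^] a n \<otimes> w [^] a n \<in> carrier F" using c by simp
      ultimately have "approx_unit F n ?r \<otimes> (u [^] a n \<otimes> w [^] a n) = \<one> \<otimes> (u [^] a n \<otimes> w [^] a n)"
        by (simp add: m_ac)
      then show ?thesis using m_rcancel[of "u [^] a n \<otimes> w [^] a n" "approx_unit F n ?r" \<one>] c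
          \<open>u [^] a n \<otimes> w [^] a n \<noteq> \<zero>\<close> by simp
    qed
    then have "vanishes_at F p v ?r"
      unfolding vanishes_at_def by (intro exI[of _ 1]) (simp add: a_minus_def r_neg)
    then show "?r \<in> {c. Poly_Mapping.keys c \<subseteq> S \<and> vanishes_at F p v c}" using r by simp
  next
    fix a b u assume a: "a \<in> carrier Zp" and b: "b \<in> carrier Zp" and u: "u \<in> carrier U"
    let ?r = "frag_of (a \<oplus>\<^bsub>Zp\<^esub> b, u) - frag_of (a, u) - frag_of (b, u)"
    have S: "(a, u) \<in> S" "(b, u) \<in> S" "(a \<oplus>\<^bsub>Zp\<^esub> b, u) \<in> S" using a b u Zp_add_closed
        by (auto simp: tensor_generators_def)
    have r: "Poly_Mapping.keys ?r \<subseteq> S" using Rel_keys[OF Rel_left[OF a b u]] .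
    obtain m where m: "m > 0" "coprime m p" "v (u [^] (m::nat) \<ominus> \<one>) < 1" using unit_order[OF u] by blast
    have uF: "u \<in> carrier F" using u by (rule unit_group_carrier)
    have "v (approx_unit F n ?r [^] m \<ominus> \<one>) = v ((u [^] m) [^] ((a \<oplus>\<^bsub>Zp\<^esub> b) n) \<ominus> (u [^] m) [^]
        (a n + b n))" for n
    proof -
      let ?w = "approx_unit F n ?r" and ?s = "(a \<oplus>\<^bsub>Zp\<^esub> b) n"
      have wc: "?w \<in> carrier F" by (rule unit_seq(1)[OF r])
      have "approx_unit F n (?r + frag_of (b, u) + frag_of (a, u)) = ?w \<otimes> u [^] b n \<otimes> u [^] a n"
        using approx_add[OF keys_S_add[OF r] , of "frag_of (b, u)" "frag_of (a, u)" n] approx_add[OF r,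
            of "frag_of (b, u)" n]
          S by (simp add: approx_of)
      then have "?w \<otimes> u [^] (a n + b n) = u [^] ?s"
        using S uF wc by (simp add: approx_of m_assoc nat_pow_mult add.commute)
      then have "?w [^] m \<otimes> (u [^] (a n + b n)) [^] m = (u [^] ?s) [^] m"
        using uF wc by (simp add: nat_pow_distrib[symmetric])
      then have e: "?w [^] m \<otimes> (u [^] m) [^] (a n + b n) = (u [^] m) [^] ?s"
        using uF by (simp add: nat_pow_pow mult.commute)
      have cc: "?w [^] m \<in> carrier F" "(u [^] m) [^] (a n + b n) \<in> carrier F" using wc uF by auto
      have "(?w [^] m \<ominus> \<one>) \<otimes> (u [^] m) [^] (a n + b n) = (u [^] m) [^] ?s \<ominus> (u [^] m) [^] (a n + b n)"
        unfolding e[symmetric] using cc by algebra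
      moreover have "v ((u [^] m) [^] (a n + b n)) = 1" using uF v_unit[OF u] by (simp add: v_pow)
      ultimately show ?thesis using v_mult[of "?w [^] m \<ominus> \<one>" "(u [^] m) [^] (a n + b n)"] cc by simp
    qed
    moreover have "(\<lambda>n. v ((u [^] m) [^] ((a \<oplus>\<^bsub>Zp\<^esub> b) n) \<ominus> (u [^] m) [^] (a n + b n))) \<longlonglongrightarrow> 0"
      by (rule pow_seq_null) (use uF m in \<open>auto simp: Zp_add\<close>)
    ultimately have "vanishes_at F p v ?r" unfolding vanishes_at_def using m by auto
    then show "?r \<in> {c. Poly_Mapping.keys c \<subseteq> S \<and> vanishes_at F p v c}" using r by simp
  qed
  then show ?thesis by simp
qed

text \<open>Split \<open>D\<close> into a power of \<open>p\<close> and a factor \<open>m\<close>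
  prime to \<open>p\<close>. By \<open>prime_power_torsion\<close>, \<open>m\<close> times
  \<open>c\<close> becomes the tensor of one with a unit \<open>u\<close>. Vanishing forces a power
  of \<open>u\<close> with exponent prime to \<open>p\<close> to be \<one>, so this tensor is
  trivial by \<open>coprime_torsion\<close>, which then disposes of \<open>m\<close> as
  well.\<close>

lemma torsion_vanishes:
  assumes c: "Poly_Mapping.keys c \<subseteq> S" "frag_cmul (int D) c \<in> Rel" and D: "D > 0"
      and van: "vanishes_at F p v c"
  shows "c \<in> Rel"
proof -
  obtain k m where km: "D = p ^ k * m" "\<not> p dvd m"
    using multiplicity_decompose'[of D p] D prime
    by (metis gr_implies_not0 not_prime_unit)
  have m: "coprime m p" using km(2) prime prime_imp_coprime coprime_commute by blast
  let ?d = "frag_cmul (int m) c"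
  have d: "Poly_Mapping.keys ?d \<subseteq> S" using keys_S_cmul[OF c(1)] .
  have "frag_cmul (int (p ^ k)) ?d \<in> Rel" using c(2) unfolding km(1) by (simp add: frag_cmul_cmul)
  from prime_power_torsion[OF d this] obtain u where u: "u \<in> carrier U" "?d - frag_of (zp_nat 1, u) \<in>
      Rel" by blast
  have uS: "(zp_nat 1, u) \<in> S" using u zp_nat_closed by (simp add: tensor_generators_def)
  have "vanishes_at F p v (?d - (?d - frag_of (zp_nat 1, u)))"
    by (rule vanishes_diff[OF d vanishes_cmul[OF c(1) van] Rel_keys[OF u(2)] vanishes_Rel[OF u(2)]])
  then have "vanishes_at F p v (frag_of (zp_nat 1, u))" by simp
  then obtain l where l: "l > 0" "coprime l p"
      "(\<lambda>n. v (approx_unit F n (frag_of (zp_nat 1, u)) [^] (l::nat) \<ominus> \<one>)) \<longlonglongrightarrow> 0"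
    unfolding vanishes_at_def by blast
  have uF: "u \<in> carrier F" using u unit_group_carrier by blast
  \<comment> \<open>Level zero is skipped: the residue of one modulo \<open>p ^ 0\<close> is zero.
    From level one on, the approximating unit is the constant \<open>u\<close>.\<close>
  have "approx_unit F (Suc n) (frag_of (zp_nat 1, u)) = u" for n
  proof -
    have "1 < p ^ Suc n" by (rule one_less_power[OF p_gt_1]) simp
    then show ?thesis using uS uF p_gt_1 by (simp add: approx_of zp_nat_def del: power_Suc)
  qed
  then have "(\<lambda>n. v (u [^] l \<ominus> \<one>)) \<longlonglongrightarrow> 0" using LIMSEQ_Suc[OF l(3)] by simp
  then have "v (u [^] l \<ominus> \<one>) = 0" by (simp add: LIMSEQ_const_iff)
  then have "u [^] l = \<one>" using uF v_zero_iff[of "u [^] l \<ominus> \<one>"] by simp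
  then have "frag_cmul (int l) (frag_of (zp_nat 1, u)) \<in> Rel"
    using Rel_add[OF Rel_times_right[OF zp_nat_closed u(1), of l 1] Rel_one_right[OF zp_nat_closed[of
        1]]] by simp
  then have "frag_of (zp_nat 1, u) \<in> Rel" using coprime_torsion[OF _ _ l(2)] uS by simp
  from Rel_add[OF u(2) this] have "?d \<in> Rel" by simp
  then show ?thesis by (rule coprime_torsion[OF c(1) _ m])
qed

end

section \<open>The conjecture as a statement about formal sums\<close>

context unit_tensor begin

lemma padic_placeI: "v \<in> places_above F p \<Longrightarrow> padic_place F v p"
  by unfold_locales (auto simp: prime)

text \<open>The map on classes is induced by a homomorphism \<open>\<Phi>\<close> on formal sums,
  whose values are tested place by place; injectivity is triviality of the kernel.\<close>

lemma Leo_iff: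
  "Leo F p \<longleftrightarrow> (\<forall>c. Poly_Mapping.keys c \<subseteq> S \<longrightarrow> (\<forall>v\<in>places_above F p. vanishes_at F p v c) \<longrightarrow> c \<in> Rel)"
proof -
  let ?I = "places_above F p"
  let ?C = "leopoldt_codomain F p"
  let ?A = "free_Abelian_group S"
  define \<Phi> where "\<Phi> = frag_product ?C (\<lambda>t. leopoldt_pure F p (fst t) (snd t))"
  have PUg: "comm_group (principal_units F v)" if "v \<in> ?I" for v
    using padic_place.comm_group_PU[OF padic_placeI[OF that]] .
  have gC: "group ?C" unfolding leopoldt_codomain_def using PUg comm_group.axioms(2)
      by (intro product_group) blast
  interpret C: comm_group ?C
  proof (rule group.group_comm_groupI[OF gC])
    fix x y assume "x \<in> carrier ?C" "y \<in> carrier ?C"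
    then show "x \<otimes>\<^bsub>?C\<^esub> y = y \<otimes>\<^bsub>?C\<^esub> x"
      unfolding leopoldt_codomain_def
      by simp (intro restrict_ext comm_monoid.m_comm[OF comm_group.axioms(1)[OF PUg]], auto elim:
          PiE_mem)
  qed
  have in_C: "(\<lambda>t. leopoldt_pure F p (fst t) (snd t)) \<in> S \<rightarrow> carrier ?C"
  proof
    fix t assume "t \<in> S"
    then have t: "fst t \<in> carrier Zp" "snd t \<in> carrier U" by (auto simp: tensor_generators_def)
    have "leopoldt_pure F p (fst t) (snd t) v \<in> carrier (principal_units F v)" if "v \<in> ?I" for v
      using padic_place.pure_local(1)[OF padic_placeI[OF that] t(2,1)] .
    then show "leopoldt_pure F p (fst t) (snd t) \<in> carrier ?C"
      unfolding leopoldt_codomain_def by (auto simp: leopoldt_pure_def)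
  qed
  have \<Phi>: "\<Phi> \<in> hom ?A ?C" unfolding \<Phi>_def by (rule C.frag_product_hom[OF in_C])
  interpret h: group_hom ?A ?C \<Phi> using \<Phi> by (simp add: group_hom_def group_hom_axioms_def gC)
  have comp: "\<Phi> c v = \<one>\<^bsub>completion F v\<^esub> \<longleftrightarrow> vanishes_at F p v c" if c: "Poly_Mapping.keys c \<subseteq> S"
      and v: "v \<in> ?I" for c v
  proof (rule padic_place.local_component_trivial_iff[OF padic_placeI[OF v] _ _ c])
    show "(\<lambda>c. \<Phi> c v) \<in> hom ?A (principal_units F v)"
    proof (rule homI)
      fix c assume "c \<in> carrier ?A"
      then have "\<Phi> c \<in> carrier ?C" by (rule h.hom_closed)
      then show "\<Phi> c v \<in> carrier (principal_units F v)" using v by (auto simp: leopoldt_codomain_def)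
    next
      fix c d assume "c \<in> carrier ?A" "d \<in> carrier ?A"
      then have "\<Phi> (c \<otimes>\<^bsub>?A\<^esub> d) = \<Phi> c \<otimes>\<^bsub>?C\<^esub> \<Phi> d" by (rule h.hom_mult)
      then show "\<Phi> (c \<otimes>\<^bsub>?A\<^esub> d) v = \<Phi> c v \<otimes>\<^bsub>principal_units F v\<^esub> \<Phi> d v"
        using v by (simp add: leopoldt_codomain_def)
    qed
    fix a u assume "a \<in> carrier Zp" "u \<in> carrier U"
    then have "(a, u) \<in> S" by (simp add: tensor_generators_def)
    then show "\<Phi> (frag_of (a, u)) v = leopoldt_pure F p a u v"
      unfolding \<Phi>_def using C.frag_product_of[of "\<lambda>t. leopoldt_pure F p (fst t) (snd t)" "(a, u)"]
          funcset_mem[OF in_C \<open>(a, u) \<in> S\<close>] by simp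
  qed
  have one: "\<one>\<^bsub>?C\<^esub> = (\<lambda>v\<in>?I. \<one>\<^bsub>completion F v\<^esub>)"
    by (simp add: leopoldt_codomain_def principal_units_def)
  have triv: "\<Phi> c = \<one>\<^bsub>?C\<^esub> \<longleftrightarrow> (\<forall>v\<in>?I. vanishes_at F p v c)" if c: "Poly_Mapping.keys c \<subseteq> S" for c
  proof -
    have "\<Phi> c \<in> extensional ?I" using h.hom_closed[of c] c by (simp add: leopoldt_codomain_def PiE_def)
    then have "\<Phi> c = \<one>\<^bsub>?C\<^esub> \<longleftrightarrow> (\<forall>v\<in>?I. \<Phi> c v = \<one>\<^bsub>completion F v\<^esub>)"
      unfolding one by (auto intro: extensionalityI)
    then show ?thesis using comp[OF c] by auto
  qed
  have Rel1: "\<Phi> r = \<one>\<^bsub>?C\<^esub>" if "r \<in> Rel" for r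
    using triv[OF Rel_keys[OF that]] padic_place.vanishes_Rel[OF padic_placeI that] by blast
  have dom: "leopoldt_domain F p = ?A Mod Rel"
    unfolding leopoldt_domain_def tensor_product_def tensor_relators_def tensor_generators_def by simp
  define coset where "coset = (\<lambda>c. Rel #>\<^bsub>?A\<^esub> c)"
  have coset_mem: "d \<in> coset c \<longleftrightarrow> d - c \<in> Rel" for c d
    unfolding coset_def r_coset_def by (auto intro!: bexI[of _ "d - c"])
  have coset_eq: "coset c = coset d \<longleftrightarrow> c - d \<in> Rel" for c d
  proof
    assume "coset c = coset d"
    then have "c \<in> coset d" using coset_mem[of c c] Rel_zero by simp
    then show "c - d \<in> Rel" using coset_mem by blast
  next
    assume cd: "c - d \<in> Rel"
    have "x - c \<in> Rel \<longleftrightarrow> x - d \<in> Rel" for x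
      using Rel_add[OF _ cd, of "x - c"] Rel_diff[OF _ cd, of "x - d"] by auto
    then show "coset c = coset d" using coset_mem by blast
  qed
  have carr: "carrier (leopoldt_domain F p) = coset ` {c. Poly_Mapping.keys c \<subseteq> S}"
    unfolding dom carrier_FactGroup coset_def by (rule image_cong) auto
  have map: "leopoldt_map F p (coset c) = \<Phi> c" if c: "Poly_Mapping.keys c \<subseteq> S" for c
  proof -
    have "\<Phi> d = \<Phi> c" if "d \<in> coset c" for d
    proof -
      have r: "d - c \<in> Rel" using that coset_mem by blast
      have "\<Phi> ((d - c) + c) = \<Phi> (d - c) \<otimes>\<^bsub>?C\<^esub> \<Phi> c" using h.hom_mult[of "d - c" c] Rel_keys[OF r] c
          by simp
      then show ?thesis using Rel1[OF r] h.hom_closed[of c] c by simp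
    qed
    moreover have "c \<in> coset c" using coset_mem[of c c] Rel_zero by simp
    ultimately have "\<Phi> ` coset c = {\<Phi> c}" by blast
    moreover have "leopoldt_map F p (coset c) = the_elem (\<Phi> ` coset c)"
      unfolding leopoldt_map_def \<Phi>_def frag_product_def ..
    ultimately show ?thesis by simp
  qed
  show ?thesis
  proof
    assume "Leo F p"
    then have inj: "inj_on (leopoldt_map F p) (coset ` {c. Poly_Mapping.keys c \<subseteq> S})"
        unfolding Leo_def carr .
    show "\<forall>c. Poly_Mapping.keys c \<subseteq> S \<longrightarrow> (\<forall>v\<in>?I. vanishes_at F p v c) \<longrightarrow> c \<in> Rel"
    proof (intro allI impI)
      fix c assume c: "Poly_Mapping.keys c \<subseteq> S" "\<forall>v\<in>?I. vanishes_at F p v c"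
      have "leopoldt_map F p (coset c) = leopoldt_map F p (coset 0)"
        using map[OF c(1)] map[of 0] triv[OF c(1)] c(2) Rel1[OF Rel_zero] by simp
      then have "coset c = coset 0" using inj c(1) by (auto dest!: inj_onD)
      then show "c \<in> Rel" using coset_eq[of c 0] by simp
    qed
  next
    assume *: "\<forall>c. Poly_Mapping.keys c \<subseteq> S \<longrightarrow> (\<forall>v\<in>?I. vanishes_at F p v c) \<longrightarrow> c \<in> Rel"
    show "Leo F p"
      unfolding Leo_def carr
    proof (rule inj_onI, clarify)
      fix c d assume c: "Poly_Mapping.keys c \<subseteq> S" and d: "Poly_Mapping.keys d \<subseteq> S"
        and eq: "leopoldt_map F p (coset c) = leopoldt_map F p (coset d)"
      have "\<Phi> (c - d) = \<Phi> c \<otimes>\<^bsub>?C\<^esub> inv\<^bsub>?C\<^esub> \<Phi> d"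
        using h.hom_mult[of c "- d"] h.hom_inv[of d] c d by simp
      also have "\<dots> = \<one>\<^bsub>?C\<^esub>" using eq map c d h.hom_closed[of d] by (simp add: C.r_inv)
      finally have "c - d \<in> Rel" using * triv[OF keys_S_diff[OF c d]] keys_S_diff[OF c d] by blast
      then show "coset c = coset d" using coset_eq by blast
    qed
  qed
qed

end

text \<open>Seminorms below are infima, so factors are known only through bounds strictly above
  them; this passes from such bounds to the product of the infima.\<close>

lemma le_mult_of_strict_upper:
  fixes t a b :: real
  assumes "a \<ge> 0" "b \<ge> 0" and le: "\<And>r s. r > a \<Longrightarrow> s > b \<Longrightarrow> t \<le> r * s"
  shows "t \<le> a * b"
proof (rule field_le_epsilon)
  fix e :: real assume e: "e > 0"
  \<comment> \<open>The cap at one makes the excess of (a + d) (b + d) over a b at most d (a + b +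
    1), and the second bound makes this at most \<open>e\<close>.\<close>
  define d where "d = min 1 (e / (a + b + 1))"
  have pos: "a + b + 1 > 0" using assms(1,2) by simp
  have d: "d > 0" "d \<le> 1" using e pos by (auto simp: d_def)
  have "d \<le> e / (a + b + 1)" by (simp add: d_def)
  then have d3: "d * (a + b + 1) \<le> e" using pos by (simp add: pos_le_divide_eq)
  have "t \<le> (a + d) * (b + d)" using le d by simp
  also have "\<dots> = a * b + d * (a + b + d)" by (simp add: algebra_simps)
  also have "d * (a + b + d) \<le> d * (a + b + 1)" using d by (intro mult_left_mono) auto
  finally show "t \<le> a * b + e" using d3 by simp
qed

section \<open>Extension of absolute values\<close>

text \<open>Submultiplicative non-archimedean seminorms bounded on \<open>M\<close> by a given absolute value.
  Restricting them to vanish off the carrier makes the pointwise order antisymmetric.\<close>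

definition ring_seminorm :: "('a, 'b) ring_scheme \<Rightarrow> 'a set \<Rightarrow> ('a \<Rightarrow> real) \<Rightarrow> ('a \<Rightarrow> real) \<Rightarrow> bool" where
  "ring_seminorm R M v q \<longleftrightarrow> (\<forall>x. x \<notin> carrier R \<longrightarrow> q x = 0) \<and> (\<forall>x\<in>carrier R. 0 \<le> q x) \<and> q \<one>\<^bsub>R\<^esub> = 1 \<and>
     (\<forall>x\<in>carrier R. \<forall>y\<in>carrier R. q (x \<otimes>\<^bsub>R\<^esub> y) \<le> q x * q y) \<and>
     (\<forall>x\<in>carrier R. \<forall>y\<in>carrier R. q (x \<oplus>\<^bsub>R\<^esub> y) \<le> max (q x) (q y)) \<and> (\<forall>c\<in>M. q c \<le> v c)"

lemma ring_seminormD: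
  assumes "ring_seminorm R M v q"
  shows "x \<notin> carrier R \<Longrightarrow> q x = 0" "0 \<le> q x" "q \<one>\<^bsub>R\<^esub> = 1"
    "x \<in> carrier R \<Longrightarrow> y \<in> carrier R \<Longrightarrow> q (x \<otimes>\<^bsub>R\<^esub> y) \<le> q x * q y"
    "x \<in> carrier R \<Longrightarrow> y \<in> carrier R \<Longrightarrow> q (x \<oplus>\<^bsub>R\<^esub> y) \<le> max (q x) (q y)" "c \<in> M \<Longrightarrow> q c \<le> v c"
  using assms unfolding ring_seminorm_def by (cases "x \<in> carrier R"; auto)+

context field begin

text \<open>In a chain, two values of the infimum are approximated by one and the same member, so
  the inequalities between values at two arguments survive.\<close>

lemma seminorm_chain_Inf:
  assumes C: "C \<noteq> {}" "\<And>q. q \<in> C \<Longrightarrow> ring_seminorm R M v q"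
    and tot: "\<And>q s. q \<in> C \<Longrightarrow> s \<in> C \<Longrightarrow> (\<forall>x. q x \<le> s x) \<or> (\<forall>x. s x \<le> q x)"
  defines "i \<equiv> \<lambda>x. INF q\<in>C. q x"
  shows "ring_seminorm R M v i" "\<And>q x. q \<in> C \<Longrightarrow> i x \<le> q x"
proof -
  note D = ring_seminormD[OF C(2)]
  have bdd: "bdd_below ((\<lambda>q. q x) ` C)" for x by (rule bdd_belowI2[of _ 0]) (use D(2) in blast)
  show le: "i x \<le> q x" if "q \<in> C" for q x unfolding i_def by (rule cINF_lower[OF bdd that])
  have ge: "t \<le> i x" if "\<And>q. q \<in> C \<Longrightarrow> t \<le> q x" for t x unfolding i_def
      by (rule cINF_greatest[OF C(1) that])
  have ex: "\<exists>q\<in>C. q x < r" if "i x < r" for x r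
    using that C(1) bdd[of x] unfolding i_def by (subst (asm) cINF_less_iff) auto
  obtain q0 where q0: "q0 \<in> C" using C(1) by blast
  have both: "\<exists>m\<in>C. m x < r \<and> m y < s" if rs: "i x < r" "i y < s" for x y r s
  proof -
    obtain a where a: "a \<in> C" "a x < r" using ex rs(1) by blast
    obtain b where b: "b \<in> C" "b y < s" using ex rs(2) by blast
    show ?thesis using tot[OF a(1) b(1)] a b by (meson le_less_trans)
  qed
  show "ring_seminorm R M v i"
    unfolding ring_seminorm_def
  proof (intro conjI ballI allI impI)
    show "i x = 0" if "x \<notin> carrier R" for x
    proof (rule antisym)
      show "i x \<le> 0" using le[OF q0, of x] D(1)[OF q0 that] by simp
      show "0 \<le> i x" by (rule ge) (use D(2) in blast)
    qed
    show "0 \<le> i x" for x by (rule ge) (use D(2) in blast)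
    show "i \<one> = 1"
    proof (rule antisym)
      show "i \<one> \<le> 1" using le[OF q0, of \<one>] D(3)[OF q0] by simp
      show "1 \<le> i \<one>" by (rule ge) (simp add: D(3))
    qed
    show "i c \<le> v c" if "c \<in> M" for c using le[OF q0] D(6)[OF q0 that] by (rule order_trans)
  next
    fix x y assume x: "x \<in> carrier R" and y: "y \<in> carrier R"
    show "i (x \<otimes> y) \<le> i x * i y"
    proof (rule le_mult_of_strict_upper)
      show "0 \<le> i x" "0 \<le> i y" by (rule ge, use D(2) in blast)+
      fix r s assume "i x < r" "i y < s"
      from both[OF this] obtain m where m: "m \<in> C" "m x < r" "m y < s" by blast
      have "i (x \<otimes> y) \<le> m x * m y" using le[OF m(1)] D(4)[OF m(1) x y] by (rule order_trans)
      also have "\<dots> \<le> r * s" using m D(2)[OF m(1), of x] D(2)[OF m(1), of y] by (intro mult_mono) auto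
      finally show "i (x \<otimes> y) \<le> r * s" .
    qed
    show "i (x \<oplus> y) \<le> max (i x) (i y)"
    proof (rule dense_ge)
      fix r assume "max (i x) (i y) < r"
      then have "i x < r" "i y < r" by auto
      from both[OF this] obtain m where m: "m \<in> C" "m x < r" "m y < r" by blast
      have "i (x \<oplus> y) \<le> max (m x) (m y)" using le[OF m(1)] D(5)[OF m(1) x y] by (rule order_trans)
      then show "i (x \<oplus> y) \<le> r" using m by simp
    qed
  qed
qed

text \<open>Zorn's lemma downwards: \<open>P\<close> is the reversed pointwise order, so the infimum
  of a chain is an upper bound for it.\<close>

lemma minimal_seminorm_exists:
  assumes "ring_seminorm R M v q0"
  shows "\<exists>q. ring_seminorm R M v q \<and> (\<forall>s. ring_seminorm R M v s \<longrightarrow> (\<forall>x. s x \<le> q x) \<longrightarrow> s = q)"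
proof -
  define A where "A = {q. ring_seminorm R M v q}"
  define P where "P = (\<lambda>q s :: 'a \<Rightarrow> real. \<forall>x. s x \<le> q x)"
  have "\<exists>m\<in>A. \<forall>a\<in>A. P m a \<longrightarrow> a = m"
  proof (rule predicate_Zorn)
    show "partial_order_on A (relation_of P A)"
      by (rule partial_order_on_relation_ofI) (auto simp: P_def intro: order_trans ext antisym)
    fix C assume C: "C \<in> Chains (relation_of P A)"
    show "\<exists>u\<in>A. \<forall>a\<in>C. P a u"
    proof (cases "C = {}")
      case True then show ?thesis using assms unfolding A_def by blast
    next
      case False
      have CA: "C \<subseteq> A" using C unfolding Chains_def relation_of_def by blast
      have tot: "(\<forall>x. q x \<le> s x) \<or> (\<forall>x. s x \<le> q x)" if "q \<in> C" "s \<in> C" for q s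
        using C that unfolding Chains_def relation_of_def P_def by blast
      have sn: "ring_seminorm R M v q" if "q \<in> C" for q using that CA unfolding A_def by blast
      let ?i = "\<lambda>x. INF q\<in>C. q x"
      have "ring_seminorm R M v ?i" by (rule seminorm_chain_Inf(1)[OF False]) (use sn tot in blast)+
      moreover have "?i x \<le> q x" if "q \<in> C" for q x
        by (rule seminorm_chain_Inf(2)[OF False _ _ that]) (use sn tot in blast)+
      ultimately show ?thesis unfolding A_def P_def by (intro bexI[of _ ?i]) auto
    qed
  qed
  then show ?thesis unfolding A_def P_def by blast
qed

lemma seminorm_pow:
  assumes q: "ring_seminorm R M v q" and x: "x \<in> carrier R" shows "q (x [^] (n::nat)) \<le> q x ^ n"
proof (induction n)
  case 0 then show ?case using ring_seminormD(3)[OF q] by simp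
next
  case (Suc n)
  have "q (x [^] Suc n) \<le> q (x [^] n) * q x" using ring_seminormD(4)[OF q] x by simp
  also have "\<dots> \<le> q x ^ n * q x" using Suc ring_seminormD(2)[OF q] by (rule mult_right_mono)
  finally show ?case by (simp add: mult.commute)
qed

text \<open>Under the ultrametric inequality a bound for the monomials bounds the power of the sum,
  whatever their multiplicities. The factor \<open>z\<close> collects the factors already
  expanded.\<close>

lemma seminorm_binomial:
  assumes q: "ring_seminorm R M v q" and x: "x \<in> carrier R" and y: "y \<in> carrier R"
  shows "z \<in> carrier R \<Longrightarrow> (\<And>i. i \<le> n \<Longrightarrow> q (x [^] i \<otimes> y [^] (n - i) \<otimes> z) \<le> B) \<Longrightarrow>
    q ((x \<oplus> y) [^] (n::nat) \<otimes> z) \<le> B"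
proof (induction n arbitrary: z)
  case 0 then show ?case using 0(2)[of 0] by simp
next
  case (Suc n)
  have "q ((x \<oplus> y) [^] n \<otimes> (x \<otimes> z)) \<le> B"
  proof (rule Suc.IH)
    fix i assume "i \<le> n"
    then have "q (x [^] Suc i \<otimes> y [^] (Suc n - Suc i) \<otimes> z) \<le> B" using Suc.prems(2)[of "Suc i"] by simp
    then show "q (x [^] i \<otimes> y [^] (n - i) \<otimes> (x \<otimes> z)) \<le> B" using x y Suc.prems(1) by (simp add: m_ac)
  qed (use x Suc.prems in simp)
  moreover have "q ((x \<oplus> y) [^] n \<otimes> (y \<otimes> z)) \<le> B"
  proof (rule Suc.IH)
    fix i assume i: "i \<le> n"
    then have "q (x [^] i \<otimes> y [^] (Suc n - i) \<otimes> z) \<le> B" using Suc.prems(2)[of i] by simp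
    then show "q (x [^] i \<otimes> y [^] (n - i) \<otimes> (y \<otimes> z)) \<le> B"
      using x y Suc.prems(1) i by (simp add: m_ac Suc_diff_le)
  qed (use y Suc.prems in simp)
  moreover have "(x \<oplus> y) [^] Suc n \<otimes> z = (x \<oplus> y) [^] n \<otimes> (x \<otimes> z) \<oplus> (x \<oplus> y) [^] n \<otimes> (y \<otimes> z)"
    using x y Suc.prems(1) by (simp add: m_assoc l_distr r_distr)
  moreover have "q ((x \<oplus> y) [^] n \<otimes> (x \<otimes> z) \<oplus> (x \<oplus> y) [^] n \<otimes> (y \<otimes> z)) \<le>
      max (q ((x \<oplus> y) [^] n \<otimes> (x \<otimes> z))) (q ((x \<oplus> y) [^] n \<otimes> (y \<otimes> z)))"
    using ring_seminormD(5)[OF q] x y Suc.prems(1) by simp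
  ultimately show ?case by simp
qed

text \<open>The infimum of \<open>A x\<close> is the spectral radius, the limit of the n-th roots of
  q (x ^ n). Bounds of the form C r ^ n express it without roots and are easily combined for
  products and sums.\<close>

lemma spectral_seminorm:
  assumes q: "ring_seminorm R M v q" and M: "M \<subseteq> carrier R"
  defines "A \<equiv> \<lambda>x. {r. r > 0 \<and> (\<exists>C. \<forall>n. q (x [^] (n::nat)) \<le> C * r ^ n)}"
  defines "s \<equiv> \<lambda>x. if x \<in> carrier R then Inf (A x) else 0"
  shows "ring_seminorm R M v s" "\<And>x. s x \<le> q x"
    "\<And>x r. x \<in> carrier R \<Longrightarrow> r \<in> A x \<Longrightarrow> s x \<le> r"
proof -
  note D = ring_seminormD[OF q]
  have bdd: "bdd_below (A x)" for x by (rule bdd_belowI[of _ 0]) (auto simp: A_def)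
  have memq: "q x + e \<in> A x" if "x \<in> carrier R" "e > 0" for x e
  proof -
    have "q (x [^] n) \<le> 1 * (q x + e) ^ n" for n :: nat
      using order_trans[OF seminorm_pow[OF q that(1)] power_mono[of "q x" "q x + e" n]] that(2) D(2)[of
          x] by simp
    then show ?thesis unfolding A_def using D(2)[of x] that(2)
        by (auto intro: exI[of _ 1] add_nonneg_pos)
  qed
  have ne: "A x \<noteq> {}" if "x \<in> carrier R" for x using memq[OF that, of 1] by auto
  show sle: "s x \<le> r" if "x \<in> carrier R" "r \<in> A x" for x r
    unfolding s_def using that cInf_lower[OF that(2) bdd] by simp
  show sq: "s x \<le> q x" for x
  proof (cases "x \<in> carrier R")
    case True
    show ?thesis by (rule field_le_epsilon) (rule sle[OF True memq[OF True]])
  next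
    case False then show ?thesis using D(1) by (simp add: s_def)
  qed
  have s0: "0 \<le> s x" for x
    unfolding s_def using ne by (auto intro!: cInf_greatest simp: A_def less_imp_le)
  have up: "\<exists>C. C \<ge> 0 \<and> (\<forall>n. q (x [^] (n::nat)) \<le> C * r ^ n)" if x: "x \<in> carrier R" and r: "s x < r"
      for x r
  proof -
    have "Inf (A x) < r" using x r by (simp add: s_def)
    then obtain t where t: "t \<in> A x" "t < r" using cInf_lessD[OF ne[OF x]] by blast
    then obtain C where C: "t > 0" "\<And>n. q (x [^] (n::nat)) \<le> C * t ^ n" unfolding A_def by blast
    have "q (x [^] (0::nat)) \<le> C" using C(2)[of 0] by simp
    then have C0: "C \<ge> 0" using D(2)[of "x [^] (0::nat)"] by linarith
    have "q (x [^] n) \<le> C * r ^ n" for n :: nat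
      using C(2)[of n] mult_left_mono[OF power_mono[of t r n] C0] t C(1) by linarith
    then show ?thesis using C0 by blast
  qed
  have memI: "r \<in> A x" if "r > 0" "\<And>n. q (x [^] (n::nat)) \<le> C * r ^ n" for x r C
    unfolding A_def using that by blast
  show "ring_seminorm R M v s"
    unfolding ring_seminorm_def
  proof (intro conjI ballI allI impI s0)
    show "s x = 0" if "x \<notin> carrier R" for x using that by (simp add: s_def)
    show "s c \<le> v c" if "c \<in> M" for c using sq D(6)[OF that] by (rule order_trans)
    show "s \<one> = 1"
    proof (rule antisym)
      show "s \<one> \<le> 1" using sq[of \<one>] D(3) by simp
      show "1 \<le> s \<one>"
      proof (rule ccontr)
        assume "\<not> 1 \<le> s \<one>"
        define r where "r = (s \<one> + 1) / 2"
        have r: "s \<one> < r" "r < 1" "0 \<le> r" using \<open>\<not> 1 \<le> s \<one>\<close> s0[of \<one>] by (auto simp: r_def)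
        obtain C where C: "\<And>n. q (\<one> [^] (n::nat)) \<le> C * r ^ n" using up[OF one_closed r(1)] by blast
        have "(\<lambda>n. C * r ^ n) \<longlonglongrightarrow> C * 0" using r by (intro tendsto_mult_left LIMSEQ_power_zero) auto
        then have "1 \<le> C * 0" by (rule LIMSEQ_le_const) (use C D(3) in auto)
        then show False by simp
      qed
    qed
  next
    fix x y assume x: "x \<in> carrier R" and y: "y \<in> carrier R"
    show "s (x \<otimes> y) \<le> s x * s y"
    proof (rule le_mult_of_strict_upper[OF s0 s0])
      fix r t assume rt: "s x < r" "s y < t"
      obtain C where C: "C \<ge> 0" "\<And>n. q (x [^] (n::nat)) \<le> C * r ^ n" using up[OF x rt(1)] by blast
      obtain E where E: "E \<ge> 0" "\<And>n. q (y [^] (n::nat)) \<le> E * t ^ n" using up[OF y rt(2)] by blast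
      have pos: "r > 0" "t > 0" using rt s0[of x] s0[of y] by linarith+
      show "s (x \<otimes> y) \<le> r * t"
      proof (rule sle[OF m_closed[OF x y]], rule memI)
        fix n :: nat
        have "q ((x \<otimes> y) [^] n) \<le> q (x [^] n) * q (y [^] n)" using x y D(4)
            by (simp add: nat_pow_distrib)
        also have "\<dots> \<le> (C * r ^ n) * (E * t ^ n)" using C E D(2) pos by (intro mult_mono) auto
        finally show "q ((x \<otimes> y) [^] n) \<le> C * E * (r * t) ^ n" by (simp add: power_mult_distrib mult_ac)
      qed (use pos in simp)
    qed
    show "s (x \<oplus> y) \<le> max (s x) (s y)"
    proof (rule dense_ge)
      fix r assume "max (s x) (s y) < r"
      then have rt: "s x < r" "s y < r" by auto
      obtain C where C: "C \<ge> 0" "\<And>n. q (x [^] (n::nat)) \<le> C * r ^ n" using up[OF x rt(1)] by blast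
      obtain E where E: "E \<ge> 0" "\<And>n. q (y [^] (n::nat)) \<le> E * r ^ n" using up[OF y rt(2)] by blast
      have pos: "r > 0" using rt s0[of x] by linarith
      show "s (x \<oplus> y) \<le> r"
      proof (rule sle[OF a_closed[OF x y]], rule memI[OF pos])
        fix n :: nat
        have "q ((x \<oplus> y) [^] n \<otimes> \<one>) \<le> C * E * r ^ n"
        proof (rule seminorm_binomial[OF q x y one_closed])
          fix i assume i: "i \<le> n"
          have "q (x [^] i \<otimes> y [^] (n - i) \<otimes> \<one>) \<le> q (x [^] i) * q (y [^] (n - i))" using D(4) x y by simp
          also have "\<dots> \<le> (C * r ^ i) * (E * r ^ (n - i))" using C E D(2) pos by (intro mult_mono) auto
          also have "\<dots> = C * E * (r ^ i * r ^ (n - i))" by simp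
          also have "r ^ i * r ^ (n - i) = r ^ n" using i by (simp flip: power_add)
          finally show "q (x [^] i \<otimes> y [^] (n - i) \<otimes> \<one>) \<le> C * E * r ^ n" .
        qed
        then show "q ((x \<oplus> y) [^] n) \<le> C * E * r ^ n" using x y by simp
      qed
    qed
  qed
qed

text \<open>The values \<open>a x n\<close> decrease with \<open>n\<close>, so two of them can be
  compared at a common index. By the last claim, \<open>s\<close> is strictly below \<open>q\<close>
  at \<open>x\<close> whenever \<open>q (f \<otimes> x)\<close> is less than
  \<open>q f * q x\<close>; this is what minimality excludes.\<close>

lemma localised_seminorm:
  assumes q: "ring_seminorm R M v q" and M: "M \<subseteq> carrier R" and f: "f \<in> carrier R" "q f > 0"
    and pow: "\<And>n. q (f [^] (n::nat)) = q f ^ n"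
  defines "a \<equiv> \<lambda>x n. q (f [^] (n::nat) \<otimes> x) / q f ^ n"
  defines "s \<equiv> \<lambda>x. if x \<in> carrier R then INF n. a x n else 0"
  shows "ring_seminorm R M v s" "\<And>x. s x \<le> q x" "\<And>x. x \<in> carrier R \<Longrightarrow> s x \<le> q (f \<otimes> x) / q f"
proof -
  note D = ring_seminormD[OF q]
  have a0: "a x n \<ge> 0" for x n unfolding a_def using D(2) by simp
  have bdd: "bdd_below (range (a x))" for x by (rule bdd_belowI2[of _ 0]) (rule a0)
  have sle: "s x \<le> a x n" if "x \<in> carrier R" for x n using that cINF_lower[OF bdd, of n]
      by (simp add: s_def)
  have sge: "t \<le> s x" if "x \<in> carrier R" "\<And>n. t \<le> a x n" for t x
    using that by (auto simp: s_def intro: cINF_greatest)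
  have ex: "\<exists>n. a x n < r" if "x \<in> carrier R" "s x < r" for x r
    using that bdd[of x] by (auto simp: s_def cINF_less_iff)
  have s0: "0 \<le> s x" for x using sge[OF _ a0] by (cases "x \<in> carrier R") (auto simp: s_def)
  have dec: "a x m \<le> a x n" if x: "x \<in> carrier R" and "n \<le> m" for x n m
    using that(2)
  proof (induction rule: dec_induct)
    case (step k)
    have "q (f [^] Suc k \<otimes> x) \<le> q f * q (f [^] k \<otimes> x)"
    proof -
      have "f [^] Suc k \<otimes> x = f \<otimes> (f [^] k \<otimes> x)" using f x by (simp add: m_ac)
      then show ?thesis using D(4)[of f "f [^] k \<otimes> x"] f x by simp
    qed
    then have "a x (Suc k) \<le> a x k" unfolding a_def using f(2) by (simp add: field_simps)
    then show ?case using step by simp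
  qed simp
  show sq: "s x \<le> q x" for x
    using sle[of x 0] D(1)[of x] by (cases "x \<in> carrier R") (auto simp: a_def s_def)
  show "s x \<le> q (f \<otimes> x) / q f" if "x \<in> carrier R" for x using sle[OF that, of 1] f by (simp add: a_def)
  show "ring_seminorm R M v s"
    unfolding ring_seminorm_def
  proof (intro conjI ballI allI impI s0)
    show "s x = 0" if "x \<notin> carrier R" for x using that by (simp add: s_def)
    show "s c \<le> v c" if "c \<in> M" for c using sq D(6)[OF that] by (rule order_trans)
    have "a \<one> n = 1" for n unfolding a_def using f pow by simp
    then show "s \<one> = 1" by (simp add: s_def)
  next
    fix x y assume x: "x \<in> carrier R" and y: "y \<in> carrier R"
    show "s (x \<otimes> y) \<le> s x * s y"
    proof (rule le_mult_of_strict_upper[OF s0 s0])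
      fix r t assume "s x < r" "s y < t"
      then obtain m n where mn: "a x m < r" "a y n < t" using ex x y by blast
      have "s (x \<otimes> y) \<le> a (x \<otimes> y) (m + n)" using sle x y by simp
      also have "\<dots> \<le> a x m * a y n"
      proof -
        have "f [^] (m + n) \<otimes> (x \<otimes> y) = (f [^] m \<otimes> x) \<otimes> (f [^] n \<otimes> y)"
          using f x y by (simp add: nat_pow_mult[symmetric] m_ac)
        then have "q (f [^] (m + n) \<otimes> (x \<otimes> y)) \<le> q (f [^] m \<otimes> x) * q (f [^] n \<otimes> y)"
          using D(4)[of "f [^] m \<otimes> x" "f [^] n \<otimes> y"] f x y by simp
        then have "q (f [^] (m + n) \<otimes> (x \<otimes> y)) / (q f ^ m * q f ^ n) \<le> q (f [^] m \<otimes> x) * q (f [^] n \<otimes> y)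
            / (q f ^ m * q f ^ n)"
          using f(2) by (intro divide_right_mono) auto
        then show ?thesis unfolding a_def by (simp add: power_add)
      qed
      also have "\<dots> \<le> r * t" using mn a0[of x m] a0[of y n] by (intro mult_mono) linarith+
      finally show "s (x \<otimes> y) \<le> r * t" .
    qed
    show "s (x \<oplus> y) \<le> max (s x) (s y)"
    proof (rule dense_ge)
      fix r assume "max (s x) (s y) < r"
      then obtain m n where mn: "a x m < r" "a y n < r" using ex[OF x] ex[OF y]
          by (meson max_less_iff_conj)
      let ?k = "max m n"
      have le: "q (f [^] ?k \<otimes> (x \<oplus> y)) \<le> max (q (f [^] ?k \<otimes> x)) (q (f [^] ?k \<otimes> y))"
        using D(5)[of "f [^] ?k \<otimes> x" "f [^] ?k \<otimes> y"] f x y by (simp add: r_distr)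
      have "a (x \<oplus> y) ?k \<le> max (a x ?k) (a y ?k)"
        unfolding a_def using divide_right_mono[OF le, of "q f ^ ?k"] f(2)
            by (simp add: max_divide_distrib_right)
      also have "\<dots> \<le> max (a x m) (a y n)" using max.mono[OF dec[OF x, of m ?k] dec[OF y, of n ?k]]
          by simp
      finally show "s (x \<oplus> y) \<le> r" using sle[of "x \<oplus> y" ?k] x y mn by simp
    qed
  qed
qed

text \<open>Minimality makes \<open>q\<close> equal to both of its modifications. Equality with the
  spectral seminorm gives compatibility with powers, which localisation at \<open>x\<close>
  requires; equality with the localised seminorm then gives the missing lower bound.\<close>

lemma minimal_seminorm_mult:
  assumes q: "ring_seminorm R M v q" and M: "M \<subseteq> carrier R"
    and min: "\<And>s. ring_seminorm R M v s \<Longrightarrow> (\<forall>x. s x \<le> q x) \<Longrightarrow> s = q"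
    and x: "x \<in> carrier R" and y: "y \<in> carrier R"
  shows "q (x \<otimes> y) = q x * q y"
proof -
  note D = ring_seminormD[OF q]
  let ?A = "\<lambda>x. {r. r > 0 \<and> (\<exists>C. \<forall>n. q (x [^] (n::nat)) \<le> C * r ^ n)}"
  let ?s = "\<lambda>x. if x \<in> carrier R then Inf (?A x) else 0"
  have sq: "?s = q" using min spectral_seminorm(1,2)[OF q M] by blast
  have spec: "q x \<le> r" if "x \<in> carrier R" "r > 0" "\<And>n. q (x [^] (n::nat)) \<le> C * r ^ n" for x r C
  proof -
    have "r \<in> ?A x" using that by blast
    from spectral_seminorm(3)[OF q M that(1) this] show ?thesis using fun_cong[OF sq, of x] by simp
  qed
  have pow: "q (x [^] (k::nat)) = q x ^ k" if x: "x \<in> carrier R" for x k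
  proof (rule antisym[OF seminorm_pow[OF q x]], rule ccontr)
    assume "\<not> q x ^ k \<le> q (x [^] k)"
    then have lt: "q (x [^] k) < q x ^ k" by simp
    have k: "k > 0" using lt D(3) by (cases k) auto
    obtain t where t: "q (x [^] k) < t" "t < q x ^ k" using dense[OF lt] by blast
    have t0: "t > 0" using t D(2)[of "x [^] k"] by linarith
    \<comment> \<open>The rate \<open>r\<close> is below \<open>q x\<close>, while
      \<open>r ^ k\<close> is above \<open>q (x [^] k)\<close>. So the powers of \<open>x\<close>
      grow at most at the rate \<open>r\<close>, contrary to \<open>spec\<close>.\<close>
    define r where "r = root k t"
    have r: "r > 0" "r ^ k = t" using k t0 by (auto simp: r_def)
    have rq: "r < q x" using t(2) r(2) power_less_imp_less_base[of r k "q x"] D(2)[of x] by simp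
    \<comment> \<open>The constant pays for the fewer than \<open>k\<close> factors left over by
      dividing the exponent by \<open>k\<close>: each of them costs \<open>q x\<close> in place of
      \<open>r\<close>.\<close>
    have "q (x [^] n) \<le> (q x / r) ^ k * r ^ n" for n :: nat
    proof -
      let ?m = "n div k" and ?i = "n mod k"
      have "x [^] n = (x [^] k) [^] ?m \<otimes> x [^] ?i" using x by (simp add: nat_pow_pow nat_pow_mult)
      then have "q (x [^] n) \<le> q ((x [^] k) [^] ?m) * q (x [^] ?i)" using D(4) x by simp
      also have "\<dots> \<le> q (x [^] k) ^ ?m * q x ^ ?i"
        using seminorm_pow[OF q] x D(2) by (intro mult_mono) auto
      also have "\<dots> \<le> t ^ ?m * q x ^ ?i" using t D(2) by (intro mult_right_mono power_mono) auto
      also have "t ^ ?m = r ^ (k * ?m)" by (simp add: r(2)[symmetric] power_mult)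
      also have "q x ^ ?i = (q x / r) ^ ?i * r ^ ?i" using r(1) by (simp add: power_divide)
      also have "r ^ (k * ?m) * ((q x / r) ^ ?i * r ^ ?i) = (q x / r) ^ ?i * (r ^ (k * ?m) * r ^ ?i)"
          by simp
      also have "r ^ (k * ?m) * r ^ ?i = r ^ n" by (simp flip: power_add)
      also have "(q x / r) ^ ?i * r ^ n \<le> (q x / r) ^ k * r ^ n"
        using rq r(1) k by (intro mult_right_mono power_increasing) (auto simp: less_imp_le)
      finally show ?thesis .
    qed
    from spec[OF x r(1) this] rq show False by simp
  qed
  show ?thesis
  proof (cases "q x = 0")
    case True then show ?thesis using D(4)[OF x y] D(2)[of "x \<otimes> y"] by simp
  next
    case False
    then have qx: "q x > 0" using D(2)[of x] by simp
    let ?s = "\<lambda>z. if z \<in> carrier R then INF n. q (x [^] (n::nat) \<otimes> z) / q x ^ n else 0"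
    have "?s = q" using min localised_seminorm(1,2)[OF q M x qx pow[OF x]] by blast
    then have "q y \<le> q (x \<otimes> y) / q x" using localised_seminorm(3)[OF q M x qx pow[OF x] y] fun_cong[of ?s
        q y] by simp
    then have "q x * q y \<le> q (x \<otimes> y)" using qx by (simp add: field_simps)
    then show ?thesis using D(4)[OF x y] by simp
  qed
qed

lemma combine_all_zero: "\<forall>k\<in>set Ks. k = \<zero> \<Longrightarrow> set Us \<subseteq> carrier R \<Longrightarrow> combine Ks Us = \<zero>"
  by (induction Ks Us rule: combine.induct) auto

text \<open>The operator norm with respect to a basis is the seminorm from which Zorn's lemma starts.\<close>

lemma operator_seminorm:
  assumes M: "subfield M R" and fd: "finite_dimension M (carrier R)"
    and v0: "\<And>c. c \<in> M \<Longrightarrow> v c \<ge> 0" and vz: "\<And>c. c \<in> M \<Longrightarrow> v c = 0 \<longleftrightarrow> c = \<zero>"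
    and vm: "\<And>c e. c \<in> M \<Longrightarrow> e \<in> M \<Longrightarrow> v (c \<otimes> e) = v c * v e"
    and va: "\<And>c e. c \<in> M \<Longrightarrow> e \<in> M \<Longrightarrow> v (c \<oplus> e) \<le> max (v c) (v e)"
  shows "\<exists>q. ring_seminorm R M v q"
proof -
  have MR: "M \<subseteq> carrier R" using subringE(1)[OF subfieldE(1)[OF M]] .
  have Mc: "\<one> \<in> M" "\<And>a b. a \<in> M \<Longrightarrow> b \<in> M \<Longrightarrow> a \<oplus> b \<in> M" "\<And>a b. a \<in> M \<Longrightarrow> b \<in> M \<Longrightarrow> a \<otimes> b \<in> M"
    using subringE[OF subfieldE(1)[OF M]] by auto
  obtain n where "dimension n M (carrier R)" using fd by blast
  then obtain Us where Us: "set Us \<subseteq> carrier R" "independent M Us" "Span M Us = carrier R"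
    using exists_base[OF M] by metis
  have dec: "\<exists>!Ks. set Ks \<subseteq> M \<and> length Ks = length Us \<and> z = combine Ks Us" if "z \<in> carrier R" for z
    using unique_decomposition[OF M Us(2)] that Us(3) by simp
  define co where "co = (\<lambda>z. THE Ks. set Ks \<subseteq> M \<and> length Ks = length Us \<and> z = combine Ks Us)"
  have co: "set (co z) \<subseteq> M" "length (co z) = length Us" "combine (co z) Us = z" if "z \<in> carrier R" for z
    using theI'[OF dec[OF that]] unfolding co_def by auto
  have co_eq: "co z = Ks" if "z \<in> carrier R" "set Ks \<subseteq> M" "length Ks = length Us" "z = combine Ks Us"
      for z Ks
    using dec[OF that(1)] co[OF that(1)] that by metis
  \<comment> \<open>The maximum norm of the coordinates; the inserted zero makes the maximum
    meaningful for an empty list.\<close>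
  define N where "N = (\<lambda>z. Max (insert 0 (v ` set (co z))))"
  have N0: "N z \<ge> 0" for z unfolding N_def by (rule Max_ge) auto
  have N_ge: "v k \<le> N z" if "k \<in> set (co z)" for z k unfolding N_def by (rule Max_ge) (use that in auto)
  have N_le: "N z \<le> B" if "B \<ge> 0" "\<And>k. k \<in> set (co z) \<Longrightarrow> v k \<le> B" for z B
    unfolding N_def by (rule Max.boundedI) (use that in auto)
  have N_add: "N (z \<oplus> w) \<le> max (N z) (N w)" if z: "z \<in> carrier R" and w: "w \<in> carrier R" for z w
  proof (rule N_le)
    have sub: "set (map2 (\<oplus>) (co z) (co w)) \<subseteq> M"
      using co(1)[OF z] co(1)[OF w] by (auto elim!: in_set_zipE intro: Mc(2))
    have "combine (map2 (\<oplus>) (co z) (co w)) Us = z \<oplus> w"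
      using combine_add[of "co z" Us "co w"] co[OF z] co[OF w] Us(1) MR by auto
    then have e: "co (z \<oplus> w) = map2 (\<oplus>) (co z) (co w)"
      using co(2)[OF z] co(2)[OF w] sub z w by (intro co_eq) auto
    fix k assume "k \<in> set (co (z \<oplus> w))"
    then obtain a b where ab: "a \<in> set (co z)" "b \<in> set (co w)" "k = a \<oplus> b"
      unfolding e by (auto elim: in_set_zipE)
    have "v k \<le> max (v a) (v b)" unfolding ab(3) using va ab co(1)[OF z] co(1)[OF w] by blast
    then show "v k \<le> max (N z) (N w)" 
      using max.mono[OF N_ge[OF ab(1)] N_ge[OF ab(2)]] by (rule order_trans)
  qed (simp add: N0 le_max_iff_disj)
  have N_smult: "N (c \<otimes> z) \<le> v c * N z" if c: "c \<in> M" and z: "z \<in> carrier R" for c z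
  proof (rule N_le)
    have cR: "c \<in> carrier R" using c MR by blast
    have "combine (map ((\<otimes>) c) (co z)) Us = c \<otimes> z"
      using combine_r_distr[of "co z" Us c] co[OF z] Us(1) MR cR by auto
    then have e: "co (c \<otimes> z) = map ((\<otimes>) c) (co z)"
      using co(1,2)[OF z] c z cR Mc(3) by (intro co_eq) auto
    fix k assume "k \<in> set (co (c \<otimes> z))"
    then obtain a where a: "a \<in> set (co z)" "k = c \<otimes> a" unfolding e by auto
    have "v k = v c * v a" unfolding a(2) using vm[OF c] co(1)[OF z] a(1) by blast
    then show "v k \<le> v c * N z" using mult_left_mono[OF N_ge[OF a(1)] v0[OF c]] by simp
  qed (use v0[OF c] N0 in simp)
  have N1: "N \<one> > 0"
  proof (rule ccontr)
    assume "\<not> N \<one> > 0"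
    then have "N \<one> = 0" using N0[of \<one>] by simp
    have "k = \<zero>" if "k \<in> set (co \<one>)" for k
    proof -
      have kM: "k \<in> M" using that co(1)[OF one_closed] by blast
      then have "v k = 0" using N_ge[OF that] v0[OF kM] \<open>N \<one> = 0\<close> by simp
      then show ?thesis using vz[OF kM] by simp
    qed
    then have "\<one> = \<zero>" using combine_all_zero[of "co \<one>" Us] Us(1) co(3)[OF one_closed] by simp
    then show False by simp
  qed
  have N_zero: "N \<zero> \<le> 0"
  proof -
    have z: "\<zero> \<in> M" using subringE(2)[OF subfieldE(1)[OF M]] .
    show ?thesis using N_smult[OF z one_closed] vz[OF z] by simp
  qed
  have bound: "\<exists>B\<ge>0. \<forall>z\<in>carrier R. N (x \<otimes> z) \<le> B * N z" if x: "x \<in> carrier R" for x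
  proof -
    define C where "C = Max (insert 0 ((\<lambda>u. N (x \<otimes> u)) ` set Us))"
    have C: "C \<ge> 0" "\<And>u. u \<in> set Us \<Longrightarrow> N (x \<otimes> u) \<le> C" unfolding C_def by (rule Max_ge, simp, simp)+
    \<comment> \<open>By the ultrametric inequality a combination is bounded by a bound for its
      coefficients times the largest image of a basis vector. The lists are general so that the
      induction can follow \<open>combine\<close>.\<close>
    have "N (x \<otimes> combine Ks Vs) \<le> B * C"
      if "set Ks \<subseteq> M" "set Vs \<subseteq> set Us" "\<forall>k\<in>set Ks. v k \<le> B" "B \<ge> 0" for Ks Vs B
      using that
    proof (induction Ks Vs rule: combine.induct)
      case (1 k Ks u Vs)
      have k: "k \<in> M" "k \<in> carrier R" "u \<in> set Us" "u \<in> carrier R" using 1 MR Us(1) by auto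
      have r: "combine Ks Vs \<in> carrier R" using 1(2,3) MR Us(1) by (intro combine_in_carrier) auto
      have "x \<otimes> combine (k # Ks) (u # Vs) = k \<otimes> (x \<otimes> u) \<oplus> x \<otimes> combine Ks Vs"
        using x k r by (simp add: r_distr m_ac)
      then have "N (x \<otimes> combine (k # Ks) (u # Vs)) \<le> max (N (k \<otimes> (x \<otimes> u))) (N (x \<otimes> combine Ks Vs))"
        using N_add[of "k \<otimes> (x \<otimes> u)" "x \<otimes> combine Ks Vs"] x k r by simp
      moreover have "N (x \<otimes> combine Ks Vs) \<le> B * C" using 1 by auto
      moreover have "N (k \<otimes> (x \<otimes> u)) \<le> B * C"
      proof -
        have "N (k \<otimes> (x \<otimes> u)) \<le> v k * N (x \<otimes> u)" using N_smult k x by simp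
        also have "\<dots> \<le> B * C" using C(2)[OF k(3)] 1(4,5) N0 by (intro mult_mono) auto
        finally show ?thesis .
      qed
      ultimately show ?case by simp
    next
      case ("2_1" Us) then show ?case using N_zero C(1) x order_trans[OF N_zero] by simp
    next
      case ("2_2" Ks) then show ?case using N_zero C(1) x order_trans[OF N_zero] by simp
    qed
    then have "N (x \<otimes> z) \<le> C * N z" if "z \<in> carrier R" for z
      using co[OF that] N_ge[of _ z] N0[of z] by (metis mult.commute order_refl)
    then show ?thesis using C(1) by blast
  qed
  define BB where "BB = (\<lambda>x. {B. B \<ge> 0 \<and> (\<forall>z\<in>carrier R. N (x \<otimes> z) \<le> B * N z)})"
  define q where "q = (\<lambda>x. if x \<in> carrier R then Inf (BB x) else 0)"
  have bdd: "bdd_below (BB x)" for x by (rule bdd_belowI[of _ 0]) (auto simp: BB_def)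
  have ne: "BB x \<noteq> {}" if "x \<in> carrier R" for x using bound[OF that] unfolding BB_def by blast
  have q0: "q x \<ge> 0" for x unfolding q_def using ne by (auto intro!: cInf_greatest simp: BB_def)
  have q_le: "q x \<le> B" if "x \<in> carrier R" "B \<ge> 0" "\<And>z. z \<in> carrier R \<Longrightarrow> N (x \<otimes> z) \<le> B * N z" for x B
  proof -
    have "B \<in> BB x" using that unfolding BB_def by blast
    then show ?thesis unfolding q_def using that(1) cInf_lower[OF _ bdd] by simp
  qed
  have q_bound: "N (x \<otimes> z) \<le> q x * N z" if x: "x \<in> carrier R" and z: "z \<in> carrier R" for x z
  proof (cases "N z = 0")
    case True
    then show ?thesis using bound[OF x] z by (metis mult_zero_right)
  next
    case False
    then have pos: "N z > 0" using N0[of z] by simp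
    have "N (x \<otimes> z) / N z \<le> Inf (BB x)"
      by (rule cInf_greatest[OF ne[OF x]]) (use pos z in \<open>auto simp: BB_def divide_le_eq\<close>)
    then show ?thesis using pos x by (simp add: q_def field_simps)
  qed
  have "ring_seminorm R M v q"
    unfolding ring_seminorm_def
  proof (intro conjI ballI allI impI q0)
    show "q x = 0" if "x \<notin> carrier R" for x using that by (simp add: q_def)
    show "q \<one> = 1"
    proof (rule antisym)
      show "q \<one> \<le> 1" by (rule q_le) auto
      show "1 \<le> q \<one>" using q_bound[of \<one> \<one>] N1 by simp
    qed
    show "q c \<le> v c" if "c \<in> M" for c by (rule q_le) (use that v0 MR N_smult in auto)
  next
    fix x y assume x: "x \<in> carrier R" and y: "y \<in> carrier R"
    show "q (x \<otimes> y) \<le> q x * q y"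
    proof (rule q_le)
      fix z assume z: "z \<in> carrier R"
      have "N (x \<otimes> y \<otimes> z) \<le> q x * N (y \<otimes> z)" using q_bound[of x "y \<otimes> z"] x y z by (simp add: m_assoc)
      also have "\<dots> \<le> q x * (q y * N z)" using q_bound[OF y z] q0 by (intro mult_left_mono)
      finally show "N (x \<otimes> y \<otimes> z) \<le> q x * q y * N z" by simp
    qed (use x y q0 in auto)
    show "q (x \<oplus> y) \<le> max (q x) (q y)"
    proof (rule q_le)
      fix z assume z: "z \<in> carrier R"
      have "N ((x \<oplus> y) \<otimes> z) \<le> max (N (x \<otimes> z)) (N (y \<otimes> z))" using N_add[of "x \<otimes> z" "y \<otimes> z"] x y z
          by (simp add: l_distr)
      also have "\<dots> \<le> max (q x) (q y) * N z"
        using order_trans[OF q_bound[OF x z] mult_right_mono[OF max.cobounded1 N0]]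
          order_trans[OF q_bound[OF y z] mult_right_mono[OF max.cobounded2 N0]] by simp
      finally show "N ((x \<oplus> y) \<otimes> z) \<le> max (q x) (q y) * N z" .
    qed (use x y q0 in \<open>auto simp: le_max_iff_disj\<close>)
  qed
  then show ?thesis by blast
qed

text \<open>A multiplicative seminorm is nonzero on the nonzero elements of a field. On
  \<open>M\<close> it is at most \<open>v\<close>, both at \<open>c\<close> and at its inverse; as
  the two values have product one for either function, equality holds.\<close>

lemma absolute_value_extends:
  assumes M: "subfield M R" and fd: "finite_dimension M (carrier R)"
    and v0: "\<And>c. c \<in> M \<Longrightarrow> v c \<ge> 0" and vz: "\<And>c. c \<in> M \<Longrightarrow> v c = 0 \<longleftrightarrow> c = \<zero>"
    and vm: "\<And>c e. c \<in> M \<Longrightarrow> e \<in> M \<Longrightarrow> v (c \<otimes> e) = v c * v e"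
    and va: "\<And>c e. c \<in> M \<Longrightarrow> e \<in> M \<Longrightarrow> v (c \<oplus> e) \<le> max (v c) (v e)"
    and p: "v ([p] \<cdot> \<one>) = 1 / real p"
  shows "\<exists>w\<in>places_above R p. \<forall>x\<in>M. w x = v x"
proof -
  obtain q0 where "ring_seminorm R M v q0" using operator_seminorm[OF assms(1-6)] by blast
  from minimal_seminorm_exists[OF this] obtain q where q: "ring_seminorm R M v q"
    and min: "\<And>s. ring_seminorm R M v s \<Longrightarrow> (\<forall>x. s x \<le> q x) \<Longrightarrow> s = q" by blast
  have MR: "M \<subseteq> carrier R" using subringE(1)[OF subfieldE(1)[OF M]] .
  note D = ring_seminormD[OF q]
  have mult: "q (x \<otimes> y) = q x * q y" if "x \<in> carrier R" "y \<in> carrier R" for x y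
    by (rule minimal_seminorm_mult[OF q MR min that])
  have zM: "\<zero> \<in> M" "\<one> \<in> M" using subringE(2,3)[OF subfieldE(1)[OF M]] by auto
  have q_zero: "q \<zero> = 0" using D(6)[OF zM(1)] D(2)[of \<zero>] vz[OF zM(1)] by simp
  have inv: "x \<otimes> inv x = \<one>" "inv x \<in> carrier R" if "x \<in> carrier R" "x \<noteq> \<zero>" for x
    using that by (auto simp: field_Units)
  have q_nz: "q x \<noteq> 0" if "x \<in> carrier R" "x \<noteq> \<zero>" for x
    using mult[OF that(1) inv(2)[OF that]] inv(1)[OF that] D(3) by auto
  have q_zero_iff: "q x = 0 \<longleftrightarrow> x = \<zero>" if "x \<in> carrier R" for x using q_nz[OF that] q_zero by blast
  have v1: "v \<one> = 1" using vm[OF zM(2) zM(2)] vz[OF zM(2)] by simp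
  have qM: "q c = v c" if c: "c \<in> M" for c
  proof (cases "c = \<zero>")
    case True then show ?thesis using q_zero vz[OF c] by simp
  next
    case False
    have cR: "c \<in> carrier R" using c MR by blast
    have ic: "inv c \<in> M" using subfield_m_inv(1)[OF M] c False by simp
    have "q c * q (inv c) = 1" using mult[OF cR inv(2)[OF cR False]] inv(1)[OF cR False] D(3) by simp
    moreover have "v c * v (inv c) = 1" using vm[OF c ic] inv(1)[OF cR False] v1 by simp
    moreover have "q c \<le> v c" "q (inv c) \<le> v (inv c)" using D(6) c ic by auto
    moreover have "q c > 0" using q_nz[OF cR False] D(2)[of c] by simp
    moreover have "v (inv c) > 0" using calculation(2) v0[OF ic] by (cases "v (inv c) = 0") auto
    ultimately have "v c * v (inv c) \<le> q c * v (inv c)" by (metis mult_left_mono D(2))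
    then have "v c \<le> q c" using \<open>v (inv c) > 0\<close> by simp
    then show ?thesis using \<open>q c \<le> v c\<close> by simp
  qed
  have pM: "[p] \<cdot> \<one> \<in> M"
  proof -
    have "[n] \<cdot> \<one> \<in> M" for n :: nat
      by (induction n) (use zM subringE(7)[OF subfieldE(1)[OF M]] in auto)
    then show ?thesis .
  qed
  let ?w = "restrict q (carrier R)"
  have "?w \<in> places_above R p"
    unfolding places_above_def
    using D(2,5) mult q_zero_iff qM[OF pM] p by auto
  moreover have "\<forall>x\<in>M. ?w x = v x" using qM MR by auto
  ultimately show ?thesis by blast
qed

end

section \<open>Existence and extension of places\<close>

definition int_padic_abs :: "nat \<Rightarrow> int \<Rightarrow> real" where
  "int_padic_abs p k = (if k = 0 then 0 else (1 / real p) ^ multiplicity (int p) k)"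

lemma int_padic_abs:
  assumes p: "Factorial_Ring.prime p"
  shows "int_padic_abs p k \<ge> 0" "int_padic_abs p k = 0 \<longleftrightarrow> k = 0" "int_padic_abs p 1 = 1"
    "int_padic_abs p (int p) = 1 / real p"
    "int_padic_abs p (a * b) = int_padic_abs p a * int_padic_abs p b"
    "int_padic_abs p (a + b) \<le> max (int_padic_abs p a) (int_padic_abs p b)"
proof -
  have p1: "p > 1" using p prime_gt_1_nat by blast
  have pe: "prime_elem (int p)" using p by simp
  have pu: "\<not> is_unit (int p)" using pe by (rule prime_elem_not_unit)
  show "int_padic_abs p k \<ge> 0" "int_padic_abs p k = 0 \<longleftrightarrow> k = 0" "int_padic_abs p 1 = 1"
    using p1 by (auto simp: int_padic_abs_def)
  show "int_padic_abs p (int p) = 1 / real p"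
    using p1 pu by (simp add: int_padic_abs_def multiplicity_self)
  show "int_padic_abs p (a * b) = int_padic_abs p a * int_padic_abs p b"
    using prime_elem_multiplicity_mult_distrib[OF pe, of a b] by (simp add: int_padic_abs_def power_add)
  show "int_padic_abs p (a + b) \<le> max (int_padic_abs p a) (int_padic_abs p b)"
  proof (cases "a = 0 \<or> b = 0 \<or> a + b = 0")
    case True then show ?thesis using p1 by (auto simp: int_padic_abs_def le_max_iff_disj)
  next
    case False
    let ?m = "min (multiplicity (int p) a) (multiplicity (int p) b)"
    have "int p ^ ?m dvd a + b" by (intro dvd_add multiplicity_dvd') auto
    then have "?m \<le> multiplicity (int p) (a + b)" using False pu by (intro multiplicity_geI) auto
    then have "(1 / real p) ^ multiplicity (int p) (a + b) \<le> (1 / real p) ^ ?m"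
      using p1 by (intro power_decreasing) auto
    also have "\<dots> \<le> max ((1 / real p) ^ multiplicity (int p) a) ((1 / real p) ^ multiplicity (int p) b)"
      by (auto simp: min_def)
    finally show ?thesis using False by (simp add: int_padic_abs_def)
  qed
qed

context field begin

lemma int_emb_eq_zero:
  assumes ch: "\<forall>n::nat. n > 0 \<longrightarrow> [n] \<cdot> \<one> \<noteq> \<zero>" and z: "int_emb R k = \<zero>"
  shows "k = 0"
proof (rule ccontr)
  assume "k \<noteq> 0"
  have "int_emb R \<bar>k\<bar> = \<zero>" using z by (cases "k \<ge> 0") (auto simp: int_emb_uminus)
  then have "[nat \<bar>k\<bar>] \<cdot> \<one> = \<zero>" using int_emb_of_nat[of "nat \<bar>k\<bar>"] by simp
  then show False using ch \<open>k \<noteq> 0\<close> by auto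
qed

lemma inv_facts: "x \<in> carrier R \<Longrightarrow> x \<noteq> \<zero> \<Longrightarrow> inv x \<in> carrier R \<and> x \<otimes> inv x = \<one> \<and> inv x \<otimes> x = \<one>"
  by (auto simp: field_Units)

lemma prime_field_fraction:
  assumes ch: "\<forall>n::nat. n > 0 \<longrightarrow> [n] \<cdot> \<one> \<noteq> \<zero>" and x: "x \<in> generate_field R {}"
  shows "\<exists>a b. b \<noteq> 0 \<and> x \<otimes> int_emb R b = int_emb R a"
  using x
proof induction
  case one show ?case by (intro exI[of _ 1]) simp
next
  case (a_inv h)
  then obtain a b where "b \<noteq> 0" "h \<otimes> int_emb R b = int_emb R a" by blast
  moreover have "h \<in> carrier R" using a_inv generate_field_in_carrier by blast
  ultimately show ?case by (intro exI[of _ "- a"] exI[of _ b]) (simp add: int_emb_uminus l_minus)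
next
  case (m_inv h)
  then obtain a b where ab: "b \<noteq> 0" "h \<otimes> int_emb R b = int_emb R a" by blast
  have h: "h \<in> carrier R" using m_inv generate_field_in_carrier by blast
  have "int_emb R b \<noteq> \<zero>" using int_emb_eq_zero[OF ch] ab(1) by blast
  then have "int_emb R a \<noteq> \<zero>" using ab(2) h m_inv(2) integral[of h "int_emb R b"] by auto
  then have "a \<noteq> 0" by auto
  moreover have "inv h \<otimes> int_emb R a = int_emb R b" unfolding ab(2)[symmetric]
    using inv_facts[OF h m_inv(2)] h by (simp add: m_assoc[symmetric])
  ultimately show ?case by blast
next
  case (eng_add h k)
  obtain a b where ab: "b \<noteq> 0" "h \<otimes> int_emb R b = int_emb R a" using eng_add by blast
  obtain c d where cd: "d \<noteq> 0" "k \<otimes> int_emb R d = int_emb R c" using eng_add by blast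
  have hk: "h \<in> carrier R" "k \<in> carrier R" using eng_add generate_field_in_carrier by blast+
  have "(h \<oplus> k) \<otimes> (int_emb R b \<otimes> int_emb R d) = (h \<otimes> int_emb R b) \<otimes> int_emb R d \<oplus> (k \<otimes> int_emb R d) \<otimes>
      int_emb R b"
    using hk by (simp add: l_distr r_distr m_ac)
  then have "(h \<oplus> k) \<otimes> int_emb R (b * d) = int_emb R (a * d + c * b)" unfolding ab cd
      by (simp add: int_emb_mult int_emb_add)
  then show ?case using ab cd by (intro exI[of _ "a * d + c * b"] exI[of _ "b * d"]) simp
next
  case (eng_mult h k)
  obtain a b where ab: "b \<noteq> 0" "h \<otimes> int_emb R b = int_emb R a" using eng_mult by blast
  obtain c d where cd: "d \<noteq> 0" "k \<otimes> int_emb R d = int_emb R c" using eng_mult by blast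
  have hk: "h \<in> carrier R" "k \<in> carrier R" using eng_mult generate_field_in_carrier by blast+
  have "(h \<otimes> k) \<otimes> (int_emb R b \<otimes> int_emb R d) = (h \<otimes> int_emb R b) \<otimes> (k \<otimes> int_emb R d)"
    using hk by (simp add: m_ac)
  then have "(h \<otimes> k) \<otimes> int_emb R (b * d) = int_emb R (a * c)" unfolding ab cd by (simp add: int_emb_mult)
  then show ?case using ab cd by (intro exI[of _ "a * c"] exI[of _ "b * d"]) simp
qed simp

text \<open>The \<open>p\<close>-adic absolute value on the prime field, read off from fractions of
  integers, extends to the whole field by \<open>absolute_value_extends\<close>.\<close>

lemma place_exists:
  assumes ch: "\<forall>n::nat. n > 0 \<longrightarrow> [n] \<cdot> \<one> \<noteq> \<zero>"
    and fd: "finite_dimension (generate_field R {}) (carrier R)"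
    and p: "Factorial_Ring.prime p"
  shows "places_above R p \<noteq> {}"
proof -
  let ?Q = "generate_field R {}"
  note A = int_padic_abs[OF p]
  \<comment> \<open>The value is computed from some fraction representing \<open>x\<close>; by
    \<open>cross\<close>, all such fractions give the same.\<close>
  define v where "v = (\<lambda>x. SOME r. \<exists>a b. b \<noteq> 0 \<and> x \<otimes> int_emb R b = int_emb R a \<and>
  r = int_padic_abs p a / int_padic_abs p b)"
  have Q: "x \<in> carrier R" if "x \<in> ?Q" for x using that generate_field_in_carrier by blast
  have cross: "a * d = c * b" if x: "x \<in> carrier R" and "x \<otimes> int_emb R b = int_emb R a" "x \<otimes> int_emb R d
      = int_emb R c" for x a b c d
  proof -
    have "int_emb R (a * d) = (x \<otimes> int_emb R b) \<otimes> int_emb R d" using that by (simp add: int_emb_mult)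
    also have "\<dots> = (x \<otimes> int_emb R d) \<otimes> int_emb R b" using x by (simp add: m_ac)
    also have "\<dots> = int_emb R (c * b)" using that by (simp add: int_emb_mult)
    finally have "int_emb R (a * d - c * b) = \<zero>" by (simp add: int_emb_diff a_minus_def r_neg)
    then show ?thesis using int_emb_eq_zero[OF ch] by fastforce
  qed
  have v_eq: "v x = int_padic_abs p a / int_padic_abs p b"
    if x: "x \<in> carrier R" and b: "b \<noteq> 0" and e: "x \<otimes> int_emb R b = int_emb R a" for x a b
    unfolding v_def
  proof (rule some_equality)
    show "\<exists>a' b'. b' \<noteq> 0 \<and> x \<otimes> int_emb R b' = int_emb R a' \<and>
      int_padic_abs p a / int_padic_abs p b = int_padic_abs p a' / int_padic_abs p b'" using b e by blast
    fix r assume "\<exists>a b. b \<noteq> 0 \<and> x \<otimes> int_emb R b = int_emb R a \<and> r = int_padic_abs p a / int_padic_abs p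
        b"
    then obtain c d where cd: "d \<noteq> 0" "x \<otimes> int_emb R d = int_emb R c" "r = int_padic_abs p c /
        int_padic_abs p d" by blast
    have "int_padic_abs p a * int_padic_abs p d = int_padic_abs p c * int_padic_abs p b"
      using cross[OF x e cd(2)] by (metis A(5))
    then show "r = int_padic_abs p a / int_padic_abs p b" using cd b A(2) by (simp add: frac_eq_eq)
  qed
  have "\<exists>w\<in>places_above R p. \<forall>x\<in>?Q. w x = v x"
  proof (rule absolute_value_extends[OF generate_field_is_subfield fd])
    fix x assume x: "x \<in> ?Q"
    obtain a b where ab: "b \<noteq> 0" "x \<otimes> int_emb R b = int_emb R a" using prime_field_fraction[OF ch x]
        by blast
    have vx: "v x = int_padic_abs p a / int_padic_abs p b" using v_eq[OF Q[OF x] ab] .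
    show "v x \<ge> 0" unfolding vx using A(1) by simp
    have "int_emb R b \<noteq> \<zero>" using int_emb_eq_zero[OF ch] ab by blast
    then have "x = \<zero> \<longleftrightarrow> int_emb R a = \<zero>" using ab Q[OF x] integral[of x "int_emb R b"] by auto
    also have "\<dots> \<longleftrightarrow> a = 0" using int_emb_eq_zero[OF ch] by auto
    finally show "v x = 0 \<longleftrightarrow> x = \<zero>" unfolding vx using A(2) ab by simp
    fix y assume y: "y \<in> ?Q"
    obtain c d where cd: "d \<noteq> 0" "y \<otimes> int_emb R d = int_emb R c" using prime_field_fraction[OF ch y]
        by blast
    have vy: "v y = int_padic_abs p c / int_padic_abs p d" using v_eq[OF Q[OF y] cd] .
    note xy = Q[OF x] Q[OF y]
    have "(x \<otimes> y) \<otimes> (int_emb R b \<otimes> int_emb R d) = (x \<otimes> int_emb R b) \<otimes> (y \<otimes> int_emb R d)" using xy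
        by (simp add: m_ac)
    then have "(x \<otimes> y) \<otimes> int_emb R (b * d) = int_emb R (a * c)" unfolding ab cd
        by (simp add: int_emb_mult)
    then have "v (x \<otimes> y) = int_padic_abs p (a * c) / int_padic_abs p (b * d)" using xy ab cd
        by (intro v_eq) auto
    then show "v (x \<otimes> y) = v x * v y" unfolding vx vy A(5) by simp
    have "(x \<oplus> y) \<otimes> (int_emb R b \<otimes> int_emb R d) = (x \<otimes> int_emb R b) \<otimes> int_emb R d \<oplus> (y \<otimes> int_emb R d) \<otimes>
        int_emb R b"
      using xy by (simp add: l_distr r_distr m_ac)
    then have "(x \<oplus> y) \<otimes> int_emb R (b * d) = int_emb R (a * d + c * b)" unfolding ab cd
        by (simp add: int_emb_mult int_emb_add)
    then have "v (x \<oplus> y) = int_padic_abs p (a * d + c * b) / int_padic_abs p (b * d)" using xy ab cd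
        by (intro v_eq) auto
    also have "\<dots> \<le> max (int_padic_abs p (a * d)) (int_padic_abs p (c * b)) / int_padic_abs p (b * d)"
      using A(6) A(1) by (rule divide_right_mono)
    also have "\<dots> = max (v x) (v y)"
      unfolding vx vy A(5) using A(1)[of "b * d"] A(2)[of b] A(2)[of d] ab cd
      by (simp add: max_divide_distrib_right A(1) A(5))
    finally show "v (x \<oplus> y) \<le> max (v x) (v y)" .
  next
    have "v (int_emb R (int p)) = int_padic_abs p (int p) / int_padic_abs p 1" by (rule v_eq) auto
    then show "v ([p] \<cdot> \<one>) = 1 / real p" by (simp add: int_emb_of_nat A)
  qed auto
  then show ?thesis by blast
qed

lemma finite_dimension_over_subfield:
  assumes Q: "subfield Q R" and M: "subfield M R" and QM: "Q \<subseteq> M"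
      and fd: "finite_dimension Q (carrier R)"
  shows "finite_dimension M (carrier R)"
proof -
  obtain n where "dimension n Q (carrier R)" using fd by blast
  then obtain Us where Us: "set Us \<subseteq> carrier R" "Span Q Us = carrier R" using exists_base[OF Q] by metis
  have "Span Q Us \<subseteq> Span M Us"
    unfolding Span_eq_combine_set[OF Q Us(1)] Span_eq_combine_set[OF M Us(1)] using QM by blast
  then have "Span M Us = carrier R" using Us Span_in_carrier[OF subringE(1)[OF subfieldE(1)[OF M]] Us(1)]
      by blast
  then show ?thesis using Span_finite_dimension[OF M Us(1)] by simp
qed

end

section \<open>Functoriality: the map id \<otimes> h on formal sums, and places along
  embeddings\<close>

definition push :: "('a \<Rightarrow> 'c) \<Rightarrow> ((nat \<Rightarrow> nat) \<times> 'a \<Rightarrow>\<^sub>0 int) \<Rightarrow> ((nat \<Rightarrow> nat) \<times> 'c \<Rightarrow>\<^sub>0 int)" where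
  "push h = frag_extend (\<lambda>t. frag_of (fst t, h (snd t)))"

lemma push_simps [simp]: "push h 0 = 0" "push h (frag_of (a, u)) = frag_of (a, h u)"
  by (simp_all add: push_def)

lemma push_diff: "push h (c - d) = push h c - push h d"
  and push_add: "push h (c + d) = push h c + push h d"
  and push_cmul: "push h (frag_cmul k c) = frag_cmul k (push h c)"
  by (simp_all add: push_def frag_extend_diff frag_extend_add frag_extend_cmul)

lemma push_sum: "finite I \<Longrightarrow> push h (\<Sum>i\<in>I. c i) = (\<Sum>i\<in>I. push h (c i))"
  by (simp add: push_def frag_extend_sum)

locale unit_tensor_hom = A: unit_tensor F p + B: unit_tensor F' p
  for F :: "('a, 'b) ring_scheme" and F' :: "('c, 'd) ring_scheme" and p +
  fixes h :: "'a \<Rightarrow> 'c"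
  assumes hom: "h \<in> hom (unit_group F) (unit_group F')"
begin

lemma keys_push: assumes "Poly_Mapping.keys c \<subseteq> tensor_generators F p"
    shows "Poly_Mapping.keys (push h c) \<subseteq> tensor_generators F' p"
proof -
  have "Poly_Mapping.keys (push h c) \<subseteq> (\<Union>t\<in>Poly_Mapping.keys c. Poly_Mapping.keys
      (frag_of (fst t, h (snd t))))"
    unfolding push_def by (rule keys_frag_extend)
  also have "\<dots> \<subseteq> tensor_generators F' p" using assms hom_in_carrier[OF hom]
      by (auto simp: tensor_generators_def)
  finally show ?thesis .
qed

lemma push_rel: assumes "c \<in> tensor_relators F p" shows "push h c \<in> tensor_relators F' p"
proof -
  have "c \<in> {c. push h c \<in> tensor_relators F' p}"
  proof (rule A.Rel_least[OF assms])
    show "frag_of (a, u \<otimes>\<^bsub>F\<^esub> w) - frag_of (a, u) - frag_of (a, w) \<in> {c. push h c \<in> tensor_relators F' p}"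
      if "a \<in> carrier (padic_integers p)" "u \<in> carrier (unit_group F)" "w \<in> carrier (unit_group F)"
      for a u w
      using B.Rel_right[OF that(1) hom_in_carrier[OF hom that(2)] hom_in_carrier[OF hom that(3)]]
          hom_mult[OF hom that(2,3)]
      by (simp add: push_diff)
  qed (use B.Rel_left hom_in_carrier[OF hom] in \<open>auto simp: push_diff B.Rel_zero B.Rel_diff\<close>)
  then show ?thesis by simp
qed

lemma approx_push:
  assumes "Poly_Mapping.keys c \<subseteq> tensor_generators F p"
  shows "approx_unit F' n (push h c) = h (approx_unit F n c)"
  using assms
proof (induction c rule: free_Abelian_group_induct[consumes 1, case_names zero diff of])
  interpret h: group_hom "unit_group F" "unit_group F'" h using hom
  by (simp add: group_hom_def group_hom_axioms_def)
  {
    case zero then show ?case using h.hom_one by (simp add: A.approx_0 B.approx_0)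
  next
    case (diff c d)
    let ?a = "approx_unit F n c" and ?b = "approx_unit F n d"
    have ab: "?a \<in> carrier (unit_group F)" "?b \<in> carrier (unit_group F)" using A.approx_closed diff
        by auto
    have "h (approx_unit F n (c - d)) = h (?a \<otimes>\<^bsub>unit_group F\<^esub> inv\<^bsub>unit_group F\<^esub> ?b)"
      using A.approx_diff diff by simp
    also have "\<dots> = h ?a \<otimes>\<^bsub>unit_group F'\<^esub> inv\<^bsub>unit_group F'\<^esub> h ?b"
      using h.hom_mult[OF ab(1) A.U.inv_closed[OF ab(2)]] h.hom_inv[OF ab(2)] by simp
    finally show ?case using B.approx_diff[OF keys_push keys_push] diff by (simp add: push_diff)
  next
    case (of t)
    then obtain a u where t: "t = (a, u)" "a \<in> carrier (padic_integers p)" "u \<in> carrier (unit_group F)"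
        by (auto simp: tensor_generators_def)
    have "(a, h u) \<in> tensor_generators F' p" using t hom_in_carrier[OF hom]
        by (simp add: tensor_generators_def)
    then show ?case using of t h.hom_nat_pow[OF t(3), of "a n"] by (simp add: A.approx_of B.approx_of)
  }
qed

end

lemma field_hom_unit_group:
  assumes F: "Ring.field F" and F': "Ring.field F'" and h: "h \<in> Ring.ring_hom F F'"
  shows "h \<in> hom (unit_group F) (unit_group F')"
proof -
  interpret F: field F by fact
  interpret F': field F' by fact
  note I = ring_hom_integral[OF F.is_cring F'.is_cring h F.one_not_zero F'.one_not_zero]
  show ?thesis
  proof (rule homI)
    fix u assume "u \<in> carrier (unit_group F)"
    then obtain w where uw: "integral_element F u" "integral_element F w" "u \<otimes>\<^bsub>F\<^esub> w = \<one>\<^bsub>F\<^esub>"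
      unfolding F.carrier_unit_group by blast
    then have "h u \<otimes>\<^bsub>F'\<^esub> h w = \<one>\<^bsub>F'\<^esub>"
      using ring_hom_mult[OF h, of u w] ring_hom_one[OF h] by (simp add: integral_element_def)
    then show "h u \<in> carrier (unit_group F')" unfolding F'.carrier_unit_group using I uw by blast
  next
    fix u w assume "u \<in> carrier (unit_group F)" "w \<in> carrier (unit_group F)"
    then show "h (u \<otimes>\<^bsub>unit_group F\<^esub> w) = h u \<otimes>\<^bsub>unit_group F'\<^esub> h w"
      using ring_hom_mult[OF h] F.unit_group_carrier by simp
  qed
qed

text \<open>A homomorphism of fields is injective, so the pulled back function still vanishes only
  at zero.\<close>

lemma place_pullback:
  assumes F: "Ring.field F" and F': "Ring.field F'" and h: "h \<in> Ring.ring_hom F F'"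
      and w: "w \<in> places_above F' p"
  shows "(\<lambda>x\<in>carrier F. w (h x)) \<in> places_above F p"
proof -
  interpret F: field F by fact
  interpret F': field F' by fact
  interpret h: ring_hom_cring F F' h
    using h F.is_cring F'.is_cring by (simp add: ring_hom_cring.intro ring_hom_cring_axioms.intro)
  have nz: "h x \<noteq> \<zero>\<^bsub>F'\<^esub>" if x: "x \<in> carrier F" "x \<noteq> \<zero>\<^bsub>F\<^esub>" for x
  proof
    assume "h x = \<zero>\<^bsub>F'\<^esub>"
    moreover have "h x \<otimes>\<^bsub>F'\<^esub> h (inv\<^bsub>F\<^esub> x) = \<one>\<^bsub>F'\<^esub>"
      using F.inv_facts[OF x] x by (simp flip: h.hom_mult)
    moreover have "h (inv\<^bsub>F\<^esub> x) \<in> carrier F'" using F.inv_facts[OF x] by simp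
    ultimately show False by simp
  qed
  have zp: "h ([p] \<cdot>\<^bsub>F\<^esub> \<one>\<^bsub>F\<^esub>) = [p] \<cdot>\<^bsub>F'\<^esub> \<one>\<^bsub>F'\<^esub>"
    using ring_hom_int_emb[OF F.is_cring F'.is_cring h, of "int p"]
        by (simp add: F.int_emb_of_nat F'.int_emb_of_nat)
  show ?thesis
    using w nz zp unfolding places_above_def by auto
qed

text \<open>The homomorphism commutes with approximating units and their powers, so at every level
  both sides measure the same distance to one.\<close>

lemma vanishes_push:
  assumes ut: "unit_tensor F p" "unit_tensor F' p" and h: "h \<in> Ring.ring_hom F F'"
    and c: "Poly_Mapping.keys c \<subseteq> tensor_generators F p" and v: "\<And>x. x \<in> carrier F \<Longrightarrow> v x = w (h x)"
  shows "vanishes_at F' p w (push h c) \<longleftrightarrow> vanishes_at F p v c"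
proof -
  interpret A: unit_tensor F p by fact
  interpret B: unit_tensor F' p by fact
  interpret unit_tensor_hom F F' p h
    by unfold_locales (rule field_hom_unit_group[OF A.field_axioms B.field_axioms h])
  interpret h: ring_hom_cring F F' h
    using h A.is_cring B.is_cring by (simp add: ring_hom_cring.intro ring_hom_cring_axioms.intro)
  have "w (approx_unit F' n (push h c) [^]\<^bsub>F'\<^esub> m \<ominus>\<^bsub>F'\<^esub> \<one>\<^bsub>F'\<^esub>) = v (approx_unit F n c [^]\<^bsub>F\<^esub> m \<ominus>\<^bsub>F\<^esub> \<one>\<^bsub>F\<^esub>)"
      for n and m :: nat
  proof -
    have hp: "h (x [^]\<^bsub>F\<^esub> m) = h x [^]\<^bsub>F'\<^esub> m" if "x \<in> carrier F" for x
      by (induction m) (use that in auto)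
    have x: "approx_unit F n c \<in> carrier F" using A.approx_closed[OF c] A.unit_group_carrier by blast
    have "h (approx_unit F n c [^]\<^bsub>F\<^esub> m \<ominus>\<^bsub>F\<^esub> \<one>\<^bsub>F\<^esub>) = h (approx_unit F n c) [^]\<^bsub>F'\<^esub> m \<ominus>\<^bsub>F'\<^esub> \<one>\<^bsub>F'\<^esub>"
      using x by (simp add: a_minus_def hp)
    then show ?thesis using v x approx_push[OF c, of n] by simp
  qed
  then show ?thesis unfolding vanishes_at_def by simp
qed

section \<open>Galois action and norms\<close>

context field begin

lemma subfield_field: "subfield M R \<Longrightarrow> Ring.field (R\<lparr>carrier := M\<rparr>)"
  using subfield_iff(2) subringE(1)[OF subfieldE(1)] by blast

lemma inclusion_hom: "M \<subseteq> carrier R \<Longrightarrow> (\<lambda>x. x) \<in> Ring.ring_hom (R\<lparr>carrier := M\<rparr>) R"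
  by (auto simp: Ring.ring_hom_def)

lemma integral_subfield_iff:
  assumes M: "subfield M R" shows "integral_element (R\<lparr>carrier := M\<rparr>) x \<longleftrightarrow> x \<in> M \<and> integral_element R x"
proof -
  interpret M: field "R\<lparr>carrier := M\<rparr>" by (rule subfield_field[OF M])
  have MR: "M \<subseteq> carrier R" using subringE(1)[OF subfieldE(1)[OF M]] .
  have "int_poly_eval (R\<lparr>carrier := M\<rparr>) q x = int_poly_eval R q x" if "x \<in> M" for q
    using ring_hom_int_poly_eval[OF M.is_cring is_cring inclusion_hom[OF MR], of x q] that by simp
  then show ?thesis
    unfolding M.integral_element_iff[OF M.one_not_zero] integral_element_iff[OF one_not_zero] using MR
        by auto
qed

text \<open>Integrality does not depend on the ambient field, and the inverse of an element of
  \<open>M\<close> stays in \<open>M\<close>.\<close>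

lemma unit_group_subfield:
  assumes M: "subfield M R"
  shows "carrier (unit_group (R\<lparr>carrier := M\<rparr>)) = M \<inter> carrier (unit_group R)"
proof -
  interpret M: field "R\<lparr>carrier := M\<rparr>" by (rule subfield_field[OF M])
  have MR: "M \<subseteq> carrier R" using subringE(1)[OF subfieldE(1)[OF M]] .
  have "w \<in> M" if uw: "u \<in> M" "w \<in> carrier R" "u \<otimes> w = \<one>" for u w
  proof -
    have "u \<noteq> \<zero>" using uw by auto
    then have "inv u \<in> M" using subfield_m_inv(1)[OF M] uw by simp
    moreover have "inv u = w" using uw MR by (intro comm_inv_char) auto
    ultimately show ?thesis by simp
  qed
  then show ?thesis
    by (auto simp: M.carrier_unit_group carrier_unit_group integral_subfield_iff[OF M])
      (auto simp: integral_element_def)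
qed

lemma ring_hom_fixes_prime_field:
  assumes s: "s \<in> Ring.ring_hom R R" and x: "x \<in> generate_field R {}" shows "s x = x"
proof -
  interpret s: ring_hom_cring R R s using s is_cring
  by (simp add: ring_hom_cring.intro ring_hom_cring_axioms.intro)
  have c: "x \<in> carrier R" if "x \<in> generate_field R {}" for x using generate_field_in_carrier[OF _ that]
      by blast
  show ?thesis
    using x
  proof induction
    case (m_inv h)
    have h: "h \<in> carrier R" using m_inv generate_field_in_carrier by blast
    have "s (inv h) \<in> carrier R" "h \<otimes> s (inv h) = \<one>"
      using s.hom_mult[of h "inv h"] inv_facts[OF h m_inv(2)] h m_inv(3) by auto
    then show ?case using h by (metis comm_inv_char)
  qed (auto simp: c)
qed

end

locale automorphisms = field L for L :: "('a, 'm) ring_scheme" (structure) +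
  fixes K :: "'a set"
begin

definition Gal where "Gal = galois_group L K"

lemma Gal_iff: "s \<in> carrier Gal \<longleftrightarrow> s \<in> Bij (carrier L) \<and> s \<in> Ring.ring_hom L L \<and> (\<forall>x\<in>K. s x = x)"
  by (auto simp: Gal_def galois_group_def)

lemma Gal_hom: "s \<in> carrier Gal \<Longrightarrow> ring_hom_cring L L s"
  using is_cring by (simp add: Gal_iff ring_hom_cring.intro ring_hom_cring_axioms.intro)

lemma Gal_closed: "s \<in> carrier Gal \<Longrightarrow> x \<in> carrier L \<Longrightarrow> s x \<in> carrier L"
  using Bij_imp_funcset by (auto simp: Gal_iff)

lemma Gal_mult: "s \<in> carrier Gal \<Longrightarrow> t \<in> carrier Gal \<Longrightarrow> s \<otimes>\<^bsub>Gal\<^esub> t = compose (carrier L) s t"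
  by (simp add: Gal_def galois_group_def BijGroup_def)

lemma Gal_mult_apply: "s \<in> carrier Gal \<Longrightarrow> t \<in> carrier Gal \<Longrightarrow> x \<in> carrier L \<Longrightarrow> (s \<otimes>\<^bsub>Gal\<^esub> t) x = s (t x)"
  by (simp add: Gal_mult compose_eq)

lemma Gal_one_apply: "x \<in> carrier L \<Longrightarrow> \<one>\<^bsub>Gal\<^esub> x = x"
  by (simp add: Gal_def galois_group_def BijGroup_def)

lemma group_Gal:
  assumes KL: "K \<subseteq> carrier L" shows "group Gal"
proof -
  interpret B: group "BijGroup (carrier L)" by (rule group_BijGroup)
  have "subgroup (carrier Gal) (BijGroup (carrier L))"
  proof (rule B.subgroupI)
    show "carrier Gal \<subseteq> carrier (BijGroup (carrier L))" by (auto simp: Gal_iff BijGroup_def)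
    have "(\<lambda>x\<in>carrier L. x) \<in> carrier Gal"
      using KL id_Bij by (auto simp: Gal_iff Ring.ring_hom_def)
    then show "carrier Gal \<noteq> {}" by blast
  next
    fix s assume s: "s \<in> carrier Gal"
    then have sB: "s \<in> Bij (carrier L)" by (simp add: Gal_iff)
    then have bij: "bij_betw s (carrier L) (carrier L)" by (simp add: Bij_def)
    interpret s: ring_hom_cring L L s by (rule Gal_hom[OF s])
    define t where "t = (\<lambda>x\<in>carrier L. inv_into (carrier L) s x)"
    have t: "t \<in> Bij (carrier L)" unfolding t_def by (rule restrict_inv_into_Bij[OF sB])
    have tc: "t x \<in> carrier L" if "x \<in> carrier L" for x using Bij_imp_funcset[OF t] that by blast
    have st: "s (t x) = x" if "x \<in> carrier L" for x using bij that
        by (simp add: t_def bij_betw_inv_into_right)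
    have ts: "t (s x) = x" if "x \<in> carrier L" for x using bij that Gal_closed[OF s]
        by (simp add: t_def bij_betw_inv_into_left)
    have "t \<in> Ring.ring_hom L L"
    proof (rule ring_hom_memI)
      fix x y assume xy: "x \<in> carrier L" "y \<in> carrier L"
      note c = tc[OF xy(1)] tc[OF xy(2)]
      have "s (t x \<otimes> t y) = x \<otimes> y" "s (t x \<oplus> t y) = x \<oplus> y" using c st xy by simp_all
      then show "t (x \<otimes> y) = t x \<otimes> t y" "t (x \<oplus> y) = t x \<oplus> t y"
        using ts[OF m_closed[OF c]] ts[OF a_closed[OF c]] by simp_all
    next
      show "t \<one> = \<one>" using ts[OF one_closed] by simp
    qed (rule tc)
    moreover have "t x = x" if "x \<in> K" for x
    proof -
      have "s x = x" using s that by (simp add: Gal_iff)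
      then show ?thesis using ts[of x] that KL by auto
    qed
    ultimately have "t \<in> carrier Gal" using t by (simp add: Gal_iff)
    then show "inv\<^bsub>BijGroup (carrier L)\<^esub> s \<in> carrier Gal" using inv_BijGroup[OF sB] by (simp add: t_def)
  next
    fix s t assume st: "s \<in> carrier Gal" "t \<in> carrier Gal"
    interpret s: ring_hom_cring L L s by (rule Gal_hom[OF st(1)])
    interpret t: ring_hom_cring L L t by (rule Gal_hom[OF st(2)])
    have "compose (carrier L) s t \<in> Ring.ring_hom L L"
      by (rule ring_hom_memI) (auto simp: compose_eq)
    then have "compose (carrier L) s t \<in> carrier Gal"
      using st KL by (auto simp: Gal_iff compose_Bij compose_eq subset_iff)
    then show "s \<otimes>\<^bsub>BijGroup (carrier L)\<^esub> t \<in> carrier Gal"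
      using st by (simp add: BijGroup_def Gal_iff)
  qed
  then have "group (BijGroup (carrier L)\<lparr>carrier := carrier Gal\<rparr>)"
      by (rule subgroup.subgroup_is_group) (rule B.group_axioms)
  moreover have "BijGroup (carrier L)\<lparr>carrier := carrier Gal\<rparr> = Gal"
      by (simp add: Gal_def galois_group_def)
  ultimately show ?thesis by simp
qed

text \<open>An automorphism is determined by its values on a finite list spanning the field over the
  prime field. Each value is a root of a polynomial whose coefficients the automorphism fixes, so
  there are finitely many choices.\<close>

lemma finite_Gal:
  assumes fd: "finite_dimension (generate_field L {}) (carrier L)"
  shows "finite (carrier Gal)"
proof -
  let ?Q = "generate_field L {}"
  have Q: "subfield ?Q L" by (rule generate_field_is_subfield) simp
  have QL: "?Q \<subseteq> carrier L" using subringE(1)[OF subfieldE(1)[OF Q]] .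
  obtain n where "dimension n ?Q (carrier L)" using fd by blast
  then obtain Us where Us: "set Us \<subseteq> carrier L" "Span ?Q Us = carrier L" using exists_base[OF Q] by metis
  have fixQ: "s x = x" if "s \<in> carrier Gal" "x \<in> ?Q" for s x
    using ring_hom_fixes_prime_field that by (simp add: Gal_iff)
  have ev: "s (eval f x) = eval f (s x)" if s: "s \<in> carrier Gal" and "set f \<subseteq> ?Q" "x \<in> carrier L"
      for s f x
  proof -
    interpret s: ring_hom_cring L L s by (rule Gal_hom[OF s])
    have pw: "s (x [^] (k::nat)) = s x [^] k" for k by (induction k) (use that in auto)
    show ?thesis
      using that(2)
    proof (induction f)
      case (Cons a f)
      have "a \<in> carrier L" "set f \<subseteq> carrier L" using Cons(2) QL by auto
      then show ?case using Cons that(3) pw fixQ[OF s, of a] by (simp add: eval_in_carrier)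
    qed simp
  qed
  have roots: "\<exists>T. finite T \<and> (\<forall>s\<in>carrier Gal. s u \<in> T)" if u: "u \<in> carrier L" for u
  proof -
    have "(algebraic over ?Q) u"
      by (rule finite_dimension_imp_algebraic[OF Q carrier_is_subring fd u])
    then obtain f where f: "f \<in> carrier (?Q[X])" "f \<noteq> []" "eval f u = \<zero>"
      using algebraicE[OF subfieldE(1)[OF Q] u] by metis
    have fQ: "set f \<subseteq> ?Q" "f \<in> carrier (poly_ring L)"
      using f(1) QL unfolding univ_poly_carrier[symmetric] polynomial_def by auto
    have "is_root f (s u)" if s: "s \<in> carrier Gal" for s
    proof -
      interpret s: ring_hom_cring L L s by (rule Gal_hom[OF s])
      have "eval f (s u) = \<zero>" using ev[OF s fQ(1) u] f(3) by simp
      then show ?thesis using f(2) u by (simp add: is_root_def)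
    qed
    then show ?thesis using finite_number_of_roots[OF fQ(2)] by blast
  qed
  then have "\<forall>u\<in>carrier L. \<exists>T. finite T \<and> (\<forall>s\<in>carrier Gal. s u \<in> T)" by blast
  from bchoice[OF this] obtain T where T: "\<And>u. u \<in> carrier L \<Longrightarrow> finite (T u)"
    "\<And>u s. u \<in> carrier L \<Longrightarrow> s \<in> carrier Gal \<Longrightarrow> s u \<in> T u" by blast
  have "inj_on (\<lambda>s. map s Us) (carrier Gal)"
  proof (rule inj_onI)
    fix s t assume st: "s \<in> carrier Gal" "t \<in> carrier Gal" and eq: "map s Us = map t Us"
    interpret s: ring_hom_cring L L s by (rule Gal_hom[OF st(1)])
    interpret t: ring_hom_cring L L t by (rule Gal_hom[OF st(2)])
    have comb: "s (combine Ks Vs) = t (combine Ks Vs)"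
      if "set Ks \<subseteq> ?Q" "set Vs \<subseteq> set Us" for Ks Vs
      using that
    proof (induction Ks Vs rule: combine.induct)
      case (1 k Ks u Vs)
      have c: "k \<in> carrier L" "u \<in> carrier L" "combine Ks Vs \<in> carrier L" "k \<in> ?Q" "u \<in> set Us"
        using 1 QL Us(1) by (auto intro!: combine_in_carrier)
      have "s u = t u" using eq c(5) by (auto simp: map_eq_conv)
      then show ?case using 1 c fixQ[OF st(1) c(4)] fixQ[OF st(2) c(4)] by simp
    qed auto
    have "s x = t x" if "x \<in> carrier L" for x
    proof -
      have "x \<in> Span ?Q Us" using that Us(2) by simp
      then obtain Ks where "set Ks \<subseteq> ?Q" "x = combine Ks Us" unfolding Span_eq_combine_set[OF Q Us(1)]
          by blast
      then show ?thesis using comb[of Ks Us] by simp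
    qed
    then show "s = t" using st by (intro extensionalityI[of s "carrier L" t]) (auto simp: Gal_iff
        Bij_def)
  qed
  moreover have "(\<lambda>s. map s Us) ` carrier Gal \<subseteq> {xs. set xs \<subseteq> (\<Union>u\<in>set Us. T u) \<and> length xs = length Us}"
  proof clarify
    fix s assume s: "s \<in> carrier Gal"
    show "set (map s Us) \<subseteq> (\<Union>u\<in>set Us. T u) \<and> length (map s Us) = length Us"
      using T(2)[OF subsetD[OF Us(1)] s] by auto
  qed
  moreover have "finite {xs. set xs \<subseteq> (\<Union>u\<in>set Us. T u) \<and> length xs = length Us}"
    using T(1) Us(1) by (intro finite_lists_length_eq finite_UN_I) auto
  ultimately show ?thesis by (meson finite_imageD finite_subset)
qed

lemma subfield_fixed_field:
  assumes H: "H \<subseteq> carrier Gal" shows "subfield (fixed_field L H) L"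
proof (rule subfieldI')
  have hom: "ring_hom_cring L L s" if "s \<in> H" for s using Gal_hom H that by blast
  show "subring (fixed_field L H) L"
  proof (rule subringI)
    show "fixed_field L H \<subseteq> carrier L" by (auto simp: fixed_field_def)
    have "s \<one> = \<one>" if "s \<in> H" for s
    proof -
      interpret s: ring_hom_cring L L s by (rule hom[OF that])
      show ?thesis by simp
    qed
    then show "\<one> \<in> fixed_field L H" by (simp add: fixed_field_def)
    show "\<ominus> x \<in> fixed_field L H" if "x \<in> fixed_field L H" for x
    proof -
      have "s (\<ominus> x) = \<ominus> x" if "s \<in> H" for s
      proof -
        interpret s: ring_hom_cring L L s by (rule hom[OF that])
        have "s x = x" "x \<in> carrier L" using \<open>x \<in> fixed_field L H\<close> that by (auto simp: fixed_field_def)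
        then show ?thesis by simp
      qed
      then show ?thesis using that by (simp add: fixed_field_def)
    qed
    fix x y assume xy: "x \<in> fixed_field L H" "y \<in> fixed_field L H"
    have "s (x \<otimes> y) = x \<otimes> y \<and> s (x \<oplus> y) = x \<oplus> y" if "s \<in> H" for s
    proof -
      interpret s: ring_hom_cring L L s by (rule hom[OF that])
      have "s x = x" "s y = y" "x \<in> carrier L" "y \<in> carrier L" using xy that
          by (auto simp: fixed_field_def)
      then show ?thesis by simp
    qed
    then show "x \<otimes> y \<in> fixed_field L H" "x \<oplus> y \<in> fixed_field L H" using xy
        by (auto simp: fixed_field_def)
  qed
  fix x assume x: "x \<in> fixed_field L H - {\<zero>}"
  then have xL: "x \<in> carrier L" "x \<noteq> \<zero>" by (auto simp: fixed_field_def)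
  have "s (inv x) = inv x" if "s \<in> H" for s
  proof -
    interpret s: ring_hom_cring L L s by (rule hom[OF that])
    have sx: "s x = x" using x that by (auto simp: fixed_field_def)
    have "s (inv x) \<in> carrier L" "x \<otimes> s (inv x) = \<one>"
      using s.hom_mult[of x "inv x"] inv_facts[OF xL] xL sx by auto
    then show ?thesis using xL by (metis comm_inv_char)
  qed
  then show "inv x \<in> fixed_field L H" using inv_facts[OF xL] by (simp add: fixed_field_def)
qed

lemma Gal_unit_hom: "s \<in> carrier Gal \<Longrightarrow> s \<in> hom (unit_group L) (unit_group L)"
  using field_hom_unit_group[OF field_axioms field_axioms] by (simp add: Gal_iff)

definition unit_norm :: "('a \<Rightarrow> 'a) set \<Rightarrow> 'a \<Rightarrow> 'a" where
  "unit_norm H u = (\<Otimes>\<^bsub>unit_group L\<^esub>s\<in>H. s u)"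

text \<open>An element of \<open>H\<close> permutes the factors of the product, which therefore lies
  in the fixed field.\<close>

lemma unit_norm_hom:
  assumes H: "subgroup H Gal"
  shows "unit_norm H \<in> hom (unit_group L) (unit_group (L\<lparr>carrier := fixed_field L H\<rparr>))"
proof (rule homI)
  interpret U: comm_group "unit_group L" by (rule comm_group_unit_group)
  have HG: "H \<subseteq> carrier Gal" using H by (rule subgroup.subset)
  have cl: "s u \<in> carrier (unit_group L)" if "s \<in> H" "u \<in> carrier (unit_group L)" for s u
    using hom_in_carrier[OF Gal_unit_hom] HG that by blast
  {
    fix u assume u: "u \<in> carrier (unit_group L)"
    have nu: "unit_norm H u \<in> carrier (unit_group L)"
      unfolding unit_norm_def by (rule U.finprod_closed) (use cl u in auto)
    have uL: "u \<in> carrier L" using u unit_group_carrier by blast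
    have "t (unit_norm H u) = unit_norm H u" if t: "t \<in> H" for t
    proof -
      have tG: "t \<in> carrier Gal" using t HG by blast
      interpret t: group_hom "unit_group L" "unit_group L" t
        using Gal_unit_hom[OF tG] by (simp add: group_hom_def group_hom_axioms_def)
      have pull: "t (\<Otimes>\<^bsub>unit_group L\<^esub>s\<in>A. s u) = (\<Otimes>\<^bsub>unit_group L\<^esub>s\<in>A. t (s u))" if "finite A" "A \<subseteq> H"
          for A
        using that
      proof (induction A rule: finite_induct)
        case empty show ?case using t.hom_one by simp
      next
        case (insert s A)
        have "(\<Otimes>\<^bsub>unit_group L\<^esub>s\<in>insert s A. s u) = s u \<otimes>\<^bsub>unit_group L\<^esub> (\<Otimes>\<^bsub>unit_group L\<^esub>s\<in>A. s u)"
          using insert cl u by (intro U.finprod_insert) auto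
        moreover have "(\<Otimes>\<^bsub>unit_group L\<^esub>s\<in>insert s A. t (s u)) = t (s u) \<otimes>\<^bsub>unit_group L\<^esub>
            (\<Otimes>\<^bsub>unit_group L\<^esub>s\<in>A. t (s u))"
          using insert cl u by (intro U.finprod_insert) (auto intro: t.hom_closed)
        moreover have "s u \<in> carrier (unit_group L)" "(\<Otimes>\<^bsub>unit_group L\<^esub>s\<in>A. s u) \<in> carrier (unit_group L)"
          using insert cl u by (auto intro!: U.finprod_closed)
        ultimately show ?case using insert t.hom_mult by (simp del: unit_group_mult)
      qed
      have tH: "t \<otimes>\<^bsub>Gal\<^esub> s \<in> H" if "s \<in> H" for s using subgroup.m_closed[OF H t that] .
      have inj: "inj_on (\<lambda>s. t \<otimes>\<^bsub>Gal\<^esub> s) H"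
        proof (rule inj_onI)
          fix s r assume sr: "s \<in> H" "r \<in> H" "t \<otimes>\<^bsub>Gal\<^esub> s = t \<otimes>\<^bsub>Gal\<^esub> r"
          have g: "s \<in> carrier Gal" "r \<in> carrier Gal" using sr HG by auto
          have tinj: "inj_on t (carrier L)" using tG by (simp add: Gal_iff Bij_def bij_betw_def)
          have "s x = r x" if "x \<in> carrier L" for x
          proof -
            have "t (s x) = t (r x)" using fun_cong[OF sr(3), of x] Gal_mult_apply[OF tG _ that] g
                by simp
            then show ?thesis using tinj Gal_closed g that by (auto dest: inj_onD)
          qed
          then show "s = r" using g by (intro extensionalityI[of s "carrier L" r]) (auto simp: Gal_iff
              Bij_def)
        qed
      have "(\<Otimes>\<^bsub>unit_group L\<^esub>s\<in>(\<lambda>s. t \<otimes>\<^bsub>Gal\<^esub> s) ` H. s u) = (\<Otimes>\<^bsub>unit_group L\<^esub>s\<in>H. (t \<otimes>\<^bsub>Gal\<^esub> s) u)"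
        by (rule U.finprod_reindex[OF _ inj]) (use cl u tH in auto)
      also have "\<dots> = (\<Otimes>\<^bsub>unit_group L\<^esub>s\<in>H. t (s u))"
        by (rule U.finprod_cong') (use cl u HG Gal_mult_apply[OF tG _ uL] t.hom_closed in \<open>auto simp:
            subset_iff\<close>)
      finally have re: "(\<Otimes>\<^bsub>unit_group L\<^esub>s\<in>H. t (s u)) = (\<Otimes>\<^bsub>unit_group L\<^esub>s\<in>(\<lambda>s. t \<otimes>\<^bsub>Gal\<^esub> s) ` H. s u)" ..
      have "(\<lambda>s. t \<otimes>\<^bsub>Gal\<^esub> s) ` H = H" if "finite H"
        using that inj tH by (intro endo_inj_surj) auto
      \<comment> \<open>For infinite \<open>H\<close> the product is \<one> by default, which is
        fixed as well.\<close>
      with re pull show ?thesis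
        unfolding unit_norm_def using t.hom_one by (cases "finite H") auto
    qed
    then have "unit_norm H u \<in> fixed_field L H"
      using unit_group_carrier[OF nu] by (simp add: fixed_field_def)
    then show "unit_norm H u \<in> carrier (unit_group (L\<lparr>carrier := fixed_field L H\<rparr>))"
      unfolding unit_group_subfield[OF subfield_fixed_field[OF HG]] using nu by simp
  }
  fix u w assume uw: "u \<in> carrier (unit_group L)" "w \<in> carrier (unit_group L)"
  have "unit_norm H (u \<otimes>\<^bsub>unit_group L\<^esub> w) = (\<Otimes>\<^bsub>unit_group L\<^esub>s\<in>H. s u \<otimes>\<^bsub>unit_group L\<^esub> s w)"
    unfolding unit_norm_def
  proof (rule U.finprod_cong')
    fix s assume "s \<in> H"
    then show "s (u \<otimes>\<^bsub>unit_group L\<^esub> w) = s u \<otimes>\<^bsub>unit_group L\<^esub> s w"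
      using hom_mult[OF Gal_unit_hom[OF subsetD[OF HG]] uw] by blast
  qed (use cl uw in \<open>auto intro!: U.m_closed simp del: unit_group_mult\<close>)
  also have "\<dots> = unit_norm H u \<otimes>\<^bsub>unit_group L\<^esub> unit_norm H w"
    unfolding unit_norm_def by (rule U.finprod_multf) (use cl uw in auto)
  finally show "unit_norm H (u \<otimes>\<^bsub>unit_group L\<^esub> w) =
      unit_norm H u \<otimes>\<^bsub>unit_group (L\<lparr>carrier := fixed_field L H\<rparr>)\<^esub> unit_norm H w" by simp
qed

end

section \<open>Inclusion, norm and trace between a number field and its fixed fields\<close>

locale number_field_automorphisms = automorphisms L K for L :: "('a, 'm) ring_scheme" (structure) and K +
  fixes p :: nat
  assumes nf: "number_field L" and KL: "K \<subseteq> carrier L" and prime: "Factorial_Ring.prime p"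
begin

sublocale UL: unit_tensor L p by unfold_locales (rule prime)

sublocale G: group Gal by (rule group_Gal[OF KL])

abbreviation "fixf H \<equiv> L\<lparr>carrier := fixed_field L H\<rparr>"

lemma char_zero: "\<forall>n::nat. n > 0 \<longrightarrow> [n] \<cdot> \<one> \<noteq> \<zero>"
  and fd: "finite_dimension (generate_field L {}) (carrier L)"
  using nf by (auto simp: number_field_def)

lemma finG: "finite (carrier Gal)" by (rule finite_Gal[OF fd])

lemma fixed_sub: "H \<subseteq> carrier Gal \<Longrightarrow> fixed_field L H \<subseteq> carrier L"
  by (auto simp: fixed_field_def)

lemma unit_tensor_fixed: "H \<subseteq> carrier Gal \<Longrightarrow> unit_tensor (fixf H) p"
  using subfield_field[OF subfield_fixed_field] prime
      by (simp add: unit_tensor_def unit_tensor_axioms_def)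

lemma keys_fixed:
  assumes "H \<subseteq> carrier Gal" "Poly_Mapping.keys c \<subseteq> tensor_generators (fixf H) p"
      shows "Poly_Mapping.keys c \<subseteq> tensor_generators L p"
  using assms unit_group_subfield[OF subfield_fixed_field[OF assms(1)]]
      by (auto simp: tensor_generators_def)

lemma push_id: "push (\<lambda>x. x) c = c"
  using frag_expansion[of c] by (simp add: push_def)

lemma Rel_fixed:
  assumes H: "H \<subseteq> carrier Gal" and c: "c \<in> tensor_relators (fixf H) p" shows "c \<in> tensor_relators L p"
proof -
  have h: "(\<lambda>x. x) \<in> hom (unit_group (fixf H)) (unit_group L)"
    by (rule field_hom_unit_group[OF subfield_field[OF subfield_fixed_field[OF H]] field_axioms
        inclusion_hom[OF fixed_sub[OF H]]])
  interpret unit_tensor_hom "fixf H" L p "\<lambda>x. x"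
    unfolding unit_tensor_hom_def unit_tensor_hom_axioms_def
    using unit_tensor_fixed[OF H] UL.unit_tensor_axioms h by blast
  show ?thesis using push_rel[OF c] by (simp add: push_id)
qed

lemma vanishes_fixed:
  assumes H: "H \<subseteq> carrier Gal" and c: "Poly_Mapping.keys c \<subseteq> tensor_generators (fixf H) p"
    and vw: "\<And>x. x \<in> fixed_field L H \<Longrightarrow> v x = w x"
  shows "vanishes_at L p w c \<longleftrightarrow> vanishes_at (fixf H) p v c"
  using vanishes_push[OF unit_tensor_fixed[OF H] UL.unit_tensor_axioms inclusion_hom[OF fixed_sub[OF H]]
      c, of v w] vw
  by (simp add: push_id)

lemma place_restricts:
  assumes H: "H \<subseteq> carrier Gal" and w: "w \<in> places_above L p"
  shows "(\<lambda>x\<in>fixed_field L H. w x) \<in> places_above (fixf H) p"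
  using place_pullback[OF subfield_field[OF subfield_fixed_field[OF H]] field_axioms inclusion_hom[OF
      fixed_sub[OF H]] w] by simp

text \<open>Automorphisms fix the prime field, so it lies in the fixed field and \<open>L\<close> is
  finite-dimensional over the latter, as \<open>absolute_value_extends\<close> demands.\<close>

lemma place_extends:
  assumes H: "H \<subseteq> carrier Gal" and v: "v \<in> places_above (fixf H) p"
  shows "\<exists>w\<in>places_above L p. \<forall>x\<in>fixed_field L H. w x = v x"
proof -
  let ?M = "fixed_field L H"
  have M: "subfield ?M L" by (rule subfield_fixed_field[OF H])
  have Q: "subfield (generate_field L {}) L" by (rule generate_field_is_subfield) simp
  have QM: "generate_field L {} \<subseteq> ?M"
    using ring_hom_fixes_prime_field generate_field_in_carrier[of "{}"] H
        by (auto simp: fixed_field_def Gal_iff)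
  interpret V: padic_place "fixf H" v p
    using unit_tensor_fixed[OF H] v by (simp add: padic_place_def padic_place_axioms_def unit_tensor_def
        unit_tensor_axioms_def)
  have "[p] \<cdot>\<^bsub>fixf H\<^esub> \<one>\<^bsub>fixf H\<^esub> = [p] \<cdot> \<one>"
    using ring_hom_int_emb[OF V.is_cring is_cring inclusion_hom[OF fixed_sub[OF H]], of "int p"]
    by (simp add: V.int_emb_of_nat int_emb_of_nat)
  then have vp: "v ([p] \<cdot> \<one>) = 1 / real p" using V.v_p' by simp
  show ?thesis
    by (rule absolute_value_extends[where v = v and p = p, OF M finite_dimension_over_subfield[OF Q M QM
        fd] _ _ _ _ vp])
      (use V.v_nonneg V.v_zero_iff V.v_mult V.v_add in auto)
qed

lemma places_nonempty: "places_above L p \<noteq> {}"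
  by (rule place_exists[OF char_zero fd prime])

definition trace :: "('a \<Rightarrow> 'a) set \<Rightarrow> ((nat \<Rightarrow> nat) \<times> 'a \<Rightarrow>\<^sub>0 int) \<Rightarrow> ((nat \<Rightarrow> nat) \<times> 'a \<Rightarrow>\<^sub>0 int)" where
  "trace H c = (\<Sum>s\<in>H. push s c)"

lemma Gal_tensor_hom: "s \<in> carrier Gal \<Longrightarrow> unit_tensor_hom L L p s"
  unfolding unit_tensor_hom_def unit_tensor_hom_axioms_def
  using UL.unit_tensor_axioms Gal_unit_hom by blast

lemma keys_push: "s \<in> carrier Gal \<Longrightarrow> Poly_Mapping.keys c \<subseteq> tensor_generators L p \<Longrightarrow>
    Poly_Mapping.keys (push s c) \<subseteq> tensor_generators L p"
  using unit_tensor_hom.keys_push[OF Gal_tensor_hom] .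

lemma keys_sum:
  fixes f :: "'i \<Rightarrow> ((nat \<Rightarrow> nat) \<times> 'a \<Rightarrow>\<^sub>0 int)"
  assumes "\<And>i. i \<in> I \<Longrightarrow> Poly_Mapping.keys (f i) \<subseteq> tensor_generators L p"
      shows "Poly_Mapping.keys (\<Sum>i\<in>I. f i) \<subseteq> tensor_generators L p"
  using sum_closed_free_Abelian_group[of I f "tensor_generators L p"] assms by simp

lemma keys_trace: "H \<subseteq> carrier Gal \<Longrightarrow> Poly_Mapping.keys c \<subseteq> tensor_generators L p \<Longrightarrow>
    Poly_Mapping.keys (trace H c) \<subseteq> tensor_generators L p"
  unfolding trace_def by (rule keys_sum) (use keys_push in blast)

lemma push_mult:
  assumes "s \<in> carrier Gal" "t \<in> carrier Gal" "Poly_Mapping.keys c \<subseteq> tensor_generators L p"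
  shows "push (s \<otimes>\<^bsub>Gal\<^esub> t) c = push s (push t c)"
  using assms(3)
proof (induction c rule: free_Abelian_group_induct[consumes 1, case_names zero diff of])
  case (of u)
  then show ?case using Gal_mult_apply[OF assms(1,2)] unit_group_carrier
      by (cases u) (simp add: tensor_generators_def)
qed (simp_all add: push_diff)

lemma push_one:
  assumes "Poly_Mapping.keys c \<subseteq> tensor_generators L p" shows "push \<one>\<^bsub>Gal\<^esub> c = c"
  using assms
proof (induction c rule: free_Abelian_group_induct[consumes 1, case_names zero diff of])
  case (of u)
  then show ?case using Gal_one_apply unit_group_carrier by (cases u) (simp add: tensor_generators_def)
qed (simp_all add: push_diff)

text \<open>The norm is a product of conjugates, and modulo relators a product in the unit argument
  becomes a sum. As formal sums the two are different, hence the relator.\<close>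

lemma norm_trace:
  assumes H: "subgroup H Gal" and c: "Poly_Mapping.keys c \<subseteq> tensor_generators L p"
  shows "push (unit_norm H) c - trace H c \<in> tensor_relators L p"
  using c
proof (induction c rule: free_Abelian_group_induct[consumes 1, case_names zero diff of])
  case zero then show ?case by (simp add: trace_def UL.Rel_zero)
next
  case (diff c d)
  have "push (unit_norm H) (c - d) - trace H (c - d) =
      (push (unit_norm H) c - trace H c) - (push (unit_norm H) d - trace H d)"
    by (simp add: push_diff trace_def sum_subtractf)
  then show ?case using UL.Rel_diff[OF diff(3,4)] by simp
next
  case (of t)
  then obtain a u where t: "t = (a, u)" "a \<in> carrier (padic_integers p)" "u \<in> carrier (unit_group L)"
      by (auto simp: tensor_generators_def)
  have HG: "H \<subseteq> carrier Gal" using H by (rule subgroup.subset)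
  have cl: "s u \<in> carrier (unit_group L)" if "s \<in> H" for s
    using hom_in_carrier[OF Gal_unit_hom] HG that t(3) by blast
  have "frag_of (a, \<Otimes>\<^bsub>unit_group L\<^esub>s\<in>A. s u) - (\<Sum>s\<in>A. frag_of (a, s u)) \<in> tensor_relators L p"
      if "finite A" "A \<subseteq> H" for A
    using that
  proof (induction A rule: finite_induct)
    case empty then show ?case using UL.Rel_one_right[OF t(2)] by simp
  next
    case (insert s A)
    let ?x = "\<Otimes>\<^bsub>unit_group L\<^esub>s\<in>A. s u"
    have x: "?x \<in> carrier (unit_group L)" using insert cl by (intro UL.U.finprod_closed) auto
    have "(\<Otimes>\<^bsub>unit_group L\<^esub>s\<in>insert s A. s u) = s u \<otimes>\<^bsub>unit_group L\<^esub> ?x"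
      using insert cl by (intro UL.U.finprod_insert) auto
    then have e: "(\<Otimes>\<^bsub>unit_group L\<^esub>s\<in>insert s A. s u) = s u \<otimes> ?x" by simp
    have "frag_of (a, s u \<otimes> ?x) - frag_of (a, s u) - frag_of (a, ?x) \<in> tensor_relators L p"
      by (rule UL.Rel_right[OF t(2) _ x]) (use cl insert in auto)
    moreover have "frag_of (a, ?x) - (\<Sum>s\<in>A. frag_of (a, s u)) \<in> tensor_relators L p" using insert
        by blast
    ultimately have "(frag_of (a, s u \<otimes> ?x) - frag_of (a, s u) - frag_of (a, ?x)) +
        (frag_of (a, ?x) - (\<Sum>s\<in>A. frag_of (a, s u))) \<in> tensor_relators L p" by (rule UL.Rel_add)
    then show ?case unfolding e using insert(1,2) by (simp add: algebra_simps)
  qed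
  from this[OF finite_subset[OF HG finG] order_refl] show ?case
    by (simp add: t(1) trace_def unit_norm_def)
qed

lemma norm_tensor_hom:
  assumes H: "subgroup H Gal" shows "unit_tensor_hom L (fixf H) p (unit_norm H)"
  unfolding unit_tensor_hom_def unit_tensor_hom_axioms_def
  using UL.unit_tensor_axioms unit_tensor_fixed[OF subgroup.subset[OF H]] unit_norm_hom[OF H] by blast

text \<open>All conjugates of a fixed unit coincide, so its norm is a power with exponent
  \<open>card H\<close>.\<close>

lemma norm_fixed:
  assumes H: "subgroup H Gal" and c: "Poly_Mapping.keys c \<subseteq> tensor_generators (fixf H) p"
  shows "frag_cmul (int (card H)) c - push (unit_norm H) c \<in> tensor_relators (fixf H) p"
proof -
  interpret M: unit_tensor "fixf H" p by (rule unit_tensor_fixed[OF subgroup.subset[OF H]])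
  have HG: "H \<subseteq> carrier Gal" using H by (rule subgroup.subset)
  show ?thesis
    using c
  proof (induction c rule: free_Abelian_group_induct[consumes 1, case_names zero diff of])
    case zero then show ?case by (simp add: M.Rel_zero)
  next
    case (diff c d)
    have "frag_cmul (int (card H)) (c - d) - push (unit_norm H) (c - d) =
      (frag_cmul (int (card H)) c - push (unit_norm H) c) - (frag_cmul (int (card H)) d - push (unit_norm
      H) d)"
      by (simp add: push_diff frag_cmul_diff_distrib2)
    then show ?case using M.Rel_diff[OF diff(3,4)] by simp
  next
    case (of t)
    then obtain a u where t: "t = (a, u)" "a \<in> carrier (padic_integers p)"
        "u \<in> carrier (unit_group (fixf H))"
      by (auto simp: tensor_generators_def)
    have uL: "u \<in> fixed_field L H" "u \<in> carrier (unit_group L)"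
      using t(3) unit_group_subfield[OF subfield_fixed_field[OF HG]] by auto
    have "unit_norm H u = (\<Otimes>\<^bsub>unit_group L\<^esub>s\<in>H. u)"
      unfolding unit_norm_def by (rule UL.U.finprod_cong') (use uL in \<open>auto simp: fixed_field_def\<close>)
    also have "\<dots> = u [^]\<^bsub>unit_group L\<^esub> card H" using uL finite_subset[OF HG finG]
        by (intro UL.U.finprod_const) auto
    also have "\<dots> = u [^]\<^bsub>fixf H\<^esub> card H" by (simp add: nat_pow_def)
    finally show ?case using M.Rel_times_right[OF t(2,3), of "card H"] by (simp add: t(1))
  qed
qed

text \<open>Inclusion carries the kernel for the fixed field into the kernel for \<open>L\<close>,
  which is trivial. The norm brings it back multiplied by \<open>card H\<close>, and
  \<open>torsion_vanishes\<close> removes this factor.\<close>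

lemma Leo_descends:
  assumes H: "subgroup H Gal" and L: "Leo L p" shows "Leo (fixf H) p"
proof -
  have HG: "H \<subseteq> carrier Gal" using H by (rule subgroup.subset)
  interpret M: unit_tensor "fixf H" p by (rule unit_tensor_fixed[OF HG])
  interpret N: unit_tensor_hom L "fixf H" p "unit_norm H" by (rule norm_tensor_hom[OF H])
  show ?thesis
    unfolding M.Leo_iff
  proof (intro allI impI)
    fix c assume c: "Poly_Mapping.keys c \<subseteq> tensor_generators (fixf H) p"
      and van: "\<forall>v\<in>places_above (fixf H) p. vanishes_at (fixf H) p v c"
    have "vanishes_at L p w c" if "w \<in> places_above L p" for w
      using vanishes_fixed[OF HG c, of "\<lambda>x\<in>fixed_field L H. w x" w] van place_restricts[OF HG that]
          by simp
    then have "c \<in> tensor_relators L p" using L keys_fixed[OF HG c] unfolding UL.Leo_iff by blast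
    then have "push (unit_norm H) c \<in> tensor_relators (fixf H) p" by (rule N.push_rel)
    from M.Rel_add[OF norm_fixed[OF H c] this]
    have t: "frag_cmul (int (card H)) c \<in> tensor_relators (fixf H) p" by simp
    have "card H > 0" using finite_subset[OF HG finG] subgroup.one_closed[OF H]
        by (auto simp: card_gt_0_iff)
    obtain w where w: "w \<in> places_above L p" using places_nonempty by blast
    note v = place_restricts[OF HG w]
    interpret V: padic_place "fixf H" "\<lambda>x\<in>fixed_field L H. w x" p by (rule M.padic_placeI[OF v])
    show "c \<in> tensor_relators (fixf H) p" by (rule V.torsion_vanishes[OF c t \<open>card H > 0\<close>]) (use van v in
        blast)
  qed
qed

text \<open>The formal sums that represent elements of the kernel of the Leopoldt homomorphism of
  \<open>L\<close>.\<close>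

definition vanishing_everywhere :: "((nat \<Rightarrow> nat) \<times> 'a \<Rightarrow>\<^sub>0 int) set" where
  "vanishing_everywhere = {c. Poly_Mapping.keys c \<subseteq> tensor_generators L p \<and>
  (\<forall>w\<in>places_above L p. vanishes_at L p w c)}"

text \<open>Pulling a place of \<open>L\<close> back along an automorphism gives a place of
  \<open>L\<close> again.\<close>

lemma vanishing_everywhere_push:
  assumes c: "c \<in> vanishing_everywhere" and s: "s \<in> carrier Gal" shows "push s c \<in> vanishing_everywhere"
proof -
  have k: "Poly_Mapping.keys c \<subseteq> tensor_generators L p" using c by (simp add: vanishing_everywhere_def)
  have sh: "s \<in> Ring.ring_hom L L" using s by (simp add: Gal_iff)
  have "vanishes_at L p w (push s c)" if w: "w \<in> places_above L p" for w
    using vanishes_push[OF UL.unit_tensor_axioms UL.unit_tensor_axioms sh k, of "\<lambda>x\<in>carrier L. w (s x)"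
        w]
      place_pullback[OF field_axioms field_axioms sh w] c by (simp add: vanishing_everywhere_def)
  then show ?thesis using keys_push[OF s k] by (simp add: vanishing_everywhere_def)
qed

lemma vanishing_everywhere_zero: "0 \<in> vanishing_everywhere"
  unfolding vanishing_everywhere_def using padic_place.vanishes_0[OF UL.padic_placeI] by simp

lemma vanishing_everywhere_diff:
  assumes "c \<in> vanishing_everywhere" "d \<in> vanishing_everywhere" shows "c - d \<in> vanishing_everywhere"
proof -
  have "vanishes_at L p w (c - d)" if "w \<in> places_above L p" for w
    by (rule padic_place.vanishes_diff[OF UL.padic_placeI[OF that]]) (use assms that in \<open>simp_all add:
        vanishing_everywhere_def\<close>)
  then show ?thesis using assms UL.keys_S_diff[of c d] by (simp add: vanishing_everywhere_def)
qed

lemma vanishing_everywhere_cmul: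
  assumes "c \<in> vanishing_everywhere" shows "frag_cmul k c \<in> vanishing_everywhere"
proof -
  have "vanishes_at L p w (frag_cmul k c)" if "w \<in> places_above L p" for w
    by (rule padic_place.vanishes_cmul[OF UL.padic_placeI[OF that]]) (use assms that in \<open>simp_all add:
        vanishing_everywhere_def\<close>)
  then show ?thesis using assms UL.keys_S_cmul[of c k] by (simp add: vanishing_everywhere_def)
qed

lemma vanishing_everywhere_Rel: "c \<in> tensor_relators L p \<Longrightarrow> c \<in> vanishing_everywhere"
  unfolding vanishing_everywhere_def using padic_place.vanishes_Rel[OF UL.padic_placeI] UL.Rel_keys[of c]
      by simp

lemma vanishing_everywhere_add: "c \<in> vanishing_everywhere \<Longrightarrow> d \<in> vanishing_everywhere \<Longrightarrow>
    c + d \<in> vanishing_everywhere"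
  using vanishing_everywhere_diff[OF _ vanishing_everywhere_diff[OF vanishing_everywhere_zero, of d], of
      c] by simp

lemma vanishing_everywhere_trace:
  assumes c: "c \<in> vanishing_everywhere" and H: "H \<subseteq> carrier Gal" shows "trace H c \<in> vanishing_everywhere"
proof -
  have "(\<Sum>s\<in>A. push s c) \<in> vanishing_everywhere" if "finite A" "A \<subseteq> H" for A
    using that
    by (induction A rule: finite_induct)
      (use vanishing_everywhere_zero vanishing_everywhere_add vanishing_everywhere_push[OF c] H in auto)
  from this[OF finite_subset[OF H finG] order_refl] show ?thesis by (simp add: trace_def)
qed

text \<open>Modulo relators the trace is the norm, viewed in \<open>L\<close>. The norm vanishes at
  every place of the fixed field, because each of these places extends to \<open>L\<close>; the
  conjecture for the fixed field then makes it a relator.\<close>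

lemma trace_in_Rel:
  assumes H: "subgroup H Gal" and M: "Leo (fixf H) p" and c: "c \<in> vanishing_everywhere"
      shows "trace H c \<in> tensor_relators L p"
proof -
  have HG: "H \<subseteq> carrier Gal" using H by (rule subgroup.subset)
  have k: "Poly_Mapping.keys c \<subseteq> tensor_generators L p" using c by (simp add: vanishing_everywhere_def)
  interpret M: unit_tensor "fixf H" p by (rule unit_tensor_fixed[OF HG])
  interpret N: unit_tensor_hom L "fixf H" p "unit_norm H" by (rule norm_tensor_hom[OF H])
  let ?d = "push (unit_norm H) c"
  have d: "Poly_Mapping.keys ?d \<subseteq> tensor_generators (fixf H) p" by (rule N.keys_push[OF k])
  have "?d \<in> vanishing_everywhere"
    using vanishing_everywhere_add[OF vanishing_everywhere_Rel[OF norm_trace[OF H k]]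
        vanishing_everywhere_trace[OF c HG]] by simp
  then have dv: "\<And>w. w \<in> places_above L p \<Longrightarrow> vanishes_at L p w ?d" by (simp add: vanishing_everywhere_def)
  have "vanishes_at (fixf H) p v ?d" if v: "v \<in> places_above (fixf H) p" for v
  proof -
    obtain w where w: "w \<in> places_above L p" "\<forall>x\<in>fixed_field L H. w x = v x" using place_extends[OF HG v]
        by blast
    show ?thesis using vanishes_fixed[OF HG d, of v w] w dv by auto
  qed
  then have "?d \<in> tensor_relators (fixf H) p" using M d unfolding M.Leo_iff by blast
  then have "?d \<in> tensor_relators L p" by (rule Rel_fixed[OF HG])
  from UL.Rel_diff[OF this norm_trace[OF H k]] show ?thesis by simp
qed

text \<open>The operator \<open>complement N\<close> is \<open>card N\<close> times the projection killing the \<open>N\<close>-invariants.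
  Composing them over all kernels of irreducible characters gives zero.\<close>

definition complement where "complement N c = frag_cmul (int (card N)) c - trace N c"

lemma keys_complement: "N \<subseteq> carrier Gal \<Longrightarrow> Poly_Mapping.keys c \<subseteq> tensor_generators L p \<Longrightarrow>
    Poly_Mapping.keys (complement N c) \<subseteq> tensor_generators L p"
  unfolding complement_def by (intro UL.keys_S_diff UL.keys_S_cmul keys_trace)

text \<open>Conjugation by \<open>s\<close> permutes the normal subgroup \<open>N\<close>, so the
  trace over it commutes with the whole group.\<close>

lemma trace_push:
  assumes N: "N \<lhd> Gal" and s: "s \<in> carrier Gal" and c: "Poly_Mapping.keys c \<subseteq> tensor_generators L p"
  shows "trace N (push s c) = push s (trace N c)"
proof -
  have sub: "subgroup N Gal" and conj: "\<And>x h. x \<in> carrier Gal \<Longrightarrow> h \<in> N \<Longrightarrow> x \<otimes>\<^bsub>Gal\<^esub> h \<otimes>\<^bsub>Gal\<^esub> inv\<^bsub>Gal\<^esub> x \<in> N"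
    using N unfolding G.normal_inv_iff by auto
  have NG: "h \<in> carrier Gal" if "h \<in> N" for h using subgroup.mem_carrier[OF sub that] .
  have fin: "finite N" using subgroup.subset[OF sub] finG finite_subset by blast
  have cancel: "inv\<^bsub>Gal\<^esub> s \<otimes>\<^bsub>Gal\<^esub> (s \<otimes>\<^bsub>Gal\<^esub> h) = h" "s \<otimes>\<^bsub>Gal\<^esub> (inv\<^bsub>Gal\<^esub> s \<otimes>\<^bsub>Gal\<^esub> h) = h"
      if "h \<in> carrier Gal" for h
    using s that by (simp_all flip: G.m_assoc)
  have "push s (trace N c) = (\<Sum>h\<in>N. push (s \<otimes>\<^bsub>Gal\<^esub> h) c)"
    unfolding trace_def push_sum[OF fin] by (rule sum.cong) (use push_mult[OF s _ c] NG in auto)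
  also have "\<dots> = (\<Sum>h\<in>N. push (h \<otimes>\<^bsub>Gal\<^esub> s) c)"
  proof (rule sum.reindex_bij_witness[of _ "\<lambda>h. inv\<^bsub>Gal\<^esub> s \<otimes>\<^bsub>Gal\<^esub> h \<otimes>\<^bsub>Gal\<^esub> s" "\<lambda>h. s \<otimes>\<^bsub>Gal\<^esub> h \<otimes>\<^bsub>Gal\<^esub>
  inv\<^bsub>Gal\<^esub> s"])
    fix h assume h: "h \<in> N"
    note hG = NG[OF h]
    show "inv\<^bsub>Gal\<^esub> s \<otimes>\<^bsub>Gal\<^esub> (s \<otimes>\<^bsub>Gal\<^esub> h \<otimes>\<^bsub>Gal\<^esub> inv\<^bsub>Gal\<^esub> s) \<otimes>\<^bsub>Gal\<^esub> s = h"
      "s \<otimes>\<^bsub>Gal\<^esub> (inv\<^bsub>Gal\<^esub> s \<otimes>\<^bsub>Gal\<^esub> h \<otimes>\<^bsub>Gal\<^esub> s) \<otimes>\<^bsub>Gal\<^esub> inv\<^bsub>Gal\<^esub> s = h"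
      using s hG by (simp_all add: G.m_assoc cancel)
    show "s \<otimes>\<^bsub>Gal\<^esub> h \<otimes>\<^bsub>Gal\<^esub> inv\<^bsub>Gal\<^esub> s \<in> N" using conj[OF s h] .
    show "inv\<^bsub>Gal\<^esub> s \<otimes>\<^bsub>Gal\<^esub> h \<otimes>\<^bsub>Gal\<^esub> s \<in> N" using conj[of "inv\<^bsub>Gal\<^esub> s" h] s h by simp
    show "push (s \<otimes>\<^bsub>Gal\<^esub> h \<otimes>\<^bsub>Gal\<^esub> inv\<^bsub>Gal\<^esub> s \<otimes>\<^bsub>Gal\<^esub> s) c = push (s \<otimes>\<^bsub>Gal\<^esub> h) c"
      using s hG by (simp add: G.m_assoc)
  qed
  also have "\<dots> = trace N (push s c)"
    unfolding trace_def by (rule sum.cong) (use push_mult[OF _ s c] NG in auto)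
  finally show ?thesis ..
qed

lemma trace_diff: "trace N (c - d) = trace N c - trace N d"
  by (simp add: trace_def push_diff sum_subtractf)

lemma trace_cmul: "finite N \<Longrightarrow> trace N (frag_cmul k c) = frag_cmul k (trace N c)"
  by (simp add: trace_def push_cmul frag_cmul_sum)

lemma trace_sum: "finite I \<Longrightarrow> trace N (\<Sum>i\<in>I. f i) = (\<Sum>i\<in>I. trace N (f i))"
  unfolding trace_def by (simp add: push_sum) (rule sum.swap)

lemma trace_complement_commute:
  assumes N: "N \<lhd> Gal" and M: "subgroup M Gal" and c: "Poly_Mapping.keys c \<subseteq> tensor_generators L p"
  shows "trace N (complement M c) = complement M (trace N c)"
proof -
  have MG: "M \<subseteq> carrier Gal" using M by (rule subgroup.subset)
  have NG: "N \<subseteq> carrier Gal" using N unfolding G.normal_inv_iff by (blast dest: subgroup.subset)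
  have fin: "finite M" "finite N" using MG NG finG finite_subset by blast+
  have "trace N (trace M c) = trace M (trace N c)"
  proof -
    have "trace N (trace M c) = (\<Sum>s\<in>M. trace N (push s c))" unfolding trace_def[of M]
        by (rule trace_sum[OF fin(1)])
    also have "\<dots> = (\<Sum>s\<in>M. push s (trace N c))" by (rule sum.cong) (use trace_push[OF N _ c] MG in auto)
    finally show ?thesis by (simp add: trace_def)
  qed
  then show ?thesis by (simp add: complement_def trace_diff trace_cmul[OF fin(2)])
qed

text \<open>The trace is invariant under \<open>N\<close>, so taking it twice multiplies it by
  \<open>card N\<close>.\<close>

lemma trace_complement_same:
  assumes N: "subgroup N Gal" and c: "Poly_Mapping.keys c \<subseteq> tensor_generators L p"
  shows "trace N (complement N c) = 0"
proof -
  have NG: "N \<subseteq> carrier Gal" using N by (rule subgroup.subset)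
  have fin: "finite N" using NG finG finite_subset by blast
  have "push s (trace N c) = trace N c" if s: "s \<in> N" for s
  proof -
    have sG: "s \<in> carrier Gal" using s NG by blast
    have "push s (trace N c) = (\<Sum>h\<in>N. push (s \<otimes>\<^bsub>Gal\<^esub> h) c)"
      unfolding trace_def push_sum[OF fin] by (rule sum.cong) (use push_mult[OF sG _ c] NG in auto)
    also have "\<dots> = (\<Sum>h\<in>N. push h c)"
      by (rule sum.reindex_bij_witness[of _ "\<lambda>h. inv\<^bsub>Gal\<^esub> s \<otimes>\<^bsub>Gal\<^esub> h" "\<lambda>h. s \<otimes>\<^bsub>Gal\<^esub> h"])
        (use s sG NG subgroup.m_closed[OF N] subgroup.m_inv_closed[OF N s] in \<open>auto simp:
        G.m_assoc[symmetric]\<close>)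
    finally show ?thesis by (simp add: trace_def)
  qed
  then have "trace N (trace N c) = (\<Sum>s\<in>N. trace N c)" unfolding trace_def[of N "trace N c"]
      by (intro sum.cong) auto
  also have "\<dots> = frag_cmul (int (card N)) (trace N c)"
    by (rule poly_mapping_eqI) (simp add: lookup_sum)
  finally show ?thesis by (simp add: complement_def trace_diff trace_cmul[OF fin])
qed

lemma Leo_ascends:
  assumes "\<And>\<chi>. \<chi> \<in> irreducible_characters Gal \<Longrightarrow> Leo (fixf (character_kernel Gal \<chi>)) p"
  shows "Leo L p"
  unfolding UL.Leo_iff
proof (intro allI impI)
  fix c assume c: "Poly_Mapping.keys c \<subseteq> tensor_generators L p"
      and van: "\<forall>v\<in>places_above L p. vanishes_at L p v c"
  \<comment> \<open>Normality is included because \<open>trace_complement_commute\<close> needs it;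
    \<open>irreducible_character_detects\<close> asks only about kernels that are normal.\<close>
  define \<N> where "\<N> = {N. N \<lhd> Gal \<and> (\<exists>\<chi>\<in>irreducible_characters Gal. N = character_kernel Gal \<chi>)}"
  have sub: "subgroup N Gal" if "N \<in> \<N>" for N using that unfolding \<N>_def G.normal_inv_iff by blast
  have "\<N> \<subseteq> Pow (carrier Gal)" using sub subgroup.subset by blast
  then have "finite \<N>" using finG finite_subset by blast
  then obtain Ns where Ns: "set Ns = \<N>" using finite_list by blast
  have NL: "Leo (fixf N) p" if "N \<in> \<N>" for N using assms that unfolding \<N>_def by blast
  have ce: "c \<in> vanishing_everywhere" using c van by (simp add: vanishing_everywhere_def)
  let ?P = "\<lambda>Ms. foldr complement Ms c"
  have Pk: "Poly_Mapping.keys (?P Ms) \<subseteq> tensor_generators L p" if "set Ms \<subseteq> \<N>" for Ms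
    using that by (induction Ms) (use c keys_complement subgroup.subset[OF sub] in auto)
  have Pe: "?P Ms \<in> vanishing_everywhere" if "set Ms \<subseteq> \<N>" for Ms
    using that
  proof (induction Ms)
    case (Cons M Ms)
    then have "?P Ms \<in> vanishing_everywhere" "M \<subseteq> carrier Gal" using subgroup.subset[OF sub] by auto
    then show ?case
      unfolding foldr.simps comp_apply complement_def
          by (intro vanishing_everywhere_diff vanishing_everywhere_cmul vanishing_everywhere_trace)
  qed (use ce in simp)
  \<comment> \<open>The trace terms are relators by \<open>trace_in_Rel\<close>, so modulo relators
    the composite acts on \<open>c\<close> as the integer \<open>D\<close>, the product of the
    orders of the kernels.\<close>
  have Pm: "\<exists>D>0. frag_cmul (int D) c - ?P Ms \<in> tensor_relators L p" if "set Ms \<subseteq> \<N>" for Ms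
    using that
  proof (induction Ms)
    case Nil then show ?case by (intro exI[of _ 1]) (simp add: UL.Rel_zero)
  next
    case (Cons M Ms)
    then obtain D where D: "D > 0" "frag_cmul (int D) c - ?P Ms \<in> tensor_relators L p" by auto
    have M: "M \<in> \<N>" "set Ms \<subseteq> \<N>" using Cons.prems by auto
    have "trace M (?P Ms) \<in> tensor_relators L p" by (rule trace_in_Rel[OF sub[OF M(1)] NL[OF M(1)] Pe[OF
        M(2)]])
    from UL.Rel_add[OF UL.Rel_cmul[OF D(2), of "int (card M)"] this]
    have "frag_cmul (int (card M * D)) c - ?P (M # Ms) \<in> tensor_relators L p"
      by (simp add: complement_def frag_cmul_diff_distrib2 frag_cmul_cmul algebra_simps)
    moreover have "card M > 0"
      using subgroup.one_closed[OF sub[OF M(1)]] finite_subset[OF subgroup.subset[OF sub[OF M(1)]] finG]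
      by (auto simp: card_gt_0_iff)
    ultimately show ?case using D(1) by (intro exI[of _ "card M * D"]) simp
  qed
  \<comment> \<open>The trace over the normal subgroup \<open>N\<close> moves past the other factors
    until it meets the factor of \<open>N\<close> itself, which it kills.\<close>
  have Pt: "trace N (?P Ms) = 0" if "set Ms \<subseteq> \<N>" "N \<in> set Ms" for Ms N
    using that
  proof (induction Ms)
    case (Cons M Ms)
    have M: "M \<in> \<N>" "set Ms \<subseteq> \<N>" "N \<in> \<N>" using Cons.prems by auto
    show ?case
    proof (cases "N = M")
      case True then show ?thesis using trace_complement_same[OF sub[OF M(1)] Pk[OF M(2)]] by simp
    next
      case False
      then have "trace N (?P Ms) = 0" using Cons by auto
      moreover have "N \<lhd> Gal" using M(3) by (simp add: \<N>_def)
      moreover have "complement M 0 = 0" by (simp add: complement_def trace_def)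
      ultimately show ?thesis using trace_complement_commute[OF _ sub[OF M(1)] Pk[OF M(2)], of N] by simp
    qed
  qed simp
  let ?d = "?P Ns"
  have dk: "Poly_Mapping.keys ?d \<subseteq> tensor_generators L p" using Pk[of Ns] Ns by simp
  have "Poly_Mapping.lookup ?d t = 0" for t
  proof -
    \<comment> \<open>The coefficient of \<open>t\<close> in the conjugates of \<open>?d\<close>, as
      a complex function on the group. Its sums over cosets of a kernel are coefficients of
      conjugates of a trace of \<open>?d\<close>, which is zero by \<open>Pt\<close>, and its value
      at the neutral element is the coefficient of \<open>?d\<close> itself.\<close>
    let ?f = "\<lambda>s. of_int (Poly_Mapping.lookup (push s ?d) t) :: complex"
    have "?f \<one>\<^bsub>Gal\<^esub> = 0"
    proof (rule G.irreducible_character_detects[where f = ?f, OF finG])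
      fix \<chi> s assume \<chi>: "\<chi> \<in> irreducible_characters Gal" "character_kernel Gal \<chi> \<lhd> Gal"
          and s: "s \<in> carrier Gal"
      let ?N = "character_kernel Gal \<chi>"
      have N: "?N \<in> \<N>" using \<chi> unfolding \<N>_def by blast
      have fin: "finite ?N" using subgroup.subset[OF sub[OF N]] finG finite_subset by blast
      have NG: "h \<in> carrier Gal" if "h \<in> ?N" for h using subgroup.mem_carrier[OF sub[OF N] that] .
      have "(\<Sum>h\<in>?N. push (s \<otimes>\<^bsub>Gal\<^esub> h) ?d) = (\<Sum>h\<in>?N. push s (push h ?d))"
        by (rule sum.cong) (use push_mult[OF s _ dk] NG in auto)
      also have "\<dots> = push s (trace ?N ?d)" by (simp add: trace_def push_sum[OF fin])
      also have "\<dots> = 0" using Pt[of Ns ?N] Ns N by simp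
      finally have z: "(\<Sum>h\<in>?N. push (s \<otimes>\<^bsub>Gal\<^esub> h) ?d) = 0" .
      have "(\<Sum>h\<in>?N. ?f (s \<otimes>\<^bsub>Gal\<^esub> h)) = of_int (Poly_Mapping.lookup (\<Sum>h\<in>?N. push (s \<otimes>\<^bsub>Gal\<^esub> h) ?d) t)"
        by (simp add: lookup_sum)
      then show "(\<Sum>h\<in>?N. ?f (s \<otimes>\<^bsub>Gal\<^esub> h)) = 0" unfolding z by simp
    qed simp
    then show ?thesis using push_one[OF dk] by simp
  qed
  then have d0: "?d = 0" by (intro poly_mapping_eqI) simp
  obtain D where D: "D > 0" "frag_cmul (int D) c \<in> tensor_relators L p" using Pm[of Ns] Ns d0 by auto
  obtain w where w: "w \<in> places_above L p" using places_nonempty by blast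
  interpret W: padic_place L w p by (rule UL.padic_placeI[OF w])
  show "c \<in> tensor_relators L p" by (rule W.torsion_vanishes[OF c D(2,1)]) (use van w in blast)
qed

text \<open>Descent requires a subgroup. The kernel of a character enters it only as a subset
  \<open>Y\<close>; the stabiliser of its fixed field is a subgroup with the same fixed field and
  takes its place.\<close>

lemma stabiliser:
  assumes Y: "Y \<subseteq> carrier Gal"
  defines "H \<equiv> {s \<in> carrier Gal. \<forall>x\<in>fixed_field L Y. s x = x}"
  shows "subgroup H Gal" "fixed_field L H = fixed_field L Y"
proof -
  have FL: "x \<in> carrier L" if "x \<in> fixed_field L Y" for x using that by (simp add: fixed_field_def)
  show "subgroup H Gal"
  proof (rule G.subgroupI)
    show "H \<subseteq> carrier Gal" by (auto simp: H_def)
    show "H \<noteq> {}" using Gal_one_apply FL by (auto simp: H_def)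
  next
    fix s assume "s \<in> H"
    then have s: "s \<in> carrier Gal" "\<And>x. x \<in> fixed_field L Y \<Longrightarrow> s x = x" by (auto simp: H_def)
    have "(inv\<^bsub>Gal\<^esub> s) x = x" if x: "x \<in> fixed_field L Y" for x
    proof -
      have "(inv\<^bsub>Gal\<^esub> s) x = (inv\<^bsub>Gal\<^esub> s) (s x)" using s(2)[OF x] by simp
      also have "\<dots> = (inv\<^bsub>Gal\<^esub> s \<otimes>\<^bsub>Gal\<^esub> s) x" using Gal_mult_apply[OF G.inv_closed[OF s(1)] s(1) FL[OF
          x]] by simp
      also have "\<dots> = x" using s(1) Gal_one_apply[OF FL[OF x]] by simp
      finally show ?thesis .
    qed
    then show "inv\<^bsub>Gal\<^esub> s \<in> H" using s by (simp add: H_def)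
  next
    fix s t assume "s \<in> H" "t \<in> H"
    then show "s \<otimes>\<^bsub>Gal\<^esub> t \<in> H" using Gal_mult_apply FL by (auto simp: H_def)
  qed
  show "fixed_field L H = fixed_field L Y" using Y by (auto simp: fixed_field_def H_def)
qed

end

theorem theorem3p5:
  fixes L :: "('a, 'm) ring_scheme" and K :: "'a set" and p :: nat
  assumes "number_field L"
    and "number_field (L\<lparr>carrier := K\<rparr>)"
    and "finite_galois_extension L K"
    and "Factorial_Ring.prime p"
  shows "Leo L p \<longleftrightarrow>
    (\<forall>\<chi> \<in> irreducible_characters (galois_group L K).
       Leo (L\<lparr>carrier := fixed_field L (character_kernel (galois_group L K) \<chi>)\<rparr>) p)"
proof -
  interpret field L using assms(1) by (simp add: number_field_def)
  interpret automorphisms L K by unfold_locales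
  have "K \<subseteq> carrier L"
    using assms(3) subringE(1)[OF subfieldE(1)] by (simp add: finite_galois_extension_def)
  then interpret number_field_automorphisms L K p
    using assms(1,4) by unfold_locales
  show ?thesis
    unfolding Gal_def[symmetric]
  proof
    assume L: "Leo L p"
    show "\<forall>\<chi>\<in>irreducible_characters Gal. Leo (fixf (character_kernel Gal \<chi>)) p"
    proof
      fix \<chi>
      have "character_kernel Gal \<chi> \<subseteq> carrier Gal" by (auto simp: character_kernel_def)
      from Leo_descends[OF stabiliser(1)[OF this] L]
      show "Leo (fixf (character_kernel Gal \<chi>)) p"
        unfolding stabiliser(2)[OF \<open>character_kernel Gal \<chi> \<subseteq> carrier Gal\<close>] .
    qed
  qed (use Leo_ascends in blast)
qed

end
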